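(* Let $M\ge5$ and let $\Omega_{\mathrm{app}},\Psi_{\mathrm{app}},\zeta_{\mathrm{app}}$ be the approximate solution of order $M$ defined in the context. Then the advection speed $Z_2'(t)=\frac{\Gamma}{2\pi d}\,\zeta_{\mathrm{app}}(t)$ satisfies $$Z_2'(t)=\frac{\Gamma}{2\pi d}\Bigl(1-2\pi\alpha\,\varepsilon^4+\mathcal O\bigl(\varepsilon^5+\delta^2\varepsilon\bigr)\Bigr),$$ where $$\alpha=\frac1\pi\int_{\mathbb R^2}\bigl(\xi_2^2-\xi_1^2\bigr)\Omega_2(\xi)\,d\xi=\int_0^\infty r^3\,\mathsf w_2(r)\,dr\approx22.24,$$ and $\mathsf w_2$ is the function such that, in polar coordinates $\xi=(r\cos\theta,r\sin\theta)$, $\Omega_2(\xi)=-\mathsf w_2(r)\cos(2\theta)+\delta\,\hat{\mathsf w}_2(r)\sin(2\theta)$.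
   Context: **Notation.** $\Gamma,d,\nu>0$; $\delta=\nu/\Gamma$; $\varepsilon=\varepsilon(t)=\sqrt{\nu t}/d$ (so $t\partial_t$ acts on functions of $\varepsilon$ as $\frac\varepsilon2\partial_\varepsilon$). $\{f,g\}=\partial_1f\partial_2g-\partial_2f\partial_1g$; $(\Delta^{-1}\Omega)(\xi)=\frac1{2\pi}\int_{\mathbb R^2}\log|\xi-\eta|\Omega(\eta)d\eta$; $\mathcal L=\Delta+\frac12\xi\cdot\nabla+1$; $(\mathcal T_\varepsilon\Psi)(\xi)=\Psi(-\xi_1-\varepsilon^{-1},\xi_2)$; $\Omega_0(\xi)=G(\xi)=\frac1{4\pi}e^{-|\xi|^2/4}$, $\Psi_0=\Delta^{-1}\Omega_0$; $\mathrm M[f]=\int f$, $\mathrm m_j[f]=\int\xi_jf$. $\mathcal S_*$: smooth functions on $\mathbb R^2$ all of whose derivatives grow at most polynomially; $\mathcal Z=\{f: e^{|\xi|^2/4}f\in\mathcal S_*\}$; $\mathcal Y=L^2(\mathbb R^2,e^{|\xi|^2/4}d\xi)$; $\mathcal Y_n$: elements of $\mathcal Y$ of the form $a(r)\cos n\theta+b(r)\sin n\theta$; $\mathcal P_0$: orthogonal projection in $\mathcal Y$ onto $\mathcal Y_0$. $g_\varepsilon=\mathcal O_{\mathcal S_*}(\varepsilon^K)$: for all $\alpha\in\mathbb N^2$, $0\le m\le K$ there are $C,N$ with $|\partial_\xi^\alpha\partial_\varepsilon^mg_\varepsilon|\le C(1+|\xi|)^N\varepsilon^{K-m}$; $f_\varepsilon=\mathcal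 O_{\mathcal Z}(\varepsilon^K)$: $e^{|\xi|^2/4}f_\varepsilon=\mathcal O_{\mathcal S_*}(\varepsilon^K)$; $\mathcal O_{\mathcal Z}(\varepsilon^K+\delta^2\varepsilon^2)$: sum $f+\delta^2g$ with $f=\mathcal O_{\mathcal Z}(\varepsilon^K)$, $g=\mathcal O_{\mathcal Z}(\varepsilon^2)$ uniformly in $\delta\in(0,1]$. $\Lambda f=\{\Psi_0,f\}+\{\Delta^{-1}f,\Omega_0\}$ is skew-adjoint in $\mathcal Y$ with $\ker\Lambda=\mathcal Y_0\oplus\mathrm{span}(\partial_1G,\partial_2G)$; for $g\in(\ker\Lambda)^\perp\cap\mathcal Z$ the equation $\Lambda f=g$ has a unique solution $f\in(\ker\Lambda)^\perp\cap\mathcal Z$ (known). **Approximate solution of order $M\ge2$.** $\Omega_{\mathrm{app}}=\Omega_0+\sum_{k=2}^M\varepsilon^k\Omega_k$, $\Psi_{\mathrm{app}}=\Delta^{-1}\Omega_{\mathrm{app}}$, $\zeta_{\mathrm{app}}=1+\sum_{k=1}^{M-1}\varepsilon^k\zeta_k$, with $\Omega_k=\Omega_k^E+\delta\Omega_k^{NS}$, $\zeta_k=\zeta_k^E+\delta\zeta_k^{NS}$, all profiles independent of $\delta,\varepsilon$. Its remainder is $\mathcal R_M=\delta(\mathcal L\Omega_{\mathrm{app}}-t\partial_t\Omega_{\mathrm{app}})+\{\Psi_{\mathrm{app}}-\mathcal T_\varepsilon\Psi_{\mathrm{app}}+\frac{\varepsilon\xi_1}{2\pi}\zeta_{\mathrm{app}},\Omega_{\mathrm{app}}\}$.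 For order 2: $\zeta_1=0$, and $\Omega_2^E,\Omega_2^{NS}\in\mathcal Y_2\cap\mathcal Z$ are the unique solutions of $\Lambda\Omega_2^E=\frac1{2\pi}\xi_1\xi_2G$ and $\Lambda\Omega_2^{NS}+(\mathcal L-1)\Omega_2^E=0$. From order $k$ to $k+1$: write $\mathcal R_k=\varepsilon^{k+1}(\mathcal H_0+\delta\mathcal H_1)+\mathcal O_{\mathcal Z}(\varepsilon^{k+2}+\delta^2\varepsilon^2)$ with $\mathcal H_0,\mathcal H_1\in\mathcal Z$, set $\zeta_k^E=2\pi\,\mathrm m_2[\mathcal H_0]$, $\zeta_k^{NS}=2\pi\,\mathrm m_2[\mathcal H_1]$, $\tilde{\mathcal H}_0=\mathcal H_0+\frac{\zeta_k^E}{2\pi}\partial_2\Omega_0$, $\tilde{\mathcal H}_1=\mathcal H_1+\frac{\zeta_k^{NS}}{2\pi}\partial_2\Omega_0$, and $\Omega_{k+1}^E=\Omega^{E,0}+\Omega^{E,1}$ where $\Omega^{E,0}\in\mathcal Y_0\cap\mathcal Z$ solves $(\mathcal L-\frac{k+1}2)\Omega^{E,0}+\mathcal P_0\tilde{\mathcal H}_1=0$ and $\Omega^{E,1}\in(\ker\Lambda)^\perp\cap\mathcal Z$ solves $\Lambda\Omega^{E,1}+\tilde{\mathcal H}_0=0$; finally $\Omega_{k+1}^{NS}\in(\ker\Lambda)^\perp\cap\mathcal Z$ solves $\Lambda\Omega_{k+1}^{NS}+(1-\mathcal P_0)\tilde{\mathcal H}_1+(\mathcal L-\frac{k+1}2)\Omega^{E,1}=0$.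 Then $\mathcal R_M=\mathcal O_{\mathcal Z}(\varepsilon^{M+1}+\delta^2\varepsilon^2)$, the $\Omega_k$ ($k\ge2$) have $\mathrm M=\mathrm m_1=\mathrm m_2=0$, and $\Omega_k^E$ is even in $\xi_2$. The profile $\Omega_2$ has the polar form stated in the claim, for some functions $\mathsf w_2,\hat{\mathsf w}_2$ on $\mathbb R_+$ independent of $\delta$. The $\mathcal O(\varepsilon^5+\delta^2\varepsilon)$ is for $\varepsilon$ small, uniformly in $\delta\in(0,1]$. *)

theory Defs
  imports "HOL-Analysis.Analysis"
begin

text \<open>The plane is \<open>real \<times> real\<close>, whose norm is the Euclidean one.\<close>

type_synonym plane = "real \<times> real"

definition pd1 :: "(plane \<Rightarrow> real) \<Rightarrow> plane \<Rightarrow> real" where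
  "pd1 f \<xi> = deriv (\<lambda>s. f (s, snd \<xi>)) (fst \<xi>)"

definition pd2 :: "(plane \<Rightarrow> real) \<Rightarrow> plane \<Rightarrow> real" where
  "pd2 f \<xi> = deriv (\<lambda>s. f (fst \<xi>, s)) (snd \<xi>)"

definition pd :: "nat \<Rightarrow> nat \<Rightarrow> (plane \<Rightarrow> real) \<Rightarrow> plane \<Rightarrow> real" where
  "pd a b f = (pd1 ^^ a) ((pd2 ^^ b) f)"

definition d_eps :: "(real \<Rightarrow> plane \<Rightarrow> real) \<Rightarrow> real \<Rightarrow> plane \<Rightarrow> real" where
  "d_eps g \<epsilon> \<xi> = deriv (\<lambda>e. g e \<xi>) \<epsilon>"

text \<open>Since \<open>deriv\<close> is total, differentiability is demanded separately. (Frechet)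
  differentiability of all the \<open>pd a b f\<close> is equivalent to \<open>f\<close> being of class C-infinity,
  because it makes mixed partial derivatives commute.\<close>

definition smooth_plane :: "(plane \<Rightarrow> real) \<Rightarrow> bool" where
  "smooth_plane f \<longleftrightarrow> (\<forall>a b. pd a b f differentiable_on UNIV)"

definition bracket :: "(plane \<Rightarrow> real) \<Rightarrow> (plane \<Rightarrow> real) \<Rightarrow> plane \<Rightarrow> real" where
  "bracket f g \<xi> = pd1 f \<xi> * pd2 g \<xi> - pd2 f \<xi> * pd1 g \<xi>"

definition inv_laplace :: "(plane \<Rightarrow> real) \<Rightarrow> plane \<Rightarrow> real" where
  "inv_laplace \<Omega> \<xi> = 1 / (2 * pi) * (LINT \<eta>|lborel. ln (norm (\<xi> - \<eta>)) * \<Omega> \<eta>)"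

definition diffusion :: "(plane \<Rightarrow> real) \<Rightarrow> plane \<Rightarrow> real" where
  "diffusion f \<xi> = pd1 (pd1 f) \<xi> + pd2 (pd2 f) \<xi>
     + (fst \<xi> * pd1 f \<xi> + snd \<xi> * pd2 f \<xi>) / 2 + f \<xi>"

definition reflect_shift :: "real \<Rightarrow> (plane \<Rightarrow> real) \<Rightarrow> plane \<Rightarrow> real" where
  "reflect_shift \<epsilon> \<Psi> \<xi> = \<Psi> (- fst \<xi> - 1 / \<epsilon>, snd \<xi>)"

definition gaussian :: "plane \<Rightarrow> real" where
  "gaussian \<xi> = 1 / (4 * pi) * exp (- (norm \<xi>)\<^sup>2 / 4)"

definition moment2 :: "(plane \<Rightarrow> real) \<Rightarrow> real" where
  "moment2 f = (LINT \<xi>|lborel. snd \<xi> * f \<xi>)"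

definition weight :: "plane \<Rightarrow> real" where
  "weight \<xi> = exp ((norm \<xi>)\<^sup>2 / 4)"

definition S_star :: "(plane \<Rightarrow> real) set" where
  "S_star = {f. smooth_plane f \<and>
     (\<forall>a b. \<exists>C (N::nat). \<forall>\<xi>. \<bar>pd a b f \<xi>\<bar> \<le> C * (1 + norm \<xi>) ^ N)}"

definition Z_space :: "(plane \<Rightarrow> real) set" where
  "Z_space = {f. (\<lambda>\<xi>. weight \<xi> * f \<xi>) \<in> S_star}"

definition Y_space :: "(plane \<Rightarrow> real) set" where
  "Y_space = {f \<in> borel_measurable lborel. integrable lborel (\<lambda>\<xi>. (f \<xi>)\<^sup>2 * weight \<xi>)}"

definition inner_Y :: "(plane \<Rightarrow> real) \<Rightarrow> (plane \<Rightarrow> real) \<Rightarrow> real" where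
  "inner_Y f g = (LINT \<xi>|lborel. f \<xi> * g \<xi> * weight \<xi>)"

definition norm_Y :: "(plane \<Rightarrow> real) \<Rightarrow> real" where
  "norm_Y f = sqrt (inner_Y f f)"

definition Y_mode :: "nat \<Rightarrow> (plane \<Rightarrow> real) set" where
  "Y_mode n = {f \<in> Y_space. \<exists>a b. \<forall>r>0. \<forall>\<theta>.
     f (r * cos \<theta>, r * sin \<theta>) = a r * cos (real n * \<theta>) + b r * sin (real n * \<theta>)}"

text \<open>\<open>proj0 f p\<close>: \<open>p\<close> represents the orthogonal projection in Y of \<open>f\<close> onto Y_0. It is a
  relation because the projection is determined only almost everywhere.\<close>

definition proj0 :: "(plane \<Rightarrow> real) \<Rightarrow> (plane \<Rightarrow> real) \<Rightarrow> bool" where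
  "proj0 f p \<longleftrightarrow> p \<in> Y_mode 0 \<and> (\<forall>g \<in> Y_mode 0. inner_Y (\<lambda>\<xi>. f \<xi> - p \<xi>) g = 0)"

definition Lambda :: "(plane \<Rightarrow> real) \<Rightarrow> plane \<Rightarrow> real" where
  "Lambda f \<xi> = bracket (inv_laplace gaussian) f \<xi> + bracket (inv_laplace f) gaussian \<xi>"

text \<open>As a skew-adjoint operator in Y, Lambda is the closure of its restriction to Z, where all
  derivatives are classical; the following is the kernel of that closure.\<close>

definition ker_Lambda :: "(plane \<Rightarrow> real) set" where
  "ker_Lambda = {f \<in> Y_space. \<exists>F. (\<forall>n. F n \<in> Z_space)
     \<and> (\<lambda>n. norm_Y (\<lambda>\<xi>. F n \<xi> - f \<xi>)) \<longlonglongrightarrow> 0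
     \<and> (\<lambda>n. norm_Y (Lambda (F n))) \<longlonglongrightarrow> 0}"

definition ker_Lambda_perp :: "(plane \<Rightarrow> real) set" where
  "ker_Lambda_perp = {f \<in> Y_space. \<forall>g \<in> ker_Lambda. inner_Y f g = 0}"

definition bigO_S :: "nat \<Rightarrow> (real \<Rightarrow> plane \<Rightarrow> real) \<Rightarrow> bool" where
  "bigO_S K g \<longleftrightarrow> (\<exists>\<epsilon>0>0.
     (\<forall>m\<le>K. \<forall>\<epsilon>\<in>{0<..<\<epsilon>0}. smooth_plane ((d_eps ^^ m) g \<epsilon>)) \<and>
     (\<forall>m<K. \<forall>\<epsilon>\<in>{0<..<\<epsilon>0}. \<forall>\<xi>. (\<lambda>e. (d_eps ^^ m) g e \<xi>) differentiable (at \<epsilon>)) \<and>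
     (\<forall>a b. \<forall>m\<le>K. \<exists>C (N::nat). \<forall>\<epsilon>\<in>{0<..<\<epsilon>0}. \<forall>\<xi>.
        \<bar>pd a b ((d_eps ^^ m) g \<epsilon>) \<xi>\<bar> \<le> C * (1 + norm \<xi>) ^ N * \<epsilon> ^ (K - m)))"

definition bigO_Z :: "nat \<Rightarrow> (real \<Rightarrow> plane \<Rightarrow> real) \<Rightarrow> bool" where
  "bigO_Z K f \<longleftrightarrow> bigO_S K (\<lambda>\<epsilon> \<xi>. weight \<xi> * f \<epsilon> \<xi>)"

text \<open>\<open>bigO_Z_delta K R\<close>: \<open>R\<close>, a function of delta, epsilon and xi, is of order
  epsilon^K + delta^2 epsilon^2 in Z, uniformly for delta in (0,1]. The two parts \<open>f\<close> and \<open>g\<close>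
  depend polynomially on delta, as the remainders below do. Without a restriction of this kind
  the term of order delta in an expansion would not be determined: with a smooth cutoff chi of
  delta/epsilon, equal to 1 near 0 and to 0 near infinity, delta epsilon^(k+1) H equals
  [chi delta epsilon^(k+1) H] + delta^2 [(1 - chi) delta^(-1) epsilon^(k+1) H], where for k at
  least 2 the brackets are of order epsilon^(k+2) and epsilon^2 uniformly in delta.\<close>

definition bigO_Z_delta :: "nat \<Rightarrow> (real \<Rightarrow> real \<Rightarrow> plane \<Rightarrow> real) \<Rightarrow> bool" where
  "bigO_Z_delta K R \<longleftrightarrow> (\<exists>(n::nat) f g.
     (\<forall>j\<le>n. bigO_Z K (f j) \<and> bigO_Z 2 (g j)) \<and>
     (\<forall>\<delta>\<in>{0<..1}. \<forall>\<epsilon>>0. \<forall>\<xi>.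
        R \<delta> \<epsilon> \<xi> = (\<Sum>j\<le>n. \<delta> ^ j * f j \<epsilon> \<xi>) + \<delta>\<^sup>2 * (\<Sum>j\<le>n. \<delta> ^ j * g j \<epsilon> \<xi>)))"

text \<open>Throughout, \<open>wE k\<close>, \<open>wNS k\<close> are the Euler and Navier-Stokes parts of the profile
  Omega_k (k at least 2; Omega_0 is the Gaussian), and \<open>zE k\<close>, \<open>zNS k\<close> those of the
  coefficient zeta_k (k at least 1).\<close>

definition profile ::
  "(nat \<Rightarrow> plane \<Rightarrow> real) \<Rightarrow> (nat \<Rightarrow> plane \<Rightarrow> real) \<Rightarrow> real \<Rightarrow> nat \<Rightarrow> plane \<Rightarrow> real" where
  "profile wE wNS \<delta> k \<xi> = wE k \<xi> + \<delta> * wNS k \<xi>"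

definition Omega_app :: "(nat \<Rightarrow> plane \<Rightarrow> real) \<Rightarrow> (nat \<Rightarrow> plane \<Rightarrow> real) \<Rightarrow>
    nat \<Rightarrow> real \<Rightarrow> real \<Rightarrow> plane \<Rightarrow> real" where
  "Omega_app wE wNS M \<delta> \<epsilon> \<xi> = gaussian \<xi> + (\<Sum>k=2..M. \<epsilon> ^ k * profile wE wNS \<delta> k \<xi>)"

definition Psi_app :: "(nat \<Rightarrow> plane \<Rightarrow> real) \<Rightarrow> (nat \<Rightarrow> plane \<Rightarrow> real) \<Rightarrow>
    nat \<Rightarrow> real \<Rightarrow> real \<Rightarrow> plane \<Rightarrow> real" where
  "Psi_app wE wNS M \<delta> \<epsilon> = inv_laplace (Omega_app wE wNS M \<delta> \<epsilon>)"

definition zeta_app :: "(nat \<Rightarrow> real) \<Rightarrow> (nat \<Rightarrow> real) \<Rightarrow> nat \<Rightarrow> real \<Rightarrow> real \<Rightarrow> real" where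
  "zeta_app zE zNS M \<delta> \<epsilon> = 1 + (\<Sum>k=1..M-1. \<epsilon> ^ k * (zE k + \<delta> * zNS k))"

text \<open>The time derivative acts on functions of epsilon = sqrt (nu t) / d through
  t d/dt = (epsilon/2) d/d epsilon.\<close>

definition remainder :: "(nat \<Rightarrow> plane \<Rightarrow> real) \<Rightarrow> (nat \<Rightarrow> plane \<Rightarrow> real) \<Rightarrow>
    (nat \<Rightarrow> real) \<Rightarrow> (nat \<Rightarrow> real) \<Rightarrow> nat \<Rightarrow> real \<Rightarrow> real \<Rightarrow> plane \<Rightarrow> real" where
  "remainder wE wNS zE zNS M \<delta> \<epsilon> \<xi> =
     \<delta> * (diffusion (Omega_app wE wNS M \<delta> \<epsilon>) \<xi> - \<epsilon> / 2 * d_eps (Omega_app wE wNS M \<delta>) \<epsilon> \<xi>)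
     + bracket
         (\<lambda>\<eta>. Psi_app wE wNS M \<delta> \<epsilon> \<eta> - reflect_shift \<epsilon> (Psi_app wE wNS M \<delta> \<epsilon>) \<eta>
              + \<epsilon> * fst \<eta> / (2 * pi) * zeta_app zE zNS M \<delta> \<epsilon>)
         (Omega_app wE wNS M \<delta> \<epsilon>) \<xi>"

definition order_two :: "(nat \<Rightarrow> plane \<Rightarrow> real) \<Rightarrow> (nat \<Rightarrow> plane \<Rightarrow> real) \<Rightarrow>
    (nat \<Rightarrow> real) \<Rightarrow> (nat \<Rightarrow> real) \<Rightarrow> bool" where
  "order_two wE wNS zE zNS \<longleftrightarrow>
     zE 1 = 0 \<and> zNS 1 = 0 \<and>
     wE 2 \<in> Y_mode 2 \<inter> Z_space \<and> wNS 2 \<in> Y_mode 2 \<inter> Z_space \<and>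
     (\<forall>\<xi>. Lambda (wE 2) \<xi> = 1 / (2 * pi) * fst \<xi> * snd \<xi> * gaussian \<xi>) \<and>
     (\<forall>\<xi>. Lambda (wNS 2) \<xi> + (diffusion (wE 2) \<xi> - wE 2 \<xi>) = 0)"

definition next_order :: "(nat \<Rightarrow> plane \<Rightarrow> real) \<Rightarrow> (nat \<Rightarrow> plane \<Rightarrow> real) \<Rightarrow>
    (nat \<Rightarrow> real) \<Rightarrow> (nat \<Rightarrow> real) \<Rightarrow> nat \<Rightarrow> bool" where
  "next_order wE wNS zE zNS k \<longleftrightarrow> (\<exists>H0\<in>Z_space. \<exists>H1\<in>Z_space. \<exists>K0 K1 P u v.
     bigO_Z_delta (k + 2) (\<lambda>\<delta> \<epsilon> \<xi>.
        remainder wE wNS zE zNS k \<delta> \<epsilon> \<xi> - \<epsilon> ^ (k + 1) * (H0 \<xi> + \<delta> * H1 \<xi>)) \<and>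
     zE k = 2 * pi * moment2 H0 \<and> zNS k = 2 * pi * moment2 H1 \<and>
     K0 = (\<lambda>\<xi>. H0 \<xi> + zE k / (2 * pi) * pd2 gaussian \<xi>) \<and>
     K1 = (\<lambda>\<xi>. H1 \<xi> + zNS k / (2 * pi) * pd2 gaussian \<xi>) \<and>
     proj0 K1 P \<and>
     u \<in> Y_mode 0 \<inter> Z_space \<and>
     (\<forall>\<xi>. diffusion u \<xi> - real (k + 1) / 2 * u \<xi> + P \<xi> = 0) \<and>
     v \<in> ker_Lambda_perp \<inter> Z_space \<and>
     (\<forall>\<xi>. Lambda v \<xi> + K0 \<xi> = 0) \<and>
     wE (k + 1) = (\<lambda>\<xi>. u \<xi> + v \<xi>) \<and>
     wNS (k + 1) \<in> ker_Lambda_perp \<inter> Z_space \<and>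
     (\<forall>\<xi>. Lambda (wNS (k + 1)) \<xi> + (K1 \<xi> - P \<xi>)
            + (diffusion v \<xi> - real (k + 1) / 2 * v \<xi>) = 0))"

definition approximate_solution :: "(nat \<Rightarrow> plane \<Rightarrow> real) \<Rightarrow> (nat \<Rightarrow> plane \<Rightarrow> real) \<Rightarrow>
    (nat \<Rightarrow> real) \<Rightarrow> (nat \<Rightarrow> real) \<Rightarrow> nat \<Rightarrow> bool" where
  "approximate_solution wE wNS zE zNS M \<longleftrightarrow> M \<ge> 2 \<and> order_two wE wNS zE zNS \<and>
     (\<forall>k. 2 \<le> k \<and> k < M \<longrightarrow> next_order wE wNS zE zNS k)"

text \<open>The speed Z_2'(t) for circulation \<open>\<Gamma>\<close>, distance \<open>d\<close> and viscosity \<open>\<nu>\<close>.\<close>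

definition advection_speed ::
  "(nat \<Rightarrow> real) \<Rightarrow> (nat \<Rightarrow> real) \<Rightarrow> nat \<Rightarrow> real \<Rightarrow> real \<Rightarrow> real \<Rightarrow> real \<Rightarrow> real" where
  "advection_speed zE zNS M \<Gamma> d \<nu> t =
     \<Gamma> / (2 * pi * d) * zeta_app zE zNS M (\<nu> / \<Gamma>) (sqrt (\<nu> * t) / d)"

end

theory Submission
  imports Defs "HOL-Computational_Algebra.Polynomial"
begin

text \<open>Integrating the remainder against \<open>1\<close> and \<open>\<xi>\<^sub>2\<close> kills all its terms but moments of the profiles
  and the interaction of a vortex with its mirror image. The latter has a multipole expansion in
  powers of \<open>\<epsilon>\<close>, in which the vanishing of the low moments of the profiles leaves
  \<open>\<epsilon> + 2 Re c\<^sub>2 \<epsilon>\<^sup>5\<close> up to order \<open>\<epsilon>\<^sup>6\<close>, where \<open>c\<^sub>2\<close> is the complex quadratic moment of the Euler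
  part of the profile of order two. Comparing coefficients, first in \<open>\<delta>\<close> and then in \<open>\<epsilon>\<close>, shows that the
  correction of the speed first appears at \<open>\<epsilon>\<^sup>4\<close> and is \<open>2 Re c\<^sub>2 = - 2 \<pi> \<alpha>\<close>. The terms \<open>\<delta> \<epsilon>\<^sup>k\<close> with
  \<open>k \<ge> 3\<close> are absorbed by \<open>\<epsilon>\<^sup>5 + \<delta>\<^sup>2 \<epsilon>\<close>. The value of \<open>\<alpha>\<close> comes from the radial equation of the second
  angular mode, which reduces to a scalar Riccati equation that is enclosed by piecewise polynomial
  barriers.\<close>

section \<open>Barriers for the Riccati equation\<close>

text \<open>No profile beyond order two is computed. The Euler profiles of orders three and four
  enter only through moments: mass 0 for both, and for order three also a vanishing
  \<open>fst\<close>-moment. Their part in \<open>ker_Lambda_perp\<close> has both, because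
  \<open>gaussian\<close> and \<open>pd1 gaussian\<close> lie in the kernel and become multiples of
  1 and of the first coordinate after multiplication by \<open>weight\<close>. Their radial part has
  mass 0 because diffusion conserves mass and \<open>H1\<close> has mass 0; this is why the
  remainder is tested with 1 as well. The error term absorbs \<delta> \<epsilon>^3 but not \<delta>
  \<epsilon>^2, so \<open>zNS 2 = 0\<close> needs a proof of its own. The vorticity is not compactly
  supported, so the multipole expansion does not come from a convergent series. Its geometric sum is
  stopped with an exact remainder whose singular denominator is controlled by a bound for the
  convolution with 1/|x| that is uniform in the centre. The Riccati equation is singular at 0 and
  lives on a half line: comparison starts at 0 under a quadratic bound, runs over eleven pieces up
  to 19/2, and ends with an explicit tail.\<close>

lemma nonpos_of_growth:
  fixes D D' :: "real \<Rightarrow> real"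
  assumes der: "\<And>s. s \<in> {a<..b} \<Longrightarrow> (D has_real_derivative D' s) (at s)"
    and growth: "\<And>s. s \<in> {a<..b} \<Longrightarrow> D s > 0 \<Longrightarrow> D' s \<le> C * D s"
    and init: "\<And>e. e > 0 \<Longrightarrow> \<forall>\<^sub>F s in at_right a. D s < e"
    and c: "c \<in> {a<..b}"
  shows "D c \<le> 0"
proof (rule ccontr)
  assume "\<not> D c \<le> 0"
  then have Dc: "D c > 0" by simp
  \<comment> \<open>Gronwall: the weight makes E nonincreasing wherever D is positive. At the left
    endpoint only the upper limit of D is controlled, which suits comparison starting at the
    singular point 0.\<close>
  define E where "E s = exp (- C * s) * D s" for s
  have derE: "(E has_real_derivative exp (- C * s) * (D' s - C * D s)) (at s)"
    if "s \<in> {a<..b}" for s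
    unfolding E_def by (auto intro!: derivative_eq_intros der[OF that] simp: algebra_simps)
  have Ec: "E c > 0" using Dc by (simp add: E_def)
  define K where "K = max (exp (- C * a)) (exp (- C * c))"
  have K: "K > 0" and Kb: "exp (- C * s) \<le> K" if "a < s" "s < c" for s
  proof -
    show "K > 0" by (simp add: K_def less_max_iff_disj)
    show "exp (- C * s) \<le> K"
    proof (cases "C \<ge> 0")
      case True
      then show ?thesis using that by (auto simp: K_def le_max_iff_disj mult_left_mono)
    next
      case False
      then show ?thesis using that by (auto simp: K_def le_max_iff_disj mult_left_mono_neg)
    qed
  qed
  have K0: "K > 0" by (simp add: K_def less_max_iff_disj)
  have "\<forall>\<^sub>F s in at_right a. D s < E c / (2 * K)" using Ec K0 by (intro init) simp
  moreover have "\<forall>\<^sub>F s in at_right a. s \<in> {a<..<c}"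
    using eventually_at_right_real[of a c] c by auto
  ultimately have "\<forall>\<^sub>F s in at_right a. D s < E c / (2 * K) \<and> s \<in> {a<..<c}"
    by (rule eventually_conj)
  then obtain t1 where t1: "D t1 < E c / (2 * K)" "a < t1" "t1 < c"
    using eventually_happens[of _ "at_right a"] by (auto simp: trivial_limit_at_right_real)
  have Et1: "E t1 \<le> E c / 2"
  proof -
    have "E t1 \<le> exp (- C * t1) * (E c / (2 * K))"
      unfolding E_def using t1(1) by (intro mult_left_mono) (auto simp: E_def)
    also have "\<dots> \<le> K * (E c / (2 * K))"
      using Kb[OF t1(2,3)] Ec K0 by (intro mult_right_mono) auto
    finally show ?thesis using K0 by simp
  qed
  \<comment> \<open>The maximum \<open>\<tau>\<close> of S is the last time at which E is at most
    half of \<open>E c\<close>. Afterwards D is positive, so E cannot increase, and yet it would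
    have to reach \<open>E c\<close>.\<close>
  define S where "S = {t \<in> {t1..c}. E t \<le> E c / 2}"
  have contE: "continuous_on {t1..c} E"
    using t1 c by (intro DERIV_continuous_on[OF has_field_derivative_at_within[OF derE]]) auto
  have "closed S" unfolding S_def
    by (intro continuous_on_closed_Collect_le contE continuous_on_const) auto
  then have "compact S" unfolding S_def
    by (metis (no_types, lifting) bounded_closed_interval bounded_subset compact_eq_bounded_closed mem_Collect_eq subsetI)
  moreover have "t1 \<in> S" using Et1 t1 by (auto simp: S_def)
  then have "S \<noteq> {}" by blast
  ultimately obtain \<tau> where \<tau>: "\<tau> \<in> S" "\<And>t. t \<in> S \<Longrightarrow> t \<le> \<tau>"
    using compact_attains_sup[of S] by auto
  have "\<tau> < c" using \<tau>(1) Ec by (auto simp: S_def order_le_less)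
  then obtain z where z: "\<tau> < z" "z < c"
      "E c - E \<tau> = (c - \<tau>) * (exp (- C * z) * (D' z - C * D z))"
    using MVT2[of \<tau> c E "\<lambda>z. exp (- C * z) * (D' z - C * D z)"] derE \<tau>(1) t1 c
    by (auto simp: S_def)
  have "z \<notin> S" using \<tau>(2) z by force
  then have "E z > 0" using z \<tau>(1) Ec by (auto simp: S_def)
  then have "D z > 0" by (simp add: E_def zero_less_mult_iff)
  then have "D' z - C * D z \<le> 0" using growth[of z] z \<tau>(1) t1 c by (auto simp: S_def)
  then have "(c - \<tau>) * (exp (- C * z) * (D' z - C * D z)) \<le> 0"
    using \<open>\<tau> < c\<close> by (intro mult_nonneg_nonpos) auto
  then show False using z(3) \<tau>(1) Ec by (auto simp: S_def)
qed

section \<open>Rational certificates for polynomial inequalities and for the exponential\<close>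

fun horner_lb :: "real \<Rightarrow> real list \<Rightarrow> real" where
  "horner_lb h [] = 0"
| "horner_lb h (c # cs) = c + min 0 (h * horner_lb h cs)"

text \<open>Horner's scheme in the worst case: for t between 0 and h, a nonnegative inner bound
  contributes at least 0 and a negative one at least h times itself. Nonnegativity on a whole piece
  thereby becomes one rational evaluation.\<close>

lemma horner_lb_le_poly:
  assumes "0 \<le> t" "t \<le> h"
  shows "horner_lb h cs \<le> poly (Poly cs) t"
proof (induction cs)
  case (Cons c cs)
  have "min 0 (h * horner_lb h cs) \<le> t * poly (Poly cs) t"
  proof (cases "horner_lb h cs \<ge> 0")
    case True
    then show ?thesis using Cons assms by (simp add: min_def)
  next
    case False
    then have "h * horner_lb h cs \<le> t * horner_lb h cs"
      using assms by (intro mult_right_mono_neg) auto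
    also have "\<dots> \<le> t * poly (Poly cs) t" using Cons assms by (intro mult_left_mono)
    finally show ?thesis by (simp add: min_def)
  qed
  then show ?case by simp
qed simp

lemma poly_nonneg_by_horner:
  assumes "0 \<le> horner_lb h (coeffs p)" "0 \<le> t" "t \<le> h"
  shows "0 \<le> poly p t"
  using horner_lb_le_poly[OF assms(2,3), of "coeffs p"] assms(1) by simp

text \<open>Taylor polynomials of degree 10. \<open>exp_hi\<close> differs from
  \<open>exp_lo\<close> only in the last coefficient, 3/10! for 1/10!: the Lagrange remainder with
  \<open>exp \<theta> \<le> 3\<close> is absorbed there, which confines \<open>exp_hi\<close> to
  [0, 1].\<close>

definition exp_lo :: "real poly" where
  "exp_lo = [:1, 1, 1/2, 1/6, 1/24, 1/120, 1/720, 1/5040, 1/40320, 1/362880, 1/3628800:]"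

definition exp_hi :: "real poly" where
  "exp_hi = [:1, 1, 1/2, 1/6, 1/24, 1/120, 1/720, 1/5040, 1/40320, 1/362880, 3/3628800:]"

lemma exp_lo_le:
  assumes "0 \<le> t"
  shows "poly exp_lo t \<le> exp t"
proof -
  obtain \<theta> where \<theta>: "exp t = (\<Sum>m<11. t ^ m / fact m) + (exp \<theta> / fact 11) * t ^ 11"
    using Maclaurin_exp_le[of t 11] by auto
  have "poly exp_lo t = (\<Sum>m<11. t ^ m / fact m)"
    by (simp add: exp_lo_def eval_nat_numeral lessThan_Suc algebra_simps)
  then show ?thesis using \<theta> assms by simp
qed

lemma le_exp_hi:
  assumes "0 \<le> t" "t \<le> 1"
  shows "exp t \<le> poly exp_hi t"
proof -
  obtain \<theta> where \<theta>: "\<bar>\<theta>\<bar> \<le> \<bar>t\<bar>" "exp t = (\<Sum>m<10. t ^ m / fact m) + (exp \<theta> / fact 10) * t ^ 10"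
    using Maclaurin_exp_le[of t 10] by auto
  have "exp \<theta> \<le> exp 1" using \<theta>(1) assms by simp
  then have "exp \<theta> \<le> 3" using exp_le by linarith
  then have "(exp \<theta> / fact 10) * t ^ 10 \<le> (3 / fact 10) * t ^ 10"
    using assms by (intro mult_right_mono divide_right_mono) auto
  moreover have "poly exp_hi t = (\<Sum>m<10. t ^ m / fact m) + (3 / fact 10) * t ^ 10"
    by (simp add: exp_hi_def eval_nat_numeral lessThan_Suc algebra_simps)
  ultimately show ?thesis using \<theta>(2) by linarith
qed

text \<open>The Riccati inequality for the barrier \<open>M (s - a)\<close>, s = a + t, cleared of
  denominators, with E in place of e^s. If E is a lower bound of e^s, nonnegativity gives a
  supersolution; if E is an upper bound, nonpositivity gives a subsolution.\<close>

definition residual :: "real \<Rightarrow> real poly \<Rightarrow> real poly \<Rightarrow> real poly" where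
  "residual a E M = smult 2 [:a, 1:] * pderiv M * (E - [:1:]) - ([:a\<^sup>2, 2 * a, 1:] + M)\<^sup>2"

lemma poly_residual:
  "poly (residual a E M) t = 2 * (a + t) * poly (pderiv M) t * (poly E t - 1) - ((a + t)\<^sup>2 + poly M t)\<^sup>2"
  by (simp add: residual_def power2_eq_square algebra_simps)

section \<open>Comparison principle for the Riccati equation\<close>

locale riccati =
  fixes m :: "real \<Rightarrow> real" and C \<beta> :: real
  assumes deriv_m: "\<And>s. s > 0 \<Longrightarrow>
      (m has_real_derivative (s\<^sup>2 + m s)\<^sup>2 / (2 * s * (exp s - 1))) (at s)"
    and m_nonneg: "\<And>s. s > 0 \<Longrightarrow> 0 \<le> m s"
    and m_le: "\<And>s. s > 0 \<Longrightarrow> m s \<le> C * s\<^sup>2"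
    and m_tendsto: "(m \<longlongrightarrow> \<beta>) at_top"
begin

definition rate :: "real \<Rightarrow> real \<Rightarrow> real" where
  "rate s x = (s\<^sup>2 + x)\<^sup>2 / (2 * s * (exp s - 1))"

text \<open>The factor 1 / (2 s (e^s - 1)) blows up like 1 / (2 s^2) at 0. For arguments of size B
  s^2 the sum 2 s^2 + z + x compensates this, and a Lipschitz constant uniform up to 0 remains;
  hence the hypothesis \<open>m_le\<close> of the locale.\<close>

lemma rate_diff_le:
  assumes s: "s > 0" and "x \<ge> 0" "z \<ge> x" "z \<le> B * s\<^sup>2"
  shows "rate s z - rate s x \<le> (1 + B) * (z - x)"
proof -
  define k where "k = 1 / (2 * s * (exp s - 1))"
  have "s \<le> exp s - 1" using exp_ge_add_one_self[of s] by linarith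
  then have "2 * s * s \<le> 2 * s * (exp s - 1)" using s by (intro mult_left_mono) auto
  then have k: "0 \<le> k" "k \<le> 1 / (2 * s\<^sup>2)"
    using s unfolding k_def by (auto simp: power2_eq_square intro!: divide_left_mono)
  have "rate s z - rate s x = k * (2 * s\<^sup>2 + z + x) * (z - x)"
    unfolding rate_def k_def by (simp add: diff_divide_distrib[symmetric] power2_eq_square algebra_simps)
  also have "\<dots> \<le> (1 / (2 * s\<^sup>2)) * (2 * s\<^sup>2 + 2 * (B * s\<^sup>2)) * (z - x)"
    using assms k by (intro mult_right_mono mult_mono) auto
  also have "\<dots> = (1 + B) * (z - x)" using s by (simp add: field_simps)
  finally show ?thesis .
qed

lemma upper_barrier:
  assumes "0 \<le> a"
    and M: "\<And>s. s \<in> {a<..b} \<Longrightarrow> (M has_real_derivative M' s) (at s)"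
    and ineq: "\<And>s. s \<in> {a<..b} \<Longrightarrow> rate s (M s) \<le> M' s"
    and M0: "\<And>s. s \<in> {a<..b} \<Longrightarrow> 0 \<le> M s"
    and init: "\<And>e. e > 0 \<Longrightarrow> \<forall>\<^sub>F s in at_right a. m s - M s < e"
    and c: "c \<in> {a<..b}"
  shows "m c \<le> M c"
proof -
  have "m c - M c \<le> 0"
  proof (rule nonpos_of_growth[where D = "\<lambda>s. m s - M s" and D' = "\<lambda>s. rate s (m s) - M' s"
        and a = a and b = b and C = "1 + C"])
    fix s assume s: "s \<in> {a<..b}"
    then have s0: "s > 0" using \<open>0 \<le> a\<close> by simp
    show "((\<lambda>s. m s - M s) has_real_derivative rate s (m s) - M' s) (at s)"
      unfolding rate_def by (intro DERIV_diff deriv_m s0 M s)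
    assume "m s - M s > 0"
    then have "rate s (m s) - rate s (M s) \<le> (1 + C) * (m s - M s)"
      by (intro rate_diff_le s0 M0 s m_le) auto
    then show "rate s (m s) - M' s \<le> (1 + C) * (m s - M s)" using ineq[OF s] by linarith
  qed (use init c in auto)
  then show ?thesis by simp
qed

text \<open>In \<open>upper_barrier\<close> the larger function at a violation is m, bounded by
  \<open>m_le\<close>. Here it is the barrier, so the quadratic bound is demanded of M.\<close>

lemma lower_barrier:
  assumes "0 \<le> a"
    and M: "\<And>s. s \<in> {a<..b} \<Longrightarrow> (M has_real_derivative M' s) (at s)"
    and ineq: "\<And>s. s \<in> {a<..b} \<Longrightarrow> M' s \<le> rate s (M s)"
    and MB: "\<And>s. s \<in> {a<..b} \<Longrightarrow> M s \<le> B * s\<^sup>2"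
    and init: "\<And>e. e > 0 \<Longrightarrow> \<forall>\<^sub>F s in at_right a. M s - m s < e"
    and c: "c \<in> {a<..b}"
  shows "M c \<le> m c"
proof -
  have "M c - m c \<le> 0"
  proof (rule nonpos_of_growth[where D = "\<lambda>s. M s - m s" and D' = "\<lambda>s. M' s - rate s (m s)"
        and a = a and b = b and C = "1 + B"])
    fix s assume s: "s \<in> {a<..b}"
    then have s0: "s > 0" using \<open>0 \<le> a\<close> by simp
    show "((\<lambda>s. M s - m s) has_real_derivative M' s - rate s (m s)) (at s)"
      unfolding rate_def by (intro DERIV_diff deriv_m s0 M s)
    assume "M s - m s > 0"
    then have "rate s (M s) - rate s (m s) \<le> (1 + B) * (M s - m s)"
      by (intro rate_diff_le s0 m_nonneg MB s) auto
    then show "M' s - rate s (m s) \<le> (1 + B) * (M s - m s)" using ineq[OF s] by linarith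
  qed (use init c in auto)
  then show ?thesis by simp
qed

lemma m_cont: "s > 0 \<Longrightarrow> isCont m s"
  using deriv_m DERIV_isCont by blast

lemma m_at_0: "(m \<longlongrightarrow> 0) (at_right 0)"
proof (rule real_tendsto_sandwich)
  show "\<forall>\<^sub>F s in at_right 0. 0 \<le> m s" "\<forall>\<^sub>F s in at_right 0. m s \<le> C * s\<^sup>2"
    using m_nonneg m_le by (auto simp: eventually_at_right_field intro: exI[of _ 1])
  show "((\<lambda>s. C * s\<^sup>2) \<longlongrightarrow> 0) (at_right 0)"
    by (auto intro!: tendsto_eq_intros)
qed auto

text \<open>The start value \<open>v\<close> at \<open>a = 0\<close> is the limit 0 of \<open>m\<close>; the value of \<open>m\<close> at 0 itself is
  irrelevant.\<close>

lemma upper_piece: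
  assumes a: "a = 0 \<and> v = 0 \<or> a > 0 \<and> m a \<le> v" and h: "0 < h"
    and e: "1 \<le> e" "e \<le> exp a"
    and res: "0 \<le> horner_lb h (coeffs (residual a (smult e exp_lo) (pCons v N)))"
    and N: "0 \<le> horner_lb h (coeffs (pCons v N))"
    and w: "poly (pCons v N) h \<le> w"
  shows "m (a + h) \<le> w"
proof -
  define M where "M s = poly (pCons v N) (s - a)" for s
  have "m (a + h) \<le> M (a + h)"
  proof (rule upper_barrier[where a = a and b = "a + h" and M = M
        and M' = "\<lambda>s. poly (pderiv (pCons v N)) (s - a)"])
    show "0 \<le> a" using a by auto
    fix s assume s: "s \<in> {a<..a + h}"
    show "(M has_real_derivative poly (pderiv (pCons v N)) (s - a)) (at s)"
      unfolding M_def by (rule DERIV_chain_s[OF poly_DERIV, where f' = 1, simplified])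
        (auto intro!: derivative_eq_intros)
    show "0 \<le> M s" unfolding M_def using s by (intro poly_nonneg_by_horner[OF N]) auto
    have s0: "s > 0" using s a by auto
    have ex: "poly (smult e exp_lo) (s - a) \<le> exp s"
    proof -
      have "poly (smult e exp_lo) (s - a) = e * poly exp_lo (s - a)" by simp
      also have "\<dots> \<le> exp a * exp (s - a)"
        using s e exp_lo_le[of "s - a"] by (intro mult_mono) (auto simp: exp_lo_def)
      finally show ?thesis by (simp flip: exp_add)
    qed
    have E1': "1 < poly (smult e exp_lo) (s - a)"
    proof -
      have "1 < poly exp_lo (s - a)" using s
        by (auto simp: exp_lo_def intro!: mult_pos_pos add_pos_pos)
      moreover have "1 * poly exp_lo (s - a) \<le> e * poly exp_lo (s - a)"
        using e(1) calculation(1) by (intro mult_right_mono) auto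
      ultimately show ?thesis unfolding poly_smult by linarith
    qed
    have "0 \<le> poly (residual a (smult e exp_lo) (pCons v N)) (s - a)"
      using s by (intro poly_nonneg_by_horner[OF res]) auto
    then have *: "(s\<^sup>2 + M s)\<^sup>2 \<le> 2 * s * poly (pderiv (pCons v N)) (s - a) * (poly (smult e exp_lo) (s - a) - 1)"
      unfolding poly_residual M_def by simp
    \<comment> \<open>Replacing the polynomial lower bound of e^s by e^s itself goes in the right
      direction only for a nonnegative slope. The residual forces this: its first term dominates a
      square, and all other factors of that term are positive.\<close>
    have "0 \<le> poly (pderiv (pCons v N)) (s - a)"
    proof (rule ccontr)
      assume "\<not> ?thesis"
      then have "2 * s * poly (pderiv (pCons v N)) (s - a) * (poly (smult e exp_lo) (s - a) - 1) < 0"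
        using s0 E1' by (auto simp: mult_less_0_iff zero_less_mult_iff)
      then show False using * zero_le_power2[of "s\<^sup>2 + M s"] by linarith
    qed
    then have "2 * s * poly (pderiv (pCons v N)) (s - a) * (poly (smult e exp_lo) (s - a) - 1)
       \<le> 2 * s * poly (pderiv (pCons v N)) (s - a) * (exp s - 1)"
      using s0 ex by (intro mult_left_mono) auto
    then have "(s\<^sup>2 + M s)\<^sup>2 \<le> poly (pderiv (pCons v N)) (s - a) * (2 * s * (exp s - 1))"
      using * by (simp add: algebra_simps)
    then show "rate s (M s) \<le> poly (pderiv (pCons v N)) (s - a)"
      unfolding rate_def using s0 by (subst pos_divide_le_eq) auto
  next
    fix r :: real assume r: "r > 0"
    have "((\<lambda>s. M s) \<longlongrightarrow> M a) (at_right a)" unfolding M_def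
      by (intro tendsto_intros)
    moreover obtain l where "l \<le> v" "(m \<longlongrightarrow> l) (at_right a)"
    proof (cases "a = 0")
      case True
      then show ?thesis using a m_at_0 that[of 0] by simp
    next
      case False
      then have "a > 0" "v \<ge> m a" using a by auto
      then show ?thesis
        using m_cont[of a] that[of "m a"] by (simp add: isCont_def filterlim_at_split)
    qed
    ultimately have "((\<lambda>s. m s - M s) \<longlongrightarrow> l - M a) (at_right a)" by (intro tendsto_intros)
    moreover have "l - M a < r" using \<open>l \<le> v\<close> r by (simp add: M_def)
    ultimately show "\<forall>\<^sub>F s in at_right a. m s - M s < r" by (rule order_tendstoD)
  qed (use h in auto)
  then show ?thesis using w by (simp add: M_def)
qed

text \<open>At a = 0 the condition \<open>poly N 0 = 0\<close> gives the barrier a double zero and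
  hence the quadratic bound of \<open>lower_barrier\<close>; for a > 0 boundedness on the piece
  suffices. \<open>h \<le> 1\<close> is the range of \<open>exp_hi\<close>.\<close>

lemma lower_piece:
  assumes a: "a = 0 \<and> v = 0 \<and> poly N 0 = 0 \<or> a > 0 \<and> v \<le> m a" and h: "0 < h" "h \<le> 1"
    and e: "exp a \<le> e"
    and res: "0 \<le> horner_lb h (coeffs (- residual a (smult e exp_hi) (pCons v N)))"
    and w: "w \<le> poly (pCons v N) h"
  shows "w \<le> m (a + h)"
proof -
  define M where "M s = poly (pCons v N) (s - a)" for s
  obtain B where B: "\<And>s. s \<in> {a<..a+h} \<Longrightarrow> M s \<le> B * s\<^sup>2"
  proof (cases "a > 0")
    case True
    have "bounded (M ` {a..a+h})" unfolding M_def
      by (intro compact_imp_bounded compact_continuous_image continuous_intros) auto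
    then obtain K where K: "K > 0" "\<And>s. s \<in> {a..a+h} \<Longrightarrow> M s \<le> K"
      by (auto simp: bounded_pos) force
    have "M s \<le> K / a\<^sup>2 * s\<^sup>2" if "s \<in> {a<..a+h}" for s
    proof -
      have "K / a\<^sup>2 * a\<^sup>2 \<le> K / a\<^sup>2 * s\<^sup>2"
        using that K True by (intro mult_left_mono power_mono) auto
      then show ?thesis using K(2)[of s] that True by simp
    qed
    then show ?thesis using that by blast
  next
    case False
    then have "a = 0" "v = 0" "poly N 0 = 0" using a by auto
    moreover obtain n P where "N = pCons n P" by (cases N)
    ultimately have P: "a = 0" "v = 0" "N = pCons 0 P" by auto
    have "bounded (poly P ` {0..h})"
      by (intro compact_imp_bounded compact_continuous_image continuous_intros) auto
    then obtain K where K: "K > 0" "\<And>s. s \<in> {0..h} \<Longrightarrow> poly P s \<le> K"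
      by (auto simp: bounded_pos) force
    have "M s \<le> K * s\<^sup>2" if "s \<in> {a<..a+h}" for s
    proof -
      have "s\<^sup>2 * poly P s \<le> s\<^sup>2 * K" using K(2)[of s] that P by (intro mult_left_mono) auto
      then show ?thesis using P by (simp add: M_def power2_eq_square algebra_simps)
    qed
    then show ?thesis using that by blast
  qed
  have "M (a + h) \<le> m (a + h)"
  proof (rule lower_barrier[where a = a and b = "a + h" and M = M and B = B
        and M' = "\<lambda>s. poly (pderiv (pCons v N)) (s - a)"])
    show "0 \<le> a" using a by auto
    fix s assume s: "s \<in> {a<..a + h}"
    show "(M has_real_derivative poly (pderiv (pCons v N)) (s - a)) (at s)"
      unfolding M_def by (rule DERIV_chain_s[OF poly_DERIV, where f' = 1, simplified])
        (auto intro!: derivative_eq_intros)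
    show "M s \<le> B * s\<^sup>2" using B s by blast
    have s0: "s > 0" using s a by auto
    have ex: "exp s \<le> poly (smult e exp_hi) (s - a)"
    proof -
      have "exp s = exp a * exp (s - a)" by (simp flip: exp_add)
      also have "\<dots> \<le> e * poly exp_hi (s - a)"
        using s h e le_exp_hi[of "s - a"] order_trans[OF exp_ge_zero e] by (intro mult_mono) auto
      finally show ?thesis by simp
    qed
    have "0 \<le> poly (- residual a (smult e exp_hi) (pCons v N)) (s - a)"
      using s by (intro poly_nonneg_by_horner[OF res]) auto
    then have *: "2 * s * poly (pderiv (pCons v N)) (s - a) * (poly (smult e exp_hi) (s - a) - 1) \<le> (s\<^sup>2 + M s)\<^sup>2"
      unfolding poly_minus poly_residual M_def by simp
    show "poly (pderiv (pCons v N)) (s - a) \<le> rate s (M s)"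
    \<comment> \<open>The slope of a lower barrier has no known sign; where it is negative the
      inequality is trivial, because the rate is nonnegative.\<close>
    proof (cases "0 \<le> poly (pderiv (pCons v N)) (s - a)")
      case True
      then have "2 * s * poly (pderiv (pCons v N)) (s - a) * (exp s - 1)
        \<le> 2 * s * poly (pderiv (pCons v N)) (s - a) * (poly (smult e exp_hi) (s - a) - 1)"
        using s0 ex by (intro mult_left_mono) auto
      then have "poly (pderiv (pCons v N)) (s - a) * (2 * s * (exp s - 1)) \<le> (s\<^sup>2 + M s)\<^sup>2"
        using * by (simp add: algebra_simps)
      then show ?thesis unfolding rate_def using s0 by (subst pos_le_divide_eq) auto
    next
      case False
      moreover have "0 \<le> rate s (M s)" unfolding rate_def using s0 by simp
      ultimately show ?thesis by linarith
    qed
  next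
    fix r :: real assume r: "r > 0"
    have "((\<lambda>s. M s) \<longlongrightarrow> M a) (at_right a)" unfolding M_def
      by (intro tendsto_intros)
    moreover obtain l where "l \<ge> v" "(m \<longlongrightarrow> l) (at_right a)"
    proof (cases "a = 0")
      case True
      then show ?thesis using a m_at_0 that[of 0] by simp
    next
      case False
      then have "a > 0" "v \<le> m a" using a by auto
      then show ?thesis
        using m_cont[of a] that[of "m a"] by (simp add: isCont_def filterlim_at_split)
    qed
    ultimately have "((\<lambda>s. M s - m s) \<longlongrightarrow> M a - l) (at_right a)" by (intro tendsto_intros)
    moreover have "M a - l < r" using \<open>l \<ge> v\<close> r by (simp add: M_def)
    ultimately show "\<forall>\<^sub>F s in at_right a. M s - m s < r" by (rule order_tendstoD)
  qed (use h in auto)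
  then show ?thesis using w by (simp add: M_def)
qed

end

section \<open>Rational enclosures of the exponential at the grid points\<close>

lemma exp_mult_ge:
  fixes x y :: real
  assumes "l \<le> exp x" "l' \<le> exp y" "0 \<le> l" "0 \<le> l'" "x + y = z" "l'' \<le> l * l'"
  shows "l'' \<le> exp z"
proof -
  have "l * l' \<le> exp x * exp y" using assms by (intro mult_mono) auto
  then show ?thesis using assms by (simp flip: exp_add)
qed

lemma exp_mult_le:
  fixes x y :: real
  assumes "exp x \<le> u" "exp y \<le> u'" "x + y = z" "u * u' \<le> u''"
  shows "exp z \<le> u''"
proof -
  have "exp x * exp y \<le> u * u'"
    using assms order_trans[OF exp_ge_zero \<open>exp x \<le> u\<close>] by (intro mult_mono) auto
  then show ?thesis using assms by (simp flip: exp_add)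
qed

text \<open>The Taylor bounds are sharp only for small arguments. All grid values are therefore
  built from 1/4 by multiplication, each product being rounded outward.\<close>

lemma exp_1_4: "12840254166877 / 10000000000000 \<le> exp (1 / 4 :: real)" "exp (1 / 4 :: real) \<le> 3210063541721 / 2500000000000"
proof -
  show "12840254166877 / 10000000000000 \<le> exp (1 / 4 :: real)"
    by (rule order_trans[OF _ exp_lo_le]) (simp_all add: exp_lo_def)
  show "exp (1 / 4 :: real) \<le> 3210063541721 / 2500000000000"
    by (rule order_trans[OF le_exp_hi]) (simp_all add: exp_hi_def)
qed

lemma exp_1_2: "16487212707 / 10000000000 \<le> exp (1 / 2 :: real)" "exp (1 / 2 :: real) \<le> 164872127071 / 100000000000"
  by (rule exp_mult_ge[OF exp_1_4(1) exp_1_4(1)]; simp) (rule exp_mult_le[OF exp_1_4(2) exp_1_4(2)]; simp)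

lemma exp_1_1: "54365636569 / 20000000000 \<le> exp (1 :: real)" "exp (1 :: real) \<le> 5436563657 / 2000000000"
  by (rule exp_mult_ge[OF exp_1_2(1) exp_1_2(1)]; simp) (rule exp_mult_le[OF exp_1_2(2) exp_1_2(2)]; simp)

lemma exp_3_4: "211700001661 / 100000000000 \<le> exp (3 / 4 :: real)" "exp (3 / 4 :: real) \<le> 211700001663 / 100000000000"
  by (rule exp_mult_ge[OF exp_1_2(1) exp_1_4(1)]; simp) (rule exp_mult_le[OF exp_1_2(2) exp_1_4(2)]; simp)

lemma exp_7_4: "575460267597 / 100000000000 \<le> exp (7 / 4 :: real)" "exp (7 / 4 :: real) \<le> 287730133807 / 50000000000"
  by (rule exp_mult_ge[OF exp_1_1(1) exp_3_4(1)]; simp) (rule exp_mult_le[OF exp_1_1(2) exp_3_4(2)]; simp)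

lemma exp_5_2: "1218249396061 / 100000000000 \<le> exp (5 / 2 :: real)" "exp (5 / 2 :: real) \<le> 1218249396109 / 100000000000"
  by (rule exp_mult_ge[OF exp_7_4(1) exp_3_4(1)]; simp) (rule exp_mult_le[OF exp_7_4(2) exp_3_4(2)]; simp)

lemma exp_7_2: "413943149479 / 12500000000 \<le> exp (7 / 2 :: real)" "exp (7 / 2 :: real) \<le> 132461807841 / 4000000000"
  by (rule exp_mult_ge[OF exp_5_2(1) exp_1_1(1)]; simp) (rule exp_mult_le[OF exp_5_2(2) exp_1_1(2)]; simp)

lemma exp_9_2: "9001713129921 / 100000000000 \<le> exp (9 / 2 :: real)" "exp (9 / 2 :: real) \<le> 2250428282653 / 25000000000"
  by (rule exp_mult_ge[OF exp_7_2(1) exp_1_1(1)]; simp) (rule exp_mult_le[OF exp_7_2(2) exp_1_1(2)]; simp)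

lemma exp_11_2: "95582786039 / 390625000 \<le> exp (11 / 2 :: real)" "exp (11 / 2 :: real) \<le> 24469193228313 / 100000000000"
  by (rule exp_mult_ge[OF exp_9_2(1) exp_1_1(1)]; simp) (rule exp_mult_le[OF exp_9_2(2) exp_1_1(2)]; simp)

lemma exp_13_2: "4157135206439 / 6250000000 \<le> exp (13 / 2 :: real)" "exp (13 / 2 :: real) \<le> 66514163310579 / 100000000000"
  by (rule exp_mult_ge[OF exp_11_2(1) exp_1_1(1)]; simp) (rule exp_mult_le[OF exp_11_2(2) exp_1_1(2)]; simp)

lemma exp_15_2: "36160848288233 / 20000000000 \<le> exp (15 / 2 :: real)" "exp (15 / 2 :: real) \<le> 180804241465029 / 100000000000"
  by (rule exp_mult_ge[OF exp_13_2(1) exp_1_1(1)]; simp) (rule exp_mult_le[OF exp_13_2(2) exp_1_1(2)]; simp)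

lemma exp_17_2: "98295376803241 / 20000000000 \<le> exp (17 / 2 :: real)" "exp (17 / 2 :: real) \<le> 98295376818023 / 20000000000"
  by (rule exp_mult_ge[OF exp_15_2(1) exp_1_1(1)]; simp) (rule exp_mult_le[OF exp_15_2(2) exp_1_1(2)]; simp)

lemma exp_19_2: "667986341462239 / 50000000000 \<le> exp (19 / 2 :: real)" "exp (19 / 2 :: real) \<le> 1335972683149961 / 100000000000"
  by (rule exp_mult_ge[OF exp_17_2(1) exp_1_1(1)]; simp) (rule exp_mult_le[OF exp_17_2(2) exp_1_1(2)]; simp)

section \<open>Polynomial barriers on the pieces up to 19/2\<close>

context riccati begin

text \<open>The polynomials \<open>N\<close> are rounded Taylor polynomials of solutions of the equation with its right-hand
  side slightly enlarged or reduced, which gives the residual a strict sign.\<close>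

lemma upper_0: "m (1 / 2) \<le> 96223 / 5000000"
proof -
  have "m (0 + 1 / 2) \<le> 96223 / 5000000"
    \<comment> \<open>Near 0 the solution behaves like s^3/6, so N starts with two zeros followed by
      a number slightly above 1/6. The value e = 1 is e^0.\<close>
    by (rule upper_piece[where e = "1" and v = "0" and
        N = "[:0, 0, 6667 / 40000, -2083229 / 100000000, -486153 / 50000000, 2777 / 4000000, 65937 / 100000000, 3 / 20000000:]"])
      (simp_all add: residual_def exp_lo_def pderiv_pCons power2_eq_square)
  then show ?thesis by simp
qed

text \<open>From here on v is the bound proved at the left endpoint a, and e is e^a rounded down; in
  the lower chain e is rounded up.\<close>

lemma upper_1: "m 1 \<le> 274863 / 2000000"
proof -
  have "m (1 / 2 + 1 / 2) \<le> 274863 / 2000000"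
    by (rule upper_piece[where e = "1648721 / 1000000" and v = "96223 / 5000000" and
        N = "[:558763 / 5000000, 2076819 / 10000000, 129781 / 1250000, -199097 / 5000000, -45123 / 10000000, 3203 / 1250000, 147 / 500000, -1657 / 10000000:]"])
      (use upper_0 exp_1_2 in \<open>simp_all add: residual_def exp_lo_def pderiv_pCons power2_eq_square\<close>)
  then show ?thesis by simp
qed

lemma upper_2: "m (7 / 4) \<le> 5853797 / 10000000"
proof -
  have "m (1 + 3 / 4) \<le> 5853797 / 10000000"
    by (rule upper_piece[where e = "2718281 / 1000000" and v = "274863 / 2000000" and
        N = "[:3764851 / 10000000, 375711 / 1250000, 196493 / 10000000, -409701 / 10000000, 17463 / 5000000, 11867 / 5000000, -3767 / 10000000, -647 / 5000000:]"])
      (use upper_1 exp_1_1 in \<open>simp_all add: residual_def exp_lo_def pderiv_pCons power2_eq_square\<close>)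
  then show ?thesis by simp
qed

lemma upper_3: "m (5 / 2) \<le> 12825293 / 10000000"
proof -
  have "m (7 / 4 + 3 / 4) \<le> 12825293 / 10000000"
    by (rule upper_piece[where e = "2877301 / 500000" and v = "5853797 / 10000000" and
        N = "[:3998439 / 5000000, 575387 / 2500000, -86177 / 1250000, -151911 / 10000000, 81171 / 10000000, -3569 / 10000000, -4367 / 10000000, 17 / 200000:]"])
      (use upper_2 exp_7_4 in \<open>simp_all add: residual_def exp_lo_def pderiv_pCons power2_eq_square\<close>)
  then show ?thesis by simp
qed

lemma upper_4: "m (7 / 2) \<le> 2286753 / 1000000"
proof -
  have "m (5 / 2 + 1) \<le> 2286753 / 1000000"
    by (rule upper_piece[where e = "12182493 / 1000000" and v = "12825293 / 10000000" and
        N = "[:10148333 / 10000000, 545997 / 10000000, -754741 / 10000000, 9801 / 1250000, 276 / 78125, -49 / 40000, 651 / 10000000, 51 / 1000000:]"])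
      (use upper_3 exp_5_2 in \<open>simp_all add: residual_def exp_lo_def pderiv_pCons power2_eq_square\<close>)
  then show ?thesis by simp
qed

lemma upper_5: "m (9 / 2) \<le> 31022503 / 10000000"
proof -
  have "m (7 / 2 + 1) \<le> 31022503 / 10000000"
    by (rule upper_piece[where e = "165577 / 5000" and v = "2286753 / 1000000" and
        N = "[:9400359 / 10000000, -42197 / 400000, -292079 / 10000000, 2857 / 250000, -87 / 80000, -2777 / 10000000, 231 / 2000000, -33 / 2000000:]"])
      (use upper_4 exp_7_2 in \<open>simp_all add: residual_def exp_lo_def pderiv_pCons power2_eq_square\<close>)
  then show ?thesis by simp
qed

lemma upper_6: "m (11 / 2) \<le> 36522081 / 10000000"
proof -
  have "m (9 / 2 + 1) \<le> 36522081 / 10000000"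
    by (rule upper_piece[where e = "900171 / 10000" and v = "31022503 / 10000000" and
        N = "[:1361423 / 2000000, -688119 / 5000000, 6411 / 2000000, 949 / 200000, -12023 / 10000000, 583 / 5000000, 121 / 10000000, -17 / 2500000:]"])
      (use upper_5 exp_9_2 in \<open>simp_all add: residual_def exp_lo_def pderiv_pCons power2_eq_square\<close>)
  then show ?thesis by simp
qed

lemma upper_7: "m (13 / 2) \<le> 7968173 / 2000000"
proof -
  have "m (11 / 2 + 1) \<le> 7968173 / 2000000"
    by (rule upper_piece[where e = "2446919 / 10000" and v = "36522081 / 10000000" and
        N = "[:1071973 / 2500000, -1097059 / 10000000, 12633 / 1000000, 5701 / 10000000, -309 / 625000, 959 / 10000000, -93 / 10000000, -1 / 5000000:]"])
      (use upper_6 exp_11_2 in \<open>simp_all add: residual_def exp_lo_def pderiv_pCons power2_eq_square\<close>)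
  then show ?thesis by simp
qed

lemma upper_8: "m (15 / 2) \<le> 5212893 / 1250000"
proof -
  have "m (13 / 2 + 1) \<le> 5212893 / 1250000"
    by (rule upper_piece[where e = "831427 / 1250" and v = "7968173 / 2000000" and
        N = "[:154747 / 625000, -90107 / 1250000, 115673 / 10000000, -779 / 1000000, -1031 / 10000000, 193 / 5000000, -61 / 10000000, 3 / 5000000:]"])
      (use upper_7 exp_13_2 in \<open>simp_all add: residual_def exp_lo_def pderiv_pCons power2_eq_square\<close>)
  then show ?thesis by simp
qed

lemma upper_9: "m (17 / 2) \<le> 10673837 / 2500000"
proof -
  have "m (15 / 2 + 1) \<le> 10673837 / 2500000"
    by (rule upper_piece[where e = "2260053 / 1250" and v = "5212893 / 1250000" and
        N = "[:1346877 / 10000000, -26639 / 625000, 80093 / 10000000, -2229 / 2500000, 37 / 1250000, 99 / 10000000, -3 / 1250000, 3 / 10000000:]"])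
      (use upper_8 exp_15_2 in \<open>simp_all add: residual_def exp_lo_def pderiv_pCons power2_eq_square\<close>)
  then show ?thesis by simp
qed

lemma upper_10: "m (19 / 2) \<le> 4320351 / 1000000"
proof -
  have "m (17 / 2 + 1) \<le> 4320351 / 1000000"
    by (rule upper_piece[where e = "6143461 / 1250" and v = "10673837 / 2500000" and
        N = "[:28039 / 400000, -117709 / 5000000, 9737 / 2000000, -6603 / 10000000, 53 / 1000000, -1 / 10000000, -7 / 10000000, 1 / 10000000:]"])
      (use upper_9 exp_17_2 in \<open>simp_all add: residual_def exp_lo_def pderiv_pCons power2_eq_square\<close>)
  then show ?thesis by simp
qed

lemma lower_0: "192423 / 10000000 \<le> m (1 / 2)"
proof -
  have "192423 / 10000000 \<le> m (0 + 1 / 2)"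
    \<comment> \<open>The first nonzero coefficient lies slightly below 1/6; the zero constant term
      of N is the condition of \<open>lower_piece\<close> at a = 0.\<close>
    by (rule lower_piece[where e = "1" and v = "0" and
        N = "[:0, 0, 16665833 / 100000000, -2083437 / 100000000, -972139 / 100000000, 8683 / 12500000, 2637 / 4000000, 11 / 100000000:]"])
      (simp_all add: residual_def exp_hi_def pderiv_pCons power2_eq_square)
  then show ?thesis by simp
qed

lemma lower_1: "1374143 / 10000000 \<le> m 1"
proof -
  have "1374143 / 10000000 \<le> m (1 / 2 + 1 / 2)"
    by (rule lower_piece[where e = "824361 / 500000" and v = "192423 / 10000000" and
        N = "[:223479 / 2000000, 25957 / 125000, 129761 / 1250000, -79633 / 2000000, -45103 / 10000000, 12811 / 5000000, 1469 / 5000000, -207 / 1250000, -197 / 10000000:]"])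
      (use lower_0 exp_1_2 in \<open>simp_all add: residual_def exp_hi_def pderiv_pCons power2_eq_square\<close>)
  then show ?thesis by simp
qed

lemma lower_2: "5853029 / 10000000 \<le> m (7 / 4)"
proof -
  have "5853029 / 10000000 \<le> m (1 + 3 / 4)"
    by (rule lower_piece[where e = "1359141 / 500000" and v = "1374143 / 10000000" and
        N = "[:3764361 / 10000000, 1502627 / 5000000, 196429 / 10000000, -409639 / 10000000, 34931 / 10000000, 1483 / 625000, -3767 / 10000000, -647 / 5000000, 1 / 31250:]"])
      (use lower_1 exp_1_1 in \<open>simp_all add: residual_def exp_hi_def pderiv_pCons power2_eq_square\<close>)
  then show ?thesis by simp
qed

lemma lower_3: "12823519 / 10000000 \<le> m (5 / 2)"
proof -
  have "12823519 / 10000000 \<le> m (7 / 4 + 3 / 4)"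
    by (rule lower_piece[where e = "5754603 / 1000000" and v = "5853029 / 10000000" and
        N = "[:7995741 / 10000000, 230117 / 1000000, -137863 / 2000000, -243 / 16000, 20289 / 2500000, -357 / 1000000, -2183 / 5000000, 17 / 200000, 137 / 10000000:]"])
      (use lower_2 exp_7_4 in \<open>simp_all add: residual_def exp_hi_def pderiv_pCons power2_eq_square\<close>)
  then show ?thesis by simp
qed

lemma lower_4: "11432073 / 5000000 \<le> m (7 / 2)"
proof -
  have "11432073 / 5000000 \<le> m (5 / 2 + 1)"
    by (rule lower_piece[where e = "6091247 / 500000" and v = "12823519 / 10000000" and
        N = "[:253671 / 250000, 545907 / 10000000, -754611 / 10000000, 19599 / 2500000, 883 / 250000, -1531 / 1250000, 651 / 10000000, 51 / 1000000, -69 / 5000000:]"])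
      (use lower_3 exp_5_2 in \<open>simp_all add: residual_def exp_hi_def pderiv_pCons power2_eq_square\<close>)
  then show ?thesis by simp
qed

lemma lower_5: "31017943 / 10000000 \<le> m (9 / 2)"
proof -
  have "31017943 / 10000000 \<le> m (7 / 2 + 1)"
    by (rule lower_piece[where e = "66231 / 2000" and v = "11432073 / 5000000" and
        N = "[:4699491 / 5000000, -52737 / 500000, -58407 / 2000000, 114259 / 10000000, -10873 / 10000000, -2777 / 10000000, 577 / 5000000, -33 / 2000000, -1 / 1250000:]"])
      (use lower_4 exp_7_2 in \<open>simp_all add: residual_def exp_hi_def pderiv_pCons power2_eq_square\<close>)
  then show ?thesis by simp
qed

lemma lower_6: "9129197 / 2500000 \<le> m (11 / 2)"
proof -
  have "9129197 / 2500000 \<le> m (9 / 2 + 1)"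
    by (rule lower_piece[where e = "225043 / 2500" and v = "31017943 / 10000000" and
        N = "[:850771 / 1250000, -68801 / 500000, 32043 / 10000000, 47443 / 10000000, -12021 / 10000000, 583 / 5000000, 121 / 10000000, -17 / 2500000, 13 / 10000000:]"])
      (use lower_5 exp_9_2 in \<open>simp_all add: residual_def exp_hi_def pderiv_pCons power2_eq_square\<close>)
  then show ?thesis by simp
qed

lemma lower_7: "796703 / 200000 \<le> m (13 / 2)"
proof -
  have "796703 / 200000 \<le> m (11 / 2 + 1)"
    by (rule lower_piece[where e = "61173 / 250" and v = "9129197 / 2500000" and
        N = "[:4287329 / 10000000, -1096899 / 10000000, 126307 / 10000000, 5701 / 10000000, -4943 / 10000000, 959 / 10000000, -93 / 10000000, -1 / 5000000, 3 / 10000000:]"])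
      (use lower_6 exp_11_2 in \<open>simp_all add: residual_def exp_hi_def pderiv_pCons power2_eq_square\<close>)
  then show ?thesis by simp
qed

lemma lower_8: "41697201 / 10000000 \<le> m (15 / 2)"
proof -
  have "41697201 / 10000000 \<le> m (13 / 2 + 1)"
    by (rule lower_piece[where e = "6651417 / 10000" and v = "796703 / 200000" and
        N = "[:2475643 / 10000000, -720759 / 10000000, 23131 / 2000000, -1947 / 2500000, -1031 / 10000000, 193 / 5000000, -61 / 10000000, 3 / 5000000, 0:]"])
      (use lower_7 exp_13_2 in \<open>simp_all add: residual_def exp_hi_def pderiv_pCons power2_eq_square\<close>)
  then show ?thesis by simp
qed

lemma lower_9: "42689289 / 10000000 \<le> m (17 / 2)"
proof -
  have "42689289 / 10000000 \<le> m (15 / 2 + 1)"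
    by (rule lower_piece[where e = "723217 / 400" and v = "41697201 / 10000000" and
        N = "[:336679 / 2500000, -42617 / 1000000, 40041 / 5000000, -4457 / 5000000, 37 / 1250000, 99 / 10000000, -3 / 1250000, 3 / 10000000, 0:]"])
      (use lower_8 exp_15_2 in \<open>simp_all add: residual_def exp_hi_def pderiv_pCons power2_eq_square\<close>)
  then show ?thesis by simp
qed

lemma lower_10: "43197393 / 10000000 \<le> m (19 / 2)"
proof -
  have "43197393 / 10000000 \<le> m (17 / 2 + 1)"
    by (rule lower_piece[where e = "49147689 / 10000" and v = "42689289 / 10000000" and
        N = "[:350447 / 5000000, -23539 / 1000000, 48679 / 10000000, -3301 / 5000000, 53 / 1000000, -1 / 10000000, -7 / 10000000, 1 / 10000000, 0:]"])
      (use lower_9 exp_17_2 in \<open>simp_all add: residual_def exp_hi_def pderiv_pCons power2_eq_square\<close>)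
  then show ?thesis by simp
qed

end

section \<open>The tail from 19/2 to infinity\<close>

context riccati begin

lemma m_mono: "0 < a \<Longrightarrow> a \<le> b \<Longrightarrow> m a \<le> m b"
  by (rule DERIV_nonneg_imp_nondecreasing) (auto intro!: exI deriv_m)

text \<open>In (s^2 + c)^2 / (2 s) = s^3/2 + c s + c^2 / (2 s) the last term is dropped, and 1 /
  (e^s - 1) is replaced by e^(-s): the minorant has an elementary primitive.\<close>

lemma rate_tail_ge:
  assumes "s > 0" "c \<ge> 0" "x \<ge> c"
  shows "exp (- s) * (s ^ 3 / 2 + c * s) \<le> rate s x"
proof -
  have "(s ^ 3 / 2 + c * s) * (2 * s) \<le> (s\<^sup>2 + c)\<^sup>2"
    using assms by (simp add: power2_eq_square power3_eq_cube algebra_simps)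
  also have "\<dots> \<le> (s\<^sup>2 + x)\<^sup>2" using assms by (intro power_mono add_mono) auto
  finally have "s ^ 3 / 2 + c * s \<le> (s\<^sup>2 + x)\<^sup>2 / (2 * s)"
    using assms by (simp add: pos_le_divide_eq)
  moreover have "exp (- s) \<le> 1 / (exp s - 1)"
    using assms by (simp add: exp_minus inverse_eq_divide frac_le)
  ultimately have "exp (- s) * (s ^ 3 / 2 + c * s) \<le> 1 / (exp s - 1) * ((s\<^sup>2 + x)\<^sup>2 / (2 * s))"
    using assms by (intro mult_mono) auto
  then show ?thesis by (simp add: rate_def mult_ac)
qed

text \<open>A majorant of the same shape: c^2 / (2 s) is frozen at s = S, and e^s - 1 is at least
  e^s (1 - e^(-S)).\<close>

lemma rate_tail_le:
  assumes "s \<ge> S" "S > 0" "0 \<le> x" "x \<le> c"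
  shows "rate s x \<le> exp (- s) * (1 / (1 - exp (- S))) * (s ^ 3 / 2 + c * s + c\<^sup>2 / (2 * S))"
proof -
  have s: "s > 0" using assms by linarith
  have "c\<^sup>2 / (2 * s) \<le> c\<^sup>2 / (2 * S)" using assms by (intro divide_left_mono) auto
  moreover have "(s\<^sup>2 + c)\<^sup>2 / (2 * s) = s ^ 3 / 2 + c * s + c\<^sup>2 / (2 * s)"
    using s by (simp add: field_simps power2_eq_square power3_eq_cube)
  moreover have "(s\<^sup>2 + x)\<^sup>2 / (2 * s) \<le> (s\<^sup>2 + c)\<^sup>2 / (2 * s)"
    using assms s by (intro divide_right_mono power_mono add_mono) auto
  ultimately have 1: "(s\<^sup>2 + x)\<^sup>2 / (2 * s) \<le> s ^ 3 / 2 + c * s + c\<^sup>2 / (2 * S)" by linarith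
  have "exp (- s) \<le> exp (- S)" using assms by simp
  then have "exp s * (1 - exp (- S)) \<le> exp s * (1 - exp (- s))" by (intro mult_left_mono) auto
  also have "\<dots> = exp s - 1" by (simp add: exp_minus field_simps)
  finally have "1 / (exp s - 1) \<le> 1 / (exp s * (1 - exp (- S)))"
    using s assms by (intro divide_left_mono) (auto intro!: mult_pos_pos)
  then have 2: "1 / (exp s - 1) \<le> exp (- s) * (1 / (1 - exp (- S)))"
    by (simp add: exp_minus field_simps)
  have "rate s x = 1 / (exp s - 1) * ((s\<^sup>2 + x)\<^sup>2 / (2 * s))" by (simp add: rate_def mult_ac)
  also have "\<dots> \<le> (exp (- s) * (1 / (1 - exp (- S)))) * (s ^ 3 / 2 + c * s + c\<^sup>2 / (2 * S))"
    using 1 2 s assms by (intro mult_mono) auto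
  finally show ?thesis .
qed

text \<open>Minus a primitive of the majorant of the rate.\<close>

definition tail :: "real \<Rightarrow> real \<Rightarrow> real \<Rightarrow> real" where
  "tail c k s = exp (- s) * ((s ^ 3 + 3 * s\<^sup>2 + 6 * s + 6) / 2 + c * (s + 1) + k)"

lemma deriv_tail: "(tail c k has_real_derivative - (exp (- s) * (s ^ 3 / 2 + c * s + k))) (at s)"
  unfolding tail_def by (auto intro!: derivative_eq_intros simp: field_simps power2_eq_square power3_eq_cube)

lemma tail_nonneg: "c \<ge> 0 \<Longrightarrow> k \<ge> 0 \<Longrightarrow> s \<ge> 0 \<Longrightarrow> tail c k s \<ge> 0"
  unfolding tail_def by (intro mult_nonneg_nonneg add_nonneg_nonneg) auto

lemma tail_tendsto: "(tail c k \<longlongrightarrow> 0) at_top"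
proof -
  have *: "((\<lambda>s::real. s ^ n * exp (- s)) \<longlongrightarrow> 0) at_top" for n
    using tendsto_power_div_exp_0[of n] by (simp add: exp_minus field_simps)
  have "((\<lambda>s::real. (s ^ 3 * exp (- s) + 3 * (s ^ 2 * exp (- s)) + 6 * (s ^ 1 * exp (- s)) + 6 * (s ^ 0 * exp (- s))) / 2
      + c * (s ^ 1 * exp (- s) + s ^ 0 * exp (- s)) + k * (s ^ 0 * exp (- s))) \<longlongrightarrow>
      (0 + 3 * 0 + 6 * 0 + 6 * 0) / 2 + c * (0 + 0) + k * 0) at_top"
    by (intro tendsto_intros *) auto
  then show ?thesis unfolding tail_def by (simp add: field_simps)
qed

text \<open>Since m is nondecreasing, c stays a lower bound beyond S, so \<open>m + tail c 0\<close>
  has a nonnegative derivative there. As \<open>tail\<close> tends to 0, the limit of the sum is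
  \<open>\<beta>\<close>.\<close>

lemma limit_ge:
  assumes S: "S > 0" and c: "0 \<le> c" "c \<le> m S"
  shows "c + tail c 0 S \<le> \<beta>"
proof -
  have "c - tail c 0 s + tail c 0 S \<le> m s" if s: "s \<ge> S" for s
  proof -
    have "(\<lambda>x. m x + tail c 0 x) S \<le> (\<lambda>x. m x + tail c 0 x) s"
    proof (rule DERIV_nonneg_imp_nondecreasing[OF s])
      fix x assume x: "S \<le> x" "x \<le> s"
      have "m x \<ge> c" using m_mono[OF S x(1)] c by linarith
      then have "exp (- x) * (x ^ 3 / 2 + c * x) \<le> rate x (m x)"
        using x S c by (intro rate_tail_ge) auto
      moreover have "((\<lambda>x. m x + tail c 0 x) has_real_derivative rate x (m x) + - (exp (- x) * (x ^ 3 / 2 + c * x + 0))) (at x)"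
        unfolding rate_def using x S by (intro DERIV_add deriv_m deriv_tail) auto
      ultimately show "\<exists>y. ((\<lambda>x. m x + tail c 0 x) has_real_derivative y) (at x) \<and> 0 \<le> y" by force
    qed
    then show ?thesis using c by simp
  qed
  then have "\<forall>\<^sub>F s in at_top. c - tail c 0 s + tail c 0 S \<le> m s"
    by (auto simp: eventually_at_top_linorder)
  moreover have "((\<lambda>s. c - tail c 0 s + tail c 0 S) \<longlongrightarrow> c - 0 + tail c 0 S) at_top"
    by (intro tendsto_intros tail_tendsto)
  ultimately show ?thesis using m_tendsto tendsto_le[of at_top m \<beta> _ "c - 0 + tail c 0 S"] by auto
qed

text \<open>Bounding the rate from above presupposes a bound of m by c, the very conclusion. The
  circle is broken by comparison: c - T stays below c, so its rate is at most the majorant for c,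
  and T is chosen so that this majorant is the derivative of c - T. Thus c - T is a supersolution
  starting above \<open>m S\<close>.\<close>

lemma limit_le:
  assumes S: "S > 0" and c0: "c \<ge> 0" and c: "m S \<le> c - 1 / (1 - exp (- S)) * tail c (c\<^sup>2 / (2 * S)) S"
  shows "\<beta> \<le> c"
proof -
  define K where "K = 1 / (1 - exp (- S))"
  define T where "T s = K * tail c (c\<^sup>2 / (2 * S)) s" for s
  have K: "K > 0" using S by (simp add: K_def)
  have T0: "T s \<ge> 0" if "s \<ge> S" for s
    unfolding T_def using that S K c0 by (intro mult_nonneg_nonneg tail_nonneg) auto
  have "m s \<le> c" if s: "s > S" for s
  proof -
    have "m s \<le> c - T s"
    proof (rule upper_barrier[where a = S and b = s and M' = "\<lambda>s. K * (exp (- s) * (s ^ 3 / 2 + c * s + c\<^sup>2 / (2 * S)))"])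
      fix x assume x: "x \<in> {S<..s}"
      show "((\<lambda>s. c - T s) has_real_derivative K * (exp (- x) * (x ^ 3 / 2 + c * x + c\<^sup>2 / (2 * S)))) (at x)"
        unfolding T_def using DERIV_diff[OF DERIV_const[of c] DERIV_cmult[OF deriv_tail[of c "c\<^sup>2 / (2 * S)" x], of K]]
        by simp
      have "T x \<le> T S"
      proof (rule DERIV_nonpos_imp_nonincreasing[of S x T])
        show "S \<le> x" using x by simp
        fix z assume z: "S \<le> z" "z \<le> x"
        have "K * (- (exp (- z) * (z ^ 3 / 2 + c * z + c\<^sup>2 / (2 * S)))) \<le> 0"
          using z S c0 K by (intro mult_nonneg_nonpos) (auto intro!: mult_nonneg_nonneg add_nonneg_nonneg)
        then show "\<exists>y. (T has_real_derivative y) (at z) \<and> y \<le> 0"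
          unfolding T_def using DERIV_cmult[OF deriv_tail] by blast
      qed
      then show 0: "0 \<le> c - T x" using m_nonneg[OF S] c by (simp add: T_def K_def)
      show "rate x (c - T x) \<le> K * (exp (- x) * (x ^ 3 / 2 + c * x + c\<^sup>2 / (2 * S)))"
        using rate_tail_le[of S x "c - T x" c] x S 0 T0[of x] by (simp add: K_def mult_ac)
    next
      fix e :: real assume "e > 0"
      have "((\<lambda>s. m s - (c - T s)) \<longlongrightarrow> m S - (c - T S)) (at S)"
        using m_cont[OF S] DERIV_isCont[OF deriv_tail[of c "c\<^sup>2 / (2 * S)" S]]
        unfolding T_def isCont_def by (intro tendsto_intros)
      then have "((\<lambda>s. m s - (c - T s)) \<longlongrightarrow> m S - (c - T S)) (at_right S)"
        by (rule tendsto_within_subset) auto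
      moreover have "m S - (c - T S) < e" using c \<open>e > 0\<close> by (simp add: T_def K_def)
      ultimately show "\<forall>\<^sub>F s in at_right S. m s - (c - T s) < e" by (rule order_tendstoD)
    qed (use S s in auto)
    then show ?thesis using T0[of s] s by linarith
  qed
  then have "\<forall>\<^sub>F s in at_top. m s \<le> c" by (rule eventually_mono[OF eventually_gt_at_top[of S]])
  then show ?thesis using m_tendsto tendsto_upperbound trivial_limit_at_top_linorder by blast
qed

theorem limit_bounds: "22.24 * pi / 16 \<le> \<beta>" "\<beta> < 22.25 * pi / 16"
proof -
  \<comment> \<open>e^(19/2) is about 13359.73. The numbers 640 and 643 below round the polynomial
    factor of \<open>tail\<close> at 19/2, about 640.9 in the lower and 642.4 in the upper
    estimate.\<close>
  have e: "1 / 13360 \<le> exp (- (19 / 2 :: real))" "exp (- (19 / 2 :: real)) \<le> 1 / 13359"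
    using exp_19_2 by (simp_all add: exp_minus inverse_eq_divide field_simps)
  have "43197393 / 10000000 + tail (43197393 / 10000000) 0 (19 / 2) \<le> \<beta>"
    by (rule limit_ge) (use lower_10 in auto)
  moreover have "1 / 13360 * 640 \<le> tail (43197393 / 10000000) 0 (19 / 2)"
    unfolding tail_def by (intro mult_mono e) (simp_all add: power2_eq_square power3_eq_cube)
  ultimately show "22.24 * pi / 16 \<le> \<beta>" using pi_approx(2) by simp
  \<comment> \<open>This is 22.25 pi / 16 rounded down. Its distance to the upper bound of
    \<open>m (19 / 2)\<close> is about 0.0484, just enough for the tail of about 0.0481.\<close>
  define c :: real where "c = 436877 / 100000"
  have t: "tail c (c\<^sup>2 / (2 * (19 / 2))) (19 / 2) \<le> 1 / 13359 * 643"
    unfolding tail_def unfolding c_def by (intro mult_mono e) (simp_all add: power2_eq_square power3_eq_cube)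
  have "1 / (1 - exp (- (19 / 2 :: real))) \<le> 1 / (1 - 1 / 13359)"
    using e by (intro divide_left_mono) auto
  then have "1 / (1 - exp (- (19 / 2))) * tail c (c\<^sup>2 / (2 * (19 / 2))) (19 / 2)
      \<le> 1 / (1 - 1 / 13359) * (1 / 13359 * 643)"
    using t by (intro mult_mono tail_nonneg) (simp_all add: c_def)
  also have "\<dots> \<le> c - 4320351 / 1000000" unfolding c_def by simp
  finally have "\<beta> \<le> c" using upper_10 by (intro limit_le[of "19 / 2"]) (simp_all add: c_def[symmetric], simp add: c_def)
  then show "\<beta> < 22.25 * pi / 16" using pi_approx(1) by (simp add: c_def)
qed

end

section \<open>Tempered and rapidly decreasing functions\<close>

text \<open>Growth classes that serve integrability and boundary terms only; conditions on
  derivatives are added in \<open>nice1\<close> and \<open>temp1\<close>. Measurability is included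
  because a size bound alone does not yield an integral.\<close>

definition tempered :: "(plane \<Rightarrow> real) \<Rightarrow> bool" where
  "tempered f \<longleftrightarrow> f \<in> borel_measurable borel \<and> (\<exists>C n. \<forall>\<xi>. \<bar>f \<xi>\<bar> \<le> C * (1 + norm \<xi>) ^ n)"

definition rapid :: "(plane \<Rightarrow> real) \<Rightarrow> bool" where
  "rapid f \<longleftrightarrow> f \<in> borel_measurable borel \<and> (\<forall>n. \<exists>C. \<forall>\<xi>. \<bar>f \<xi>\<bar> * (1 + norm \<xi>) ^ n \<le> C)"

lemma rapid_measurable [measurable_dest]: "rapid f \<Longrightarrow> f \<in> borel_measurable borel"
  by (simp add: rapid_def)

lemma tempered_measurable [measurable_dest]: "tempered f \<Longrightarrow> f \<in> borel_measurable borel"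
  by (simp add: tempered_def)

lemma rapidD:
  assumes "rapid f"
  obtains C where "C > 0" "\<And>\<xi>. \<bar>f \<xi>\<bar> \<le> C / (1 + norm \<xi>) ^ n"
proof -
  obtain C where C: "\<And>\<xi>. \<bar>f \<xi>\<bar> * (1 + norm \<xi>) ^ n \<le> C"
    using assms unfolding rapid_def by meson
  have "\<bar>f \<xi>\<bar> \<le> max C 1 / (1 + norm \<xi>) ^ n" for \<xi>
    using C[of \<xi>] by (simp add: pos_le_divide_eq add_pos_nonneg le_max_iff_disj)
  then show ?thesis by (intro that[of "max C 1"]) auto
qed

lemma temperedD:
  assumes "tempered f"
  obtains C n where "C > 0" "\<And>\<xi>. \<bar>f \<xi>\<bar> \<le> C * (1 + norm \<xi>) ^ n"
proof -
  obtain C n where C: "\<And>\<xi>. \<bar>f \<xi>\<bar> \<le> C * (1 + norm \<xi>) ^ n"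
    using assms unfolding tempered_def by meson
  have "\<bar>f \<xi>\<bar> \<le> max C 1 * (1 + norm \<xi>) ^ n" for \<xi>
    using C[of \<xi>] by (rule order_trans) (auto intro!: mult_right_mono)
  then show ?thesis by (intro that[of "max C 1" n]) auto
qed

lemma temperedI:
  "f \<in> borel_measurable borel \<Longrightarrow> (\<And>\<xi>. \<bar>f \<xi>\<bar> \<le> C * (1 + norm \<xi>) ^ n) \<Longrightarrow> tempered f"
  by (auto simp: tempered_def)

lemma tempered_mult_rapid:
  assumes "tempered f" "rapid g"
  shows "rapid (\<lambda>\<xi>. f \<xi> * g \<xi>)"
proof -
  obtain C k where C: "C > 0" "\<And>\<xi>. \<bar>f \<xi>\<bar> \<le> C * (1 + norm \<xi>) ^ k"
    using temperedD[OF assms(1)] by metis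
  have "\<exists>D. \<forall>\<xi>. \<bar>f \<xi> * g \<xi>\<bar> * (1 + norm \<xi>) ^ n \<le> D" for n
  proof -
    obtain D where D: "D > 0" "\<And>\<xi>. \<bar>g \<xi>\<bar> \<le> D / (1 + norm \<xi>) ^ (k + n)"
      using rapidD[OF assms(2), of "k + n"] by metis
    have "\<bar>f \<xi> * g \<xi>\<bar> * (1 + norm \<xi>) ^ n \<le> C * D" for \<xi>
    proof -
      have p: "1 + norm \<xi> > 0" by (simp add: add_pos_nonneg)
      have "\<bar>f \<xi> * g \<xi>\<bar> * (1 + norm \<xi>) ^ n
        \<le> (C * (1 + norm \<xi>) ^ k) * (D / (1 + norm \<xi>) ^ (k + n)) * (1 + norm \<xi>) ^ n"
        unfolding abs_mult using C D p by (intro mult_right_mono mult_mono) auto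
      also have "\<dots> = C * D" using p by (simp add: power_add)
      finally show ?thesis .
    qed
    then show ?thesis by blast
  qed
  then show ?thesis using assms by (auto simp: rapid_def dest: tempered_measurable)
qed

lemma rapid_mult_tempered: "rapid f \<Longrightarrow> tempered g \<Longrightarrow> rapid (\<lambda>\<xi>. f \<xi> * g \<xi>)"
  using tempered_mult_rapid[of g f] by (simp add: mult.commute)

lemma tempered_mult:
  assumes "tempered f" "tempered g"
  shows "tempered (\<lambda>\<xi>. f \<xi> * g \<xi>)"
proof -
  obtain C k where C: "C > 0" "\<And>\<xi>. \<bar>f \<xi>\<bar> \<le> C * (1 + norm \<xi>) ^ k"
    using temperedD[OF assms(1)] by metis
  obtain D l where D: "D > 0" "\<And>\<xi>. \<bar>g \<xi>\<bar> \<le> D * (1 + norm \<xi>) ^ l"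
    using temperedD[OF assms(2)] by metis
  have "\<bar>f \<xi> * g \<xi>\<bar> \<le> (C * D) * (1 + norm \<xi>) ^ (k + l)" for \<xi>
    using mult_mono[OF C(2)[of \<xi>] D(2)[of \<xi>]] C D by (simp add: abs_mult power_add mult_ac)
  then show ?thesis using assms by (intro temperedI) (auto dest: tempered_measurable)
qed

lemma rapid_add: assumes "rapid f" "rapid g" shows "rapid (\<lambda>\<xi>. f \<xi> + g \<xi>)"
proof -
  have "\<exists>D. \<forall>\<xi>. \<bar>f \<xi> + g \<xi>\<bar> * (1 + norm \<xi>) ^ n \<le> D" for n
  proof -
    obtain C D where "\<And>\<xi>. \<bar>f \<xi>\<bar> * (1 + norm \<xi>) ^ n \<le> C" "\<And>\<xi>. \<bar>g \<xi>\<bar> * (1 + norm \<xi>) ^ n \<le> D"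
      using assms by (meson rapid_def)
    moreover have "\<bar>f \<xi> + g \<xi>\<bar> * (1 + norm \<xi>) ^ n \<le> \<bar>f \<xi>\<bar> * (1 + norm \<xi>) ^ n + \<bar>g \<xi>\<bar> * (1 + norm \<xi>) ^ n" for \<xi>
      by (simp flip: distrib_right add: mult_right_mono)
    ultimately have "\<bar>f \<xi> + g \<xi>\<bar> * (1 + norm \<xi>) ^ n \<le> C + D" for \<xi> by (meson add_mono order_trans)
    then show ?thesis by blast
  qed
  then show ?thesis using assms by (auto simp: rapid_def)
qed

lemma tempered_add: assumes "tempered f" "tempered g" shows "tempered (\<lambda>\<xi>. f \<xi> + g \<xi>)"
proof -
  obtain C k where C: "C > 0" "\<And>\<xi>. \<bar>f \<xi>\<bar> \<le> C * (1 + norm \<xi>) ^ k"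
    using temperedD[OF assms(1)] by metis
  obtain D l where D: "D > 0" "\<And>\<xi>. \<bar>g \<xi>\<bar> \<le> D * (1 + norm \<xi>) ^ l"
    using temperedD[OF assms(2)] by metis
  have "\<bar>f \<xi> + g \<xi>\<bar> \<le> (C + D) * (1 + norm \<xi>) ^ (k + l)" for \<xi>
  proof -
    have "C * (1 + norm \<xi>) ^ k \<le> C * (1 + norm \<xi>) ^ (k + l)" "D * (1 + norm \<xi>) ^ l \<le> D * (1 + norm \<xi>) ^ (k + l)"
      using C D by (auto intro!: mult_left_mono power_increasing)
    then show ?thesis using C(2)[of \<xi>] D(2)[of \<xi>] by (simp add: distrib_right)
  qed
  then show ?thesis using assms by (intro temperedI) (auto dest: tempered_measurable)
qed

lemma tempered_const: "tempered (\<lambda>\<xi>. c)"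
  by (intro temperedI[of _ "\<bar>c\<bar>" 0]) auto

lemma abs_fst_le: "\<bar>fst (\<xi>::plane)\<bar> \<le> norm \<xi>" and abs_snd_le: "\<bar>snd (\<xi>::plane)\<bar> \<le> norm \<xi>"
  using norm_fst_le[of "fst \<xi>" "snd \<xi>"] norm_snd_le[of "snd \<xi>" "fst \<xi>"] by auto

lemma tempered_fst: "tempered fst"
  using abs_fst_le by (intro temperedI[of _ 1 1]) (auto intro: add_increasing simp flip: borel_prod simp del: split_paired_All)

lemma tempered_snd: "tempered snd"
  using abs_snd_le by (intro temperedI[of _ 1 1]) (auto intro: add_increasing simp flip: borel_prod simp del: split_paired_All)

lemma tempered_norm: "tempered norm"
  by (intro temperedI[of _ 1 1]) auto

lemma rapid_cmult: "rapid f \<Longrightarrow> rapid (\<lambda>\<xi>. c * f \<xi>)"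
  by (rule tempered_mult_rapid[OF tempered_const])

lemma rapid_0: "rapid (\<lambda>\<xi>. 0)"
  by (auto simp: rapid_def)

lemma rapid_minus: "rapid f \<Longrightarrow> rapid (\<lambda>\<xi>. - f \<xi>)"
  using rapid_cmult[of f "-1"] by simp

lemma rapid_diff: "rapid f \<Longrightarrow> rapid g \<Longrightarrow> rapid (\<lambda>\<xi>. f \<xi> - g \<xi>)"
  using rapid_add[OF _ rapid_minus, of f g] by simp

lemma tempered_diff: "tempered f \<Longrightarrow> tempered g \<Longrightarrow> tempered (\<lambda>\<xi>. f \<xi> - g \<xi>)"
  using tempered_add[OF _ tempered_mult[OF tempered_const[of "-1"]], of f g] by simp

lemma rapid_sum: "(\<And>k. k \<in> A \<Longrightarrow> rapid (f k)) \<Longrightarrow> rapid (\<lambda>\<xi>. \<Sum>k\<in>A. f k \<xi>)"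
  by (induction A rule: infinite_finite_induct) (auto intro: rapid_0 rapid_add)

lemma tempered_power: "tempered f \<Longrightarrow> tempered (\<lambda>\<xi>. f \<xi> ^ n)"
  by (induction n) (auto intro: tempered_const tempered_mult)

lemma rapid_abs: "rapid f \<Longrightarrow> rapid (\<lambda>\<xi>. \<bar>f \<xi>\<bar>)"
  by (auto simp: rapid_def)

section \<open>Integrability on the plane and the convolution with 1/|x|\<close>

lemma lborel_plane: "(lborel :: plane measure) = lborel \<Otimes>\<^sub>M lborel"
  by (rule lborel_prod[symmetric])

lemma integrable_inverse_quadratic: "integrable lborel (\<lambda>x::real. 1 / (1 + x\<^sup>2))"
  and integral_inverse_quadratic: "(LINT x|lborel. 1 / (1 + x\<^sup>2 :: real)) = pi"
proof -
  have d: "(arctan has_real_derivative 1 / (1 + x\<^sup>2)) (at x)" for x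
    using DERIV_arctan[of x] by (simp add: inverse_eq_divide)
  have c: "isCont (\<lambda>x::real. 1 / (1 + x\<^sup>2)) x" for x
    by (intro continuous_intros) (auto simp: add_nonneg_eq_0_iff)
  have bot: "((arctan \<circ> real_of_ereal) \<longlongrightarrow> - (pi / 2)) (at_right (- \<infinity>))"
    using tendsto_arctan_at_bot by (simp add: ereal_tendsto_simps)
  have top: "((arctan \<circ> real_of_ereal) \<longlongrightarrow> pi / 2) (at_left \<infinity>)"
    using tendsto_arctan_at_top by (simp add: ereal_tendsto_simps)
  have i: "set_integrable lborel (einterval (-\<infinity>) \<infinity>) (\<lambda>x. 1 / (1 + x\<^sup>2 :: real))"
    and v: "(LBINT x=-\<infinity>..\<infinity>. 1 / (1 + x\<^sup>2 :: real)) = pi / 2 - (- (pi / 2))"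
    using interval_integral_FTC_nonneg[of "-\<infinity>" \<infinity> arctan "\<lambda>x. 1 / (1 + x\<^sup>2)", OF _ d c _ bot top]
    by (auto intro!: AE_I2)
  show "integrable lborel (\<lambda>x::real. 1 / (1 + x\<^sup>2))" using i by (simp add: set_integrable_def)
  show "(LINT x|lborel. 1 / (1 + x\<^sup>2 :: real)) = pi"
    using v by (simp add: interval_lebesgue_integral_def set_lebesgue_integral_def)
qed

text \<open>Converts decay in the norm into a product of one-dimensional weights 1 / (1 + x^2), each
  with integral pi. Hence the exponent 4 in the bounds below.\<close>

lemma quadratic_product_le: "(1 + (fst \<xi>)\<^sup>2) * (1 + (snd \<xi>)\<^sup>2) \<le> (1 + norm (\<xi>::plane)) ^ 4"
proof -
  have "(1 + (fst \<xi>)\<^sup>2) * (1 + (snd \<xi>)\<^sup>2) \<le> (1 + norm \<xi>)\<^sup>2 * (1 + norm \<xi>)\<^sup>2"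
  proof (intro mult_mono)
    have "(fst \<xi>)\<^sup>2 \<le> (norm \<xi>)\<^sup>2" "(snd \<xi>)\<^sup>2 \<le> (norm \<xi>)\<^sup>2"
      using abs_fst_le[of \<xi>] abs_snd_le[of \<xi>] by (auto simp flip: abs_le_square_iff)
    then show "1 + (fst \<xi>)\<^sup>2 \<le> (1 + norm \<xi>)\<^sup>2" "1 + (snd \<xi>)\<^sup>2 \<le> (1 + norm \<xi>)\<^sup>2"
      using norm_ge_zero[of \<xi>] by (simp_all add: power2_sum add_increasing2)
  qed auto
  then show ?thesis by (simp flip: power_add)
qed

text \<open>A bound for the convolution with \<open>1/|x|\<close>: by the inequality between the means,
  \<open>1/|z|\<close> is at most a product of functions of the coordinates of \<open>z\<close> with integrable
  singularities.\<close>

definition sing :: "real \<Rightarrow> real" where "sing t = \<bar>t\<bar> powr (- 1 / 2)"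

lemma sing_measurable [measurable]: "sing \<in> borel_measurable borel"
  unfolding sing_def by measurable

lemma inverse_norm_le_sing:
  assumes "fst z \<noteq> 0" "snd z \<noteq> 0"
  shows "1 / norm (z::plane) \<le> sing (fst z) * sing (snd z)"
proof -
  have "\<bar>fst z\<bar> * \<bar>snd z\<bar> \<le> norm z * norm z"
    by (intro mult_mono abs_fst_le abs_snd_le) auto
  then have "(\<bar>fst z\<bar> * \<bar>snd z\<bar>) powr (1 / 2) \<le> (norm z * norm z) powr (1 / 2)"
    by (intro powr_mono2) auto
  also have "\<dots> = norm z" by (simp add: powr_half_sqrt)
  finally have "1 / norm z \<le> 1 / (\<bar>fst z\<bar> * \<bar>snd z\<bar>) powr (1 / 2)"
    using assms by (intro divide_left_mono mult_pos_pos) auto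
  also have "\<dots> = sing (fst z) * sing (snd z)"
    by (simp add: sing_def powr_mult powr_minus_divide)
  finally show ?thesis .
qed

lemma indicator_mult_eq_if: "indicat_real A x * c = (if x \<in> A then c else 0)"
  by simp

text \<open>Where |x - a| > 1 the singular factor is at most 1, which costs pi; near a the two
  one-sided integrals of t^(-1/2) over [0, 1] cost 2 each. The bound does not depend on a.\<close>

lemma nn_integral_sing_bound:
  "(\<integral>\<^sup>+x. ennreal (sing (x - a) / (1 + x\<^sup>2)) \<partial>lborel) \<le> ennreal (pi + 4)"
proof -
  define s0 :: "real \<Rightarrow> ennreal" where "s0 t = ennreal (indicator {0..1} t * t powr (-1/2))" for t
  have s0 [measurable]: "s0 \<in> borel_measurable borel" unfolding s0_def by measurable
  have I0: "(\<integral>\<^sup>+t. s0 t \<partial>lborel) = 2"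
  proof -
    have "((\<lambda>t::real. t powr (-1/2)) has_integral 2) {0..1}"
      using has_integral_powr_from_0[of "-1/2" 1] by simp
    then have "((\<lambda>t::real. indicator {0..1} t * t powr (-1/2)) has_integral 2) UNIV"
      unfolding indicator_mult_eq_if has_integral_restrict_UNIV .
    then have "(\<integral>\<^sup>+t. ennreal (indicator {0..1} t * t powr (-1/2)) \<partial>lborel) = ennreal 2"
      by (intro nn_integral_has_integral_lborel) simp_all
    then show ?thesis by (simp add: s0_def)
  qed
  have Ip: "(\<integral>\<^sup>+t. s0 (t - a) \<partial>lborel) = 2"
    using nn_integral_real_affine[OF s0, of 1 "- a"] I0 by (simp add: add.commute)
  have Im: "(\<integral>\<^sup>+t. s0 (a - t) \<partial>lborel) = 2"
    using nn_integral_real_affine[OF s0, of "-1" a] I0 by simp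
  have "(\<integral>\<^sup>+x. ennreal (sing (x - a) / (1 + x\<^sup>2)) \<partial>lborel) \<le>
     (\<integral>\<^sup>+x. ennreal (1 / (1 + x\<^sup>2)) + (s0 (x - a) + s0 (a - x)) \<partial>lborel)"
  proof (rule nn_integral_mono)
    fix x :: real
    have q: "0 < 1 + x\<^sup>2" by (simp add: add_pos_nonneg)
    show "ennreal (sing (x - a) / (1 + x\<^sup>2)) \<le> ennreal (1 / (1 + x\<^sup>2)) + (s0 (x - a) + s0 (a - x))"
    proof (cases "\<bar>x - a\<bar> \<le> 1")
      case True
      have "sing (x - a) / (1 + x\<^sup>2) \<le> sing (x - a)"
        using q mult_left_mono[of 1 "1 + x\<^sup>2" "sing (x - a)"] by (simp add: pos_divide_le_eq sing_def)
      then have "ennreal (sing (x - a) / (1 + x\<^sup>2)) \<le> ennreal (sing (x - a))" by (rule ennreal_leI)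
      also have "\<dots> \<le> s0 (x - a) + s0 (a - x)"
        using True by (cases "x \<ge> a") (auto simp: s0_def sing_def add_increasing add_increasing2)
      finally show ?thesis by (simp add: add_increasing)
    next
      case False
      have "sing (x - a) \<le> \<bar>x - a\<bar> powr 0" unfolding sing_def using False by (intro powr_mono) auto
      then have "sing (x - a) \<le> 1" using False by (auto split: if_splits)
      then have "sing (x - a) / (1 + x\<^sup>2) \<le> 1 / (1 + x\<^sup>2)"
        using q by (intro divide_right_mono) auto
      then show ?thesis by (simp add: add_increasing2 ennreal_leI)
    qed
  qed
  also have "\<dots> = (\<integral>\<^sup>+x. ennreal (1 / (1 + x\<^sup>2)) \<partial>lborel) + ((\<integral>\<^sup>+x. s0 (x - a) \<partial>lborel) + (\<integral>\<^sup>+x. s0 (a - x) \<partial>lborel))"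
    by (simp add: nn_integral_add)
  also have "(\<integral>\<^sup>+x. ennreal (1 / (1 + x\<^sup>2)) \<partial>lborel) = ennreal pi"
    using nn_integral_eq_integral[OF integrable_inverse_quadratic] integral_inverse_quadratic by simp
  finally show ?thesis unfolding Ip Im by (simp add: ennreal_plus)
qed

text \<open>\<open>inverse_norm_le_sing\<close> splits the kernel into functions of one coordinate,
  except on the two axis-parallel lines through a, which are null. Uniformity in a matters later,
  when a is the mirror image of a point and moves to infinity as \<epsilon> tends to 0.\<close>

lemma nn_integral_inverse_norm:
  assumes [measurable]: "g \<in> borel_measurable borel"
    and C: "\<And>\<eta>::plane. \<bar>g \<eta>\<bar> \<le> C / (1 + norm \<eta>) ^ 4" "C > 0"
  shows "(\<integral>\<^sup>+\<eta>. ennreal (\<bar>g \<eta>\<bar> / norm (a - \<eta>)) \<partial>lborel) \<le> ennreal (C * (pi + 4)\<^sup>2)"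
proof -
  have "(\<lambda>\<eta>::plane. ennreal (\<bar>g \<eta>\<bar> / norm (a - \<eta>))) \<in> borel_measurable lborel"
    by measurable
  note m = this[unfolded lborel_plane]
  have "(\<integral>\<^sup>+\<eta>. ennreal (\<bar>g \<eta>\<bar> / norm (a - \<eta>)) \<partial>lborel) =
     (\<integral>\<^sup>+x. (\<integral>\<^sup>+y. ennreal (\<bar>g (x, y)\<bar> / norm (a - (x, y))) \<partial>lborel) \<partial>lborel)"
    unfolding lborel_plane by (rule lborel.nn_integral_fst[OF m, symmetric])
  also have "\<dots> \<le> (\<integral>\<^sup>+x. (\<integral>\<^sup>+y. ennreal C * (ennreal (sing (x - fst a) / (1 + x\<^sup>2)) * ennreal (sing (y - snd a) / (1 + y\<^sup>2))) \<partial>lborel) \<partial>lborel)"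
  proof (intro nn_integral_mono_AE)
    show "AE x in lborel. (\<integral>\<^sup>+y. ennreal (\<bar>g (x, y)\<bar> / norm (a - (x, y))) \<partial>lborel) \<le>
      (\<integral>\<^sup>+y. ennreal C * (ennreal (sing (x - fst a) / (1 + x\<^sup>2)) * ennreal (sing (y - snd a) / (1 + y\<^sup>2))) \<partial>lborel)"
      using AE_lborel_singleton[of "fst a"]
    proof eventually_elim
      case (elim x)
      show ?case
      proof (intro nn_integral_mono_AE)
        show "AE y in lborel. ennreal (\<bar>g (x, y)\<bar> / norm (a - (x, y))) \<le>
          ennreal C * (ennreal (sing (x - fst a) / (1 + x\<^sup>2)) * ennreal (sing (y - snd a) / (1 + y\<^sup>2)))"
          using AE_lborel_singleton[of "snd a"]
        proof eventually_elim
          case (elim y)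
          have p: "0 < (1 + x\<^sup>2) * (1 + y\<^sup>2)" by (intro mult_pos_pos add_pos_nonneg) auto
          have "\<bar>g (x, y)\<bar> \<le> C / (1 + norm (x, y)) ^ 4" by (rule C)
          also have "\<dots> \<le> C / ((1 + x\<^sup>2) * (1 + y\<^sup>2))"
            using quadratic_product_le[of "(x, y)"] C(2) p by (intro frac_le) simp_all
          finally have 1: "\<bar>g (x, y)\<bar> \<le> C / ((1 + x\<^sup>2) * (1 + y\<^sup>2))" .
          have "1 / norm ((x, y) - a) \<le> sing (x - fst a) * sing (y - snd a)"
            using inverse_norm_le_sing[of "(x, y) - a"] elim \<open>x \<noteq> fst a\<close> by simp
          then have "\<bar>g (x, y)\<bar> * (1 / norm (a - (x, y))) \<le>
              C / ((1 + x\<^sup>2) * (1 + y\<^sup>2)) * (sing (x - fst a) * sing (y - snd a))"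
            using 1 by (intro mult_mono) (auto simp: norm_minus_commute)
          then have "\<bar>g (x, y)\<bar> / norm (a - (x, y)) \<le>
              C * (sing (x - fst a) / (1 + x\<^sup>2) * (sing (y - snd a) / (1 + y\<^sup>2)))" by (simp add: mult_ac)
          then show ?case
            using C(2) by (simp flip: ennreal_mult'' add: ennreal_leI sing_def)
        qed
      qed
    qed
  qed
  also have "\<dots> = ennreal C * ((\<integral>\<^sup>+x. ennreal (sing (x - fst a) / (1 + x\<^sup>2)) \<partial>lborel) *
     (\<integral>\<^sup>+y. ennreal (sing (y - snd a) / (1 + y\<^sup>2)) \<partial>lborel))"
    by (simp add: nn_integral_cmult nn_integral_multc mult.assoc)
  also have "\<dots> \<le> ennreal C * (ennreal (pi + 4) * ennreal (pi + 4))"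
    by (intro mult_left_mono mult_mono nn_integral_sing_bound) auto
  also have "\<dots> = ennreal (C * (pi + 4)\<^sup>2)"
    using C(2) by (simp add: power2_eq_square ennreal_mult'')
  finally show ?thesis .
qed

lemma inverse_norm_integrable:
  assumes [measurable]: "g \<in> borel_measurable borel"
    and C: "\<And>\<eta>::plane. \<bar>g \<eta>\<bar> \<le> C / (1 + norm \<eta>) ^ 4" "C > 0"
  shows "integrable lborel (\<lambda>\<eta>::plane. \<bar>g \<eta>\<bar> / norm (a - \<eta>))"
    and "(LINT \<eta>|lborel. \<bar>g \<eta>\<bar> / norm (a - \<eta>)) \<le> C * (pi + 4)\<^sup>2"
proof -
  show i: "integrable lborel (\<lambda>\<eta>::plane. \<bar>g \<eta>\<bar> / norm (a - \<eta>))"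
  proof (rule integrableI_bounded)
    have "(\<integral>\<^sup>+\<eta>. ennreal (\<bar>g \<eta>\<bar> / norm (a - \<eta>)) \<partial>lborel) < \<infinity>"
      using nn_integral_inverse_norm[OF assms, of a] by (rule le_less_trans) simp
    then show "(\<integral>\<^sup>+\<eta>. ennreal (norm (\<bar>g \<eta>\<bar> / norm (a - \<eta>))) \<partial>lborel) < \<infinity>" by simp
  qed measurable
  have "ennreal (LINT \<eta>|lborel. \<bar>g \<eta>\<bar> / norm (a - \<eta>)) \<le> ennreal (C * (pi + 4)\<^sup>2)"
    using nn_integral_inverse_norm[OF assms, of a] by (subst nn_integral_eq_integral[OF i, symmetric]) simp_all
  then show "(LINT \<eta>|lborel. \<bar>g \<eta>\<bar> / norm (a - \<eta>)) \<le> C * (pi + 4)\<^sup>2"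
    using C(2) by (subst (asm) ennreal_le_iff) auto
qed

text \<open>|g| is at most |g| (1 + |x|) / |x|, so plain integrability is the kernel bound centred
  at 0, at the price of one power of decay.\<close>

lemma decay_integrable:
  assumes [measurable]: "g \<in> borel_measurable borel"
    and C: "\<And>\<eta>::plane. \<bar>g \<eta>\<bar> \<le> C / (1 + norm \<eta>) ^ 5" "C > 0"
  shows "integrable lborel (g :: plane \<Rightarrow> real)"
proof (rule Bochner_Integration.integrable_bound)
  have "\<bar>g \<eta> * (1 + norm \<eta>)\<bar> \<le> C / (1 + norm \<eta>) ^ 4" for \<eta>
  proof -
    have p: "1 + norm \<eta> > 0" by (simp add: add_pos_nonneg)
    have "\<bar>g \<eta>\<bar> * (1 + norm \<eta>) \<le> C / (1 + norm \<eta>) ^ 5 * (1 + norm \<eta>)"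
      using C(1)[of \<eta>] p by (intro mult_right_mono) simp_all
    also have "\<dots> = C / (1 + norm \<eta>) ^ 4" using p by (simp add: eval_nat_numeral)
    finally show ?thesis using p by (simp add: abs_mult)
  qed
  then show "integrable lborel (\<lambda>\<eta>::plane. \<bar>g \<eta> * (1 + norm \<eta>)\<bar> / norm (0 - \<eta>))"
    by (intro inverse_norm_integrable[where C = C]) (simp_all add: C(2))
  have *: "\<bar>g \<eta>\<bar> \<le> \<bar>g \<eta> * (1 + norm \<eta>)\<bar> / norm \<eta>" if "\<eta> \<noteq> 0" for \<eta>
    using that by (simp add: abs_mult pos_le_divide_eq mult_left_mono)
  show "AE \<eta> in lborel. norm (g \<eta>) \<le> norm (\<bar>g \<eta> * (1 + norm \<eta>)\<bar> / norm (0 - \<eta>))"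
  proof (rule AE_mp[OF AE_lborel_singleton[of "0 :: plane"]], rule AE_I2, rule impI)
    fix \<eta> :: plane assume "\<eta> \<noteq> 0"
    then show "norm (g \<eta>) \<le> norm (\<bar>g \<eta> * (1 + norm \<eta>)\<bar> / norm (0 - \<eta>))"
      using *[of \<eta>] by simp
  qed
qed simp

lemma rapid_integrable: "rapid f \<Longrightarrow> integrable lborel f"
  using rapidD[of f 5] decay_integrable[of f] rapid_measurable[of f] by metis

section \<open>Integration by parts along slices\<close>

lemma integral_deriv_eq_0:
  fixes u u' :: "real \<Rightarrow> 'a::euclidean_space"
  assumes der: "\<And>x. (u has_vector_derivative u' x) (at x)"
    and int: "integrable lborel u'"
    and top: "(u \<longlongrightarrow> l) at_top" and bot: "(u \<longlongrightarrow> l) at_bot"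
  shows "(LINT x|lborel. u' x) = 0"
proof -
  have [measurable]: "u' \<in> borel_measurable borel" using int by auto
  \<comment> \<open>Fundamental theorem on [-n, n], then dominated convergence. The common limit l
    is left arbitrary because \<open>turn\<close> tends to -1 at both ends.\<close>
  have "(\<lambda>n. LINT x|lborel. indicator {- real n..real n} x *\<^sub>R u' x) \<longlonglongrightarrow> (LINT x|lborel. u' x)"
  proof (rule integral_dominated_convergence[where w = "\<lambda>x. norm (u' x)"])
    show "AE x in lborel. (\<lambda>n. indicator {- real n..real n} x *\<^sub>R u' x) \<longlonglongrightarrow> u' x"
    proof (rule AE_I2)
      fix x :: real
      obtain N where N: "\<bar>x\<bar> \<le> real N" using real_arch_simple by blast
      have "indicator {- real n..real n} x *\<^sub>R u' x = u' x" if "n \<ge> N" for n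
        using N that by (auto simp: indicator_def abs_le_iff)
      then have "\<forall>\<^sub>F n in sequentially. indicator {- real n..real n} x *\<^sub>R u' x = u' x"
        by (auto simp: eventually_sequentially)
      then show "(\<lambda>n. indicator {- real n..real n} x *\<^sub>R u' x) \<longlonglongrightarrow> u' x"
        by (rule tendsto_eventually)
    qed
  qed (use int in \<open>auto simp: indicator_def\<close>)
  moreover have "(LINT x|lborel. indicator {- real n..real n} x *\<^sub>R u' x) = u (real n) - u (- real n)" for n
  proof -
    have "(u' has_integral u (real n) - u (- real n)) {- real n..real n}"
      by (intro fundamental_theorem_of_calculus) (auto intro!: has_vector_derivative_at_within der)
    moreover have "set_integrable lborel {- real n..real n} u'"
      unfolding set_integrable_def using int by (intro integrable_mult_indicator) auto
    ultimately show ?thesis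
      using set_borel_integral_eq_integral(2)[of "{- real n..real n}" u']
      by (simp add: set_lebesgue_integral_def integral_unique)
  qed
  moreover have "(\<lambda>n. u (real n) - u (- real n)) \<longlonglongrightarrow> l - l"
  proof (rule tendsto_diff)
    show "(\<lambda>n. u (real n)) \<longlonglongrightarrow> l"
      by (rule filterlim_compose[OF top filterlim_real_sequentially])
    show "(\<lambda>n. u (- real n)) \<longlonglongrightarrow> l"
      by (rule filterlim_compose[OF bot])
        (rule filterlim_compose[OF filterlim_uminus_at_bot_at_top filterlim_real_sequentially])
  qed
  ultimately show ?thesis using LIMSEQ_unique by force
qed

lemma integral_slice_deriv_eq_0:
  fixes u u1 :: "plane \<Rightarrow> real"
  assumes der: "\<And>x y. y \<noteq> c \<Longrightarrow> ((\<lambda>s. u (s, y)) has_real_derivative u1 (x, y)) (at x)"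
    and int: "integrable lborel u1"
    and top: "\<And>y. y \<noteq> c \<Longrightarrow> ((\<lambda>x. u (x, y)) \<longlongrightarrow> 0) at_top"
    and bot: "\<And>y. y \<noteq> c \<Longrightarrow> ((\<lambda>x. u (x, y)) \<longlongrightarrow> 0) at_bot"
  shows "(LINT \<xi>|lborel. u1 \<xi>) = 0"
proof -
  have i: "integrable (lborel \<Otimes>\<^sub>M lborel) (case_prod (\<lambda>x y. u1 (x, y)))"
    using int by (simp add: lborel_prod)
  have "(LINT \<xi>|lborel. u1 \<xi>) = (LINT y|lborel. LINT x|lborel. u1 (x, y))"
    using lborel_pair.integral_snd[OF i] by (simp add: lborel_prod)
  also have "\<dots> = 0"
  proof (rule integral_eq_zero_AE, rule AE_mp[OF AE_lborel_singleton[of c]], rule AE_I2, rule impI)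
    fix y :: real assume y: "y \<noteq> c"
    show "(LINT x|lborel. u1 (x, y)) = 0"
    proof (cases "integrable lborel (\<lambda>x. u1 (x, y))")
      case True
      then show ?thesis
        by (rule integral_deriv_eq_0[OF der[OF y, unfolded has_real_derivative_iff_has_vector_derivative] _ top[OF y] bot[OF y]])
    \<comment> \<open>A slice that is not integrable has integral 0 by convention.\<close>
    qed (rule not_integrable_integral_eq)
  qed
  finally show ?thesis .
qed

text \<open>Swapping the coordinates carries statements about \<open>pd1\<close> over to
  \<open>pd2\<close>. The fixed line of the swap, the diagonal, also serves to separate the angular
  parts of the profiles of order two.\<close>

definition flip :: "plane \<Rightarrow> plane" where "flip \<xi> = (snd \<xi>, fst \<xi>)"

lemma flip_simps [simp]: "flip (x, y) = (y, x)" "flip (flip \<xi>) = \<xi>" "fst (flip \<xi>) = snd \<xi>" "snd (flip \<xi>) = fst \<xi>"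
  by (simp_all add: flip_def)

lemma norm_flip [simp]: "norm (flip \<xi>) = norm \<xi>"
  by (simp add: flip_def norm_prod_def add.commute)

lemma flip_diff: "flip (\<xi> - \<eta>) = flip \<xi> - flip \<eta>"
  by (simp add: flip_def)

lemma flip_measurable [measurable]: "flip \<in> borel_measurable borel"
  unfolding flip_def by (simp flip: borel_prod)

lemma distr_flip: "distr lborel borel flip = lborel"
proof -
  have "(lborel :: plane measure) = distr (lborel \<Otimes>\<^sub>M lborel) (lborel \<Otimes>\<^sub>M lborel) (\<lambda>(x, y). (y, x))"
    unfolding lborel_plane by (rule lborel_pair.distr_pair_swap)
  also have "\<dots> = distr lborel borel flip"
    by (intro distr_cong) (simp_all add: lborel_prod flip_def split_beta flip: borel_prod)
  finally show ?thesis by simp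
qed

lemma integral_flip:
  fixes f :: "plane \<Rightarrow> 'a::{banach, second_countable_topology}"
  assumes "f \<in> borel_measurable borel"
  shows "(LINT \<xi>|lborel. f (flip \<xi>)) = (LINT \<xi>|lborel. f \<xi>)"
  using integral_distr[of flip lborel borel f] assms by (simp add: distr_flip)

lemma distr_reflect: "distr lborel borel (\<lambda>\<eta>. a - \<eta>) = (lborel :: plane measure)"
  using lborel_affine[of "-1" a] by (simp add: density_1)

lemma integral_reflect:
  fixes f :: "plane \<Rightarrow> 'a::{banach, second_countable_topology}"
  assumes "f \<in> borel_measurable borel"
  shows "(LINT \<xi>|lborel. f (a - \<xi>)) = (LINT \<xi>|lborel. f \<xi>)"
  using integral_distr[of "\<lambda>\<eta>. a - \<eta>" lborel borel f] assms by (simp add: distr_reflect)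

lemma integrable_reflect:
  fixes f :: "plane \<Rightarrow> 'a::{banach, second_countable_topology}"
  assumes "f \<in> borel_measurable borel"
  shows "integrable lborel (\<lambda>\<xi>. f (a - \<xi>)) \<longleftrightarrow> integrable lborel f"
  using integrable_distr_eq[of "\<lambda>\<eta>. a - \<eta>" lborel borel f] assms by (simp add: distr_reflect)

text \<open>\<open>pd1\<close> and \<open>pd2\<close> are values of the total function
  \<open>deriv\<close>; this condition makes them genuine derivatives along the axes.\<close>

definition slice_diff :: "(plane \<Rightarrow> real) \<Rightarrow> bool" where
  "slice_diff f \<longleftrightarrow> (\<forall>x y. (\<lambda>s. f (s, y)) field_differentiable (at x) \<and> (\<lambda>s. f (x, s)) field_differentiable (at y))"

lemma slice_diff_pd1: "slice_diff f \<Longrightarrow> ((\<lambda>s. f (s, y)) has_real_derivative pd1 f (x, y)) (at x)"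
  and slice_diff_pd2: "slice_diff f \<Longrightarrow> ((\<lambda>s. f (x, s)) has_real_derivative pd2 f (x, y)) (at y)"
  by (simp_all add: slice_diff_def pd1_def pd2_def DERIV_deriv_iff_field_differentiable)

lemma pd1_eqI: "(\<And>x y. ((\<lambda>s. f (s, y)) has_real_derivative g (x, y)) (at x)) \<Longrightarrow> pd1 f = g"
  and pd2_eqI: "(\<And>x y. ((\<lambda>s. f (x, s)) has_real_derivative g (x, y)) (at y)) \<Longrightarrow> pd2 f = g"
  by (simp_all add: fun_eq_iff pd1_def pd2_def DERIV_imp_deriv)

lemma slice_diffI:
  assumes "\<And>x y. ((\<lambda>s. f (s, y)) has_real_derivative g (x, y)) (at x)"
    and "\<And>x y. ((\<lambda>s. f (x, s)) has_real_derivative h (x, y)) (at y)"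
  shows "slice_diff f"
  unfolding slice_diff_def field_differentiable_def using assms by blast

lemma pd1_flip: "pd1 (\<lambda>\<xi>. f (flip \<xi>)) = (\<lambda>\<xi>. pd2 f (flip \<xi>))"
  and pd2_flip: "pd2 (\<lambda>\<xi>. f (flip \<xi>)) = (\<lambda>\<xi>. pd1 f (flip \<xi>))"
  by (simp_all add: fun_eq_iff pd1_def pd2_def)

lemma slice_diff_flip: "slice_diff f \<Longrightarrow> slice_diff (\<lambda>\<xi>. f (flip \<xi>))"
  by (simp add: slice_diff_def)

lemma rapid_flip: "rapid f \<Longrightarrow> rapid (\<lambda>\<xi>. f (flip \<xi>))"
proof -
  assume f: "rapid f"
  have "\<exists>C. \<forall>\<xi>. \<bar>f (flip \<xi>)\<bar> * (1 + norm \<xi>) ^ n \<le> C" for n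
  proof -
    obtain C where C: "\<And>\<xi>. \<bar>f \<xi>\<bar> * (1 + norm \<xi>) ^ n \<le> C" using f unfolding rapid_def by metis
    have "\<bar>f (flip \<xi>)\<bar> * (1 + norm \<xi>) ^ n \<le> C" for \<xi> using C[of "flip \<xi>"] by simp
    then show ?thesis by blast
  qed
  moreover have "(\<lambda>\<xi>. f (flip \<xi>)) \<in> borel_measurable borel"
    using f by (intro measurable_compose[OF flip_measurable]) (simp add: rapid_def)
  ultimately show ?thesis unfolding rapid_def by blast
qed

lemma tempered_flip: "tempered f \<Longrightarrow> tempered (\<lambda>\<xi>. f (flip \<xi>))"
proof -
  assume f: "tempered f"
  obtain C k where "\<And>\<xi>. \<bar>f \<xi>\<bar> \<le> C * (1 + norm \<xi>) ^ k" using temperedD[OF f] by metis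
  then have "\<bar>f (flip \<xi>)\<bar> \<le> C * (1 + norm \<xi>) ^ k" for \<xi> by (metis norm_flip)
  moreover have "(\<lambda>\<xi>. f (flip \<xi>)) \<in> borel_measurable borel"
    using f by (intro measurable_compose[OF flip_measurable]) (simp add: tempered_def)
  ultimately show ?thesis by (intro temperedI[of _ C k])
qed

text \<open>What the integral identities require of an element of \<open>Z_space\<close>, in a form
  that passes easily to finite linear combinations such as \<open>Omega_app\<close>.\<close>

definition nice1 :: "(plane \<Rightarrow> real) \<Rightarrow> bool" where
  "nice1 f \<longleftrightarrow> rapid f \<and> rapid (pd1 f) \<and> rapid (pd2 f) \<and> slice_diff f"

definition nice2 :: "(plane \<Rightarrow> real) \<Rightarrow> bool" where
  "nice2 f \<longleftrightarrow> nice1 f \<and> nice1 (pd1 f) \<and> nice1 (pd2 f) \<and> pd2 (pd1 f) = pd1 (pd2 f)"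

lemma nice1_flip: "nice1 f \<Longrightarrow> nice1 (\<lambda>\<xi>. f (flip \<xi>))"
  by (simp add: nice1_def pd1_flip pd2_flip rapid_flip slice_diff_flip)

section \<open>The logarithmic potential and its derivatives\<close>

lemma abs_ln_le: "\<bar>ln (norm (z::plane))\<bar> \<le> norm z + 1 / norm z"
proof (cases "z = 0")
  case False
  then have z: "norm z > 0" by simp
  have "ln (norm z) \<le> norm z" using ln_le_minus_one[OF z] by linarith
  moreover have "- ln (norm z) \<le> 1 / norm z"
    using ln_le_minus_one[of "1 / norm z"] z by (simp add: ln_div)
  ultimately show ?thesis using z by (simp add: abs_le_iff add_increasing add_increasing2)
qed simp

lemma abs_ln_diff_le:
  "\<bar>ln (norm (\<xi> - \<eta> :: plane)) * g\<bar> \<le> norm \<xi> * \<bar>g\<bar> + norm \<eta> * \<bar>g\<bar> + \<bar>g\<bar> / norm (\<xi> - \<eta>)"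
proof -
  have "\<bar>ln (norm (\<xi> - \<eta>))\<bar> \<le> norm \<xi> + norm \<eta> + 1 / norm (\<xi> - \<eta>)"
    using abs_ln_le[of "\<xi> - \<eta>"] norm_triangle_ineq4[of \<xi> \<eta>] by linarith
  then have "\<bar>ln (norm (\<xi> - \<eta>))\<bar> * \<bar>g\<bar> \<le> (norm \<xi> + norm \<eta> + 1 / norm (\<xi> - \<eta>)) * \<bar>g\<bar>"
    by (rule mult_right_mono) simp
  then show ?thesis by (simp add: abs_mult algebra_simps)
qed

lemma rapid_kernel_integrable: "rapid g \<Longrightarrow> integrable lborel (\<lambda>\<eta>. \<bar>g \<eta>\<bar> / norm (a - \<eta>))"
  using rapidD[of g 4] inverse_norm_integrable(1)[of g _ a] rapid_measurable[of g] by metis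

lemma rapid_kernel_bound:
  assumes "rapid g"
  obtains K where "K > 0" "\<And>a. (LINT \<eta>|lborel. \<bar>g \<eta>\<bar> / norm (a - \<eta>)) \<le> K"
proof -
  obtain C where C: "C > 0" "\<And>\<xi>. \<bar>g \<xi>\<bar> \<le> C / (1 + norm \<xi>) ^ 4" using rapidD[OF assms, of 4] by metis
  show ?thesis
  proof (rule that[of "C * (pi + 4)\<^sup>2"])
    show "C * (pi + 4)\<^sup>2 > 0" using C(1) by (intro mult_pos_pos zero_less_power add_pos_pos) auto
    show "(LINT \<eta>|lborel. \<bar>g \<eta>\<bar> / norm (a - \<eta>)) \<le> C * (pi + 4)\<^sup>2" for a
      by (rule inverse_norm_integrable(2)[OF rapid_measurable[OF assms] C(2,1)])
  qed
qed

lemma log_integrable: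
  assumes g: "rapid g"
  shows "integrable lborel (\<lambda>\<eta>. ln (norm (\<xi> - \<eta>)) * g \<eta>)"
proof (rule Bochner_Integration.integrable_bound)
  note [measurable] = rapid_measurable[OF g]
  show "integrable lborel (\<lambda>\<eta>. norm \<xi> * \<bar>g \<eta>\<bar> + norm \<eta> * \<bar>g \<eta>\<bar> + \<bar>g \<eta>\<bar> / norm (\<xi> - \<eta>))"
    by (intro Bochner_Integration.integrable_add rapid_integrable rapid_cmult rapid_abs g
        tempered_mult_rapid tempered_norm rapid_kernel_integrable)
  show "(\<lambda>\<eta>. ln (norm (\<xi> - \<eta>)) * g \<eta>) \<in> borel_measurable lborel" by measurable
  show "AE \<eta> in lborel. norm (ln (norm (\<xi> - \<eta>)) * g \<eta>) \<le> norm (norm \<xi> * \<bar>g \<eta>\<bar> + norm \<eta> * \<bar>g \<eta>\<bar> + \<bar>g \<eta>\<bar> / norm (\<xi> - \<eta>))"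
  proof (rule AE_I2)
    fix \<eta>
    show "norm (ln (norm (\<xi> - \<eta>)) * g \<eta>) \<le> norm (norm \<xi> * \<bar>g \<eta>\<bar> + norm \<eta> * \<bar>g \<eta>\<bar> + \<bar>g \<eta>\<bar> / norm (\<xi> - \<eta>))"
      using abs_ln_diff_le[of \<xi> \<eta> "g \<eta>"] unfolding real_norm_def by linarith
  qed
qed

text \<open>Integrable majorant for the difference quotients of the potential. The part of the
  logarithm bounded by the norm costs one power and leaves decay of order 5; the part bounded by
  1/norm falls under the kernel bound, for which order 4 suffices.\<close>

lemma log_decay_integrable: "integrable lborel (\<lambda>\<zeta>::plane. \<bar>ln (norm \<zeta>)\<bar> / (1 + norm \<zeta>) ^ 6)"
proof (rule Bochner_Integration.integrable_bound)
  have p: "1 + norm \<zeta> > 0" for \<zeta> :: plane by (simp add: add_pos_nonneg)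
  have "norm \<zeta> / (1 + norm \<zeta>) ^ 6 \<le> 1 / (1 + norm \<zeta>) ^ 5" for \<zeta> :: plane
  proof -
    have "norm \<zeta> / (1 + norm \<zeta>) ^ 6 \<le> (1 + norm \<zeta>) / (1 + norm \<zeta>) ^ 6"
      using p[of \<zeta>] by (intro divide_right_mono) simp_all
    also have "\<dots> = 1 / (1 + norm \<zeta>) ^ 5" 
    proof -
      have "x / x ^ 6 = 1 / x ^ 5" if "x \<noteq> 0" for x :: real
        using that by (simp add: eval_nat_numeral)
      then show ?thesis using p[of \<zeta>] by (metis less_irrefl)
    qed
    finally show ?thesis .
  qed
  then have "integrable lborel (\<lambda>\<zeta>::plane. norm \<zeta> / (1 + norm \<zeta>) ^ 6)"
    by (intro decay_integrable[where C = 1]) simp_all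
  moreover have "1 / (1 + norm \<zeta>) ^ 6 \<le> 1 / (1 + norm \<zeta>) ^ 4" for \<zeta> :: plane
    by (intro frac_le power_increasing zero_less_power p) simp_all
  then have "integrable lborel (\<lambda>\<zeta>::plane. \<bar>1 / (1 + norm \<zeta>) ^ 6\<bar> / norm (0 - \<zeta>))"
    by (intro inverse_norm_integrable[where C = 1]) simp_all
  ultimately show "integrable lborel (\<lambda>\<zeta>::plane. norm \<zeta> / (1 + norm \<zeta>) ^ 6 + \<bar>1 / (1 + norm \<zeta>) ^ 6\<bar> / norm (0 - \<zeta>))"
    by (rule Bochner_Integration.integrable_add)
  have *: "\<bar>ln (norm \<zeta>)\<bar> / (1 + norm \<zeta>) ^ 6 \<le> norm \<zeta> / (1 + norm \<zeta>) ^ 6 + \<bar>1 / (1 + norm \<zeta>) ^ 6\<bar> / norm (0 - \<zeta>)" for \<zeta> :: plane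
    using divide_right_mono[OF abs_ln_le[of \<zeta>], of "(1 + norm \<zeta>) ^ 6"] p[of \<zeta>]
    by (simp add: add_divide_distrib mult.commute)
  show "AE \<zeta> in lborel. norm (\<bar>ln (norm \<zeta>)\<bar> / (1 + norm (\<zeta>::plane)) ^ 6) \<le> norm (norm \<zeta> / (1 + norm \<zeta>) ^ 6 + \<bar>1 / (1 + norm \<zeta>) ^ 6\<bar> / norm (0 - \<zeta>))"
  proof (rule AE_I2)
    fix \<zeta> :: plane
    have "0 \<le> \<bar>ln (norm \<zeta>)\<bar> / (1 + norm \<zeta>) ^ 6" by simp
    then show "norm (\<bar>ln (norm \<zeta>)\<bar> / (1 + norm \<zeta>) ^ 6) \<le> norm (norm \<zeta> / (1 + norm \<zeta>) ^ 6 + \<bar>1 / (1 + norm \<zeta>) ^ 6\<bar> / norm (0 - \<zeta>))"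
      using *[of \<zeta>] unfolding real_norm_def by linarith
  qed
qed measurable

lemma inv_laplace_conv:
  assumes "f \<in> borel_measurable borel"
  shows "inv_laplace f \<xi> = 1 / (2 * pi) * (LINT \<zeta>|lborel. ln (norm \<zeta>) * f (\<xi> - \<zeta>))"
  using integral_reflect[of "\<lambda>\<zeta>. ln (norm \<zeta>) * f (\<xi> - \<zeta>)" \<xi>] assms
  by (simp add: inv_laplace_def)

lemma inv_laplace_flip:
  assumes "f \<in> borel_measurable borel"
  shows "inv_laplace (\<lambda>\<xi>. f (flip \<xi>)) \<xi> = inv_laplace f (flip \<xi>)"
proof -
  have n: "norm (\<xi> - flip \<eta>) = norm (flip \<xi> - \<eta>)" for \<eta> by (metis flip_diff flip_simps(2) norm_flip)
  have "(LINT \<eta>|lborel. ln (norm (\<xi> - \<eta>)) * f (flip \<eta>)) = (LINT \<eta>|lborel. ln (norm (\<xi> - flip \<eta>)) * f (flip (flip \<eta>)))"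
    using measurable_compose[OF flip_measurable assms] by (intro integral_flip[symmetric]) measurable
  then show ?thesis by (simp add: inv_laplace_def n)
qed

text \<open>After the substitution \<open>\<zeta> = \<xi> - \<eta>\<close> the variable sits in f
  instead of the logarithm. Differentiation under the integral then needs only the mean value
  theorem for f and dominated convergence.\<close>

lemma inv_laplace_deriv1:
  assumes f: "nice1 f"
  shows "((\<lambda>s. inv_laplace f (s, y)) has_real_derivative inv_laplace (pd1 f) (x, y)) (at x)"
proof -
  have r: "rapid f" "rapid (pd1 f)" and d: "slice_diff f" using f by (simp_all add: nice1_def)
  note [measurable] = r[THEN rapid_measurable]
  define \<xi> :: plane where "\<xi> = (x, y)"
  obtain C where C: "C > 0" "\<And>\<xi>. \<bar>pd1 f \<xi>\<bar> \<le> C / (1 + norm \<xi>) ^ 6" using rapidD[OF r(2), of 6] by metis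
  define w where "w \<zeta> = C * (2 + norm \<xi>) ^ 6 * (\<bar>ln (norm \<zeta>)\<bar> / (1 + norm \<zeta>) ^ 6)" for \<zeta> :: plane
  define q where "q h \<zeta> = ln (norm \<zeta>) * ((f (\<xi> + (h, 0) - \<zeta>) - f (\<xi> - \<zeta>)) / h)" for h and \<zeta> :: plane
  have quot: "\<bar>(f (\<xi> + (h, 0) - \<zeta>) - f (\<xi> - \<zeta>)) / h\<bar> \<le> C * (2 + norm \<xi>) ^ 6 / (1 + norm \<zeta>) ^ 6"
    if h: "h \<noteq> 0" "\<bar>h\<bar> \<le> 1" for h \<zeta>
  proof -
    define \<phi> where "\<phi> s = f (x - fst \<zeta> + s, y - snd \<zeta>)" for s
    have g: "((\<lambda>s. x - fst \<zeta> + s) has_real_derivative 1) (at s)" for s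
      by (auto intro!: derivative_eq_intros)
    have d\<phi>: "(\<phi> has_real_derivative pd1 f (x - fst \<zeta> + s, y - snd \<zeta>)) (at s)" for s
      unfolding \<phi>_def
      using DERIV_chain2[where g = "\<lambda>s. x - fst \<zeta> + s" and f = "\<lambda>s. f (s, y - snd \<zeta>)",
          OF slice_diff_pd1[OF d] g] by simp
    have "\<exists>z. \<bar>z\<bar> \<le> \<bar>h\<bar> \<and> \<phi> h - \<phi> 0 = h * pd1 f (x - fst \<zeta> + z, y - snd \<zeta>)"
    proof (cases "h > 0")
      case True
      then obtain z where "0 < z" "z < h" "\<phi> h - \<phi> 0 = (h - 0) * pd1 f (x - fst \<zeta> + z, y - snd \<zeta>)"
        using MVT2[of 0 h \<phi>, OF _ d\<phi>] by blast
      then show ?thesis by (intro exI[of _ z]) auto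
    next
      case False
      then obtain z where "h < z" "z < 0" "\<phi> 0 - \<phi> h = (0 - h) * pd1 f (x - fst \<zeta> + z, y - snd \<zeta>)"
        using MVT2[of h 0 \<phi>, OF _ d\<phi>] h(1) by (metis linorder_neqE_linordered_idom)
      then show ?thesis by (intro exI[of _ z]) auto
    qed
    then obtain z where z: "\<bar>z\<bar> \<le> \<bar>h\<bar>" "\<phi> h - \<phi> 0 = h * pd1 f (x - fst \<zeta> + z, y - snd \<zeta>)" by blast
    define p where "p = \<xi> + (z, 0) - \<zeta>"
    have p: "p = (x - fst \<zeta> + z, y - snd \<zeta>)" by (simp add: p_def \<xi>_def prod_eq_iff)
    have "(f (\<xi> + (h, 0) - \<zeta>) - f (\<xi> - \<zeta>)) / h = (\<phi> h - \<phi> 0) / h"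
      by (simp add: \<phi>_def \<xi>_def minus_prod_def plus_prod_def algebra_simps)
    also have "\<dots> = pd1 f p" using z h by (simp add: p)
    finally have 1: "\<bar>(f (\<xi> + (h, 0) - \<zeta>) - f (\<xi> - \<zeta>)) / h\<bar> \<le> C / (1 + norm p) ^ 6"
      using C(2)[of p] by simp
    have "norm \<zeta> = norm (\<xi> + (z, 0) - p)" by (simp add: p_def)
    also have "\<dots> \<le> norm \<xi> + norm (z, 0 :: real) + norm p"
      by (meson norm_triangle_ineq norm_triangle_ineq4 order_trans add_right_mono)
    also have "norm (z, 0 :: real) \<le> 1" using z h by (simp add: norm_Pair)
    \<comment> \<open>Peetre's inequality: it turns decay at the intermediate point p into decay in
      \<open>\<zeta>\<close>, with a factor that depends on \<open>\<xi>\<close> only.\<close>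
    finally have "1 + norm \<zeta> \<le> (2 + norm \<xi>) * (1 + norm p)"
      by (simp add: distrib_left distrib_right) (smt (verit) mult_nonneg_nonneg norm_ge_zero)
    then have "(1 + norm \<zeta>) ^ 6 \<le> (2 + norm \<xi>) ^ 6 * (1 + norm p) ^ 6"
      by (simp flip: power_mult_distrib add: power_mono)
    then have "C * (1 + norm \<zeta>) ^ 6 \<le> C * ((2 + norm \<xi>) ^ 6 * (1 + norm p) ^ 6)"
      using C(1) by (intro mult_left_mono) auto
    then have "C / (1 + norm p) ^ 6 \<le> C * (2 + norm \<xi>) ^ 6 / (1 + norm \<zeta>) ^ 6"
      by (simp add: divide_simps add_nonneg_eq_0_iff add_pos_nonneg mult_ac)
    with 1 show ?thesis by linarith
  qed
  have lim: "((\<lambda>h. (f (\<xi> + (h, 0) - \<zeta>) - f (\<xi> - \<zeta>)) / h) \<longlongrightarrow> pd1 f (\<xi> - \<zeta>)) (at 0)" for \<zeta>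
    using slice_diff_pd1[OF d, of "y - snd \<zeta>" "x - fst \<zeta>"]
    by (simp add: DERIV_def \<xi>_def minus_prod_def plus_prod_def algebra_simps)
  have "((\<lambda>h. LINT \<zeta>|lborel. q h \<zeta>) \<longlongrightarrow> (LINT \<zeta>|lborel. ln (norm \<zeta>) * pd1 f (\<xi> - \<zeta>))) (at 0)"
    unfolding tendsto_at_iff_sequentially comp_def
  proof (intro allI impI)
    fix X :: "nat \<Rightarrow> real" assume X0: "\<forall>i. X i \<in> UNIV - {0}" and X: "X \<longlonglongrightarrow> 0"
    have "\<forall>\<^sub>F i in sequentially. \<bar>X i\<bar> < 1" using tendstoD[OF X, of 1] by simp
    \<comment> \<open>The bound \<open>quot\<close> requires |h| \<le> 1, hence the index shift by N
      below.\<close>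
    then obtain N where N: "\<And>i. i \<ge> N \<Longrightarrow> \<bar>X i\<bar> < 1" by (auto simp: eventually_sequentially)
    have "(\<lambda>i. LINT \<zeta>|lborel. q (X (i + N)) \<zeta>) \<longlonglongrightarrow> (LINT \<zeta>|lborel. ln (norm \<zeta>) * pd1 f (\<xi> - \<zeta>))"
    proof (rule integral_dominated_convergence[where w = w])
      show "integrable lborel w" unfolding w_def
        by (intro integrable_mult_right log_decay_integrable)
      show "AE \<zeta> in lborel. (\<lambda>i. q (X (i + N)) \<zeta>) \<longlonglongrightarrow> ln (norm \<zeta>) * pd1 f (\<xi> - \<zeta>)"
      proof (rule AE_I2)
        fix \<zeta> :: plane
        have "filterlim (\<lambda>i. X (i + N)) (at 0) sequentially"
          using X0 LIMSEQ_ignore_initial_segment[OF X, of N] by (simp add: filterlim_at)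
        then show "(\<lambda>i. q (X (i + N)) \<zeta>) \<longlonglongrightarrow> ln (norm \<zeta>) * pd1 f (\<xi> - \<zeta>)"
          unfolding q_def by (intro tendsto_mult tendsto_const filterlim_compose[OF lim])
      qed
      show "AE \<zeta> in lborel. norm (q (X (i + N)) \<zeta>) \<le> w \<zeta>" for i
      proof (rule AE_I2)
        fix \<zeta> :: plane
        have "\<bar>ln (norm \<zeta>)\<bar> * \<bar>(f (\<xi> + (X (i + N), 0) - \<zeta>) - f (\<xi> - \<zeta>)) / X (i + N)\<bar> \<le>
          \<bar>ln (norm \<zeta>)\<bar> * (C * (2 + norm \<xi>) ^ 6 / (1 + norm \<zeta>) ^ 6)"
          using quot[of "X (i + N)" \<zeta>] N[of "i + N"] X0 by (intro mult_left_mono) auto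
        then show "norm (q (X (i + N)) \<zeta>) \<le> w \<zeta>" by (simp add: q_def w_def abs_mult mult_ac)
      qed
    qed (unfold q_def, measurable)
    then show "(\<lambda>i. LINT \<zeta>|lborel. q (X i) \<zeta>) \<longlonglongrightarrow> (LINT \<zeta>|lborel. ln (norm \<zeta>) * pd1 f (\<xi> - \<zeta>))"
      by (rule LIMSEQ_offset)
  qed
  moreover have int: "integrable lborel (\<lambda>\<zeta>. ln (norm \<zeta>) * f (a - \<zeta>))" for a
    using integrable_reflect[of "\<lambda>\<eta>. ln (norm (a - \<eta>)) * f \<eta>" a] log_integrable[OF r(1), of a] by simp
  have "(LINT \<zeta>|lborel. q h \<zeta>) = 2 * pi * ((inv_laplace f (\<xi> + (h, 0)) - inv_laplace f \<xi>) / h)" for h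
  proof -
    have "(LINT \<zeta>|lborel. q h \<zeta>) = (LINT \<zeta>|lborel. (ln (norm \<zeta>) * f (\<xi> + (h, 0) - \<zeta>) - ln (norm \<zeta>) * f (\<xi> - \<zeta>)) / h)"
      by (simp add: q_def algebra_simps)
    also have "\<dots> = ((LINT \<zeta>|lborel. ln (norm \<zeta>) * f (\<xi> + (h, 0) - \<zeta>)) - (LINT \<zeta>|lborel. ln (norm \<zeta>) * f (\<xi> - \<zeta>))) / h"
      using int by (simp add: Bochner_Integration.integral_diff)
    finally have 1: "(LINT \<zeta>|lborel. q h \<zeta>) = \<dots>" .
    have 2: "(a - b) / h = 2 * pi * ((1 / (2 * pi) * a - 1 / (2 * pi) * b) / h)" for a b :: real
      by (simp add: right_diff_distrib diff_divide_distrib)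
    show ?thesis unfolding 1 inv_laplace_conv[OF rapid_measurable[OF r(1)]] by (rule 2)
  qed
  ultimately have "((\<lambda>h. 2 * pi * ((inv_laplace f (\<xi> + (h, 0)) - inv_laplace f \<xi>) / h)) \<longlongrightarrow> 2 * pi * inv_laplace (pd1 f) \<xi>) (at 0)"
    by (simp add: inv_laplace_conv)
  then have "((\<lambda>h. (inv_laplace f (\<xi> + (h, 0)) - inv_laplace f \<xi>) / h) \<longlongrightarrow> inv_laplace (pd1 f) \<xi>) (at 0)"
    using tendsto_mult_left_iff[of "2 * pi"] by fastforce
  then show ?thesis by (simp add: DERIV_def \<xi>_def)
qed

lemma inv_laplace_deriv2:
  assumes f: "nice1 f"
  shows "((\<lambda>s. inv_laplace f (x, s)) has_real_derivative inv_laplace (pd2 f) (x, y)) (at y)"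
  using inv_laplace_deriv1[OF nice1_flip[OF f], of x y] f
  by (simp add: pd1_flip inv_laplace_flip nice1_def rapid_measurable)

lemma rapid_tendsto_0:
  assumes "rapid f"
  shows "((\<lambda>x. f (x, y)) \<longlongrightarrow> 0) at_infinity"
proof -
  obtain C where C: "C > 0" "\<And>\<xi>. \<bar>f \<xi>\<bar> \<le> C / (1 + norm \<xi>) ^ 1" using rapidD[OF assms, of 1] by metis
  have "((\<lambda>x::real. C * norm (inverse x)) \<longlongrightarrow> C * norm (0::real)) at_infinity"
    by (intro tendsto_intros tendsto_inverse_0)
  then have "((\<lambda>x::real. C * norm (inverse x)) \<longlongrightarrow> 0) at_infinity" by simp
  moreover have "norm (f (x, y)) \<le> C * norm (inverse x)" if "norm x \<ge> 1" for x :: real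
  proof -
    have "\<bar>x\<bar> \<le> norm (x, y)" using abs_fst_le[of "(x, y)"] by simp
    then have "C / (1 + norm (x, y)) \<le> C / \<bar>x\<bar>" using that C by (intro divide_left_mono mult_pos_pos) auto
    then show ?thesis using C(2)[of "(x, y)"] by (simp add: divide_inverse)
  qed
  then have "\<forall>\<^sub>F x in at_infinity. norm (f (x, y)) \<le> C * norm (inverse x)"
    unfolding eventually_at_infinity by blast
  ultimately show ?thesis by (rule Lim_null_comparison[rotated])
qed

lemma integral_slice1:
  assumes der: "\<And>x y. ((\<lambda>s. u (s, y)) has_real_derivative u1 (x, y)) (at x)"
    and "rapid u" "rapid u1"
  shows "(LINT \<xi>|lborel. u1 \<xi>) = 0"
proof (rule integral_slice_deriv_eq_0[OF der])
  show "((\<lambda>x. u (x, y)) \<longlongrightarrow> 0) at_top" "((\<lambda>x. u (x, y)) \<longlongrightarrow> 0) at_bot" for y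
    using rapid_tendsto_0[OF assms(2), of y] tendsto_mono[OF at_top_le_at_infinity] tendsto_mono[OF at_bot_le_at_infinity]
    by metis+
qed (rule rapid_integrable[OF assms(3)])

lemma integral_slice2:
  assumes der: "\<And>x y. ((\<lambda>s. u (x, s)) has_real_derivative u2 (x, y)) (at y)"
    and "rapid u" "rapid u2"
  shows "(LINT \<xi>|lborel. u2 \<xi>) = 0"
proof -
  have "(LINT \<xi>|lborel. u2 (flip \<xi>)) = 0"
    by (rule integral_slice1[where u = "\<lambda>\<xi>. u (flip \<xi>)"]) (simp_all add: der assms rapid_flip)
  then show ?thesis using integral_flip[of u2] assms by (simp add: rapid_measurable)
qed

text \<open>\<open>K1\<close> and \<open>K2\<close> are the components of the gradient of ln |z|,
  with value 0 at the origin by the convention for division.\<close>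

definition K1 :: "plane \<Rightarrow> real" where "K1 z = fst z / (norm z)\<^sup>2"
definition K2 :: "plane \<Rightarrow> real" where "K2 z = snd z / (norm z)\<^sup>2"

lemma fst_plane_measurable [measurable]: "fst \<in> borel_measurable (borel :: plane measure)"
  and snd_plane_measurable [measurable]: "snd \<in> borel_measurable (borel :: plane measure)"
  by (rule tempered_measurable[OF tempered_fst] tempered_measurable[OF tempered_snd])+

lemma K1_measurable [measurable]: "K1 \<in> borel_measurable borel"
  and K2_measurable [measurable]: "K2 \<in> borel_measurable borel"
  unfolding K1_def K2_def by measurable

lemma abs_K1_le: "\<bar>K1 z\<bar> \<le> 1 / norm z" and abs_K2_le: "\<bar>K2 z\<bar> \<le> 1 / norm z"
proof -
  have "\<bar>fst z\<bar> / (norm z)\<^sup>2 \<le> norm z / (norm z)\<^sup>2" "\<bar>snd z\<bar> / (norm z)\<^sup>2 \<le> norm z / (norm z)\<^sup>2"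
    by (intro divide_right_mono abs_fst_le abs_snd_le; simp)+
  then show "\<bar>K1 z\<bar> \<le> 1 / norm z" "\<bar>K2 z\<bar> \<le> 1 / norm z"
    by (simp_all add: K1_def K2_def power2_eq_square split: if_splits)
qed

lemma K1_flip: "K1 (flip z) = K2 z" by (simp add: K1_def K2_def)

lemma kernel_integrable:
  assumes g: "rapid g" and k [measurable]: "k \<in> borel_measurable borel" and kb: "\<And>z. \<bar>k z\<bar> \<le> 1 / norm z"
  shows "integrable lborel (\<lambda>\<eta>. k (\<xi> - \<eta> :: plane) * g \<eta>)"
proof (rule Bochner_Integration.integrable_bound[OF rapid_kernel_integrable[OF g, of \<xi>]])
  note [measurable] = rapid_measurable[OF g]
  show "(\<lambda>\<eta>. k (\<xi> - \<eta>) * g \<eta>) \<in> borel_measurable lborel" by measurable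
  show "AE \<eta> in lborel. norm (k (\<xi> - \<eta>) * g \<eta>) \<le> norm (\<bar>g \<eta>\<bar> / norm (\<xi> - \<eta>))"
  proof (rule AE_I2)
    fix \<eta>
    have "\<bar>k (\<xi> - \<eta>)\<bar> * \<bar>g \<eta>\<bar> \<le> 1 / norm (\<xi> - \<eta>) * \<bar>g \<eta>\<bar>" by (intro mult_right_mono kb) simp
    then show "norm (k (\<xi> - \<eta>) * g \<eta>) \<le> norm (\<bar>g \<eta>\<bar> / norm (\<xi> - \<eta>))" by (simp add: abs_mult)
  qed
qed

lemma ln_norm_deriv:
  assumes "y \<noteq> snd \<xi>"
  shows "((\<lambda>s. ln (norm (\<xi> - (s, y)))) has_real_derivative - K1 (\<xi> - (x, y))) (at x)"
proof -
  have pos: "(fst \<xi> - s)\<^sup>2 + (snd \<xi> - y)\<^sup>2 > 0" for s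
    using assms by (simp add: sum_power2_gt_zero_iff)
  have n: "norm (\<xi> - (s, y)) = sqrt ((fst \<xi> - s)\<^sup>2 + (snd \<xi> - y)\<^sup>2)" for s
    by (simp add: norm_prod_def)
  have eq: "(\<lambda>s. ln (norm (\<xi> - (s, y)))) = (\<lambda>s. ln ((fst \<xi> - s)\<^sup>2 + (snd \<xi> - y)\<^sup>2) / 2)"
    using pos by (simp add: n ln_sqrt)
  have K: "- K1 (\<xi> - (x, y)) = - (fst \<xi> - x) / ((fst \<xi> - x)\<^sup>2 + (snd \<xi> - y)\<^sup>2)"
    using pos[of x] by (simp add: K1_def n less_imp_le minus_divide_left)
  show ?thesis unfolding eq K using pos[of x]
    by (auto intro!: derivative_eq_intros simp: divide_simps, (simp add: algebra_simps)+)
qed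

text \<open>Integration by parts moves the derivative back from f to the logarithm. On every
  horizontal line that misses \<open>\<xi>\<close> the product of logarithm and f is smooth along
  the line and vanishes at both ends, since f beats the growth of the logarithm.\<close>

lemma inv_laplace_pd1_kernel:
  assumes f: "nice1 f"
  shows "inv_laplace (pd1 f) \<xi> = 1 / (2 * pi) * (LINT \<eta>|lborel. K1 (\<xi> - \<eta>) * f \<eta>)"
proof -
  have r: "rapid f" "rapid (pd1 f)" and d: "slice_diff f" using f by (simp_all add: nice1_def)
  have i1: "integrable lborel (\<lambda>\<eta>. ln (norm (\<xi> - \<eta>)) * pd1 f \<eta>)" by (rule log_integrable[OF r(2)])
  have i2: "integrable lborel (\<lambda>\<eta>. K1 (\<xi> - \<eta>) * f \<eta>)" by (rule kernel_integrable[OF r(1) K1_measurable abs_K1_le])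
  have "(LINT \<eta>|lborel. ln (norm (\<xi> - \<eta>)) * pd1 f \<eta> - K1 (\<xi> - \<eta>) * f \<eta>) = 0"
  proof (rule integral_slice_deriv_eq_0[where c = "snd \<xi>" and u = "\<lambda>\<eta>. ln (norm (\<xi> - \<eta>)) * f \<eta>"])
    fix x y assume y: "y \<noteq> snd \<xi>"
    show "((\<lambda>s. ln (norm (\<xi> - (s, y))) * f (s, y)) has_real_derivative
        ln (norm (\<xi> - (x, y))) * pd1 f (x, y) - K1 (\<xi> - (x, y)) * f (x, y)) (at x)"
      by (rule derivative_eq_intros ln_norm_deriv[OF y] slice_diff_pd1[OF d] refl)+ (simp add: algebra_simps)
  next
    fix y assume y: "y \<noteq> snd \<xi>"
    define A where "A = norm \<xi> + 1 / \<bar>snd \<xi> - y\<bar>"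
    have "rapid (\<lambda>\<eta>. A * \<bar>f \<eta>\<bar> + norm \<eta> * \<bar>f \<eta>\<bar>)"
      by (intro rapid_add rapid_cmult tempered_mult_rapid tempered_norm rapid_abs r)
    from rapid_tendsto_0[OF this, of y]
    have l: "((\<lambda>x. A * \<bar>f (x, y)\<bar> + norm (x, y) * \<bar>f (x, y)\<bar>) \<longlongrightarrow> 0) at_infinity" .
    have b: "norm (ln (norm (\<xi> - (x, y))) * f (x, y)) \<le> A * \<bar>f (x, y)\<bar> + norm (x, y) * \<bar>f (x, y)\<bar>" for x
    proof -
      have "\<bar>snd \<xi> - y\<bar> \<le> norm (\<xi> - (x, y))" using abs_snd_le[of "\<xi> - (x, y)"] by simp
      then have "\<bar>f (x, y)\<bar> / norm (\<xi> - (x, y)) \<le> \<bar>f (x, y)\<bar> / \<bar>snd \<xi> - y\<bar>"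
        using y by (intro divide_left_mono mult_pos_pos) auto
      then show ?thesis using abs_ln_diff_le[of \<xi> "(x, y)" "f (x, y)"] by (simp add: A_def distrib_right)
    qed
    have lim: "((\<lambda>x. ln (norm (\<xi> - (x, y))) * f (x, y)) \<longlongrightarrow> 0) at_infinity"
      by (rule Lim_null_comparison[OF always_eventually l]) (rule allI, rule b)
    show "((\<lambda>x. ln (norm (\<xi> - (x, y))) * f (x, y)) \<longlongrightarrow> 0) at_top"
      by (rule tendsto_mono[OF at_top_le_at_infinity lim])
    show "((\<lambda>x. ln (norm (\<xi> - (x, y))) * f (x, y)) \<longlongrightarrow> 0) at_bot"
      by (rule tendsto_mono[OF at_bot_le_at_infinity lim])
  qed (intro Bochner_Integration.integrable_diff i1 i2)
  then show ?thesis using i1 i2 by (simp add: inv_laplace_def)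
qed

lemma inv_laplace_pd2_kernel:
  assumes f: "nice1 f"
  shows "inv_laplace (pd2 f) \<xi> = 1 / (2 * pi) * (LINT \<eta>|lborel. K2 (\<xi> - \<eta>) * f \<eta>)"
proof -
  have m: "pd2 f \<in> borel_measurable borel" "f \<in> borel_measurable borel"
    using f by (simp_all add: nice1_def rapid_measurable)
  have "inv_laplace (pd2 f) \<xi> = inv_laplace (pd1 (\<lambda>\<xi>. f (flip \<xi>))) (flip \<xi>)"
    by (simp add: pd1_flip inv_laplace_flip[OF m(1)])
  also have "\<dots> = 1 / (2 * pi) * (LINT \<eta>|lborel. K1 (flip \<xi> - \<eta>) * f (flip \<eta>))"
    by (rule inv_laplace_pd1_kernel[OF nice1_flip[OF f]])
  also have "(LINT \<eta>|lborel. K1 (flip \<xi> - \<eta>) * f (flip \<eta>)) = (LINT \<eta>|lborel. K1 (flip \<xi> - flip \<eta>) * f (flip (flip \<eta>)))"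
    using measurable_compose[OF flip_measurable m(2)] by (intro integral_flip[symmetric]) measurable
  finally show ?thesis by (simp add: K1_flip flip: flip_diff)
qed

lemma inv_laplace_tempered:
  assumes f: "rapid f"
  shows "tempered (inv_laplace f)"
proof -
  note [measurable] = rapid_measurable[OF f]
  obtain K where K: "K > 0" "\<And>a. (LINT \<eta>|lborel. \<bar>f \<eta>\<bar> / norm (a - \<eta>)) \<le> K"
    using rapid_kernel_bound[OF f] by metis
  define A where "A = (LINT \<eta>|lborel. \<bar>f \<eta>\<bar>)"
  define B where "B = (LINT \<eta>|lborel. norm \<eta> * \<bar>f \<eta>\<bar>)"
  have A: "A \<ge> 0" and B: "B \<ge> 0" by (auto simp: A_def B_def)
  show ?thesis
  proof (rule temperedI[of _ "(A + B + K)" 1])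
    show "inv_laplace f \<in> borel_measurable borel"
      unfolding inv_laplace_def by measurable
    fix \<xi>
    have i: "integrable lborel (\<lambda>\<eta>. \<bar>f \<eta>\<bar>)" "integrable lborel (\<lambda>\<eta>. norm \<eta> * \<bar>f \<eta>\<bar>)"
      by (intro rapid_integrable rapid_abs tempered_mult_rapid tempered_norm f)+
    note ik = rapid_kernel_integrable[OF f, of \<xi>]
    have "\<bar>LINT \<eta>|lborel. ln (norm (\<xi> - \<eta>)) * f \<eta>\<bar> \<le> (LINT \<eta>|lborel. \<bar>ln (norm (\<xi> - \<eta>)) * f \<eta>\<bar>)"
      using integral_norm_bound[of lborel "\<lambda>\<eta>. ln (norm (\<xi> - \<eta>)) * f \<eta>"] by simp
    also have "\<dots> \<le> (LINT \<eta>|lborel. norm \<xi> * \<bar>f \<eta>\<bar> + norm \<eta> * \<bar>f \<eta>\<bar> + \<bar>f \<eta>\<bar> / norm (\<xi> - \<eta>))"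
      by (intro integral_mono abs_ln_diff_le integrable_abs log_integrable f Bochner_Integration.integrable_add integrable_mult_right i ik)
    also have "\<dots> = norm \<xi> * A + B + (LINT \<eta>|lborel. \<bar>f \<eta>\<bar> / norm (\<xi> - \<eta>))"
      using i ik by (simp add: A_def B_def)
    also have "\<dots> \<le> norm \<xi> * A + B + K" using K(2)[of \<xi>] by simp
    also have "\<dots> \<le> (A + B + K) * (1 + norm \<xi>)"
      using A B K(1) by (simp add: distrib_left distrib_right mult.commute add_increasing2)
    finally have 1: "\<bar>LINT \<eta>|lborel. ln (norm (\<xi> - \<eta>)) * f \<eta>\<bar> \<le> (A + B + K) * (1 + norm \<xi>)" .
    have "\<bar>inv_laplace f \<xi>\<bar> = 1 / (2 * pi) * \<bar>LINT \<eta>|lborel. ln (norm (\<xi> - \<eta>)) * f \<eta>\<bar>"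
      by (simp add: inv_laplace_def abs_mult)
    also have "\<dots> \<le> 1 * \<bar>LINT \<eta>|lborel. ln (norm (\<xi> - \<eta>)) * f \<eta>\<bar>"
      using pi_gt3 by (intro mult_right_mono) auto
    finally show "\<bar>inv_laplace f \<xi>\<bar> \<le> (A + B + K) * (1 + norm \<xi>) ^ 1" using 1 by simp
  qed
qed

lemma pd_inv_laplace:
  assumes "nice1 f"
  shows "pd1 (inv_laplace f) = inv_laplace (pd1 f)" "pd2 (inv_laplace f) = inv_laplace (pd2 f)"
    "slice_diff (inv_laplace f)"
  using inv_laplace_deriv1[OF assms] inv_laplace_deriv2[OF assms]
  by (auto intro!: pd1_eqI pd2_eqI slice_diffI)

lemma tempered_inv_laplace_pd:
  assumes "nice1 f"
  shows "tempered (inv_laplace f)" "tempered (pd1 (inv_laplace f))" "tempered (pd2 (inv_laplace f))"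
  using assms by (simp_all add: pd_inv_laplace inv_laplace_tempered nice1_def)

lemma nice2D:
  assumes "nice2 f"
  shows "nice1 f" "nice1 (pd1 f)" "nice1 (pd2 f)" "pd2 (pd1 f) = pd1 (pd2 f)"
    "rapid f" "rapid (pd1 f)" "rapid (pd2 f)" "rapid (pd1 (pd1 f))" "rapid (pd1 (pd2 f))" "rapid (pd2 (pd2 f))"
    "slice_diff f" "slice_diff (pd1 f)" "slice_diff (pd2 f)"
  using assms unfolding nice2_def nice1_def by blast+

section \<open>Moments of brackets and of the diffusion operator\<close>

lemmas rapid_intros = rapid_add rapid_diff rapid_cmult tempered_mult_rapid rapid_mult_tempered
  tempered_fst tempered_snd tempered_const tempered_mult tempered_add tempered_diff

text \<open>The bracket is a divergence, \<partial>1(F \<partial>2 \<Omega>) - \<partial>2(F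
  \<partial>1 \<Omega>), because mixed derivatives commute. The weight \<xi>2 leaves the extra term
  F \<partial>1 \<Omega>, and one more integration by parts yields the third claim.\<close>

lemma bracket_integrals:
  assumes F: "slice_diff F" "tempered F" "tempered (pd1 F)" "tempered (pd2 F)" and \<Omega>: "nice2 \<Omega>"
  shows "rapid (bracket F \<Omega>)"
    and "(LINT \<xi>|lborel. bracket F \<Omega> \<xi>) = 0"
    and "(LINT \<xi>|lborel. snd \<xi> * bracket F \<Omega> \<xi>) = - (LINT \<xi>|lborel. pd1 F \<xi> * \<Omega> \<xi>)"
proof -
  note D = nice2D[OF \<Omega>]
  note d1 = slice_diff_pd1[OF F(1)] slice_diff_pd1[OF D(11)] slice_diff_pd1[OF D(12)] slice_diff_pd1[OF D(13)]
  note d2 = slice_diff_pd2[OF F(1)] slice_diff_pd2[OF D(11)] slice_diff_pd2[OF D(12)] slice_diff_pd2[OF D(13)]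
  show r: "rapid (bracket F \<Omega>)"
    unfolding bracket_def[abs_def] by (intro rapid_intros F D)
  define u1 where "u1 \<xi> = pd1 F \<xi> * pd2 \<Omega> \<xi> + F \<xi> * pd1 (pd2 \<Omega>) \<xi>" for \<xi>
  define v2 where "v2 \<xi> = pd2 F \<xi> * pd1 \<Omega> \<xi> + F \<xi> * pd1 (pd2 \<Omega>) \<xi>" for \<xi>
  have ru: "rapid u1" "rapid v2" unfolding u1_def v2_def by (intro rapid_intros F D)+
  have "(LINT \<xi>|lborel. u1 \<xi>) = 0"
    unfolding u1_def using D(4)
    by (intro integral_slice1[where u = "\<lambda>\<xi>. F \<xi> * pd2 \<Omega> \<xi>"] rapid_intros F D)
      (rule derivative_eq_intros d1 refl | simp)+
  moreover have "(LINT \<xi>|lborel. v2 \<xi>) = 0"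
    unfolding v2_def using D(4)
    by (intro integral_slice2[where u = "\<lambda>\<xi>. F \<xi> * pd1 \<Omega> \<xi>"] rapid_intros F D)
      (rule derivative_eq_intros d2 refl | simp)+
  moreover have "bracket F \<Omega> = (\<lambda>\<xi>. u1 \<xi> - v2 \<xi>)" by (simp add: fun_eq_iff bracket_def u1_def v2_def)
  ultimately show "(LINT \<xi>|lborel. bracket F \<Omega> \<xi>) = 0"
    using ru by (simp add: rapid_integrable)
  have "(LINT \<xi>|lborel. snd \<xi> * u1 \<xi>) = 0"
    unfolding u1_def using D(4)
    by (intro integral_slice1[where u = "\<lambda>\<xi>. snd \<xi> * (F \<xi> * pd2 \<Omega> \<xi>)"] rapid_intros F D)
      (rule derivative_eq_intros d1 refl | simp)+
  moreover have "(LINT \<xi>|lborel. F \<xi> * pd1 \<Omega> \<xi> + snd \<xi> * v2 \<xi>) = 0"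
    unfolding v2_def using D(4)
    by (intro integral_slice2[where u = "\<lambda>\<xi>. snd \<xi> * (F \<xi> * pd1 \<Omega> \<xi>)"] rapid_intros F D)
      (rule derivative_eq_intros d2 refl | simp)+
  moreover have "(LINT \<xi>|lborel. pd1 F \<xi> * \<Omega> \<xi> + F \<xi> * pd1 \<Omega> \<xi>) = 0"
    by (intro integral_slice1[where u = "\<lambda>\<xi>. F \<xi> * \<Omega> \<xi>"] rapid_intros F D)
      (rule derivative_eq_intros d1 refl | simp)+
  moreover have "(LINT \<xi>|lborel. snd \<xi> * bracket F \<Omega> \<xi>) = (LINT \<xi>|lborel. (snd \<xi> * u1 \<xi> - (F \<xi> * pd1 \<Omega> \<xi> + snd \<xi> * v2 \<xi>))
      + (pd1 F \<xi> * \<Omega> \<xi> + F \<xi> * pd1 \<Omega> \<xi>) - pd1 F \<xi> * \<Omega> \<xi>)"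
    by (intro Bochner_Integration.integral_cong) (auto simp: bracket_def u1_def v2_def algebra_simps)
  moreover have "\<dots> = (LINT \<xi>|lborel. snd \<xi> * u1 \<xi>) - (LINT \<xi>|lborel. F \<xi> * pd1 \<Omega> \<xi> + snd \<xi> * v2 \<xi>)
      + (LINT \<xi>|lborel. pd1 F \<xi> * \<Omega> \<xi> + F \<xi> * pd1 \<Omega> \<xi>) - (LINT \<xi>|lborel. pd1 F \<xi> * \<Omega> \<xi>)"
  proof -
    have "integrable lborel (\<lambda>\<xi>. snd \<xi> * u1 \<xi>)" "integrable lborel (\<lambda>\<xi>. F \<xi> * pd1 \<Omega> \<xi> + snd \<xi> * v2 \<xi>)"
      "integrable lborel (\<lambda>\<xi>. pd1 F \<xi> * \<Omega> \<xi> + F \<xi> * pd1 \<Omega> \<xi>)" "integrable lborel (\<lambda>\<xi>. pd1 F \<xi> * \<Omega> \<xi>)"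
      by (intro rapid_integrable rapid_intros ru F D)+
    then show ?thesis
      by (simp only: Bochner_Integration.integral_diff Bochner_Integration.integral_add
        Bochner_Integration.integrable_diff Bochner_Integration.integrable_add)
  qed
  ultimately show "(LINT \<xi>|lborel. snd \<xi> * bracket F \<Omega> \<xi>) = - (LINT \<xi>|lborel. pd1 F \<xi> * \<Omega> \<xi>)"
    by simp
qed

text \<open>The operator is the divergence of (\<partial>1 \<Omega> + \<xi>1 \<Omega> / 2,
  \<partial>2 \<Omega> + \<xi>2 \<Omega> / 2). Against \<xi>2 only minus the second component
  survives, and its derivative part integrates to 0.\<close>

lemma diffusion_integrals:
  assumes \<Omega>: "nice2 \<Omega>"
  shows "rapid (diffusion \<Omega>)"
    and "(LINT \<xi>|lborel. diffusion \<Omega> \<xi>) = 0"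
    and "(LINT \<xi>|lborel. snd \<xi> * diffusion \<Omega> \<xi>) = - 1 / 2 * (LINT \<xi>|lborel. snd \<xi> * \<Omega> \<xi>)"
proof -
  note D = nice2D[OF \<Omega>]
  note d1 = slice_diff_pd1[OF D(11)] slice_diff_pd1[OF D(12)] slice_diff_pd1[OF D(13)]
  note d2 = slice_diff_pd2[OF D(11)] slice_diff_pd2[OF D(12)] slice_diff_pd2[OF D(13)]
  define a where "a \<xi> = pd1 (pd1 \<Omega>) \<xi> + (1 / 2) * (\<Omega> \<xi> + fst \<xi> * pd1 \<Omega> \<xi>)" for \<xi>
  define b where "b \<xi> = pd2 (pd2 \<Omega>) \<xi> + (1 / 2) * (\<Omega> \<xi> + snd \<xi> * pd2 \<Omega> \<xi>)" for \<xi>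
  have ra: "rapid a" "rapid b" unfolding a_def b_def by (intro rapid_intros D)+
  have eq: "diffusion \<Omega> = (\<lambda>\<xi>. a \<xi> + b \<xi>)" by (simp add: fun_eq_iff diffusion_def a_def b_def field_simps)
  show "rapid (diffusion \<Omega>)" unfolding eq by (intro rapid_add ra)
  have "(LINT \<xi>|lborel. a \<xi>) = 0" unfolding a_def
    by (intro integral_slice1[where u = "\<lambda>\<xi>. pd1 \<Omega> \<xi> + (1 / 2) * (fst \<xi> * \<Omega> \<xi>)"] rapid_intros D)
      (rule derivative_eq_intros d1 refl | simp)+
  moreover have "(LINT \<xi>|lborel. b \<xi>) = 0" unfolding b_def
    by (intro integral_slice2[where u = "\<lambda>\<xi>. pd2 \<Omega> \<xi> + (1 / 2) * (snd \<xi> * \<Omega> \<xi>)"] rapid_intros D)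
      (rule derivative_eq_intros d2 refl | simp)+
  ultimately show "(LINT \<xi>|lborel. diffusion \<Omega> \<xi>) = 0"
    unfolding eq using ra by (simp add: rapid_integrable)
  have "(LINT \<xi>|lborel. snd \<xi> * a \<xi>) = 0" unfolding a_def
    by (intro integral_slice1[where u = "\<lambda>\<xi>. snd \<xi> * (pd1 \<Omega> \<xi> + (1 / 2) * (fst \<xi> * \<Omega> \<xi>))"] rapid_intros D)
      (rule derivative_eq_intros d1 refl | simp)+
  moreover have "(LINT \<xi>|lborel. (pd2 \<Omega> \<xi> + (1 / 2) * (snd \<xi> * \<Omega> \<xi>)) + snd \<xi> * b \<xi>) = 0" unfolding b_def
    by (intro integral_slice2[where u = "\<lambda>\<xi>. snd \<xi> * (pd2 \<Omega> \<xi> + (1 / 2) * (snd \<xi> * \<Omega> \<xi>))"] rapid_intros D)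
      (rule derivative_eq_intros d2 refl | simp)+
  moreover have "(LINT \<xi>|lborel. pd2 \<Omega> \<xi>) = 0"
    by (intro integral_slice2[where u = \<Omega>] D d2)
  moreover have i: "integrable lborel (\<lambda>\<xi>. snd \<xi> * a \<xi>)" "integrable lborel (\<lambda>\<xi>. snd \<xi> * b \<xi>)"
    "integrable lborel (\<lambda>\<xi>. snd \<xi> * \<Omega> \<xi>)" "integrable lborel (pd2 \<Omega>)"
    by (intro rapid_integrable rapid_intros ra D)+
  ultimately show "(LINT \<xi>|lborel. snd \<xi> * diffusion \<Omega> \<xi>) = - 1 / 2 * (LINT \<xi>|lborel. snd \<xi> * \<Omega> \<xi>)"
    unfolding eq by (simp add: distrib_left)
qed

section \<open>Regularity of the elements of Z\<close>

lemma MVT_sym: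
  fixes \<phi> :: "real \<Rightarrow> real"
  assumes "\<And>t. (\<phi> has_real_derivative \<phi>' t) (at t)"
  shows "\<exists>z. \<bar>z - a\<bar> \<le> \<bar>h\<bar> \<and> \<phi> (a + h) - \<phi> a = h * \<phi>' z"
proof (cases h "0::real" rule: linorder_cases)
  case less
  then obtain z where "a + h < z" "z < a" "\<phi> a - \<phi> (a + h) = (a - (a + h)) * \<phi>' z"
    using MVT2[of "a + h" a \<phi> \<phi>', OF _ assms] by auto
  then show ?thesis by (intro exI[of _ z]) (auto simp: algebra_simps)
next
  case equal
  then show ?thesis by auto
next
  case greater
  then obtain z where "a < z" "z < a + h" "\<phi> (a + h) - \<phi> a = (a + h - a) * \<phi>' z"
    using MVT2[of a "a + h" \<phi> \<phi>', OF _ assms] by auto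
  then show ?thesis by (intro exI[of _ z]) auto
qed

text \<open>\<open>S_star\<close> speaks only of derivatives with \<open>pd1\<close> applied after
  \<open>pd2\<close>. The opposite order is recovered from the continuity of that mixed
  derivative.\<close>

lemma mixed_partials:
  assumes f: "slice_diff f" and f2: "slice_diff (pd2 f)" and cont: "continuous_on UNIV (pd1 (pd2 f))"
  shows "pd2 (pd1 f) = pd1 (pd2 f)"
proof (rule pd2_eqI)
  fix x y
  define g where "g = pd1 (pd2 f)"
  show "((\<lambda>s. pd1 f (x, s)) has_real_derivative pd1 (pd2 f) (x, y)) (at y)"
    unfolding DERIV_def g_def[symmetric]
  proof (rule LIM_I)
    fix r :: real assume r: "r > 0"
    obtain d where d: "d > 0" "\<And>\<xi>. dist \<xi> (x, y) < d \<Longrightarrow> dist (g \<xi>) (g (x, y)) < r / 2"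
      using cont r unfolding g_def continuous_on_iff by (metis UNIV_I half_gt_zero)
    show "\<exists>s>0. \<forall>k. k \<noteq> 0 \<and> norm (k - 0) < s \<longrightarrow> norm ((pd1 f (x, y + k) - pd1 f (x, y)) / k - g (x, y)) < r"
    proof (intro exI[of _ "d / 2"] conjI allI impI)
      show "0 < d / 2" using d by simp
      fix k :: real assume k: "k \<noteq> 0 \<and> norm (k - 0) < d / 2"
      \<comment> \<open>Second difference over a rectangle with sides h and k: two applications of
        the mean value theorem express D h / (h k) by the mixed derivative at a nearby point; then h
        tends to 0 with k fixed.\<close>
      define D where "D h = f (x + h, y + k) - f (x + h, y) - (f (x, y + k) - f (x, y))" for h
      have bound: "\<bar>D h / h / k - g (x, y)\<bar> \<le> r / 2" if h: "h \<noteq> 0" "\<bar>h\<bar> < d / 2" for h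
      proof -
        define \<phi> where "\<phi> b = f (x + h, b) - f (x, b)" for b
        have "\<exists>b. \<bar>b - y\<bar> \<le> \<bar>k\<bar> \<and> \<phi> (y + k) - \<phi> y = k * (pd2 f (x + h, b) - pd2 f (x, b))"
          unfolding \<phi>_def by (rule MVT_sym) (intro DERIV_diff slice_diff_pd2[OF f])
        then obtain b where b: "\<bar>b - y\<bar> \<le> \<bar>k\<bar>" "\<phi> (y + k) - \<phi> y = k * (pd2 f (x + h, b) - pd2 f (x, b))" by blast
        have "\<exists>a. \<bar>a - x\<bar> \<le> \<bar>h\<bar> \<and> pd2 f (x + h, b) - pd2 f (x, b) = h * g (a, b)"
          unfolding g_def by (rule MVT_sym) (rule slice_diff_pd1[OF f2])
        then obtain a where a: "\<bar>a - x\<bar> \<le> \<bar>h\<bar>" "pd2 f (x + h, b) - pd2 f (x, b) = h * g (a, b)" by blast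
        have "dist (a, b) (x, y) \<le> \<bar>a - x\<bar> + \<bar>b - y\<bar>"
          by (simp add: dist_prod_def dist_real_def sqrt_sum_squares_le_sum_abs)
        also have "\<dots> < d" using a b h k by auto
        finally have "\<bar>g (a, b) - g (x, y)\<bar> < r / 2" using d(2)[of "(a, b)"] by (simp add: dist_real_def)
        moreover have "D h = k * (h * g (a, b))" using b(2) a(2) by (simp add: D_def \<phi>_def)
        ultimately show ?thesis using h k by simp
      qed
      have "((\<lambda>h. (f (x + h, y + k) - f (x, y + k)) / h - (f (x + h, y) - f (x, y)) / h) \<longlongrightarrow> pd1 f (x, y + k) - pd1 f (x, y)) (at 0)"
        by (intro tendsto_diff slice_diff_pd1[OF f, unfolded DERIV_def])
      moreover have "(\<lambda>h. (f (x + h, y + k) - f (x, y + k)) / h - (f (x + h, y) - f (x, y)) / h) = (\<lambda>h. D h / h)"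
        by (simp add: fun_eq_iff D_def diff_divide_distrib[symmetric] algebra_simps)
      ultimately have "((\<lambda>h. D h / h) \<longlongrightarrow> pd1 f (x, y + k) - pd1 f (x, y)) (at 0)" by simp
      then have "((\<lambda>h. \<bar>D h / h / k - g (x, y)\<bar>) \<longlongrightarrow> \<bar>(pd1 f (x, y + k) - pd1 f (x, y)) / k - g (x, y)\<bar>) (at 0)"
        using k by (intro tendsto_intros) auto
      moreover have "\<forall>\<^sub>F h in at 0. \<bar>D h / h / k - g (x, y)\<bar> \<le> r / 2"
        unfolding eventually_at using bound d(1) by (intro exI[of _ "d / 2"]) (auto simp: dist_real_def)
      ultimately have "\<bar>(pd1 f (x, y + k) - pd1 f (x, y)) / k - g (x, y)\<bar> \<le> r / 2"
        by (rule tendsto_upperbound) simp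
      then show "norm ((pd1 f (x, y + k) - pd1 f (x, y)) / k - g (x, y)) < r" using r by simp
    qed
  qed
qed

text \<open>Counterparts of \<open>nice1\<close> and \<open>nice2\<close> for the factor p in the
  factorization \<open>ew * p\<close> of an element of \<open>Z_space\<close>.\<close>

definition temp1 :: "(plane \<Rightarrow> real) \<Rightarrow> bool" where
  "temp1 p \<longleftrightarrow> tempered p \<and> tempered (pd1 p) \<and> tempered (pd2 p) \<and> slice_diff p"

definition temp2 :: "(plane \<Rightarrow> real) \<Rightarrow> bool" where
  "temp2 p \<longleftrightarrow> temp1 p \<and> temp1 (pd1 p) \<and> temp1 (pd2 p) \<and> pd2 (pd1 p) = pd1 (pd2 p)"

definition ew :: "plane \<Rightarrow> real" where "ew \<xi> = exp (- (norm \<xi>)\<^sup>2 / 4)"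

lemma ew_weight: "ew \<xi> * weight \<xi> = 1" "weight \<xi> * ew \<xi> = 1"
  by (simp_all add: ew_def weight_def exp_minus)

lemma power_le_fact_exp: "0 \<le> (x::real) \<Longrightarrow> x ^ n \<le> fact n * exp x"
proof -
  assume x: "0 \<le> x"
  obtain t where t: "exp x = (\<Sum>m<Suc n. x ^ m / fact m) + (exp t / fact (Suc n)) * x ^ Suc n"
    using Maclaurin_exp_le[of x "Suc n"] by blast
  have "x ^ n / fact n \<le> (\<Sum>m<Suc n. x ^ m / fact m)"
    using x by (intro member_le_sum) auto
  also have "\<dots> \<le> exp x" unfolding t using x by simp
  finally show ?thesis by (simp add: field_simps)
qed

lemma rapid_ew: "rapid ew"
  unfolding rapid_def
proof (intro conjI allI)
  show "ew \<in> borel_measurable borel" unfolding ew_def by measurable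
  fix n
  have "\<bar>ew \<xi>\<bar> * (1 + norm \<xi>) ^ n \<le> fact n * exp 2" for \<xi>
  proof -
    have "(1 + norm \<xi>) ^ n \<le> fact n * exp (1 + norm \<xi>)" by (rule power_le_fact_exp) simp
    also have "1 + norm \<xi> \<le> 2 + (norm \<xi>)\<^sup>2 / 4"
      using zero_le_power2[of "norm \<xi> / 2 - 1"] by (simp add: power2_eq_square algebra_simps)
    finally have "(1 + norm \<xi>) ^ n \<le> fact n * (exp 2 * exp ((norm \<xi>)\<^sup>2 / 4))"
      by (simp add: exp_add)
    then have "ew \<xi> * (1 + norm \<xi>) ^ n \<le> ew \<xi> * (fact n * (exp 2 * exp ((norm \<xi>)\<^sup>2 / 4)))"
      by (intro mult_left_mono) (simp_all add: ew_def)
    also have "\<dots> = fact n * exp 2" by (simp add: ew_def exp_minus)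
    finally show ?thesis by (simp add: ew_def)
  qed
  then show "\<exists>C. \<forall>\<xi>. \<bar>ew \<xi>\<bar> * (1 + norm \<xi>) ^ n \<le> C" by blast
qed

lemma norm_plane_power2: "(norm (\<xi>::plane))\<^sup>2 = (fst \<xi>)\<^sup>2 + (snd \<xi>)\<^sup>2"
  by (simp add: norm_prod_def)

lemma ew_deriv1: "((\<lambda>s. ew (s, y)) has_real_derivative - (x / 2) * ew (x, y)) (at x)"
  and ew_deriv2: "((\<lambda>s. ew (x, s)) has_real_derivative - (y / 2) * ew (x, y)) (at y)"
  unfolding ew_def norm_plane_power2 by (auto intro!: derivative_eq_intros)

lemma ew_mult:
  assumes p: "temp1 p"
  shows "nice1 (\<lambda>\<xi>. ew \<xi> * p \<xi>)"
    and "pd1 (\<lambda>\<xi>. ew \<xi> * p \<xi>) = (\<lambda>\<xi>. ew \<xi> * (pd1 p \<xi> - (1 / 2) * (fst \<xi> * p \<xi>)))"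
    and "pd2 (\<lambda>\<xi>. ew \<xi> * p \<xi>) = (\<lambda>\<xi>. ew \<xi> * (pd2 p \<xi> - (1 / 2) * (snd \<xi> * p \<xi>)))"
proof -
  note P = p[unfolded temp1_def]
  have sd: "slice_diff p" using P by blast
  have d1: "((\<lambda>s. ew (s, y) * p (s, y)) has_real_derivative ew (x, y) * (pd1 p (x, y) - (1 / 2) * (fst (x, y) * p (x, y)))) (at x)" for x y
    by (rule derivative_eq_intros ew_deriv1 slice_diff_pd1[OF sd] refl)+ (simp add: algebra_simps)
  have d2: "((\<lambda>s. ew (x, s) * p (x, s)) has_real_derivative ew (x, y) * (pd2 p (x, y) - (1 / 2) * (snd (x, y) * p (x, y)))) (at y)" for x y
    by (rule derivative_eq_intros ew_deriv2 slice_diff_pd2[OF sd] refl)+ (simp add: algebra_simps)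
  show 1: "pd1 (\<lambda>\<xi>. ew \<xi> * p \<xi>) = (\<lambda>\<xi>. ew \<xi> * (pd1 p \<xi> - (1 / 2) * (fst \<xi> * p \<xi>)))"
    by (rule pd1_eqI) (rule d1)
  show 2: "pd2 (\<lambda>\<xi>. ew \<xi> * p \<xi>) = (\<lambda>\<xi>. ew \<xi> * (pd2 p \<xi> - (1 / 2) * (snd \<xi> * p \<xi>)))"
    by (rule pd2_eqI) (rule d2)
  have "slice_diff (\<lambda>\<xi>. ew \<xi> * p \<xi>)" by (rule slice_diffI[OF d1 d2])
  moreover have "rapid (\<lambda>\<xi>. ew \<xi> * p \<xi>)"
    "rapid (\<lambda>\<xi>. ew \<xi> * (pd1 p \<xi> - (1 / 2) * (fst \<xi> * p \<xi>)))"
    "rapid (\<lambda>\<xi>. ew \<xi> * (pd2 p \<xi> - (1 / 2) * (snd \<xi> * p \<xi>)))"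
    by (intro rapid_mult_tempered rapid_ew tempered_diff tempered_mult tempered_const tempered_fst tempered_snd
        P[THEN conjunct1] P[THEN conjunct2, THEN conjunct1] P[THEN conjunct2, THEN conjunct2, THEN conjunct1])+
  ultimately show "nice1 (\<lambda>\<xi>. ew \<xi> * p \<xi>)" unfolding nice1_def 1 2 by blast
qed

lemma temp1_step1:
  assumes p: "temp1 p" and q: "temp1 (pd1 p)"
  shows "temp1 (\<lambda>\<xi>. pd1 p \<xi> - (1 / 2) * (fst \<xi> * p \<xi>))"
    and "pd1 (\<lambda>\<xi>. pd1 p \<xi> - (1 / 2) * (fst \<xi> * p \<xi>)) = (\<lambda>\<xi>. pd1 (pd1 p) \<xi> - (1 / 2) * (p \<xi> + fst \<xi> * pd1 p \<xi>))"
    and "pd2 (\<lambda>\<xi>. pd1 p \<xi> - (1 / 2) * (fst \<xi> * p \<xi>)) = (\<lambda>\<xi>. pd2 (pd1 p) \<xi> - (1 / 2) * (fst \<xi> * pd2 p \<xi>))"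
proof -
  note P = p[unfolded temp1_def] and Q = q[unfolded temp1_def]
  have sd: "slice_diff p" "slice_diff (pd1 p)" using P Q by blast+
  have d1: "((\<lambda>s. pd1 p (s, y) - (1 / 2) * (fst (s, y) * p (s, y))) has_real_derivative
      pd1 (pd1 p) (x, y) - (1 / 2) * (p (x, y) + fst (x, y) * pd1 p (x, y))) (at x)" for x y
    unfolding fst_conv by (rule derivative_eq_intros slice_diff_pd1[OF sd(1)] slice_diff_pd1[OF sd(2)] refl)+ (simp add: algebra_simps)
  have d2: "((\<lambda>s. pd1 p (x, s) - (1 / 2) * (fst (x, s) * p (x, s))) has_real_derivative
      pd2 (pd1 p) (x, y) - (1 / 2) * (fst (x, y) * pd2 p (x, y))) (at y)" for x y
    unfolding fst_conv by (rule derivative_eq_intros slice_diff_pd2[OF sd(1)] slice_diff_pd2[OF sd(2)] refl)+ (simp add: algebra_simps)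
  show 1: "pd1 (\<lambda>\<xi>. pd1 p \<xi> - (1 / 2) * (fst \<xi> * p \<xi>)) = (\<lambda>\<xi>. pd1 (pd1 p) \<xi> - (1 / 2) * (p \<xi> + fst \<xi> * pd1 p \<xi>))"
    by (rule pd1_eqI) (rule d1)
  show 2: "pd2 (\<lambda>\<xi>. pd1 p \<xi> - (1 / 2) * (fst \<xi> * p \<xi>)) = (\<lambda>\<xi>. pd2 (pd1 p) \<xi> - (1 / 2) * (fst \<xi> * pd2 p \<xi>))"
    by (rule pd2_eqI) (rule d2)
  have "slice_diff (\<lambda>\<xi>. pd1 p \<xi> - (1 / 2) * (fst \<xi> * p \<xi>))" by (rule slice_diffI[OF d1 d2])
  then show "temp1 (\<lambda>\<xi>. pd1 p \<xi> - (1 / 2) * (fst \<xi> * p \<xi>))"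
    unfolding temp1_def 1 2
    by (intro conjI tempered_diff tempered_add tempered_mult tempered_const tempered_fst tempered_snd
        P[THEN conjunct1] P[THEN conjunct2, THEN conjunct1] P[THEN conjunct2, THEN conjunct2, THEN conjunct1]
        Q[THEN conjunct2, THEN conjunct1] Q[THEN conjunct2, THEN conjunct2, THEN conjunct1])
qed

lemma temp1_flip: "temp1 p \<Longrightarrow> temp1 (\<lambda>\<xi>. p (flip \<xi>))"
  by (simp add: temp1_def pd1_flip pd2_flip tempered_flip slice_diff_flip)

lemma ew_flip [simp]: "ew (flip \<xi>) = ew \<xi>"
  by (simp add: ew_def)

lemma temp1_step2:
  assumes p: "temp1 p" and q: "temp1 (pd2 p)"
  shows "temp1 (\<lambda>\<xi>. pd2 p \<xi> - (1 / 2) * (snd \<xi> * p \<xi>))"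
    and "pd1 (\<lambda>\<xi>. pd2 p \<xi> - (1 / 2) * (snd \<xi> * p \<xi>)) = (\<lambda>\<xi>. pd1 (pd2 p) \<xi> - (1 / 2) * (snd \<xi> * pd1 p \<xi>))"
proof -
  note P = p[unfolded temp1_def] and Q = q[unfolded temp1_def]
  have "temp1 (\<lambda>\<xi>. pd1 (\<lambda>\<xi>. p (flip \<xi>)) \<xi> - (1 / 2) * (fst \<xi> * p (flip \<xi>)))"
    using temp1_flip[OF p] temp1_flip[OF q] by (intro temp1_step1) (simp_all add: pd1_flip)
  from temp1_flip[OF this] show "temp1 (\<lambda>\<xi>. pd2 p \<xi> - (1 / 2) * (snd \<xi> * p \<xi>))"
    by (simp add: pd1_flip)
  have sd: "slice_diff p" "slice_diff (pd2 p)" using P Q by blast+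
  show "pd1 (\<lambda>\<xi>. pd2 p \<xi> - (1 / 2) * (snd \<xi> * p \<xi>)) = (\<lambda>\<xi>. pd1 (pd2 p) \<xi> - (1 / 2) * (snd \<xi> * pd1 p \<xi>))"
    by (rule pd1_eqI, unfold snd_conv)
      ((rule derivative_eq_intros slice_diff_pd1[OF sd(1)] slice_diff_pd1[OF sd(2)] refl)+, simp add: algebra_simps)
qed

lemma nice2_ew_mult:
  assumes p: "temp2 p"
  shows "nice2 (\<lambda>\<xi>. ew \<xi> * p \<xi>)"
proof -
  note P = p[unfolded temp2_def]
  have 1: "temp1 p" "temp1 (pd1 p)" "temp1 (pd2 p)" and eq: "pd2 (pd1 p) = pd1 (pd2 p)" using P by blast+
  show ?thesis
    unfolding nice2_def ew_mult(2,3)[OF 1(1)] ew_mult(3)[OF temp1_step1(1)[OF 1(1,2)]]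
      ew_mult(2)[OF temp1_step2(1)[OF 1(1,3)]] temp1_step1(3)[OF 1(1,2)] temp1_step2(2)[OF 1(1,3)]
    using ew_mult(1)[OF 1(1)] ew_mult(1)[OF temp1_step1(1)[OF 1(1,2)]] ew_mult(1)[OF temp1_step2(1)[OF 1(1,3)]] eq
    by (auto simp: fun_eq_iff algebra_simps)
qed

lemma slice_diff_of_differentiable:
  fixes p :: "plane \<Rightarrow> real"
  assumes "p differentiable_on UNIV"
  shows "slice_diff p"
proof -
  have d: "p differentiable (at \<xi>)" for \<xi>
    using assms by (metis UNIV_I differentiable_on_def)
  have "(\<lambda>s. p (s, y)) differentiable (at x)" for x y
    using differentiable_compose[of p "\<lambda>s. (s, y)" x UNIV] d
    by (auto intro!: bounded_linear_imp_differentiable differentiable_Pair simp: o_def)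
  moreover have "(\<lambda>s. p (x, s)) differentiable (at y)" for x y
    using differentiable_compose[of p "\<lambda>s. (x, s)" y UNIV] d
    by (auto intro!: bounded_linear_imp_differentiable differentiable_Pair simp: o_def)
  ultimately show ?thesis
    by (simp add: slice_diff_def field_differentiable_def real_differentiable_def)
qed

lemma S_star_imp_temp2:
  assumes p: "p \<in> S_star"
  shows "temp2 p"
proof -
  have df: "pd a b p differentiable_on UNIV" for a b using p by (simp add: S_star_def smooth_plane_def)
  then have cont: "continuous_on UNIV (pd a b p)" for a b by (rule differentiable_imp_continuous_on)
  have t: "tempered (pd a b p)" for a b
    using p borel_measurable_continuous_onI[OF cont[of a b]] unfolding S_star_def tempered_def by blast
  have s: "slice_diff (pd a b p)" for a b by (rule slice_diff_of_differentiable[OF df])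
  have e: "pd 0 0 p = p" "pd 1 0 p = pd1 p" "pd 0 1 p = pd2 p" "pd 2 0 p = pd1 (pd1 p)"
    "pd 0 2 p = pd2 (pd2 p)" "pd 1 1 p = pd1 (pd2 p)"
    by (simp_all add: pd_def numeral_2_eq_2)
  have eq: "pd2 (pd1 p) = pd1 (pd2 p)"
    by (rule mixed_partials[OF s[of 0 0, unfolded e] s[of 0 1, unfolded e] cont[of 1 1, unfolded e]])
  have "temp1 p" "temp1 (pd1 p)" "temp1 (pd2 p)"
    unfolding temp1_def eq
    by (intro conjI t[of 0 0, unfolded e] t[of 1 0, unfolded e] t[of 0 1, unfolded e] t[of 2 0, unfolded e]
        t[of 0 2, unfolded e] t[of 1 1, unfolded e] s[of 0 0, unfolded e] s[of 1 0, unfolded e] s[of 0 1, unfolded e])+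
  then show ?thesis unfolding temp2_def using eq by blast
qed

lemma Z_space_ew: "f \<xi> = ew \<xi> * (weight \<xi> * f \<xi>)"
  by (simp add: ew_weight flip: mult.assoc)

lemma Z_imp_nice2:
  assumes "f \<in> Z_space"
  shows "nice2 f"
proof -
  have "temp2 (\<lambda>\<xi>. weight \<xi> * f \<xi>)" using assms by (simp add: Z_space_def S_star_imp_temp2)
  from nice2_ew_mult[OF this] show ?thesis by (simp flip: Z_space_ew)
qed

lemma Z_imp_Y:
  assumes "f \<in> Z_space"
  shows "f \<in> Y_space"
proof -
  define p where "p \<xi> = weight \<xi> * f \<xi>" for \<xi>
  have "temp2 p" using assms by (simp add: Z_space_def S_star_imp_temp2 p_def[abs_def])
  then have "tempered p" by (simp add: temp2_def temp1_def)
  then have "rapid (\<lambda>\<xi>. ew \<xi> * (p \<xi> * p \<xi>))" by (intro rapid_mult_tempered rapid_ew tempered_mult)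
  moreover have "(f \<xi>)\<^sup>2 * weight \<xi> = ew \<xi> * (p \<xi> * p \<xi>)" for \<xi>
    using ew_weight(1)[of \<xi>] by (simp add: p_def power2_eq_square)
  ultimately show ?thesis
    using nice2D(5)[OF Z_imp_nice2[OF assms]] by (simp add: Y_space_def rapid_integrable rapid_measurable)
qed

text \<open>The affine functions of the first coordinate are closed under both partial derivatives,
  so all \<open>pd a b\<close> stay in this class. It contains \<open>gaussian\<close> and
  \<open>pd1 gaussian\<close> up to the factor \<open>weight\<close>.\<close>

lemma affine_in_S_star: "(\<lambda>\<xi>. c * fst \<xi> + d) \<in> S_star"
proof -
  define P where "P = {f. \<exists>c d. f = (\<lambda>\<xi>::plane. c * fst \<xi> + d :: real)}"
  have 1: "pd1 f \<in> P" "pd2 f \<in> P" if f: "f \<in> P" for f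
  proof -
    obtain c d where f: "f = (\<lambda>\<xi>. c * fst \<xi> + d)" using f unfolding P_def by blast
    have "pd1 f = (\<lambda>\<xi>. 0 * fst \<xi> + c)" unfolding f
      by (rule pd1_eqI) (auto intro!: derivative_eq_intros)
    moreover have "pd2 f = (\<lambda>\<xi>. 0 * fst \<xi> + 0)" unfolding f
      by (rule pd2_eqI) (auto intro!: derivative_eq_intros)
    ultimately show "pd1 f \<in> P" "pd2 f \<in> P" unfolding P_def by blast+
  qed
  have P: "pd a b f \<in> P" if "f \<in> P" for a b f
  proof -
    have "(pd2 ^^ b) f \<in> P" by (induction b) (use that 1 in simp_all)
    then show ?thesis unfolding pd_def by (induction a) (use 1 in simp_all)
  qed
  have f: "(\<lambda>\<xi>. c * fst \<xi> + d) \<in> P" unfolding P_def by blast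
  show ?thesis unfolding S_star_def smooth_plane_def
  proof (intro CollectI conjI allI)
    fix a b
    obtain c' d' where e: "pd a b (\<lambda>\<xi>. c * fst \<xi> + d) = (\<lambda>\<xi>. c' * fst \<xi> + d')"
      using P[OF f, of a b] unfolding P_def by blast
    show "pd a b (\<lambda>\<xi>. c * fst \<xi> + d) differentiable_on UNIV"
      unfolding e differentiable_on_def by (intro ballI differentiable_add differentiable_mult differentiable_const
          bounded_linear_imp_differentiable bounded_linear_fst)
    have "\<bar>c' * fst \<xi> + d'\<bar> \<le> (\<bar>c'\<bar> + \<bar>d'\<bar>) * (1 + norm \<xi>) ^ 1" for \<xi> :: plane
    proof -
      have "\<bar>c' * fst \<xi> + d'\<bar> \<le> \<bar>c'\<bar> * \<bar>fst \<xi>\<bar> + \<bar>d'\<bar>"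
        by (metis abs_mult abs_triangle_ineq)
      also have "\<dots> \<le> \<bar>c'\<bar> * norm \<xi> + \<bar>d'\<bar>" by (intro add_right_mono mult_left_mono abs_fst_le) simp
      finally have 1: "\<bar>c' * fst \<xi> + d'\<bar> \<le> \<bar>c'\<bar> * norm \<xi> + \<bar>d'\<bar>" .
      have 2: "0 \<le> \<bar>d'\<bar> * norm \<xi>" by simp
      have 3: "(\<bar>c'\<bar> + \<bar>d'\<bar>) * (1 + norm \<xi>) ^ 1 = \<bar>c'\<bar> + \<bar>d'\<bar> + \<bar>c'\<bar> * norm \<xi> + \<bar>d'\<bar> * norm \<xi>"
        by (simp add: algebra_simps)
      show ?thesis unfolding 3 using 1 2 abs_ge_zero[of c'] by linarith
    qed
    then show "\<exists>C N. \<forall>\<xi>. \<bar>pd a b (\<lambda>\<xi>. c * fst \<xi> + d) \<xi>\<bar> \<le> C * (1 + norm \<xi>) ^ N" unfolding e by blast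
  qed
qed

section \<open>The Gaussian and the kernel of Lambda\<close>

lemma gaussian_ew: "gaussian = (\<lambda>\<xi>. ew \<xi> * (1 / (4 * pi)))"
  by (simp add: fun_eq_iff gaussian_def ew_def)

lemma gaussian_in_Z: "gaussian \<in> Z_space"
  using affine_in_S_star[of 0 "1 / (4 * pi)"] ew_weight(2)
  by (simp add: Z_space_def gaussian_ew flip: mult.assoc times_divide_eq_right)

lemma pd1_gaussian: "pd1 gaussian = (\<lambda>\<xi>. - (fst \<xi> / 2) * gaussian \<xi>)"
  and pd2_gaussian: "pd2 gaussian = (\<lambda>\<xi>. - (snd \<xi> / 2) * gaussian \<xi>)"
proof -
  show "pd1 gaussian = (\<lambda>\<xi>. - (fst \<xi> / 2) * gaussian \<xi>)"
    unfolding gaussian_ew by (rule pd1_eqI) (rule derivative_eq_intros ew_deriv1 refl | simp)+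
  show "pd2 gaussian = (\<lambda>\<xi>. - (snd \<xi> / 2) * gaussian \<xi>)"
    unfolding gaussian_ew by (rule pd2_eqI) (rule derivative_eq_intros ew_deriv2 refl | simp)+
qed

lemma pd1_gaussian_in_Z: "pd1 gaussian \<in> Z_space"
proof -
  have "(\<lambda>\<xi>. weight \<xi> * pd1 gaussian \<xi>) = (\<lambda>\<xi>. - (1 / (8 * pi)) * fst \<xi> + 0)"
  proof (rule ext)
    fix \<xi>
    have "weight \<xi> * pd1 gaussian \<xi> = - (fst \<xi> / 2) * (1 / (4 * pi)) * (weight \<xi> * ew \<xi>)"
      unfolding pd1_gaussian by (simp add: gaussian_ew mult_ac)
    then show "weight \<xi> * pd1 gaussian \<xi> = - (1 / (8 * pi)) * fst \<xi> + 0" unfolding ew_weight by simp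
  qed
  then show ?thesis unfolding Z_space_def using affine_in_S_star[of "- (1 / (8 * pi))" 0] by simp
qed

lemmas nice2_gaussian = Z_imp_nice2[OF gaussian_in_Z]
lemmas nice2_pd1_gaussian = Z_imp_nice2[OF pd1_gaussian_in_Z]

text \<open>The potential of the Gaussian is radial. No rotation is used: since z1 K2(z) = z2 K1(z),
  the outer coordinates may be replaced by those of \<open>\<eta>\<close>, which times G are -2
  times the derivatives of G. What remains is the difference of two mixed derivatives.\<close>

lemma angular_gaussian_0:
  "fst \<xi> * inv_laplace (pd2 gaussian) \<xi> - snd \<xi> * inv_laplace (pd1 gaussian) \<xi> = 0"
proof -
  note D = nice2D[OF nice2_gaussian]
  have i: "integrable lborel (\<lambda>\<eta>. K1 (\<xi> - \<eta>) * g \<eta>)" "integrable lborel (\<lambda>\<eta>. K2 (\<xi> - \<eta>) * g \<eta>)"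
    if "rapid g" for g
    by (rule kernel_integrable[OF that K1_measurable abs_K1_le] kernel_integrable[OF that K2_measurable abs_K2_le])+
  have K: "fst \<xi> * K2 (\<xi> - \<eta>) - snd \<xi> * K1 (\<xi> - \<eta>) = fst \<eta> * K2 (\<xi> - \<eta>) - snd \<eta> * K1 (\<xi> - \<eta>)" for \<eta>
    by (simp add: K1_def K2_def diff_divide_distrib algebra_simps)
  have "2 * pi * (fst \<xi> * inv_laplace (pd2 gaussian) \<xi> - snd \<xi> * inv_laplace (pd1 gaussian) \<xi>) =
     (LINT \<eta>|lborel. fst \<xi> * (K2 (\<xi> - \<eta>) * gaussian \<eta>) - snd \<xi> * (K1 (\<xi> - \<eta>) * gaussian \<eta>))"
    unfolding inv_laplace_pd1_kernel[OF D(1)] inv_laplace_pd2_kernel[OF D(1)]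
    using i[OF D(5)] by (simp add: right_diff_distrib)
  also have "\<dots> = (LINT \<eta>|lborel. 2 * (K1 (\<xi> - \<eta>) * pd2 gaussian \<eta>) - 2 * (K2 (\<xi> - \<eta>) * pd1 gaussian \<eta>))"
  proof (rule Bochner_Integration.integral_cong[OF refl])
    fix \<eta>
    show "fst \<xi> * (K2 (\<xi> - \<eta>) * gaussian \<eta>) - snd \<xi> * (K1 (\<xi> - \<eta>) * gaussian \<eta>)
      = 2 * (K1 (\<xi> - \<eta>) * pd2 gaussian \<eta>) - 2 * (K2 (\<xi> - \<eta>) * pd1 gaussian \<eta>)"
      using arg_cong[OF K[of \<eta>], of "\<lambda>x. x * gaussian \<eta>"] by (simp add: pd1_gaussian pd2_gaussian algebra_simps)
  qed
  also have "\<dots> = 4 * pi * inv_laplace (pd1 (pd2 gaussian)) \<xi> - 4 * pi * inv_laplace (pd2 (pd1 gaussian)) \<xi>"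
    unfolding inv_laplace_pd1_kernel[OF D(3)] inv_laplace_pd2_kernel[OF D(2)]
    using i[OF D(6)] i[OF D(7)] by simp
  also have "\<dots> = 0" using D(4) by simp
  finally show ?thesis by simp
qed

lemma Lambda_gaussian: "Lambda gaussian \<xi> = 0"
proof -
  note D = nice2D[OF nice2_gaussian]
  show ?thesis
    using arg_cong[OF angular_gaussian_0[of \<xi>], of "\<lambda>x. x * gaussian \<xi>"]
    by (simp add: Lambda_def bracket_def pd_inv_laplace[OF D(1)] pd1_gaussian[THEN fun_cong] pd2_gaussian[THEN fun_cong] algebra_simps)
qed

text \<open>This reflects translation invariance. The explicit check combines the angular identity
  for the Gaussian potential with the derivative of that identity in the first coordinate.\<close>

lemma Lambda_pd1_gaussian: "Lambda (pd1 gaussian) \<xi> = 0"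
proof -
  note D = nice2D[OF nice2_gaussian]
  define a where "a = inv_laplace (pd1 gaussian)"
  define b where "b = inv_laplace (pd2 gaussian)"
  have b1: "pd1 b = inv_laplace (pd1 (pd2 gaussian))" and a1: "pd1 a = inv_laplace (pd1 (pd1 gaussian))"
    and a2: "pd2 a = inv_laplace (pd2 (pd1 gaussian))"
    and sd: "slice_diff a" "slice_diff b"
    unfolding a_def b_def by (simp_all add: pd_inv_laplace[OF D(2)] pd_inv_laplace[OF D(3)])
  have "((\<lambda>s. s * b (s, snd \<xi>) - snd \<xi> * a (s, snd \<xi>)) has_real_derivative
      (1 * b (fst \<xi>, snd \<xi>) + fst \<xi> * pd1 b (fst \<xi>, snd \<xi>)) - snd \<xi> * pd1 a (fst \<xi>, snd \<xi>)) (at (fst \<xi>))"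
    by (rule derivative_eq_intros slice_diff_pd1[OF sd(1)] slice_diff_pd1[OF sd(2)] refl)+ simp
  moreover have "(\<lambda>s. s * b (s, snd \<xi>) - snd \<xi> * a (s, snd \<xi>)) = (\<lambda>s. 0)"
    using angular_gaussian_0[of "(_, snd \<xi>)"] by (simp add: a_def b_def fun_eq_iff)
  ultimately have 1: "b \<xi> + fst \<xi> * pd1 b \<xi> - snd \<xi> * pd1 a \<xi> = 0"
    using DERIV_unique[OF _ DERIV_const] by force
  have 2: "fst \<xi> * b \<xi> - snd \<xi> * a \<xi> = 0" using angular_gaussian_0[of \<xi>] by (simp add: a_def b_def)
  have g11: "pd1 (pd1 gaussian) = (\<lambda>\<xi>. (- 1 / 2 + (fst \<xi>)\<^sup>2 / 4) * gaussian \<xi>)"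
    unfolding pd1_gaussian by (rule pd1_eqI)
      (rule derivative_eq_intros slice_diff_pd1[OF D(11)] refl | simp add: pd1_gaussian power2_eq_square algebra_simps)+
  have g12: "pd2 (pd1 gaussian) = (\<lambda>\<xi>. (fst \<xi> * snd \<xi> / 4) * gaussian \<xi>)"
    unfolding pd1_gaussian by (rule pd2_eqI)
      (rule derivative_eq_intros slice_diff_pd2[OF D(11)] refl | simp add: pd2_gaussian algebra_simps)+
  have "Lambda (pd1 gaussian) \<xi> = a \<xi> * pd2 (pd1 gaussian) \<xi> - b \<xi> * pd1 (pd1 gaussian) \<xi>
      + (pd1 a \<xi> * pd2 gaussian \<xi> - pd2 a \<xi> * pd1 gaussian \<xi>)"
    by (simp add: Lambda_def bracket_def pd_inv_laplace[OF D(1)] a_def b_def)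
  also have "pd2 a = pd1 b" using D(4) by (simp add: a2 b1)
  also have "a \<xi> * pd2 (pd1 gaussian) \<xi> - b \<xi> * pd1 (pd1 gaussian) \<xi>
      + (pd1 a \<xi> * pd2 gaussian \<xi> - pd1 b \<xi> * pd1 gaussian \<xi>)
    = gaussian \<xi> / 2 * (b \<xi> + fst \<xi> * pd1 b \<xi> - snd \<xi> * pd1 a \<xi>) - gaussian \<xi> * fst \<xi> / 4 * (fst \<xi> * b \<xi> - snd \<xi> * a \<xi>)"
    unfolding g11[THEN fun_cong] g12[THEN fun_cong] pd1_gaussian[THEN fun_cong] pd2_gaussian[THEN fun_cong]
    by (simp add: power2_eq_square algebra_simps)
  also have "\<dots> = 0" unfolding 1 2 by simp
  finally show ?thesis .
qed

lemma ker_LambdaI: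
  assumes "f \<in> Z_space" "\<And>\<xi>. Lambda f \<xi> = 0"
  shows "f \<in> ker_Lambda"
proof -
  have "norm_Y (\<lambda>\<xi>. f \<xi> - f \<xi>) = 0" "norm_Y (Lambda f) = 0"
    by (simp_all add: norm_Y_def inner_Y_def assms(2))
  then have "(\<lambda>n::nat. norm_Y (\<lambda>\<xi>. f \<xi> - f \<xi>)) \<longlonglongrightarrow> 0" "(\<lambda>n::nat. norm_Y (Lambda f)) \<longlonglongrightarrow> 0" by simp_all
  then show ?thesis unfolding ker_Lambda_def
    by (intro CollectI conjI Z_imp_Y assms(1) exI[of _ "\<lambda>n. f"] allI)
qed

text \<open>The inner product of Y cancels the Gaussian factor: times \<open>weight\<close>, the
  kernel elements \<open>gaussian\<close> and \<open>pd1 gaussian\<close> become a constant and a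
  multiple of the first coordinate.\<close>

lemma ker_Lambda_perp_moments:
  assumes "v \<in> ker_Lambda_perp"
  shows "(LINT \<xi>|lborel. v \<xi>) = 0" "(LINT \<xi>|lborel. fst \<xi> * v \<xi>) = 0"
proof -
  have g: "gaussian \<xi> * weight \<xi> = 1 / (4 * pi)" for \<xi> by (simp add: gaussian_ew ew_weight)
  have "inner_Y v gaussian = 0" "inner_Y v (pd1 gaussian) = 0"
    using assms ker_LambdaI[OF gaussian_in_Z Lambda_gaussian] ker_LambdaI[OF pd1_gaussian_in_Z Lambda_pd1_gaussian]
    unfolding ker_Lambda_perp_def by blast+
  moreover have "inner_Y v gaussian = (LINT \<xi>|lborel. v \<xi> * (1 / (4 * pi)))"
    unfolding inner_Y_def by (simp only: mult.assoc g)
  moreover have "v \<xi> * pd1 gaussian \<xi> * weight \<xi> = fst \<xi> * v \<xi> * (- 1 / (8 * pi))" for \<xi>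
    using arg_cong[OF g[of \<xi>], of "\<lambda>x. v \<xi> * (- fst \<xi> / 2) * x"] by (simp add: pd1_gaussian mult_ac)
  then have "inner_Y v (pd1 gaussian) = (LINT \<xi>|lborel. fst \<xi> * v \<xi> * (- 1 / (8 * pi)))"
    unfolding inner_Y_def by simp
  ultimately show "(LINT \<xi>|lborel. v \<xi>) = 0" "(LINT \<xi>|lborel. fst \<xi> * v \<xi>) = 0"
    by (simp_all only: integral_mult_left_zero) simp_all
qed

section \<open>Angular modes\<close>

definition cpx :: "plane \<Rightarrow> complex" where "cpx \<xi> = Complex (fst \<xi>) (snd \<xi>)"

lemma cpx_simps [simp]: "Re (cpx \<xi>) = fst \<xi>" "Im (cpx \<xi>) = snd \<xi>" "norm (cpx \<xi>) = norm \<xi>"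
  by (simp_all add: cpx_def cmod_def norm_prod_def)

lemma cpx_diff: "cpx (\<xi> - \<eta>) = cpx \<xi> - cpx \<eta>" and cpx_minus: "cpx (- \<xi>) = - cpx \<xi>"
  by (simp_all add: cpx_def complex_eq_iff)

lemma cpx_measurable [measurable]: "cpx \<in> borel_measurable borel"
proof -
  have e: "cpx = (\<lambda>\<xi>. of_real (fst \<xi>) + \<i> * of_real (snd \<xi>))" by (simp add: fun_eq_iff complex_eq_iff)
  show ?thesis unfolding e by measurable
qed

text \<open>Polar coordinates on the half plane \<open>x > 0\<close>, with the slope \<open>s = tan \<theta>\<close> in place of the
  angle, so that only affine substitutions are needed.\<close>

definition ray :: "real \<times> real \<Rightarrow> plane" where
  "ray p = (fst p / sqrt (1 + (snd p)\<^sup>2), fst p * snd p / sqrt (1 + (snd p)\<^sup>2))"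

definition ray_density :: "real \<times> real \<Rightarrow> real" where
  "ray_density p = indicator {0<..} (fst p) * fst p / (1 + (snd p)\<^sup>2)"

lemma ray_measurable [measurable]: "ray \<in> borel_measurable borel"
  unfolding ray_def by (rule borel_measurable_Pair) measurable

lemma ray_density_measurable [measurable]: "ray_density \<in> borel_measurable borel"
  unfolding ray_density_def by measurable

lemma ray_density_nonneg: "0 \<le> ray_density p"
  by (simp add: ray_density_def indicator_def add_nonneg_nonneg)

text \<open>For fixed slope s the radius is rescaled by sqrt (1 + s^2) to the abscissa x; after
  exchanging the integrals, s is rescaled by x to the ordinate. Both substitutions are linear in one
  real variable.\<close>

lemma nn_integral_ray:
  fixes h :: "plane \<Rightarrow> ennreal"
  assumes [measurable]: "h \<in> borel_measurable borel"
  shows "(\<integral>\<^sup>+p. ennreal (ray_density p) * h (ray p) \<partial>lborel) = (\<integral>\<^sup>+\<xi>. indicator {0<..} (fst \<xi>) * h \<xi> \<partial>lborel)"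
proof -
  have [measurable]: "h \<in> borel_measurable (borel \<Otimes>\<^sub>M borel)" by (simp add: borel_prod)
  have [measurable]: "ray \<in> borel_measurable (borel \<Otimes>\<^sub>M borel)" "ray_density \<in> borel_measurable (borel \<Otimes>\<^sub>M borel)"
    by (simp_all add: borel_prod)
  have "(\<integral>\<^sup>+p. ennreal (ray_density p) * h (ray p) \<partial>lborel)
     = (\<integral>\<^sup>+p. ennreal (ray_density p) * h (ray p) \<partial>(lborel \<Otimes>\<^sub>M lborel))" by (simp add: lborel_prod)
  also have "\<dots> = (\<integral>\<^sup>+s. (\<integral>\<^sup>+r. ennreal (ray_density (r, s)) * h (ray (r, s)) \<partial>lborel) \<partial>lborel)"
    by (rule lborel_pair.nn_integral_snd[symmetric]) simp
  also have "\<dots> = (\<integral>\<^sup>+s. (\<integral>\<^sup>+x. indicator {0<..} x * (ennreal x * h (x, x * s)) \<partial>lborel) \<partial>lborel)"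
  proof (rule nn_integral_cong)
    fix s :: real
    define c where "c = sqrt (1 + s\<^sup>2)"
    have c: "c > 0" "c * c = 1 + s\<^sup>2" by (simp_all add: c_def add_pos_nonneg)
    have "(\<integral>\<^sup>+r. ennreal (ray_density (r, s)) * h (ray (r, s)) \<partial>lborel) =
       ennreal \<bar>c\<bar> * (\<integral>\<^sup>+x. ennreal (ray_density (0 + c * x, s)) * h (ray (0 + c * x, s)) \<partial>lborel)"
      using c by (intro nn_integral_real_affine) simp_all
    also have "\<dots> = (\<integral>\<^sup>+x. ennreal \<bar>c\<bar> * (ennreal (ray_density (0 + c * x, s)) * h (ray (0 + c * x, s))) \<partial>lborel)"
      by (rule nn_integral_cmult[symmetric]) simp
    also have "\<dots> = (\<integral>\<^sup>+x. indicator {0<..} x * (ennreal x * h (x, x * s)) \<partial>lborel)"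
    proof (rule nn_integral_cong)
      fix x :: real
      have 1: "ray (0 + c * x, s) = (x, x * s)" using c by (simp add: ray_def c_def[symmetric])
      have 2: "ray_density (0 + c * x, s) = indicator {0<..} x * (x / c)"
        using c by (simp add: ray_density_def c(2)[symmetric] indicator_def zero_less_mult_iff)
      show "ennreal \<bar>c\<bar> * (ennreal (ray_density (0 + c * x, s)) * h (ray (0 + c * x, s))) =
          indicator {0<..} x * (ennreal x * h (x, x * s))"
        unfolding 1 2 using c(1)
        by (cases "x > 0") (simp_all flip: mult.assoc ennreal_mult'')
    qed
    finally show "(\<integral>\<^sup>+r. ennreal (ray_density (r, s)) * h (ray (r, s)) \<partial>lborel) =
      (\<integral>\<^sup>+x. indicator {0<..} x * (ennreal x * h (x, x * s)) \<partial>lborel)" .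
  qed
  also have "\<dots> = (\<integral>\<^sup>+x. (\<integral>\<^sup>+s. indicator {0<..} x * (ennreal x * h (x, x * s)) \<partial>lborel) \<partial>lborel)"
    by (rule lborel_pair.Fubini') simp
  also have "\<dots> = (\<integral>\<^sup>+x. (\<integral>\<^sup>+y. indicator {0<..} x * h (x, y) \<partial>lborel) \<partial>lborel)"
  proof (rule nn_integral_cong)
    fix x :: real
    show "(\<integral>\<^sup>+s. indicator {0<..} x * (ennreal x * h (x, x * s)) \<partial>lborel) = (\<integral>\<^sup>+y. indicator {0<..} x * h (x, y) \<partial>lborel)"
    proof (cases "x > 0")
      case True
      have "(\<integral>\<^sup>+y. h (x, y) \<partial>lborel) = ennreal \<bar>x\<bar> * (\<integral>\<^sup>+s. h (x, 0 + x * s) \<partial>lborel)"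
        using True by (intro nn_integral_real_affine) simp_all
      then show ?thesis using True by (simp add: nn_integral_cmult)
    qed simp
  qed
  also have "\<dots> = (\<integral>\<^sup>+\<xi>. indicator {0<..} (fst \<xi>) * h \<xi> \<partial>(lborel \<Otimes>\<^sub>M lborel))"
    by (subst lborel.nn_integral_fst[symmetric]) simp_all
  finally show ?thesis by (simp add: lborel_prod)
qed

lemma distr_ray:
  "distr (density lborel ray_density) borel ray = density lborel (\<lambda>\<xi>. indicator {0<..} (fst \<xi>))"
proof (rule measure_eqI)
  fix A assume "A \<in> sets (distr (density lborel ray_density) borel ray)"
  then have A [measurable]: "A \<in> sets borel" by simp
  have rA: "ray -` A \<in> sets borel" using measurable_sets[OF ray_measurable A] by simp
  have "emeasure (distr (density lborel ray_density) borel ray) A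
    = (\<integral>\<^sup>+p. ennreal (ray_density p) * indicator (ray -` A) p \<partial>lborel)"
    using rA by (simp add: emeasure_distr emeasure_density)
  also have "\<dots> = (\<integral>\<^sup>+p. ennreal (ray_density p) * indicator A (ray p) \<partial>lborel)"
    by (simp add: indicator_def)
  also have "\<dots> = (\<integral>\<^sup>+\<xi>. indicator {0<..} (fst \<xi>) * indicator A \<xi> \<partial>lborel)"
    by (rule nn_integral_ray) simp
  finally show "emeasure (distr (density lborel ray_density) borel ray) A
    = emeasure (density lborel (\<lambda>\<xi>. indicator {0<..} (fst \<xi>))) A"
    by (simp add: emeasure_density)
qed simp

lemma half_plane_ray:
  fixes F :: "plane \<Rightarrow> 'a::{banach, second_countable_topology}"
  assumes F [measurable]: "F \<in> borel_measurable borel"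
  shows "integrable lborel (\<lambda>\<xi>. indicator {0<..} (fst \<xi>) *\<^sub>R F \<xi>) \<longleftrightarrow> integrable lborel (\<lambda>p. ray_density p *\<^sub>R F (ray p))"
    and "(LINT \<xi>|lborel. indicator {0<..} (fst \<xi>) *\<^sub>R F \<xi>) = (LINT p|lborel. ray_density p *\<^sub>R F (ray p))"
proof -
  have e: "(\<lambda>\<xi>::plane. indicator {0<..} (fst \<xi>) :: ennreal) = (\<lambda>\<xi>. ennreal (indicator {0<..} (fst \<xi>)))"
    by (simp add: fun_eq_iff indicator_def)
  have 1: "integrable (density lborel (\<lambda>\<xi>::plane. ennreal (indicator {0<..} (fst \<xi>)))) F \<longleftrightarrow> integrable lborel (\<lambda>\<xi>. indicator {0<..} (fst \<xi>) *\<^sub>R F \<xi>)"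
    by (rule integrable_density) simp_all
  have 2: "(LINT \<xi>|density lborel (\<lambda>\<xi>::plane. ennreal (indicator {0<..} (fst \<xi>))). F \<xi>) = (LINT \<xi>|lborel. indicator {0<..} (fst \<xi>) *\<^sub>R F \<xi>)"
    by (rule integral_density) simp_all
  have 3: "integrable (density lborel ray_density) (\<lambda>p. F (ray p)) \<longleftrightarrow> integrable lborel (\<lambda>p. ray_density p *\<^sub>R F (ray p))"
    by (rule integrable_density) (simp_all add: ray_density_nonneg)
  have 4: "(LINT p|density lborel ray_density. F (ray p)) = (LINT p|lborel. ray_density p *\<^sub>R F (ray p))"
    by (rule integral_density) (simp_all add: ray_density_nonneg)
  show "integrable lborel (\<lambda>\<xi>. indicator {0<..} (fst \<xi>) *\<^sub>R F \<xi>) \<longleftrightarrow> integrable lborel (\<lambda>p. ray_density p *\<^sub>R F (ray p))"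
    using integrable_distr_eq[of ray "density lborel ray_density" borel F] unfolding distr_ray e 1 3 by simp
  show "(LINT \<xi>|lborel. indicator {0<..} (fst \<xi>) *\<^sub>R F \<xi>) = (LINT p|lborel. ray_density p *\<^sub>R F (ray p))"
    using integral_distr[of ray "density lborel ray_density" borel F] unfolding distr_ray e 2 4 by simp
qed

lemma AE_fst_nonzero: "AE \<xi> in (lborel :: plane measure). fst \<xi> \<noteq> 0"
proof -
  have "AE x in lborel. AE y in lborel. fst (x, y :: real) \<noteq> (0::real)"
    using AE_lborel_singleton[of "0::real"] by eventually_elim simp
  then show ?thesis unfolding lborel_plane
  proof (rule lborel_pair.AE_pair_measure[rotated])
    show "{\<xi> \<in> space (lborel \<Otimes>\<^sub>M lborel). fst \<xi> \<noteq> (0::real)} \<in> sets (lborel \<Otimes>\<^sub>M lborel)" by measurable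
  qed
qed

text \<open>The left half plane is reached by the reflection through the origin and the line between
  the halves is null. Opposite points therefore occur in pairs, which suits functions of even
  angular modes.\<close>

theorem integral_polar:
  fixes F :: "plane \<Rightarrow> 'a::{banach, second_countable_topology}"
  assumes F: "integrable lborel F"
  shows "integrable lborel (\<lambda>p. ray_density p *\<^sub>R (F (ray p) + F (- ray p)))"
    and "(LINT \<xi>|lborel. F \<xi>) = (LINT p|lborel. ray_density p *\<^sub>R (F (ray p) + F (- ray p)))"
proof -
  have [measurable]: "F \<in> borel_measurable borel" using F by simp
  have Fm: "integrable lborel (\<lambda>\<xi>. F (- \<xi>))"
    using integrable_reflect[of F 0] F by simp
  have i1: "integrable lborel (\<lambda>\<xi>. indicator {0<..} (fst \<xi>) *\<^sub>R F \<xi>)"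
    and i2: "integrable lborel (\<lambda>\<xi>. indicator {0<..} (fst \<xi>) *\<^sub>R F (- \<xi>))"
  proof -
    have s: "{\<xi>::plane. 0 < fst \<xi>} \<in> sets lborel" by measurable
    have e: "indicator {\<xi>::plane. 0 < fst \<xi>} \<xi> = (indicator {0<..} (fst \<xi>) :: real)" for \<xi>
      by (simp add: indicator_def)
    show "integrable lborel (\<lambda>\<xi>. indicator {0<..} (fst \<xi>) *\<^sub>R F \<xi>)"
      "integrable lborel (\<lambda>\<xi>. indicator {0<..} (fst \<xi>) *\<^sub>R F (- \<xi>))"
      using integrable_mult_indicator[OF s F] integrable_mult_indicator[OF s Fm] unfolding e by simp_all
  qed
  have "(LINT \<xi>|lborel. F \<xi>) = (LINT \<xi>|lborel. indicator {0<..} (fst \<xi>) *\<^sub>R F \<xi> + indicator {0<..} (- fst \<xi>) *\<^sub>R F \<xi>)"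
    by (rule integral_cong_AE, measurable, rule AE_mp[OF AE_fst_nonzero]) (rule AE_I2, auto simp: indicator_def)
  also have "\<dots> = (LINT \<xi>|lborel. indicator {0<..} (fst \<xi>) *\<^sub>R F \<xi>) + (LINT \<xi>|lborel. indicator {0<..} (- fst \<xi>) *\<^sub>R F \<xi>)"
    using i1 i2 integrable_reflect[of "\<lambda>\<xi>. indicator {0<..} (- fst \<xi>) *\<^sub>R F \<xi>" 0] by simp
  also have "(LINT \<xi>|lborel. indicator {0<..} (- fst \<xi>) *\<^sub>R F \<xi>) = (LINT \<xi>|lborel. indicator {0<..} (fst \<xi>) *\<^sub>R F (- \<xi>))"
    using integral_reflect[of "\<lambda>\<xi>. indicator {0<..} (- fst \<xi>) *\<^sub>R F \<xi>" 0] by simp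
  also have "(LINT \<xi>|lborel. indicator {0<..} (fst \<xi>) *\<^sub>R F \<xi>) + (LINT \<xi>|lborel. indicator {0<..} (fst \<xi>) *\<^sub>R F (- \<xi>))
      = (LINT p|lborel. ray_density p *\<^sub>R F (ray p)) + (LINT p|lborel. ray_density p *\<^sub>R F (- ray p))"
    by (simp add: half_plane_ray(2))
  finally have 1: "(LINT \<xi>|lborel. F \<xi>) = (LINT p|lborel. ray_density p *\<^sub>R F (ray p)) + (LINT p|lborel. ray_density p *\<^sub>R F (- ray p))" .
  have j: "integrable lborel (\<lambda>p. ray_density p *\<^sub>R F (ray p))" "integrable lborel (\<lambda>p. ray_density p *\<^sub>R F (- ray p))"
    using i1 i2 half_plane_ray(1)[of F] half_plane_ray(1)[of "\<lambda>\<xi>. F (- \<xi>)"] by simp_all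
  show "integrable lborel (\<lambda>p. ray_density p *\<^sub>R (F (ray p) + F (- ray p)))"
    using Bochner_Integration.integrable_add[OF j] by (simp add: scaleR_add_right)
  show "(LINT \<xi>|lborel. F \<xi>) = (LINT p|lborel. ray_density p *\<^sub>R (F (ray p) + F (- ray p)))"
    unfolding 1 using Bochner_Integration.integral_add[OF j] by (simp add: scaleR_add_right)
qed

text \<open>The square of the unit vector on the ray of slope \<open>s\<close>.\<close>

definition turn :: "real \<Rightarrow> complex" where "turn s = (1 + \<i> * of_real s) / (1 - \<i> * of_real s)"

lemma turn_denom: "1 - \<i> * of_real s \<noteq> 0" "1 + \<i> * of_real s \<noteq> 0"
  by (auto simp: complex_eq_iff)

lemma cnj_turn: "turn s * cnj (turn s) = 1" "cnj (turn s) * turn s = 1"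
  using turn_denom[of s] by (simp_all add: turn_def)

lemma norm_turn [simp]: "norm (turn s) = 1"
  using cnj_turn(1)[of s] by (metis complex_mod_mult_cnj complex_mod_cnj norm_mult norm_one power2_eq_square real_sqrt_abs real_sqrt_one abs_norm_cancel)

lemma turn_measurable [measurable]: "turn \<in> borel_measurable borel"
  unfolding turn_def by measurable

lemma turn_Re_Im: "Re (turn s) = cos (2 * arctan s)" "Im (turn s) = sin (2 * arctan s)"
proof -
  have q: "0 < 1 + s\<^sup>2" by (simp add: add_pos_nonneg)
  have "turn s = Complex ((1 - s\<^sup>2) / (1 + s\<^sup>2)) (2 * s / (1 + s\<^sup>2))"
    using q unfolding turn_def complex_eq_iff Re_divide Im_divide by (simp add: power2_eq_square)
  moreover have "cos (2 * arctan s) = (1 - s\<^sup>2) / (1 + s\<^sup>2)"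
    unfolding cos_double cos_arctan sin_arctan using q by (simp add: power_divide diff_divide_distrib)
  moreover have "sin (2 * arctan s) = 2 * s / (1 + s\<^sup>2)"
    unfolding sin_double cos_arctan sin_arctan using q by simp
  ultimately show "Re (turn s) = cos (2 * arctan s)" "Im (turn s) = sin (2 * arctan s)" by simp_all
qed

lemma ray_polar: "ray (r, s) = (r * cos (arctan s), r * sin (arctan s))"
  by (simp add: ray_def cos_arctan sin_arctan)

lemma cpx_ray_power2: "(cpx (ray (r, s)))\<^sup>2 = of_real (r\<^sup>2) * turn s"
  by (auto simp: complex_eq_iff power2_eq_square ray_polar turn_Re_Im cos_double sin_double right_diff_distrib)

lemma norm_ray: "norm (ray (r, s)) = \<bar>r\<bar>"
  by (simp add: ray_polar norm_Pair power_mult_distrib flip: distrib_left)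

text \<open>Integration over a half circle in the slope variable: d\<theta> = ds / (1 + s^2), of
  total mass pi.\<close>

definition angular :: "(real \<Rightarrow> complex) \<Rightarrow> complex" where
  "angular g = (LINT s|lborel. (1 / (1 + s\<^sup>2)) *\<^sub>R g s)"

lemma angular_integrable:
  assumes [measurable]: "g \<in> borel_measurable borel" and b: "\<And>s. norm (g s) \<le> B"
  shows "integrable lborel (\<lambda>s. (1 / (1 + s\<^sup>2)) *\<^sub>R (g s :: complex))"
proof (rule Bochner_Integration.integrable_bound[where f = "\<lambda>s::real. B * (1 / (1 + s\<^sup>2))"])
  show "integrable lborel (\<lambda>s::real. B * (1 / (1 + s\<^sup>2)))"
    by (intro integrable_mult_right integrable_inverse_quadratic)
  have "norm ((1 / (1 + s\<^sup>2)) *\<^sub>R g s) \<le> norm (B * (1 / (1 + s\<^sup>2)))" for s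
  proof -
    have "0 \<le> B" using b[of s] norm_ge_zero order_trans by blast
    then show ?thesis using mult_left_mono[OF b[of s], of "1 / (1 + s\<^sup>2)"]
      by (simp add: abs_of_nonneg add_nonneg_nonneg divide_right_mono)
  qed
  then show "AE s in lborel. norm ((1 / (1 + s\<^sup>2)) *\<^sub>R g s) \<le> norm (B * (1 / (1 + s\<^sup>2)))" by simp
qed measurable

lemma angular_cmult: "angular (\<lambda>s. c * g s) = c * angular g"
  unfolding angular_def by (simp flip: integral_mult_right_zero)

lemma angular_cnj: "angular (\<lambda>s. cnj (g s)) = cnj (angular g)"
  using Bochner_Integration.integral_cnj[of lborel "\<lambda>s. (1 / (1 + s\<^sup>2)) *\<^sub>R g s"]
  by (simp add: angular_def scaleR_conv_of_real del: Bochner_Integration.integral_cnj)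

lemma angular_add:
  assumes "g \<in> borel_measurable borel" "\<And>s. norm (g s) \<le> B" "h \<in> borel_measurable borel" "\<And>s. norm (h s) \<le> D"
  shows "angular (\<lambda>s. g s + h s) = angular g + angular h"
  unfolding angular_def using angular_integrable[of g B] angular_integrable[of h D] assms by (simp add: scaleR_add_right)

text \<open>Along the rays \<open>turn\<close> is e^(2 i \<theta>), so its k-th power has the
  primitive \<open>turn s ^ k / (2 * \<i> * of_nat k)\<close>. As both ends of the half circle give
  turn = -1, the boundary values agree.\<close>

lemma angular_turn_power:
  assumes k: "k \<ge> 1"
  shows "angular (\<lambda>s. turn s ^ k) = 0"
proof -
  define U where "U s = turn s ^ k / (2 * \<i> * of_nat k)" for s
  have der: "(U has_vector_derivative (1 / (1 + s\<^sup>2)) *\<^sub>R turn s ^ k) (at s)" for s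
  proof -
    have "((\<lambda>z. (1 + \<i> * z) / (1 - \<i> * z)) has_field_derivative 2 * \<i> / (1 - \<i> * of_real s)\<^sup>2) (at (of_real s))"
      using turn_denom[of s]
      by (auto intro!: derivative_eq_intros simp: power2_eq_square) (simp add: divide_simps algebra_simps)
    from DERIV_cdivide[OF DERIV_power[OF this, of k], of "2 * \<i> * of_nat k"]
    have "((\<lambda>z. ((1 + \<i> * z) / (1 - \<i> * z)) ^ k / (2 * \<i> * of_nat k)) has_field_derivative
        (of_nat k * turn s ^ (k - 1) * (2 * \<i> / (1 - \<i> * of_real s)\<^sup>2)) / (2 * \<i> * of_nat k)) (at (of_real s))"
      by (simp add: turn_def mult_ac)
    also have "(of_nat k * turn s ^ (k - 1) * (2 * \<i> / (1 - \<i> * of_real s)\<^sup>2)) / (2 * \<i> * of_nat k)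
       = turn s ^ (k - 1) * (1 / (1 - \<i> * of_real s)\<^sup>2)" using k by simp
    also have "1 / (1 - \<i> * of_real s)\<^sup>2 = of_real (1 / (1 + s\<^sup>2)) * turn s"
    proof -
      have "of_real (1 + s\<^sup>2) = (1 - \<i> * of_real s) * (1 + \<i> * of_real s)"
        by (simp add: algebra_simps power2_eq_square complex_eq_iff)
      then show ?thesis using turn_denom[of s] unfolding turn_def of_real_divide of_real_1
        by (simp add: power2_eq_square divide_simps)
    qed
    also have "turn s ^ (k - 1) * (of_real (1 / (1 + s\<^sup>2)) * turn s) = (1 / (1 + s\<^sup>2)) *\<^sub>R turn s ^ k"
      using k by (simp add: scaleR_conv_of_real power_eq_if)
    finally show ?thesis unfolding U_def turn_def by (rule has_vector_derivative_real_field)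
  qed
  have lim0: "((\<lambda>s. turn s) \<longlongrightarrow> - 1) at_infinity"
  proof -
    have "((\<lambda>s::real. 2 * norm (inverse s)) \<longlongrightarrow> 2 * norm (0::real)) at_infinity"
      by (intro tendsto_intros tendsto_inverse_0)
    then have l: "((\<lambda>s::real. 2 * norm (inverse s)) \<longlongrightarrow> 0) at_infinity" by simp
    have "norm (turn s + 1) \<le> 2 * norm (inverse s)" if "norm s \<ge> 1" for s
    proof -
      have "turn s + 1 = 2 / (1 - \<i> * of_real s)" using turn_denom[of s] by (simp add: turn_def divide_simps)
      moreover have "\<bar>s\<bar> \<le> norm (1 - \<i> * of_real s)" using abs_Im_le_cmod[of "1 - \<i> * of_real s"] by simp
      moreover have "2 / norm (1 - \<i> * of_real s) \<le> 2 / \<bar>s\<bar>"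
        using that \<open>\<bar>s\<bar> \<le> _\<close> by (intro frac_le) simp_all
      ultimately show ?thesis by (simp add: norm_divide norm_mult norm_inverse divide_inverse)
    qed
    then have "\<forall>\<^sub>F s in at_infinity. norm (turn s + 1) \<le> 2 * norm (inverse s)"
      unfolding eventually_at_infinity by blast
    from Lim_null_comparison[OF this l] have "((\<lambda>s. turn s - (- 1)) \<longlongrightarrow> 0) at_infinity" by simp
    then show ?thesis by (rule LIM_zero_cancel)
  qed
  have lim: "(U \<longlongrightarrow> (- 1) ^ k / (2 * \<i> * of_nat k)) at_infinity"
    unfolding U_def using k by (intro tendsto_intros lim0) auto
  show ?thesis unfolding angular_def
    by (rule integral_deriv_eq_0[OF der _ tendsto_mono[OF at_top_le_at_infinity lim] tendsto_mono[OF at_bot_le_at_infinity lim]])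
      (rule angular_integrable[where B = 1]; simp add: norm_power)
qed

lemma cnj_measurable [measurable]: "cnj \<in> borel_measurable borel"
  by (intro borel_measurable_continuous_onI continuous_intros)

lemma angular_1: "angular (\<lambda>s. 1) = of_real pi"
proof -
  have "angular (\<lambda>s. 1) = (LINT s|lborel. of_real (1 / (1 + s\<^sup>2)) :: complex)"
    by (simp add: angular_def scaleR_conv_of_real)
  then show ?thesis by (simp only: integral_complex_of_real integral_inverse_quadratic)
qed

lemma angular_orthogonal: "angular (\<lambda>s. turn s ^ i * cnj (turn s) ^ j) = (if i = j then of_real pi else 0)"
proof -
  have c: "turn s ^ k * cnj (turn s) ^ k = 1" for s k
    by (simp add: cnj_turn flip: power_mult_distrib)
  consider "i = j" | k where "k \<ge> 1" "i = j + k" | k where "k \<ge> 1" "j = i + k"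
    by (metis One_nat_def Suc_leI add_diff_inverse_nat linorder_neqE_nat not_less_iff_gr_or_eq zero_less_diff order_less_imp_le)
  then show ?thesis
  proof cases
    case 1
    then show ?thesis by (simp add: c angular_1)
  next
    case 2
    then have "turn s ^ i * cnj (turn s) ^ j = turn s ^ k" for s
      using c[of s j] by (simp add: power_add mult_ac)
    then show ?thesis using 2 by (simp add: angular_turn_power)
  next
    case 3
    then have "turn s ^ i * cnj (turn s) ^ j = cnj (turn s ^ k)" for s
      using c[of s i] by (simp add: power_add)
    then show ?thesis using 3 by (simp only: angular_cnj) (simp add: angular_turn_power)
  qed
qed

text \<open>Geometric series in \<open>a * turn s\<close>: by orthogonality only its term of index j
  - i survives. The partial sums are bounded by 1 / (1 - |a|), which justifies the limit.\<close>

lemma angular_kernel: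
  assumes a: "norm a < 1"
  shows "angular (\<lambda>s. turn s ^ i * cnj (turn s) ^ j / (1 - a * turn s)) = (if i \<le> j then of_real pi * a ^ (j - i) else 0)"
proof -
  define g where "g s = turn s ^ i * cnj (turn s) ^ j" for s
  have [measurable]: "g \<in> borel_measurable borel" unfolding g_def by measurable
  have ng: "norm (g s) = 1" for s by (simp add: g_def norm_mult norm_power)
  define S where "S N s = (\<Sum>n<N. (a * turn s) ^ n)" for N s
  have nau: "norm (a * turn s) < 1" for s using a by (simp add: norm_mult)
  have ne: "1 - a * turn s \<noteq> 0" for s using nau[of s] by auto
  have Sb: "norm (S N s) \<le> 1 / (1 - norm a)" for N s
  proof -
    have "norm (S N s) \<le> (\<Sum>n<N. norm a ^ n)"
      unfolding S_def by (rule sum_norm_le) (simp add: norm_mult norm_power)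
    also have "\<dots> \<le> (\<Sum>n. norm a ^ n)" using a by (intro sum_le_suminf summable_geometric) auto
    also have "\<dots> = 1 / (1 - norm a)" using a by (intro suminf_geometric) auto
    finally show ?thesis .
  qed
  have "(\<lambda>N. angular (\<lambda>s. g s * S N s)) \<longlonglongrightarrow> angular (\<lambda>s. g s * (1 / (1 - a * turn s)))"
    unfolding angular_def
  proof (rule integral_dominated_convergence[where w = "\<lambda>s. (1 / (1 - norm a)) * (1 / (1 + s\<^sup>2))"])
    show "integrable lborel (\<lambda>s::real. (1 / (1 - norm a)) * (1 / (1 + s\<^sup>2)))"
      by (intro integrable_mult_right integrable_inverse_quadratic)
    show "(\<lambda>s. (1 / (1 + s\<^sup>2)) *\<^sub>R (g s * (1 / (1 - a * turn s)))) \<in> borel_measurable lborel"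
      "(\<lambda>s. (1 / (1 + s\<^sup>2)) *\<^sub>R (g s * S N s)) \<in> borel_measurable lborel" for N
      unfolding S_def by measurable
    show "AE s in lborel. (\<lambda>N. (1 / (1 + s\<^sup>2)) *\<^sub>R (g s * S N s)) \<longlonglongrightarrow> (1 / (1 + s\<^sup>2)) *\<^sub>R (g s * (1 / (1 - a * turn s)))"
    proof (rule AE_I2)
      fix s
      have "(\<lambda>N. S N s) \<longlonglongrightarrow> 1 / (1 - a * turn s)"
        using geometric_sums[OF nau[of s]] by (simp add: S_def sums_def)
      then show "(\<lambda>N. (1 / (1 + s\<^sup>2)) *\<^sub>R (g s * S N s)) \<longlonglongrightarrow> (1 / (1 + s\<^sup>2)) *\<^sub>R (g s * (1 / (1 - a * turn s)))"
        by (intro tendsto_intros)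
    qed
    show "AE s in lborel. norm ((1 / (1 + s\<^sup>2)) *\<^sub>R (g s * S N s)) \<le> (1 / (1 - norm a)) * (1 / (1 + s\<^sup>2))" for N
    proof (rule AE_I2)
      fix s :: real
      have "(1 / (1 + s\<^sup>2)) * norm (S N s) \<le> (1 / (1 + s\<^sup>2)) * (1 / (1 - norm a))"
        by (intro mult_left_mono Sb) (simp add: add_nonneg_nonneg)
      then show "norm ((1 / (1 + s\<^sup>2)) *\<^sub>R (g s * S N s)) \<le> (1 / (1 - norm a)) * (1 / (1 + s\<^sup>2))"
        by (simp add: norm_mult ng abs_of_nonneg add_nonneg_nonneg mult.commute)
    qed
  qed
  moreover have "angular (\<lambda>s. g s * S N s) = (if i \<le> j then of_real pi * a ^ (j - i) else 0)" if N: "N \<ge> Suc j" for N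
  proof -
    have "angular (\<lambda>s. g s * S N s) = (LINT s|lborel. (\<Sum>n<N. (1 / (1 + s\<^sup>2)) *\<^sub>R (a ^ n * (turn s ^ (i + n) * cnj (turn s) ^ j))))"
      unfolding angular_def S_def g_def
      by (intro Bochner_Integration.integral_cong refl)
        (simp add: sum_distrib_left scaleR_sum_right power_mult_distrib power_add mult_ac)
    also have "\<dots> = (\<Sum>n<N. angular (\<lambda>s. a ^ n * (turn s ^ (i + n) * cnj (turn s) ^ j)))"
      unfolding angular_def
      by (rule Bochner_Integration.integral_sum, rule angular_integrable[where B = "norm a ^ _"])
        (auto simp: norm_mult norm_power)
    also have "\<dots> = (\<Sum>n<N. if i + n = j then of_real pi * a ^ (j - i) else 0)"
      unfolding angular_cmult angular_orthogonal by (intro sum.cong refl) auto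
    also have "\<dots> = (\<Sum>n<N. if n = j - i then (if i \<le> j then of_real pi * a ^ (j - i) else 0) else 0)"
      by (intro sum.cong refl) auto
    also have "\<dots> = (if i \<le> j then of_real pi * a ^ (j - i) else 0)"
      using N by (subst sum.delta) auto
    finally show ?thesis .
  qed
  then have "(\<lambda>N. angular (\<lambda>s. g s * S N s)) \<longlonglongrightarrow> (if i \<le> j then of_real pi * a ^ (j - i) else 0)"
    by (intro tendsto_eventually, unfold eventually_sequentially, intro exI[of _ "Suc j"]) simp
  ultimately have "angular (\<lambda>s. g s * (1 / (1 - a * turn s))) = (if i \<le> j then of_real pi * a ^ (j - i) else 0)"
    by (rule LIMSEQ_unique)
  then show ?thesis by (simp add: g_def)
qed

lemma angular_kernel_cnj:
  assumes a: "norm a < 1"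
  shows "angular (\<lambda>s. turn s ^ i * cnj (turn s) ^ j / (1 - a * cnj (turn s))) = (if j \<le> i then of_real pi * a ^ (i - j) else 0)"
proof -
  have "angular (\<lambda>s. cnj (turn s ^ j * cnj (turn s) ^ i / (1 - cnj a * turn s))) = cnj (if j \<le> i then of_real pi * cnj a ^ (i - j) else 0)"
    unfolding angular_cnj using angular_kernel[of "cnj a" j i] a by simp
  then show ?thesis by (simp add: mult.commute split: if_splits)
qed

text \<open>\<open>P\<close> and \<open>Q\<close> below are the inner and outer contributions to the stream function generated
  by a vorticity \<open>w(r) cos 2\<theta>\<close> or \<open>w(r) sin 2\<theta>\<close>; \<open>\<kappa>\<close> switches the external strain on.\<close>

locale radial =
  fixes w :: "real \<Rightarrow> real" and \<kappa> C :: real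
  assumes w_cont: "continuous_on UNIV w"
    and w_bound: "\<And>r. r > 0 \<Longrightarrow> \<bar>w r\<bar> \<le> C / (1 + r) ^ 6"
begin

definition P :: "real \<Rightarrow> real" where "P r = (LINT t|lborel. indicator {0<..<r} t * (t ^ 3 * w t))"
definition Q :: "real \<Rightarrow> real" where "Q r = (LINT t|lborel. indicator {r<..} t * (w t / t))"
definition total :: real where "total = (LINT t|lborel. indicator {0<..} t * (t ^ 3 * w t))"

text \<open>X is minus the radial factor of the stream function of mode 2, including the external
  strain; Y is r/2 times the derivative of X.\<close>

definition X :: "real \<Rightarrow> real" where "X r = (\<kappa> * r\<^sup>2 / pi + P r / r\<^sup>2 + r\<^sup>2 * Q r) / 4"
definition Y :: "real \<Rightarrow> real" where "Y r = (\<kappa> * r\<^sup>2 / pi - P r / r\<^sup>2 + r\<^sup>2 * Q r) / 4"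

lemma C_nonneg: "C \<ge> 0"
proof -
  have "0 \<le> C / (1 + 1) ^ 6" using order_trans[OF abs_ge_zero w_bound[of 1]] by simp
  then show ?thesis by simp
qed

lemma w_measurable [measurable]: "w \<in> borel_measurable borel"
  using w_cont by (rule borel_measurable_continuous_onI)

lemma moment_bound:
  assumes "t > 0"
  shows "\<bar>t ^ 3 * w t\<bar> \<le> C * (1 / (1 + t\<^sup>2))" "\<bar>w t\<bar> \<le> C"
proof -
  have "t ^ 3 * (1 + t\<^sup>2) \<le> (1 + t) ^ 3 * ((1 + t) ^ 3)"
  proof (intro mult_mono power_mono)
    have "(1 + t) ^ 3 = 1 + 3 * t + 3 * t\<^sup>2 + t ^ 3" by (simp add: power3_eq_cube power2_eq_square algebra_simps)
    then show "1 + t\<^sup>2 \<le> (1 + t) ^ 3" using assms by (simp add: add_increasing)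
  qed (use assms in auto)
  then have "t ^ 3 * (1 + t\<^sup>2) \<le> (1 + t) ^ 6" by (simp flip: power_add)
  then have "t ^ 3 / (1 + t) ^ 6 \<le> 1 / (1 + t\<^sup>2)"
    using assms by (simp add: divide_simps add_pos_nonneg mult.commute)
  then have 1: "C * (t ^ 3 / (1 + t) ^ 6) \<le> C * (1 / (1 + t\<^sup>2))" using C_nonneg by (rule mult_left_mono)
  have "\<bar>t ^ 3 * w t\<bar> \<le> t ^ 3 * (C / (1 + t) ^ 6)"
    unfolding abs_mult using assms w_bound[OF assms] by (intro mult_mono) auto
  then show "\<bar>t ^ 3 * w t\<bar> \<le> C * (1 / (1 + t\<^sup>2))" using 1 by (simp add: mult.commute)
  have "C / (1 + t) ^ 6 \<le> C / 1" using assms C_nonneg by (intro divide_left_mono) auto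
  then show "\<bar>w t\<bar> \<le> C" using w_bound[OF assms] by simp
qed

lemma moment_integrable: "integrable lborel (\<lambda>t. indicator {0<..} t * (t ^ 3 * w t))"
proof (rule Bochner_Integration.integrable_bound)
  show "integrable lborel (\<lambda>t::real. C * (1 / (1 + t\<^sup>2)))"
    by (intro integrable_mult_right integrable_inverse_quadratic)
  show "AE t in lborel. norm (indicator {0<..} t * (t ^ 3 * w t)) \<le> norm (C * (1 / (1 + t\<^sup>2)))"
  proof (rule AE_I2)
    fix t :: real
    have "0 \<le> C * (1 / (1 + t\<^sup>2))" using C_nonneg by (simp add: add_nonneg_nonneg)
    then show "norm (indicator {0<..} t * (t ^ 3 * w t)) \<le> norm (C * (1 / (1 + t\<^sup>2)))"
      unfolding real_norm_def abs_of_nonneg[OF \<open>0 \<le> _\<close>]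
      using moment_bound(1)[of t] by (cases "t > 0") simp_all
  qed
qed measurable

text \<open>For t > r the factor 1/t is at most t^3 / r^4, so the outer integral is dominated by the
  moment integral. The same bound gives the decay of Q like r^(-4).\<close>

lemma tail_integrable:
  assumes r: "r > 0"
  shows "integrable lborel (\<lambda>t. indicator {r<..} t * (w t / t))"
    and "\<bar>w t / t\<bar> * indicator {r<..} t \<le> r powi (-4) * \<bar>indicator {0<..} t * (t ^ 3 * w t)\<bar>"
proof -
  have b: "\<bar>w t / t\<bar> * indicator {r<..} t \<le> r powi (-4) * \<bar>indicator {0<..} t * (t ^ 3 * w t)\<bar>" for t
  proof (cases "t > r")
    case True
    then have t: "t > 0" using r by simp
    have "r ^ 4 \<le> t ^ 4" using True r by (intro power_mono) auto
    then have "1 / t \<le> t ^ 3 / r ^ 4" using t r by (simp add: divide_simps eval_nat_numeral)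
    then have "1 / t * \<bar>w t\<bar> \<le> t ^ 3 / r ^ 4 * \<bar>w t\<bar>" by (rule mult_right_mono) simp
    then show ?thesis using True t r by (simp add: abs_mult power_int_minus divide_inverse mult_ac)
  qed (use r in \<open>simp add: zero_le_power_int\<close>)
  show "integrable lborel (\<lambda>t. indicator {r<..} t * (w t / t))"
  proof (rule Bochner_Integration.integrable_bound)
    show "integrable lborel (\<lambda>t. r powi (-4) * \<bar>indicator {0<..} t * (t ^ 3 * w t)\<bar>)"
      by (intro integrable_mult_right integrable_abs moment_integrable)
    show "AE t in lborel. norm (indicator {r<..} t * (w t / t)) \<le> norm (r powi (-4) * \<bar>indicator {0<..} t * (t ^ 3 * w t)\<bar>)"
    proof (rule AE_I2)
      fix t
      have "0 \<le> r powi (-4) * \<bar>indicator {0<..} t * (t ^ 3 * w t)\<bar>"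
        using r by (intro mult_nonneg_nonneg zero_le_power_int) auto
      then show "norm (indicator {r<..} t * (w t / t)) \<le> norm (r powi (-4) * \<bar>indicator {0<..} t * (t ^ 3 * w t)\<bar>)"
        using b[of t] unfolding real_norm_def abs_of_nonneg[OF \<open>0 \<le> _\<close>]
        by (simp add: abs_mult mult.commute)
    qed
  qed measurable
  show "\<bar>w t / t\<bar> * indicator {r<..} t \<le> r powi (-4) * \<bar>indicator {0<..} t * (t ^ 3 * w t)\<bar>" by (rule b)
qed

lemma P_integrable: "integrable lborel (\<lambda>t. indicator {0<..<r} t * (t ^ 3 * w t))"
  by (rule Bochner_Integration.integrable_bound[OF integrable_abs[OF moment_integrable]])
    (measurable, rule AE_I2, simp add: indicator_def)

lemma P_eq: "r \<ge> 0 \<Longrightarrow> P r = integral {0..r} (\<lambda>t. t ^ 3 * w t)"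
proof -
  assume r: "r \<ge> 0"
  have i: "set_integrable lborel {0..r} (\<lambda>t. t ^ 3 * w t)"
    by (intro borel_integrable_atLeastAtMost' continuous_intros continuous_on_subset[OF w_cont]) auto
  have "P r = (LINT t|lborel. indicator {0..r} t *\<^sub>R (t ^ 3 * w t))"
    unfolding P_def
  proof (rule integral_cong_AE)
    show "AE t in lborel. indicator {0<..<r} t * (t ^ 3 * w t) = indicator {0..r} t *\<^sub>R (t ^ 3 * w t)"
      using AE_lborel_singleton[of 0] AE_lborel_singleton[of r] by eventually_elim (auto simp: indicator_def)
  qed measurable
  then show ?thesis using set_borel_integral_eq_integral(2)[OF i] by (simp add: set_lebesgue_integral_def)
qed

lemma P_deriv: assumes "r > 0" shows "(P has_real_derivative r ^ 3 * w r) (at r)"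
proof -
  have "((\<lambda>u. integral {0..u} (\<lambda>t. t ^ 3 * w t)) has_real_derivative r ^ 3 * w r) (at r within {0..r + 1})"
    using assms by (intro integral_has_real_derivative continuous_intros continuous_on_subset[OF w_cont]) auto
  then have "((\<lambda>u. integral {0..u} (\<lambda>t. t ^ 3 * w t)) has_real_derivative r ^ 3 * w r) (at r)"
    using assms by (subst (asm) at_within_Icc_at) simp_all
  then show ?thesis
  proof (rule has_field_derivative_transform_within[where d = r])
    fix u assume "dist u r < r"
    then have "0 \<le> u" unfolding dist_real_def by linarith
    then show "integral {0..u} (\<lambda>t. t ^ 3 * w t) = P u" by (simp add: P_eq)
  qed (use assms in simp_all)
qed

lemma Q_split: assumes "0 < a" "a \<le> r" shows "Q r = Q a - integral {a..r} (\<lambda>t. w t / t)"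
proof -
  have i: "set_integrable lborel {a..r} (\<lambda>t. w t / t)"
    using assms by (intro borel_integrable_atLeastAtMost' continuous_intros continuous_on_subset[OF w_cont]) auto
  have i': "integrable lborel (\<lambda>t. indicator {a..r} t * (w t / t))" using i by (simp add: set_integrable_def)
  have "Q a = (LINT t|lborel. indicator {a..r} t * (w t / t) + indicator {r<..} t * (w t / t))"
    unfolding Q_def
  proof (rule integral_cong_AE)
    show "AE t in lborel. indicator {a<..} t * (w t / t) = indicator {a..r} t * (w t / t) + indicator {r<..} t * (w t / t)"
      using AE_lborel_singleton[of a] by eventually_elim (use assms in \<open>auto simp: indicator_def\<close>)
  qed measurable
  also have "\<dots> = integral {a..r} (\<lambda>t. w t / t) + Q r"
    using i' tail_integrable(1)[of r] assms set_borel_integral_eq_integral(2)[OF i]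
    by (simp add: Q_def set_lebesgue_integral_def)
  finally show ?thesis by simp
qed

lemma Q_deriv: assumes "r > 0" shows "(Q has_real_derivative - (w r / r)) (at r)"
proof -
  have "((\<lambda>u. integral {r/2..u} (\<lambda>t. w t / t)) has_real_derivative w r / r) (at r within {r/2..r + 1})"
    using assms by (intro integral_has_real_derivative continuous_intros continuous_on_subset[OF w_cont]) auto
  then have "((\<lambda>u. integral {r/2..u} (\<lambda>t. w t / t)) has_real_derivative w r / r) (at r)"
    using assms by (subst (asm) at_within_Icc_at) simp_all
  then have "((\<lambda>u. Q (r/2) - integral {r/2..u} (\<lambda>t. w t / t)) has_real_derivative 0 - w r / r) (at r)"
    by (intro DERIV_diff DERIV_const)
  then show ?thesis unfolding diff_0
  proof (rule has_field_derivative_transform_within[where d = "r / 2"])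
    fix u assume "dist u r < r / 2"
    then have "r / 2 \<le> u" unfolding dist_real_def by linarith
    then show "Q (r / 2) - integral {r / 2..u} (\<lambda>t. w t / t) = Q u" using assms Q_split[of "r / 2" u] by simp
  qed (use assms in simp_all)
qed

lemma P_le: assumes "r \<ge> 0" shows "\<bar>P r\<bar> \<le> C * r ^ 4"
proof (cases "r = 0")
  case False
  have i: "(\<lambda>t. t ^ 3 * w t) integrable_on {0..r}"
    by (intro integrable_continuous_interval continuous_intros continuous_on_subset[OF w_cont]) auto
  have "norm (integral {0..r} (\<lambda>t. t ^ 3 * w t)) \<le> integral {0..r} (\<lambda>t. C * r ^ 3)"
  proof (rule integral_norm_bound_integral[OF i])
    fix t assume t: "t \<in> {0..r}"
    show "norm (t ^ 3 * w t) \<le> C * r ^ 3"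
    proof (cases "t = 0")
      case False
      then have "t > 0" using t by auto
      then have "\<bar>t ^ 3\<bar> * \<bar>w t\<bar> \<le> r ^ 3 * C"
        using t moment_bound(2)[of t] by (intro mult_mono) (auto intro: power_mono simp: power_abs)
      then show ?thesis by (simp add: abs_mult mult.commute)
    qed (use C_nonneg assms in simp)
  qed (rule integrable_const_ivl)
  then show ?thesis using assms by (simp add: P_eq eval_nat_numeral mult_ac)
qed (simp add: P_def)

lemma P_tendsto: "(P \<longlongrightarrow> total) at_top"
proof -
  have "((\<lambda>r. LINT t|lborel. indicator {0<..<r} t * (t ^ 3 * w t)) \<longlongrightarrow> (LINT t|lborel. indicator {0<..} t * (t ^ 3 * w t))) at_top"
  proof (rule integral_dominated_convergence_at_top[where w = "\<lambda>t. \<bar>indicator {0<..} t * (t ^ 3 * w t)\<bar>"])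
    show "\<forall>\<^sub>F r in at_top. AE t in lborel. norm (indicator {0<..<r} t * (t ^ 3 * w t)) \<le> \<bar>indicator {0<..} t * (t ^ 3 * w t)\<bar>"
      by (intro always_eventually allI AE_I2) (auto simp: indicator_def)
    show "AE t in lborel. ((\<lambda>r. indicator {0<..<r} t * (t ^ 3 * w t)) \<longlongrightarrow> indicator {0<..} t * (t ^ 3 * w t)) at_top"
    proof (rule AE_I2)
      fix t :: real
      have "\<forall>\<^sub>F r in at_top. indicator {0<..<r} t * (t ^ 3 * w t) = indicator {0<..} t * (t ^ 3 * w t)"
        using eventually_gt_at_top[of t] by eventually_elim (auto simp: indicator_def)
      then show "((\<lambda>r. indicator {0<..<r} t * (t ^ 3 * w t)) \<longlongrightarrow> indicator {0<..} t * (t ^ 3 * w t)) at_top"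
        by (rule tendsto_eventually)
    qed
  qed (use moment_integrable in \<open>auto intro: integrable_abs\<close>)
  then show ?thesis by (simp add: P_def[abs_def] total_def)
qed

lemma Q_le: "\<exists>K. \<forall>r>0. \<bar>Q r\<bar> \<le> K / r ^ 4"
proof (intro exI allI impI)
  fix r :: real assume r: "r > 0"
  have "\<bar>Q r\<bar> \<le> (LINT t|lborel. \<bar>indicator {r<..} t * (w t / t)\<bar>)"
    unfolding Q_def using integral_norm_bound[of lborel "\<lambda>t. indicator {r<..} t * (w t / t)"] by simp
  also have "\<dots> \<le> (LINT t|lborel. r powi (-4) * \<bar>indicator {0<..} t * (t ^ 3 * w t)\<bar>)"
    using tail_integrable(2)[OF r]
    by (intro integral_mono integrable_abs tail_integrable(1)[OF r] integrable_mult_right moment_integrable)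
      (simp add: abs_mult mult.commute)
  also have "\<dots> = (LINT t|lborel. \<bar>indicator {0<..} t * (t ^ 3 * w t)\<bar>) / r ^ 4"
    using r by (simp add: power_int_minus divide_inverse mult.commute)
  finally show "\<bar>Q r\<bar> \<le> (LINT t|lborel. \<bar>indicator {0<..} t * (t ^ 3 * w t)\<bar>) / r ^ 4" .
qed

lemma Q_at_0: "((\<lambda>r. r\<^sup>2 * Q r) \<longlongrightarrow> 0) (at_right 0)"
proof -
  define K where "K = \<bar>Q 1\<bar>"
  have b: "\<bar>r\<^sup>2 * Q r\<bar> \<le> r\<^sup>2 * K + r * C" if r: "0 < r" "r < 1" for r
  proof -
    have i: "(\<lambda>t. w t / t) integrable_on {r..1}"
      using r by (intro integrable_continuous_interval continuous_intros continuous_on_subset[OF w_cont]) auto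
    have "norm (integral {r..1} (\<lambda>t. w t / t)) \<le> integral {r..1} (\<lambda>t. C / r)"
    proof (rule integral_norm_bound_integral[OF i])
      fix t assume "t \<in> {r..1}"
      then have t: "r \<le> t" "0 < t" using r by auto
      then show "norm (w t / t) \<le> C / r"
        using moment_bound(2)[of t] C_nonneg r by (simp add: abs_divide) (intro frac_le, auto)
    qed (rule integrable_const_ivl)
    also have "\<dots> \<le> C / r" using r C_nonneg mult_left_le[of "1 - r" "C / r"] by (simp add: mult.commute)
    finally have "\<bar>Q r\<bar> \<le> K + C / r" using Q_split[of r 1] r by (auto simp: K_def)
    then have "r\<^sup>2 * \<bar>Q r\<bar> \<le> r\<^sup>2 * (K + C / r)" by (intro mult_left_mono) auto
    then show ?thesis using r by (simp add: abs_mult distrib_left power2_eq_square)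
  qed
  have "\<forall>\<^sub>F r in at_right 0. norm (r\<^sup>2 * Q r) \<le> r\<^sup>2 * K + r * C"
    unfolding eventually_at_right_field using b by (intro exI[of _ 1]) auto
  moreover have "((\<lambda>r. r\<^sup>2 * K + r * C) \<longlongrightarrow> 0) (at_right 0)" by (auto intro!: tendsto_eq_intros)
  ultimately show ?thesis by (rule Lim_null_comparison)
qed

lemma P_at_0: "((\<lambda>r. P r / r\<^sup>2) \<longlongrightarrow> 0) (at_right 0)"
proof -
  have "norm (P r / r\<^sup>2) \<le> C * r\<^sup>2" if "0 < r" for r
    using P_le[of r] that by (simp add: abs_divide divide_simps eval_nat_numeral mult_ac)
  then have "\<forall>\<^sub>F r in at_right 0. norm (P r / r\<^sup>2) \<le> C * r\<^sup>2"
    unfolding eventually_at_right_field by (intro exI[of _ 1]) auto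
  moreover have "((\<lambda>r. C * r\<^sup>2) \<longlongrightarrow> 0) (at_right 0)" by (auto intro!: tendsto_eq_intros)
  ultimately show ?thesis by (rule Lim_null_comparison)
qed

lemma XY_at_0: "((\<lambda>r. X r * Y r) \<longlongrightarrow> 0) (at_right 0)"
proof -
  have "((\<lambda>r. (\<kappa> * r\<^sup>2 / pi + P r / r\<^sup>2 + r\<^sup>2 * Q r) / 4 * ((\<kappa> * r\<^sup>2 / pi - P r / r\<^sup>2 + r\<^sup>2 * Q r) / 4)) \<longlongrightarrow>
     (\<kappa> * 0\<^sup>2 / pi + 0 + 0) / 4 * ((\<kappa> * 0\<^sup>2 / pi - 0 + 0) / 4)) (at_right 0)"
    by (intro tendsto_intros P_at_0 Q_at_0) auto
  then show ?thesis by (simp add: X_def Y_def)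
qed

lemma inverse_power_tendsto: "n > 0 \<Longrightarrow> ((\<lambda>r::real. K / r ^ n) \<longlongrightarrow> 0) at_top"
  by (intro real_tendsto_divide_at_top[OF tendsto_const] filterlim_pow_at_top filterlim_ident)

lemma P_at_top: "((\<lambda>r. P r / r\<^sup>2) \<longlongrightarrow> 0) at_top"
  using tendsto_mult[OF P_tendsto inverse_power_tendsto[of 2 1]] by simp

lemma Q_at_top: "(Q \<longlongrightarrow> 0) at_top" "((\<lambda>r. r\<^sup>2 * Q r) \<longlongrightarrow> 0) at_top"
proof -
  obtain K where K: "\<And>r. r > 0 \<Longrightarrow> \<bar>Q r\<bar> \<le> K / r ^ 4" using Q_le by blast
  have "\<forall>\<^sub>F r in at_top. norm (Q r) \<le> K / r ^ 4"
    using eventually_gt_at_top[of 0] by eventually_elim (use K in simp)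
  then show "(Q \<longlongrightarrow> 0) at_top" by (rule Lim_null_comparison) (rule inverse_power_tendsto, simp)
  have *: "norm (r\<^sup>2 * Q r) \<le> K / r\<^sup>2" if "r > 0" for r
    using mult_left_mono[OF K[OF that], of "r\<^sup>2"] that by (simp add: abs_mult divide_simps eval_nat_numeral mult_ac)
  have "\<forall>\<^sub>F r in at_top. norm (r\<^sup>2 * Q r) \<le> K / r\<^sup>2"
    by (rule eventually_mono[OF eventually_gt_at_top[of 0] *])
  then show "((\<lambda>r. r\<^sup>2 * Q r) \<longlongrightarrow> 0) at_top" by (rule Lim_null_comparison) (rule inverse_power_tendsto, simp)
qed

lemma PQ_derivs:
  assumes "r > 0"
  shows "((\<lambda>r. P r / r\<^sup>2) has_real_derivative r * w r - 2 * P r / r ^ 3) (at r)"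
    and "((\<lambda>r. r\<^sup>2 * Q r) has_real_derivative 2 * r * Q r - r * w r) (at r)"
    and "((\<lambda>r. \<kappa> * r\<^sup>2 / pi) has_real_derivative 2 * \<kappa> * r / pi) (at r)"
proof -
  have "((\<lambda>r. P r / r\<^sup>2) has_real_derivative (r ^ 3 * w r * r\<^sup>2 - P r * (2 * r)) / (r\<^sup>2 * r\<^sup>2)) (at r)"
    by (rule DERIV_divide[OF P_deriv[OF assms]]) (use assms in \<open>auto intro!: derivative_eq_intros\<close>)
  moreover have "(r ^ 3 * w r * r\<^sup>2 - P r * (2 * r)) / (r\<^sup>2 * r\<^sup>2) = r * w r - 2 * P r / r ^ 3"
    using assms by (simp add: field_simps eval_nat_numeral)
  ultimately show "((\<lambda>r. P r / r\<^sup>2) has_real_derivative r * w r - 2 * P r / r ^ 3) (at r)" by simp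
  have "((\<lambda>r. r\<^sup>2 * Q r) has_real_derivative 2 * r * Q r + - (w r / r) * r\<^sup>2) (at r)"
    by (rule DERIV_mult[OF _ Q_deriv[OF assms]]) (auto intro!: derivative_eq_intros)
  then show "((\<lambda>r. r\<^sup>2 * Q r) has_real_derivative 2 * r * Q r - r * w r) (at r)"
    using assms by (simp add: power2_eq_square mult_ac)
  show "((\<lambda>r. \<kappa> * r\<^sup>2 / pi) has_real_derivative 2 * \<kappa> * r / pi) (at r)"
    by (auto intro!: derivative_eq_intros)
qed

text \<open>With \<open>Y_deriv\<close> this is the radial Poisson equation of mode 2 as a
  first-order system. The contributions of w from moving the integration limits cancel in X and add
  up in Y.\<close>

lemma X_deriv: assumes "r > 0" shows "(X has_real_derivative 2 * Y r / r) (at r)"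
proof -
  note D = PQ_derivs[OF assms]
  have e: "2 * Y r / r = (2 * \<kappa> * r / pi + (r * w r - 2 * P r / r ^ 3) + (2 * r * Q r - r * w r)) / 4"
    using assms by (simp add: Y_def field_simps eval_nat_numeral)
  show ?thesis unfolding e X_def[abs_def]
    by (rule DERIV_cdivide[OF DERIV_add[OF DERIV_add[OF D(3) D(1)] D(2)]])
qed

lemma Y_deriv: assumes "r > 0" shows "(Y has_real_derivative (2 * X r - r\<^sup>2 * w r / 2) / r) (at r)"
proof -
  note D = PQ_derivs[OF assms]
  have e: "(2 * X r - r\<^sup>2 * w r / 2) / r = (2 * \<kappa> * r / pi - (r * w r - 2 * P r / r ^ 3) + (2 * r * Q r - r * w r)) / 4"
    using assms by (simp add: X_def field_simps eval_nat_numeral)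
  show ?thesis unfolding e Y_def[abs_def]
    by (rule DERIV_cdivide[OF DERIV_add[OF DERIV_diff[OF D(3) D(1)] D(2)]])
qed

end

text \<open>The constant 4/3 makes \<open>S\<close> at most 3/4, so that 1 - S is positive in the
  energy argument. The Taylor polynomial of degree 4 suffices; the difference is s ((s - 2)(s - 3) /
  6 + s^3 / 24).\<close>

lemma quadratic_le_exp:
  assumes s: "s > 0"
  shows "4 / 3 * s\<^sup>2 \<le> exp s - (1::real)"
proof -
  have "poly exp_lo s - (1 + s + s\<^sup>2 / 2 + s ^ 3 / 6 + s ^ 4 / 24) \<ge> 0"
    using s by (simp add: exp_lo_def algebra_simps eval_nat_numeral)
  then have 1: "1 + s + s\<^sup>2 / 2 + s ^ 3 / 6 + s ^ 4 / 24 \<le> exp s" using exp_lo_le[of s] s by linarith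
  have "0 \<le> (s - 2) * (s - 3) / 6 + s ^ 3 / 24"
  proof (cases "s \<ge> 1")
    case True
    then have "1 \<le> s ^ 3" by simp
    moreover have "(s - 2) * (s - 3) = (s - 5 / 2)\<^sup>2 - 1 / 4" by (simp add: power2_eq_square algebra_simps)
    moreover have "0 \<le> (s - 5 / 2)\<^sup>2" by simp
    ultimately show ?thesis by linarith
  next
    case False
    then show ?thesis using s by (intro add_nonneg_nonneg divide_nonneg_nonneg mult_nonpos_nonpos) auto
  qed
  then have "0 \<le> s * ((s - 2) * (s - 3) / 6 + s ^ 3 / 24)" using s by (intro mult_nonneg_nonneg) auto
  also have "\<dots> = s + s\<^sup>2 / 2 + s ^ 3 / 6 + s ^ 4 / 24 - 4 / 3 * s\<^sup>2"
    by (simp add: power2_eq_square eval_nat_numeral field_simps)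
  finally show ?thesis using 1 by linarith
qed

text \<open>The equation for Lambda on angular mode 2, divided by the angular velocity
  \<open>v0\<close> of the Gaussian vortex; the coefficient in front of X is \<open>g0 / v0\<close>
  (see \<open>g0_v0\<close>).\<close>

locale radial_mode = radial +
  assumes mode: "\<And>r. r > 0 \<Longrightarrow> w r = (r\<^sup>2 / 2) / (exp (r\<^sup>2 / 4) - 1) * X r / 2"
begin

definition S :: "real \<Rightarrow> real" where "S r = (r\<^sup>2 / 4)\<^sup>2 / (exp (r\<^sup>2 / 4) - 1)"

lemma S_bounds: assumes "r > 0" shows "S r \<le> 3 / 4"
proof -
  have "4 / 3 * (r\<^sup>2 / 4)\<^sup>2 \<le> exp (r\<^sup>2 / 4) - 1" using assms by (intro quadratic_le_exp) simp
  then show ?thesis using assms by (simp add: S_def pos_divide_le_eq)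
qed

lemma Y_deriv': assumes "r > 0" shows "(Y has_real_derivative 2 * (1 - S r) * X r / r) (at r)"
proof -
  define E where "E = exp (r\<^sup>2 / 4) - 1"
  have "r\<^sup>2 * w r / 2 = 2 * S r * X r"
    unfolding mode[OF assms] S_def E_def[symmetric] by (simp add: power2_eq_square)
  then have "2 * X r - r\<^sup>2 * w r / 2 = 2 * (1 - S r) * X r" by (simp add: algebra_simps)
  then show ?thesis using Y_deriv[OF assms] by simp
qed

lemma XY_deriv:
  assumes "r > 0"
  shows "((\<lambda>r. X r * Y r) has_real_derivative (2 * (Y r)\<^sup>2 + 2 * (1 - S r) * (X r)\<^sup>2) / r) (at r)"
  using DERIV_mult[OF X_deriv[OF assms] Y_deriv'[OF assms]]
  by (simp add: power2_eq_square add_divide_distrib mult_ac)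

lemma XY_mono: assumes "0 < a" "a \<le> b" shows "X a * Y a \<le> X b * Y b"
proof (rule DERIV_nonneg_imp_nondecreasing[of a b "\<lambda>r. X r * Y r", OF assms(2)])
  fix r assume "a \<le> r" "r \<le> b"
  then have r: "r > 0" using assms by simp
  have "0 \<le> (2 * (Y r)\<^sup>2 + 2 * (1 - S r) * (X r)\<^sup>2) / r"
    using S_bounds[OF r] r by (intro divide_nonneg_nonneg add_nonneg_nonneg mult_nonneg_nonneg) auto
  then show "\<exists>y. ((\<lambda>r. X r * Y r) has_real_derivative y) (at r) \<and> 0 \<le> y" using XY_deriv[OF r] by blast
qed

lemma XY_nonneg: assumes "r > 0" shows "0 \<le> X r * Y r"
proof (rule tendsto_upperbound[OF XY_at_0])
  show "\<forall>\<^sub>F x in at_right 0. X x * Y x \<le> X r * Y r"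
    by (rule eventually_at_rightI[of 0 r]) (use XY_mono[of _ r] assms in auto)
qed simp

text \<open>Energy argument: without forcing, \<open>X Y\<close> is nondecreasing and vanishes at both ends.\<close>

lemma homogeneous_zero:
  assumes k: "\<kappa> = 0" and r: "r > 0"
  shows "w r = 0"
proof -
  have lim: "((\<lambda>r. X r * Y r) \<longlongrightarrow> 0) at_top"
  proof -
    have "((\<lambda>r. (P r / r\<^sup>2 + r\<^sup>2 * Q r) / 4 * ((- (P r / r\<^sup>2) + r\<^sup>2 * Q r) / 4)) \<longlongrightarrow>
       (0 + 0) / 4 * ((- 0 + 0) / 4)) at_top"
      by (intro tendsto_intros P_at_top Q_at_top) auto
    moreover have e: "X r = (P r / r\<^sup>2 + r\<^sup>2 * Q r) / 4" "Y r = (- (P r / r\<^sup>2) + r\<^sup>2 * Q r) / 4" for r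
      unfolding X_def Y_def by (simp_all add: k)
    ultimately show ?thesis unfolding e by simp
  qed
  have "X a * Y a \<le> 0" if a: "a > 0" for a
  proof (rule tendsto_lowerbound[OF lim])
    show "\<forall>\<^sub>F x in at_top. X a * Y a \<le> X x * Y x"
      by (rule eventually_mono[OF eventually_ge_at_top[of a]]) (rule XY_mono[OF a])
  qed simp
  then have z: "X a * Y a = 0" if "a > 0" for a using XY_nonneg[OF that] that by (meson order_antisym)
  have "((\<lambda>r. X r * Y r) has_real_derivative 0) (at r)"
  proof (rule has_field_derivative_transform_within[OF DERIV_const[of 0], where d = r])
    fix u assume "dist u r < r"
    then have "0 < u" unfolding dist_real_def by linarith
    then show "0 = X u * Y u" using z[of u] by simp
  qed (use r in simp_all)
  then have "(2 * (Y r)\<^sup>2 + 2 * (1 - S r) * (X r)\<^sup>2) / r = 0" by (rule DERIV_unique[OF XY_deriv[OF r]])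
  then have "2 * (Y r)\<^sup>2 + 2 * (1 - S r) * (X r)\<^sup>2 = 0" using r by simp
  moreover have "0 \<le> 2 * (Y r)\<^sup>2" "0 \<le> (1 - S r) * (X r)\<^sup>2" using S_bounds[OF r] by auto
  ultimately have "(1 - S r) * (X r)\<^sup>2 = 0" by linarith
  then have "X r = 0" using S_bounds[OF r] by auto
  then show ?thesis using mode[OF r] by simp
qed

text \<open>X^2 is nondecreasing because X Y \<ge> 0, and the strain r^2 / pi makes X positive far
  out. A negative value would force a later zero of X, where X^2 would have dropped.\<close>

lemma X_nonneg:
  assumes k: "\<kappa> = 1" and a: "a > 0"
  shows "0 \<le> X a"
proof (rule ccontr)
  assume neg: "\<not> 0 \<le> X a"
  have mono: "(X a)\<^sup>2 \<le> (X b)\<^sup>2" if "a \<le> b" for b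
  proof (rule DERIV_nonneg_imp_nondecreasing[of a b "\<lambda>r. (X r)\<^sup>2", OF that])
    fix x assume "a \<le> x" "x \<le> b"
    then have x: "x > 0" using a by simp
    have "((\<lambda>r. (X r)\<^sup>2) has_real_derivative 2 * X x * (2 * Y x / x)) (at x)"
      by (rule derivative_eq_intros X_deriv[OF x] refl)+ simp
    moreover have "0 \<le> 2 * X x * (2 * Y x / x)"
      using XY_nonneg[OF x] x by (simp add: divide_nonneg_nonneg mult_ac)
    ultimately show "\<exists>y. ((\<lambda>r. (X r)\<^sup>2) has_real_derivative y) (at x) \<and> 0 \<le> y" by blast
  qed
  have "((\<lambda>r. P r / r\<^sup>2 + r\<^sup>2 * Q r) \<longlongrightarrow> 0 + 0) at_top"
    by (intro tendsto_add P_at_top Q_at_top)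
  then have "\<forall>\<^sub>F r in at_top. - (1 / pi) < P r / r\<^sup>2 + r\<^sup>2 * Q r" by (rule order_tendstoD) simp
  then have "\<forall>\<^sub>F r in at_top. - (1 / pi) < P r / r\<^sup>2 + r\<^sup>2 * Q r \<and> r \<ge> max a 1"
    by (rule eventually_conj) (rule eventually_ge_at_top)
  then obtain b where b: "- (1 / pi) < P b / b\<^sup>2 + b\<^sup>2 * Q b" "b \<ge> max a 1"
    using eventually_happens[of _ "at_top :: real filter"] by (metis (mono_tags, lifting) trivial_limit_at_top_linorder)
  have "1 / pi \<le> b\<^sup>2 / pi" using b(2) by (intro divide_right_mono) (auto simp: one_le_power)
  then have Xb: "X b > 0" unfolding X_def using b(1) by (simp add: k)
  have "continuous_on {a..b} X"
    using a by (intro DERIV_continuous_on[OF has_field_derivative_at_within[OF X_deriv]]) auto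
  then obtain c where "a \<le> c" "X c = 0"
    using IVT'[of X a 0 b] neg Xb b(2) by auto
  then have "(X a)\<^sup>2 \<le> 0" using mono[of c] by simp
  then show False using neg by simp
qed

lemma w_nonneg: "\<kappa> = 1 \<Longrightarrow> r > 0 \<Longrightarrow> 0 \<le> w r"
  using mode[of r] X_nonneg[of r] by simp

lemma PQ_nonneg:
  assumes "\<kappa> = 1" "r > 0"
  shows "0 \<le> P r" "0 \<le> Q r"
proof -
  have "0 \<le> indicator {0<..<r} t * (t ^ 3 * w t)" "0 \<le> indicator {r<..} t * (w t / t)" for t
    using w_nonneg[OF assms(1), of t] assms(2) by (auto simp: indicator_def)
  then show "0 \<le> P r" "0 \<le> Q r" unfolding P_def Q_def by (intro Bochner_Integration.integral_nonneg; simp)+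
qed

text \<open>In the variable \<open>s = r^2/4\<close>, \<open>\<pi> X = s y + p/s\<close> with \<open>y' = - (s y + p/s) / (2 (e^s - 1))\<close>
  and \<open>p' = - s^2 y'\<close>, so that \<open>m = p/y\<close> solves a Riccati equation.\<close>

lemma total_bounds:
  assumes k: "\<kappa> = 1"
  shows "22.24 \<le> total" "total < 22.25"
proof -
  define y where "y s = 1 + pi * Q (2 * sqrt s)" for s
  define p where "p s = pi / 16 * P (2 * sqrt s)" for s
  define m where "m s = p s / y s" for s
  have y1: "y s \<ge> 1" and p0: "p s \<ge> 0" if "s > 0" for s
    using PQ_nonneg[OF k, of "2 * sqrt s"] that by (simp_all add: y_def p_def)
  \<comment> \<open>The constant pi C comes from \<open>P_le\<close> with r^4 = 16 s^2 and y \<ge>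
    1. The limit is that of p, since Q vanishes at infinity and y tends to 1.\<close>
  have r: "riccati m (pi * C) (pi * total / 16)"
  proof
    fix s :: real assume s: "s > 0"
    define r where "r = 2 * sqrt s"
    define E where "E = exp s - 1"
    have r0: "r > 0" and r2: "r\<^sup>2 = 4 * s" and rs: "sqrt s = r / 2" using s by (simp_all add: r_def power_mult_distrib)
    have E: "E > 0" using s by (simp add: E_def)
    have dr: "((\<lambda>s. 2 * sqrt s) has_real_derivative 2 / r) (at s)"
      using s by (auto intro!: derivative_eq_intros simp: r_def divide_simps)
    define V where "V = s * y s + p s / s"
    have X: "pi * X r = V"
    proof -
      have e: "y s = 1 + pi * Q r" "p s = pi / 16 * P r" by (simp_all add: y_def p_def r_def)
      show ?thesis unfolding X_def V_def e r2 using s by (simp add: k field_simps)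
    qed
    have w: "pi * w r = s / E * V"
    proof -
      have "w r = 2 * s / E * X r / 2" using mode[OF r0] by (simp add: r2 E_def)
      then show ?thesis using X by (simp add: mult_ac)
    qed
    have dy: "(y has_real_derivative - (V / (2 * E))) (at s)"
    proof -
      have "(y has_real_derivative 0 + pi * (- (w r / r) * (2 / r))) (at s)"
        unfolding y_def[abs_def]
        by (intro DERIV_add DERIV_const DERIV_cmult DERIV_chain2[where f = Q and g = "\<lambda>s. 2 * sqrt s", OF _ dr])
          (use Q_deriv[OF r0] in \<open>simp add: r_def\<close>)
      moreover have "pi * (- (w r / r) * (2 / r)) = - (pi * w r) * 2 / r\<^sup>2" by (simp add: power2_eq_square)
      moreover have "\<dots> = - (V / (2 * E))" unfolding w r2 using s E by (simp add: field_simps)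
      ultimately show ?thesis by simp
    qed
    have dp: "(p has_real_derivative s\<^sup>2 * V / (2 * E)) (at s)"
    proof -
      have "(p has_real_derivative pi / 16 * (r ^ 3 * w r * (2 / r))) (at s)"
        unfolding p_def[abs_def]
        by (intro DERIV_cmult DERIV_chain2[where f = P and g = "\<lambda>s. 2 * sqrt s", OF _ dr])
          (use P_deriv[OF r0] in \<open>simp add: r_def\<close>)
      moreover have "pi / 16 * (r ^ 3 * w r * (2 / r)) = (pi * w r) * r\<^sup>2 / 8" using r0 by (simp add: eval_nat_numeral)
      moreover have "\<dots> = s\<^sup>2 * V / (2 * E)" unfolding w r2 using E by (simp add: field_simps power2_eq_square)
      ultimately show ?thesis by simp
    qed
    have ys: "y s > 0" using y1[OF s] by simp
    have "(m has_real_derivative (s\<^sup>2 * V / (2 * E) * y s - p s * - (V / (2 * E))) / (y s * y s)) (at s)"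
      unfolding m_def[abs_def] by (rule DERIV_divide[OF dp dy]) (use ys in simp)
    also have "(s\<^sup>2 * V / (2 * E) * y s - p s * - (V / (2 * E))) / (y s * y s) = (s\<^sup>2 + m s)\<^sup>2 / (2 * s * E)"
      unfolding m_def V_def using ys s E by (simp add: field_simps power2_eq_square)
    finally show "(m has_real_derivative (s\<^sup>2 + m s)\<^sup>2 / (2 * s * (exp s - 1))) (at s)" by (simp add: E_def)
    show "0 \<le> m s" using p0[OF s] ys by (simp add: m_def)
    have "p s \<le> pi / 16 * (C * r ^ 4)" unfolding p_def r_def[symmetric]
      using P_le[of r] r0 by (intro mult_left_mono) auto
    also have "\<dots> = pi * C * s\<^sup>2"
    proof -
      have "r ^ 4 = (r\<^sup>2)\<^sup>2" by simp
      then show ?thesis unfolding r2 by (simp add: power_mult_distrib)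
    qed
    finally have "p s \<le> pi * C * s\<^sup>2" .
    moreover have "m s \<le> p s" using p0[OF s] y1[OF s] by (simp add: m_def divide_le_eq mult_left_le_one_le mult_le_cancel_left1)
    ultimately show "m s \<le> pi * C * s\<^sup>2" by simp
  next
    have f: "filterlim (\<lambda>s::real. 2 * sqrt s) at_top at_top"
      by (intro filterlim_tendsto_pos_mult_at_top[OF tendsto_const] sqrt_at_top) simp
    have "((\<lambda>s. pi / 16 * P (2 * sqrt s) / (1 + pi * Q (2 * sqrt s))) \<longlongrightarrow> pi / 16 * total / (1 + pi * 0)) at_top"
      by (intro tendsto_intros filterlim_compose[OF P_tendsto f] filterlim_compose[OF Q_at_top(1) f]) simp
    then show "(m \<longlongrightarrow> pi * total / 16) at_top" by (simp add: m_def[abs_def] p_def y_def)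
  qed
  show "22.24 \<le> total" "total < 22.25"
    using riccati.limit_bounds[OF r] by (simp_all add: mult.commute)
qed

end

section \<open>Cauchy transform and Lambda in polar coordinates\<close>

lemma inverse_cpx: "1 / cpx \<zeta> = Complex (K1 \<zeta>) (- K2 \<zeta>)"
  by (simp add: complex_eq_iff Re_divide Im_divide K1_def K2_def norm_plane_power2)

text \<open>Since 1/z = K1 - i K2, one complex integral carries both components of the gradient of
  the potential.\<close>

lemma cauchy_transform:
  assumes f: "rapid f"
  shows "integrable lborel (\<lambda>\<eta>. of_real (f \<eta>) / (cpx \<xi> - cpx \<eta>))"
    and "(LINT \<eta>|lborel. of_real (f \<eta>) / (cpx \<xi> - cpx \<eta>)) =
      Complex (LINT \<eta>|lborel. K1 (\<xi> - \<eta>) * f \<eta>) (- (LINT \<eta>|lborel. K2 (\<xi> - \<eta>) * f \<eta>))"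
proof -
  note [measurable] = rapid_measurable[OF f]
  show i: "integrable lborel (\<lambda>\<eta>. of_real (f \<eta>) / (cpx \<xi> - cpx \<eta>))"
    by (rule Bochner_Integration.integrable_bound[OF rapid_kernel_integrable[OF f, of \<xi>]])
      (measurable, rule AE_I2, simp add: norm_divide flip: cpx_diff)
  have e: "of_real (f \<eta>) / (cpx \<xi> - cpx \<eta>) = Complex (K1 (\<xi> - \<eta>) * f \<eta>) (- (K2 (\<xi> - \<eta>) * f \<eta>))" for \<eta>
    using arg_cong[OF inverse_cpx[of "\<xi> - \<eta>"], of "\<lambda>x. of_real (f \<eta>) * x"]
    by (simp add: cpx_diff complex_eq_iff mult.commute)
  show "(LINT \<eta>|lborel. of_real (f \<eta>) / (cpx \<xi> - cpx \<eta>)) =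
      Complex (LINT \<eta>|lborel. K1 (\<xi> - \<eta>) * f \<eta>) (- (LINT \<eta>|lborel. K2 (\<xi> - \<eta>) * f \<eta>))"
    using integral_Re[OF i] integral_Im[OF i] unfolding e by (simp add: complex_eq_iff)
qed

lemma angular_linear:
  assumes [measurable]: "g1 \<in> borel_measurable borel" "g2 \<in> borel_measurable borel" "g3 \<in> borel_measurable borel"
    and B: "\<And>s. norm (g1 s) \<le> B" "\<And>s. norm (g2 s) \<le> B" "\<And>s. norm (g3 s) \<le> B"
  shows "angular (\<lambda>s. d * (k * g1 s + c * g2 s + c' * g3 s)) = d * (k * angular g1 + c * angular g2 + c' * angular g3)"
proof -
  have b: "norm (x * g s) \<le> norm x * B" if "norm (g s) \<le> B" for x s and g :: "real \<Rightarrow> complex"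
    using that by (simp add: norm_mult mult_left_mono)
  have "angular (\<lambda>s. k * g1 s + c * g2 s + c' * g3 s) = angular (\<lambda>s. k * g1 s + c * g2 s) + angular (\<lambda>s. c' * g3 s)"
    by (rule angular_add[where B = "norm k * B + norm c * B" and D = "norm c' * B"])
      (measurable, auto intro!: norm_triangle_mono b B)
  also have "angular (\<lambda>s. k * g1 s + c * g2 s) = angular (\<lambda>s. k * g1 s) + angular (\<lambda>s. c * g2 s)"
    by (rule angular_add[where B = "norm k * B" and D = "norm c * B"]) (measurable, auto intro!: b B)
  finally show ?thesis by (simp add: angular_cmult)
qed

text \<open>Functions with the Fourier modes 0 and 2 only; \<open>c\<close> is the complex amplitude of mode 2.\<close>

locale even_modes =
  fixes f :: "plane \<Rightarrow> real" and k c :: "real \<Rightarrow> complex"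
  assumes f: "rapid f"
    and k_measurable [measurable]: "k \<in> borel_measurable borel"
    and c_measurable [measurable]: "c \<in> borel_measurable borel"
    and on_ray: "\<And>r s. r > 0 \<Longrightarrow> of_real (f (ray (r, s))) = k r + c r * turn s + cnj (c r) * cnj (turn s)"
    and on_opposite_ray: "\<And>r s. r > 0 \<Longrightarrow> f (- ray (r, s)) = f (ray (r, s))"
begin

lemma f_measurable [measurable]: "f \<in> borel_measurable borel"
  by (rule rapid_measurable[OF f])

text \<open>One radius \<open>\<rho>\<close> is exempt: on the circle through the singularity of a
  Cauchy kernel the angular integral is not evaluated, and a single radius is null.\<close>

lemma polar_angular:
  assumes F: "integrable lborel (F :: plane \<Rightarrow> complex)"
    and g: "\<And>r. r > 0 \<Longrightarrow> r \<noteq> \<rho> \<Longrightarrow> angular (\<lambda>s. F (ray (r, s)) + F (- ray (r, s))) = g r"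
    and [measurable]: "g \<in> borel_measurable borel"
  shows "(LINT \<eta>|lborel. F \<eta>) = (LINT r|lborel. indicator {0<..} r *\<^sub>R (of_real r * g r))"
proof -
  define H where "H p = ray_density p *\<^sub>R (F (ray p) + F (- ray p))" for p
  have i: "integrable (lborel \<Otimes>\<^sub>M lborel) (case_prod (\<lambda>r s. H (r, s)))"
    using integral_polar(1)[OF F] by (simp add: H_def lborel_prod case_prod_unfold)
  have i1: "integrable lborel (\<lambda>r. LINT s|lborel. H (r, s))"
    using lborel_pair.integrable_fst[OF i] by simp
  have [measurable]: "(\<lambda>r. LINT s|lborel. H (r, s)) \<in> borel_measurable borel"
    using i1 by (simp add: borel_measurable_integrable flip: measurable_lborel1)
  have "(LINT \<eta>|lborel. F \<eta>) = (LINT p|lborel. H p)"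
    using integral_polar(2)[OF F] by (simp add: H_def)
  also have "\<dots> = (LINT r|lborel. LINT s|lborel. H (r, s))"
    using lborel_pair.integral_fst[OF i] by (simp add: lborel_prod)
  also have "\<dots> = (LINT r|lborel. indicator {0<..} r *\<^sub>R (of_real r * g r))"
  proof (rule integral_cong_AE)
    have eq: "(LINT s|lborel. H (r, s)) = indicator {0<..} r *\<^sub>R (of_real r * g r)" if "r \<noteq> \<rho>" for r
    proof (cases "r > 0")
      case True
      have "(LINT s|lborel. H (r, s)) = angular (\<lambda>s. of_real r * (F (ray (r, s)) + F (- ray (r, s))))"
        unfolding angular_def using True
        by (intro Bochner_Integration.integral_cong refl) (simp add: H_def ray_density_def scaleR_conv_of_real)
      then show ?thesis using True g[OF True that] by (simp add: angular_cmult)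
    next
      case False
      then show ?thesis by (simp add: H_def ray_density_def)
    qed
    show "AE r in lborel. (LINT s|lborel. H (r, s)) = indicator {0<..} r *\<^sub>R (of_real r * g r)"
      by (rule AE_mp[OF AE_lborel_singleton[of \<rho>]], rule AE_I2, rule impI, rule eq)
  qed measurable
  finally show ?thesis .
qed

text \<open>Inside the circle through \<open>\<xi>\<close> the kernel is expanded in r^2 turn / z^2,
  outside in z^2 cnj turn / r^2. By orthogonality the inner discs contribute the mass and the
  conjugate amplitude, the outer rings only the amplitude.\<close>

lemma cauchy_polar:
  assumes \<xi>: "\<xi> \<noteq> 0"
  defines "z \<equiv> cpx \<xi>" and "\<rho> \<equiv> norm \<xi>"
  shows "(LINT \<eta>|lborel. of_real (f \<eta>) / (z - cpx \<eta>)) =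
    (LINT r|lborel. indicator {0<..} r *\<^sub>R (of_real r * (if r < \<rho> then of_real (2 * pi) * (k r / z + cnj (c r) * of_real (r\<^sup>2) / z ^ 3)
       else if \<rho> < r then - (of_real (2 * pi) * (z * c r / of_real (r\<^sup>2))) else 0)))"
proof (rule polar_angular[where \<rho> = \<rho>])
  show "integrable lborel (\<lambda>\<eta>. of_real (f \<eta>) / (z - cpx \<eta>))" unfolding z_def by (rule cauchy_transform(1)[OF f])
  show "(\<lambda>r. if r < \<rho> then of_real (2 * pi) * (k r / z + cnj (c r) * of_real (r\<^sup>2) / z ^ 3)
       else if \<rho> < r then - (of_real (2 * pi) * (z * c r / of_real (r\<^sup>2))) else 0) \<in> borel_measurable borel"
    by measurable
  have nz: "norm z = \<rho>" by (simp add: z_def \<rho>_def)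
  have \<rho>0: "\<rho> > 0" using \<xi> by (simp add: \<rho>_def)
  have z0: "z \<noteq> 0" using nz \<rho>0 by auto
  fix r :: real assume r: "r > 0" "r \<noteq> \<rho>"
  have ne: "z\<^sup>2 - of_real (r\<^sup>2) * turn s \<noteq> 0" for s
  proof
    assume "z\<^sup>2 - of_real (r\<^sup>2) * turn s = 0"
    then have "norm (z\<^sup>2) = norm (of_real (r\<^sup>2) * turn s)" by simp
    then have "\<rho>\<^sup>2 = r\<^sup>2" by (simp add: norm_mult norm_power nz)
    then show False using r \<rho>0 by (simp add: power2_eq_iff_nonneg)
  qed
  define h where "h s = k r + c r * turn s + cnj (c r) * cnj (turn s)" for s
  \<comment> \<open>Adding opposite points removes the square root from the variable: the sum
    depends on the ray through its square only, that is through \<open>turn s\<close>.\<close>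
  have S: "of_real (f (ray (r, s))) / (z - cpx (ray (r, s))) + of_real (f (- ray (r, s))) / (z - cpx (- ray (r, s)))
      = h s * (2 * z / (z\<^sup>2 - of_real (r\<^sup>2) * turn s))" for s
  proof -
    define w where "w = cpx (ray (r, s))"
    have w2: "z\<^sup>2 - of_real (r\<^sup>2) * turn s = (z - w) * (z + w)"
      unfolding cpx_ray_power2[symmetric] w_def by (simp add: power2_eq_square algebra_simps)
    have "z - w \<noteq> 0" "z + w \<noteq> 0" using ne[of s] unfolding w2 by auto
    then have "h s / (z - w) + h s / (z + w) = h s * (2 * z / ((z - w) * (z + w)))"
      by (simp add: field_simps)
    then show ?thesis unfolding w2 by (simp add: on_opposite_ray[OF r(1)] on_ray[OF r(1)] h_def cpx_minus w_def)
  qed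
  show "angular (\<lambda>s. of_real (f (ray (r, s))) / (z - cpx (ray (r, s))) + of_real (f (- ray (r, s))) / (z - cpx (- ray (r, s))))
    = (if r < \<rho> then of_real (2 * pi) * (k r / z + cnj (c r) * of_real (r\<^sup>2) / z ^ 3) else if \<rho> < r then - (of_real (2 * pi) * (z * c r / of_real (r\<^sup>2))) else 0)"
  proof (cases "r < \<rho>")
    case True
    define a where "a = of_real (r\<^sup>2) / z\<^sup>2"
    have a: "norm a < 1" using True r \<rho>0 by (simp add: a_def norm_divide norm_power nz power_strict_mono)
    define G where "G i j s = turn s ^ i * cnj (turn s) ^ j / (1 - a * turn s)" for i j s
    have Gm [measurable]: "G i j \<in> borel_measurable borel" for i j unfolding G_def by measurable
    have Gb: "norm (G i j s) \<le> 1 / (1 - norm a)" for i j s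
    proof -
      have "1 - norm a \<le> norm (1 - a * turn s)" using norm_triangle_ineq2[of 1 "a * turn s"] by (simp add: norm_mult)
      then show ?thesis using a by (simp add: G_def norm_divide norm_mult norm_power frac_le)
    qed
    have "angular (\<lambda>s. h s * (2 * z / (z\<^sup>2 - of_real (r\<^sup>2) * turn s))) =
        angular (\<lambda>s. (2 / z) * (k r * G 0 0 s + c r * G 1 0 s + cnj (c r) * G 0 1 s))"
    proof (rule arg_cong[where f = angular], rule ext)
      fix s
      define D where "D = z\<^sup>2 - of_real (r\<^sup>2) * turn s"
      have "1 - a * turn s = D / z\<^sup>2" using z0 by (simp add: a_def D_def diff_divide_distrib)
      define q where "q = z\<^sup>2 / D"
      have G: "G i j s = turn s ^ i * cnj (turn s) ^ j * q" for i j
        using \<open>1 - a * turn s = D / z\<^sup>2\<close> by (simp add: G_def q_def)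
      have "2 * z / D = (2 / z) * q" using z0 by (simp add: q_def power2_eq_square)
      then show "h s * (2 * z / (z\<^sup>2 - of_real (r\<^sup>2) * turn s)) = (2 / z) * (k r * G 0 0 s + c r * G 1 0 s + cnj (c r) * G 0 1 s)"
        unfolding G D_def[symmetric] h_def by (simp add: algebra_simps)
    qed
    also have "\<dots> = (2 / z) * (k r * angular (G 0 0) + c r * angular (G 1 0) + cnj (c r) * angular (G 0 1))"
      by (rule angular_linear[OF Gm Gm Gm Gb Gb Gb])
    also have "\<dots> = (2 / z) * (k r * pi + cnj (c r) * (pi * a))"
      unfolding G_def by (simp add: angular_kernel[OF a, of 0 0, simplified] angular_kernel[OF a, of 1 0, simplified] angular_kernel[OF a, of 0 1, simplified])
    also have "\<dots> = of_real (2 * pi) * (k r / z + cnj (c r) * of_real (r\<^sup>2) / z ^ 3)"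
      using z0 by (simp add: a_def field_simps eval_nat_numeral)
    finally show ?thesis unfolding S using True by simp
  next
    case False
    then have gt: "\<rho> < r" using r by simp
    define a where "a = z\<^sup>2 / of_real (r\<^sup>2)"
    have a: "norm a < 1" using gt r \<rho>0 by (simp add: a_def norm_divide norm_power nz power_strict_mono)
    define G where "G i j s = turn s ^ i * cnj (turn s) ^ j / (1 - a * cnj (turn s))" for i j s
    have Gm [measurable]: "G i j \<in> borel_measurable borel" for i j unfolding G_def by measurable
    have Gb: "norm (G i j s) \<le> 1 / (1 - norm a)" for i j s
    proof -
      have "1 - norm a \<le> norm (1 - a * cnj (turn s))" using norm_triangle_ineq2[of 1 "a * cnj (turn s)"] by (simp add: norm_mult)
      then show ?thesis using a by (simp add: G_def norm_divide norm_mult norm_power frac_le)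
    qed
    have "angular (\<lambda>s. h s * (2 * z / (z\<^sup>2 - of_real (r\<^sup>2) * turn s))) =
        angular (\<lambda>s. (- 2 * z / r\<^sup>2) * (k r * G 0 1 s + c r * G 1 1 s + cnj (c r) * G 0 2 s))"
    proof (rule arg_cong[where f = angular], rule ext)
      fix s
      have t1: "turn s \<noteq> 0" using cnj_turn(1)[of s] by auto
      have t2: "cnj (turn s) = 1 / turn s" using cnj_turn(2)[of s] t1 by (simp add: eq_divide_eq)
      note t = t1 t2
      define D where "D = z\<^sup>2 - of_real (r\<^sup>2) * turn s"
      define q where "q = - of_real (r\<^sup>2) / D"
      have "1 - a * cnj (turn s) = - (D / (of_real (r\<^sup>2) * turn s))"
        using r t(1) unfolding t(2) a_def D_def by (simp add: field_simps)
      then have "cnj (turn s) / (1 - a * cnj (turn s)) = q" using t(1) unfolding t(2) q_def by simp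
      then have G: "G i (Suc j) s = turn s ^ i * cnj (turn s) ^ j * q" for i j
        unfolding G_def by (simp flip: \<open>_ = q\<close>)
      have "2 * z / D = (- 2 * z / r\<^sup>2) * q" using r by (simp add: q_def)
      then show "h s * (2 * z / (z\<^sup>2 - of_real (r\<^sup>2) * turn s)) = (- 2 * z / r\<^sup>2) * (k r * G 0 1 s + c r * G 1 1 s + cnj (c r) * G 0 2 s)"
        unfolding D_def[symmetric] h_def using G[of 0 0] G[of 1 0] G[of 0 1] by (simp add: numeral_2_eq_2 algebra_simps add_divide_distrib)
    qed
    also have "\<dots> = (- 2 * z / r\<^sup>2) * (k r * angular (G 0 1) + c r * angular (G 1 1) + cnj (c r) * angular (G 0 2))"
      by (rule angular_linear[OF Gm Gm Gm Gb Gb Gb])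
    also have "\<dots> = (- 2 * z / r\<^sup>2) * (c r * pi)"
      unfolding G_def by (simp only: angular_kernel_cnj[OF a]) simp
    finally show ?thesis unfolding S using gt by simp
  qed
qed

text \<open>The power of \<open>cpx\<close> contributes turn^j, which by orthogonality meets only k
  for j = 0 and only the conjugate amplitude for j = 1.\<close>

lemma even_moment:
  assumes "rapid (\<lambda>\<eta>. norm \<eta> ^ (2 * j) * f \<eta>)"
  shows "(LINT \<eta>|lborel. cpx \<eta> ^ (2 * j) * of_real (f \<eta>)) =
    (LINT r|lborel. indicator {0<..} r *\<^sub>R (of_real r * (of_real (2 * pi * r ^ (2 * j)) * (if j = 0 then k r else if j = 1 then cnj (c r) else 0))))"
proof (rule polar_angular[where \<rho> = 0])
  show "integrable lborel (\<lambda>\<eta>. cpx \<eta> ^ (2 * j) * of_real (f \<eta>))"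
    by (rule Bochner_Integration.integrable_bound[OF rapid_integrable[OF assms]])
      (measurable, rule AE_I2, simp add: norm_mult norm_power abs_mult)
  fix r :: real assume r: "r > 0"
  have "angular (\<lambda>s. cpx (ray (r, s)) ^ (2 * j) * of_real (f (ray (r, s))) + cpx (- ray (r, s)) ^ (2 * j) * of_real (f (- ray (r, s))))
    = angular (\<lambda>s. (2 * of_real (r\<^sup>2) ^ j) * (k r * (turn s ^ j * cnj (turn s) ^ 0) + c r * (turn s ^ (Suc j) * cnj (turn s) ^ 0) + cnj (c r) * (turn s ^ j * cnj (turn s) ^ 1)))"
  proof (rule arg_cong[where f = angular], rule ext)
    fix s
    have "cpx (ray (r, s)) ^ (2 * j) = of_real (r\<^sup>2) ^ j * turn s ^ j" "cpx (- ray (r, s)) ^ (2 * j) = of_real (r\<^sup>2) ^ j * turn s ^ j"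
      unfolding power_mult by (simp_all only: cpx_minus power2_minus cpx_ray_power2 power_mult_distrib)
    then show "cpx (ray (r, s)) ^ (2 * j) * of_real (f (ray (r, s))) + cpx (- ray (r, s)) ^ (2 * j) * of_real (f (- ray (r, s))) =
      (2 * of_real (r\<^sup>2) ^ j) * (k r * (turn s ^ j * cnj (turn s) ^ 0) + c r * (turn s ^ (Suc j) * cnj (turn s) ^ 0) + cnj (c r) * (turn s ^ j * cnj (turn s) ^ 1))"
      unfolding on_opposite_ray[OF r] on_ray[OF r] by (simp add: algebra_simps)
  qed
  also have "\<dots> = (2 * of_real (r\<^sup>2) ^ j) * (k r * angular (\<lambda>s. turn s ^ j * cnj (turn s) ^ 0) + c r * angular (\<lambda>s. turn s ^ (Suc j) * cnj (turn s) ^ 0) + cnj (c r) * angular (\<lambda>s. turn s ^ j * cnj (turn s) ^ 1))"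
    by (rule angular_linear[where B = 1]) (measurable, simp_all add: norm_mult norm_power)
  also have "\<dots> = of_real (2 * pi * r ^ (2 * j)) * (if j = 0 then k r else if j = 1 then cnj (c r) else 0)"
    unfolding angular_orthogonal by (simp add: power_mult)
  finally show "angular (\<lambda>s. cpx (ray (r, s)) ^ (2 * j) * of_real (f (ray (r, s))) + cpx (- ray (r, s)) ^ (2 * j) * of_real (f (- ray (r, s))))
    = of_real (2 * pi * r ^ (2 * j)) * (if j = 0 then k r else if j = 1 then cnj (c r) else 0)" .
qed measurable

lemma odd_moment:
  assumes "odd n" and "rapid (\<lambda>\<eta>. norm \<eta> ^ n * f \<eta>)"
  shows "(LINT \<eta>|lborel. cpx \<eta> ^ n * of_real (f \<eta>)) = 0"
proof -
  have "(LINT \<eta>|lborel. cpx \<eta> ^ n * of_real (f \<eta>)) = (LINT r|lborel. indicator {0<..} r *\<^sub>R (of_real r * 0))"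
  proof (rule polar_angular[where \<rho> = 0])
    show "integrable lborel (\<lambda>\<eta>. cpx \<eta> ^ n * of_real (f \<eta>))"
      by (rule Bochner_Integration.integrable_bound[OF rapid_integrable[OF assms(2)]])
        (measurable, rule AE_I2, simp add: norm_mult norm_power abs_mult)
  qed (simp_all add: cpx_minus on_opposite_ray assms(1) angular_def)
  then show ?thesis by simp
qed

end

lemma Z_differentiable:
  assumes "f \<in> Z_space"
  shows "f differentiable (at \<xi>)"
proof -
  define p where "p \<xi> = weight \<xi> * f \<xi>" for \<xi>
  have "p \<in> S_star" using assms by (simp add: Z_space_def p_def[abs_def])
  then have "pd 0 0 p differentiable_on UNIV" unfolding S_star_def smooth_plane_def by blast
  then have p: "p differentiable (at \<xi>)" unfolding pd_def by (simp add: differentiable_on_def) (metis surj_pair)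
  have e: "ew = (\<lambda>\<xi>. exp ((\<xi> \<bullet> \<xi>) * (- 1 / 4)))"
    by (simp add: fun_eq_iff ew_def power2_norm_eq_inner)
  have "ew differentiable (at \<xi>)" unfolding e differentiable_def
    by (rule exI) (rule derivative_intros)+
  then have "(\<lambda>\<xi>. ew \<xi> * p \<xi>) differentiable (at \<xi>)" using p by (rule differentiable_mult)
  then show ?thesis by (simp add: p_def flip: Z_space_ew)
qed

lemma Z_continuous: "f \<in> Z_space \<Longrightarrow> continuous_on UNIV f"
  by (intro differentiable_imp_continuous_on) (simp add: differentiable_on_def Z_differentiable)

text \<open>Differentiation along a circle needs the total derivative; this identifies it with the
  slice derivatives \<open>pd1\<close> and \<open>pd2\<close>.\<close>

lemma gradient:
  assumes "f differentiable (at \<xi>)"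
  shows "(f has_derivative (\<lambda>h. fst h * pd1 f \<xi> + snd h * pd2 f \<xi>)) (at \<xi>)"
proof -
  obtain f' where f': "(f has_derivative f') (at \<xi>)" using assms by (auto simp: differentiable_def)
  obtain x y where \<xi>: "\<xi> = (x, y)" by (cases \<xi>)
  interpret f': bounded_linear f' using f' by (rule has_derivative_bounded_linear)
  have "((\<lambda>s. (s, y)) has_derivative (\<lambda>h. (h, 0))) (at x)" "((\<lambda>s. (x, s)) has_derivative (\<lambda>h. (0, h))) (at y)"
    by (auto intro!: derivative_eq_intros)
  from this[THEN has_derivative_compose, of f f'] f'
  have d: "((\<lambda>s. f (s, y)) has_derivative (\<lambda>h. f' (h, 0))) (at x)" "((\<lambda>s. f (x, s)) has_derivative (\<lambda>h. f' (0, h))) (at y)"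
    by (simp_all add: \<xi>)
  have e: "(\<lambda>h. f' (h, 0)) = (*) (f' (1, 0))" "(\<lambda>h. f' (0, h)) = (*) (f' (0, 1))"
  proof (rule_tac [!] ext)
    fix h :: real
    have "f' (h *\<^sub>R (1, 0)) = h *\<^sub>R f' (1, 0)" "f' (h *\<^sub>R (0, 1)) = h *\<^sub>R f' (0, 1)" by (rule f'.scaleR)+
    then show "f' (h, 0) = f' (1, 0) * h" "f' (0, h) = f' (0, 1) * h" by (simp_all add: mult.commute)
  qed
  have p: "pd1 f \<xi> = f' (1, 0)" "pd2 f \<xi> = f' (0, 1)"
    using d unfolding e has_field_derivative_def[symmetric] by (simp_all add: pd1_def pd2_def \<xi> DERIV_imp_deriv)
  have "f' = (\<lambda>h. fst h * pd1 f \<xi> + snd h * pd2 f \<xi>)"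
  proof (rule ext)
    fix h
    have "f' h = f' ((fst h, 0) + (0, snd h))" by simp
    also have "\<dots> = f' (fst h, 0) + f' (0, snd h)" by (rule f'.add)
    also have "\<dots> = f' (1, 0) * fst h + f' (0, 1) * snd h" 
      by (rule arg_cong2[where f = "(+)", OF fun_cong[OF e(1)] fun_cong[OF e(2)]])
    finally show "f' h = fst h * pd1 f \<xi> + snd h * pd2 f \<xi>" unfolding p by (simp add: mult.commute)
  qed
  then show ?thesis using f' by simp
qed

lemma angular_derivative:
  assumes "f differentiable (at (r * cos t, r * sin t))"
  shows "((\<lambda>t. f (r * cos t, r * sin t)) has_real_derivative
      r * cos t * pd2 f (r * cos t, r * sin t) - r * sin t * pd1 f (r * cos t, r * sin t)) (at t)"
proof -
  have "((\<lambda>t. (r * cos t, r * sin t)) has_derivative (\<lambda>h. (- (r * sin t) * h, r * cos t * h))) (at t)"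
    by (auto intro!: derivative_eq_intros)
  from has_derivative_compose[OF this gradient[OF assms]]
  show ?thesis unfolding has_field_derivative_def
    by (rule has_derivative_eq_rhs) (simp add: fun_eq_iff algebra_simps)
qed

definition rot :: "(plane \<Rightarrow> real) \<Rightarrow> plane \<Rightarrow> real" where
  "rot \<phi> \<xi> = fst \<xi> * pd2 \<phi> \<xi> - snd \<xi> * pd1 \<phi> \<xi>"

text \<open>The Cauchy transform is 2 pi (\<partial>1 \<psi> - i \<partial>2 \<psi>) for the
  potential \<psi>. Multiplied by \<xi>1 + i \<xi>2, it has minus the angular derivative of \<psi>,
  times 2 pi, as imaginary part.\<close>

lemma rot_inv_laplace:
  assumes f: "nice1 f"
  shows "2 * pi * rot (inv_laplace f) \<xi> = - Im (cpx \<xi> * (LINT \<eta>|lborel. of_real (f \<eta>) / (cpx \<xi> - cpx \<eta>)))"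
proof -
  have "rapid f" using f by (simp add: nice1_def)
  then show ?thesis
    by (simp add: rot_def cauchy_transform(2) pd_inv_laplace[OF f] inv_laplace_pd1_kernel[OF f] inv_laplace_pd2_kernel[OF f]
        right_diff_distrib)
qed

text \<open>Angular velocity of the Gaussian vortex: the gradient of its potential is v0 times the
  position vector (\<open>gaussian_velocity\<close>).\<close>

definition v0 :: "real \<Rightarrow> real" where "v0 r = (1 - exp (- r\<^sup>2 / 4)) / (2 * pi * r\<^sup>2)"

definition g0 :: "real \<Rightarrow> real" where "g0 r = exp (- r\<^sup>2 / 4) / (4 * pi)"

lemma gaussian_modes: "even_modes gaussian (\<lambda>r. of_real (g0 r)) (\<lambda>r. 0)"
proof
  show "rapid gaussian" by (rule nice2D(5)[OF nice2_gaussian])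
qed (simp_all add: g0_def gaussian_def norm_ray)

lemma integral_g0:
  assumes "\<rho> > 0"
  shows "(LINT r|lborel. indicator {0<..<\<rho>} r * (r * g0 r)) = (1 - exp (- \<rho>\<^sup>2 / 4)) / (2 * pi)"
    and "integrable lborel (\<lambda>r. indicator {0<..<\<rho>} r * (r * g0 r))"
proof -
  have c: "continuous_on {0..\<rho>} (\<lambda>r. r * g0 r)" unfolding g0_def by (intro continuous_intros) auto
  have i: "set_integrable lborel {0..\<rho>} (\<lambda>r. r * g0 r)" by (rule borel_integrable_atLeastAtMost'[OF c])
  have ae: "AE t in lborel. indicator {0..\<rho>} t *\<^sub>R (t * g0 t) = indicator {0<..<\<rho>} t * (t * g0 t)"
    using AE_lborel_singleton[of 0] AE_lborel_singleton[of \<rho>] by eventually_elim (auto simp: indicator_def)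
  have m [measurable]: "g0 \<in> borel_measurable borel" unfolding g0_def by measurable
  have "((\<lambda>r. r * g0 r) has_integral (- exp (- \<rho>\<^sup>2 / 4) / (2 * pi)) - (- exp (- 0\<^sup>2 / 4) / (2 * pi))) {0..\<rho>}"
    using assms unfolding g0_def
    by (intro fundamental_theorem_of_calculus)
      (auto intro!: derivative_eq_intros simp: field_simps simp flip: has_real_derivative_iff_has_vector_derivative)
  then have "integral {0..\<rho>} (\<lambda>r. r * g0 r) = (1 - exp (- \<rho>\<^sup>2 / 4)) / (2 * pi)"
    by (simp add: integral_unique diff_divide_distrib)
  moreover have "(LINT r|lborel. indicator {0<..<\<rho>} r * (r * g0 r)) = (LINT r|lborel. indicator {0..\<rho>} r *\<^sub>R (r * g0 r))"
    by (rule integral_cong_AE[symmetric, OF _ _ ae]) measurable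
  ultimately show "(LINT r|lborel. indicator {0<..<\<rho>} r * (r * g0 r)) = (1 - exp (- \<rho>\<^sup>2 / 4)) / (2 * pi)"
    using set_borel_integral_eq_integral(2)[OF i] by (simp add: set_lebesgue_integral_def)
  show "integrable lborel (\<lambda>r. indicator {0<..<\<rho>} r * (r * g0 r))"
    using i unfolding set_integrable_def by (rule integrable_cong_AE_imp[OF _ _ ae]) measurable
qed

text \<open>For a radial density only the mass inside the circle acts, as if concentrated at the
  centre; here it is 1 - exp (- \<rho>^2 / 4).\<close>

lemma gaussian_velocity:
  assumes \<xi>: "\<xi> \<noteq> 0"
  shows "pd1 (inv_laplace gaussian) \<xi> = v0 (norm \<xi>) * fst \<xi>" "pd2 (inv_laplace gaussian) \<xi> = v0 (norm \<xi>) * snd \<xi>"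
proof -
  interpret even_modes gaussian "\<lambda>r. of_real (g0 r)" "\<lambda>r. 0" by (rule gaussian_modes)
  define \<rho> where "\<rho> = norm \<xi>"
  have \<rho>: "\<rho> > 0" using \<xi> by (simp add: \<rho>_def)
  have N: "nice1 gaussian" by (rule nice2D(1)[OF nice2_gaussian])
  have "(LINT \<eta>|lborel. of_real (gaussian \<eta>) / (cpx \<xi> - cpx \<eta>)) = (LINT r|lborel. (2 * pi / cpx \<xi>) * of_real (indicator {0<..<\<rho>} r * (r * g0 r)))"
    unfolding cauchy_polar[OF \<xi>] \<rho>_def[symmetric]
    by (intro Bochner_Integration.integral_cong refl) (simp add: indicator_def scaleR_conv_of_real)
  also have "\<dots> = (2 * pi / cpx \<xi>) * of_real ((1 - exp (- \<rho>\<^sup>2 / 4)) / (2 * pi))"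
    using integral_g0(1)[OF \<rho>] by (simp only: integral_mult_right_zero integral_complex_of_real)
  also have "\<dots> = of_real (1 - exp (- \<rho>\<^sup>2 / 4)) * (1 / cpx \<xi>)" by simp
  finally have e: "Complex (LINT \<eta>|lborel. K1 (\<xi> - \<eta>) * gaussian \<eta>) (- (LINT \<eta>|lborel. K2 (\<xi> - \<eta>) * gaussian \<eta>)) =
      of_real (1 - exp (- \<rho>\<^sup>2 / 4)) * Complex (K1 \<xi>) (- K2 \<xi>)"
    unfolding cauchy_transform(2)[OF f] inverse_cpx .
  then have "(LINT \<eta>|lborel. K1 (\<xi> - \<eta>) * gaussian \<eta>) = (1 - exp (- \<rho>\<^sup>2 / 4)) * K1 \<xi>"
    "(LINT \<eta>|lborel. K2 (\<xi> - \<eta>) * gaussian \<eta>) = (1 - exp (- \<rho>\<^sup>2 / 4)) * K2 \<xi>"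
    by (simp_all add: complex_eq_iff)
  then show "pd1 (inv_laplace gaussian) \<xi> = v0 (norm \<xi>) * fst \<xi>" "pd2 (inv_laplace gaussian) \<xi> = v0 (norm \<xi>) * snd \<xi>"
    by (simp_all add: pd_inv_laplace[OF N] inv_laplace_pd1_kernel[OF N] inv_laplace_pd2_kernel[OF N] v0_def K1_def K2_def \<rho>_def)
qed

lemma gaussian_g0: "gaussian \<xi> = g0 (norm \<xi>)"
  by (simp add: gaussian_def g0_def)

text \<open>The gradients of G and of its potential are radial, so both brackets reduce to angular
  derivatives. The factor 1/2 comes from \<nabla>G = - \<xi> G / 2.\<close>

lemma Lambda_rot:
  assumes f: "nice1 f" and \<xi>: "\<xi> \<noteq> 0"
  shows "Lambda f \<xi> = v0 (norm \<xi>) * rot f \<xi> + g0 (norm \<xi>) / 2 * rot (inv_laplace f) \<xi>"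
  by (simp add: Lambda_def bracket_def rot_def gaussian_velocity[OF \<xi>] pd1_gaussian[THEN fun_cong]
      pd2_gaussian[THEN fun_cong] gaussian_g0 algebra_simps)

text \<open>Each is the value of f on a ray where the other trigonometric factor vanishes. In this
  way the merely existing coefficients in \<open>Y_mode\<close> become explicit functions that
  inherit continuity and decay from f.\<close>

definition cos_part :: "(plane \<Rightarrow> real) \<Rightarrow> real \<Rightarrow> real" where "cos_part f r = f (r, 0)"
definition sin_part :: "(plane \<Rightarrow> real) \<Rightarrow> real \<Rightarrow> real" where "sin_part f r = f (r * cos (pi / 4), r * sin (pi / 4))"

lemma Y_mode2_polar:
  assumes "f \<in> Y_mode 2" "r > 0"
  shows "f (r * cos t, r * sin t) = cos_part f r * cos (2 * t) + sin_part f r * sin (2 * t)"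
proof -
  obtain a b where ab: "\<And>r t. r > 0 \<Longrightarrow> f (r * cos t, r * sin t) = a r * cos (2 * t) + b r * sin (2 * t)"
    using assms(1) unfolding Y_mode_def by auto
  have "a r = cos_part f r" using ab[OF assms(2), of 0] by (simp add: cos_part_def)
  moreover have "b r = sin_part f r" using ab[OF assms(2), of "pi / 4"] by (simp add: sin_part_def)
  ultimately show ?thesis using ab[OF assms(2)] by simp
qed

locale mode2 =
  fixes f :: "plane \<Rightarrow> real"
  assumes mode: "f \<in> Y_mode 2" and Z: "f \<in> Z_space"
begin

lemma nice: "nice2 f" by (rule Z_imp_nice2[OF Z])

text \<open>For A cos 2\<theta> + B sin 2\<theta> the amplitude of e^(2 i \<theta>) is (A - i B) /
  2.\<close>

definition amp :: "real \<Rightarrow> complex" where "amp r = Complex (cos_part f r) (- sin_part f r) / 2"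

lemma parts_continuous: "continuous_on UNIV (cos_part f)" "continuous_on UNIV (sin_part f)"
  unfolding cos_part_def[abs_def] sin_part_def[abs_def]
  by (intro continuous_on_compose2[OF Z_continuous[OF Z]] continuous_intros; simp)+

lemma parts_radial:
  obtains C where "radial (cos_part f) C" "radial (sin_part f) C"
proof -
  obtain C where C: "C > 0" "\<And>\<xi>. \<bar>f \<xi>\<bar> \<le> C / (1 + norm \<xi>) ^ 6" using rapidD[OF nice2D(5)[OF nice], of 6] by metis
  have n: "norm (r * cos (pi / 4), r * sin (pi / 4)) = r" "norm (r, 0 :: real) = r" if "r > 0" for r
    using that by (simp_all add: norm_Pair power_mult_distrib flip: distrib_left)
  have "\<bar>cos_part f r\<bar> \<le> C / (1 + r) ^ 6" "\<bar>sin_part f r\<bar> \<le> C / (1 + r) ^ 6" if "r > 0" for r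
    using C(2)[of "(r, 0)"] C(2)[of "(r * cos (pi / 4), r * sin (pi / 4))"]
    unfolding n[OF that] cos_part_def sin_part_def by simp_all
  then show ?thesis using parts_continuous by (intro that[of C]) (unfold_locales, auto)
qed

sublocale even_modes f "\<lambda>r. 0" amp
proof
  show "rapid f" by (rule nice2D(5)[OF nice])
  have [measurable]: "cos_part f \<in> borel_measurable borel" "sin_part f \<in> borel_measurable borel"
    using parts_continuous by (auto intro: borel_measurable_continuous_onI)
  have "amp = (\<lambda>r. (of_real (cos_part f r) - \<i> * of_real (sin_part f r)) / 2)" by (simp add: fun_eq_iff amp_def complex_eq_iff)
  then show "amp \<in> borel_measurable borel" by simp
  fix r s :: real assume r: "r > 0"
  show "of_real (f (ray (r, s))) = 0 + amp r * turn s + cnj (amp r) * cnj (turn s)"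
    unfolding ray_polar Y_mode2_polar[OF mode r] by (simp add: complex_eq_iff amp_def turn_Re_Im field_simps)
  have "- ray (r, s) = (r * cos (arctan s + pi), r * sin (arctan s + pi))" by (simp add: ray_polar)
  then show "f (- ray (r, s)) = f (ray (r, s))"
    unfolding ray_polar using Y_mode2_polar[OF mode r, of "arctan s"] Y_mode2_polar[OF mode r, of "arctan s + pi"]
    by (simp add: distrib_left cos_add sin_add)
qed simp

abbreviation "PA \<equiv> radial.P (cos_part f)"
abbreviation "PB \<equiv> radial.P (sin_part f)"
abbreviation "QA \<equiv> radial.Q (cos_part f)"
abbreviation "QB \<equiv> radial.Q (sin_part f)"

lemma cauchy_mode2:
  assumes \<xi>: "\<xi> \<noteq> 0"
  shows "(LINT \<eta>|lborel. of_real (f \<eta>) / (cpx \<xi> - cpx \<eta>)) =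
    pi * (Complex (PA (norm \<xi>)) (PB (norm \<xi>)) / cpx \<xi> ^ 3 - cpx \<xi> * Complex (QA (norm \<xi>)) (- QB (norm \<xi>)))"
proof -
  obtain C where "radial (cos_part f) C" "radial (sin_part f) C" by (rule parts_radial)
  then interpret a: radial "cos_part f" 0 C + b: radial "sin_part f" 0 C by auto
  define \<rho> where "\<rho> = norm \<xi>"
  define z where "z = cpx \<xi>"
  have \<rho>: "\<rho> > 0" using \<xi> by (simp add: \<rho>_def)
  have z0: "z \<noteq> 0" using \<rho> unfolding z_def \<rho>_def by (metis cpx_simps(3) norm_zero less_irrefl)
  let ?I = "\<lambda>r::real. indicator {0<..<\<rho>} r :: real" and ?J = "\<lambda>r::real. indicator {\<rho><..} r :: real"
  have "(LINT \<eta>|lborel. of_real (f \<eta>) / (z - cpx \<eta>)) = (LINT r|lborel.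
     (pi / z ^ 3) * of_real (?I r * (r ^ 3 * cos_part f r)) + (\<i> * pi / z ^ 3) * of_real (?I r * (r ^ 3 * sin_part f r))
     + (- (pi * z)) * of_real (?J r * (cos_part f r / r)) + (\<i> * pi * z) * of_real (?J r * (sin_part f r / r)))"
    unfolding cauchy_polar[OF \<xi>, folded \<rho>_def z_def]
  proof (intro Bochner_Integration.integral_cong refl)
    fix r :: real
    have am: "amp r = (of_real (cos_part f r) - \<i> * of_real (sin_part f r)) / 2"
      "cnj (amp r) = (of_real (cos_part f r) + \<i> * of_real (sin_part f r)) / 2"
      by (simp_all add: amp_def complex_eq_iff)
    consider "r \<le> 0" | "0 < r" "r < \<rho>" | "r = \<rho>" | "\<rho> < r" by linarith
    then show "indicator {0<..} r *\<^sub>R (of_real r * (if r < \<rho> then of_real (2 * pi) * (0 / z + cnj (amp r) * of_real (r\<^sup>2) / z ^ 3)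
        else if \<rho> < r then - (of_real (2 * pi) * (z * amp r / of_real (r\<^sup>2))) else 0)) =
      (pi / z ^ 3) * of_real (?I r * (r ^ 3 * cos_part f r)) + (\<i> * pi / z ^ 3) * of_real (?I r * (r ^ 3 * sin_part f r))
      + (- (pi * z)) * of_real (?J r * (cos_part f r / r)) + (\<i> * pi * z) * of_real (?J r * (sin_part f r / r))"
    proof cases
      case 2
      then show ?thesis unfolding am using z0 by (simp add: field_simps eval_nat_numeral)
    next
      case 4
      then have "r > 0" using \<rho> by simp
      then show ?thesis unfolding am using 4 by (simp add: field_simps eval_nat_numeral)
    qed (use \<rho> in simp_all)
  qed
  also have "\<dots> = (pi / z ^ 3) * of_real (PA \<rho>) + (\<i> * pi / z ^ 3) * of_real (PB \<rho>)
      + (- (pi * z)) * of_real (QA \<rho>) + (\<i> * pi * z) * of_real (QB \<rho>)"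
  proof -
    have m: "integrable lborel (\<lambda>r. c * complex_of_real (g r))" "(LINT r|lborel. c * complex_of_real (g r)) = c * of_real (LINT r|lborel. g r)"
      if "integrable lborel g" for c and g :: "real \<Rightarrow> real"
      using that by (simp_all only: integrable_mult_right integrable_of_real integral_mult_right_zero integral_complex_of_real)
    note i = a.P_integrable[of \<rho>] b.P_integrable[of \<rho>] a.tail_integrable(1)[OF \<rho>] b.tail_integrable(1)[OF \<rho>]
    show ?thesis
      unfolding a.P_def b.P_def a.Q_def b.Q_def
      by (simp only: Bochner_Integration.integral_add Bochner_Integration.integrable_add m[OF i(1)] m[OF i(2)] m[OF i(3)] m[OF i(4)])
  qed
  also have "\<dots> = pi * (Complex (PA \<rho>) (PB \<rho>) / z ^ 3 - z * Complex (QA \<rho>) (- QB \<rho>))"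
    unfolding Complex_eq by (simp add: add_divide_distrib algebra_simps)
  finally show ?thesis unfolding \<rho>_def z_def .
qed

text \<open>Lambda acts through angular derivatives and thus exchanges sine and cosine parts. On the
  ray of angle 0 only the sine part remains, on that of angle pi/4 only the cosine part, which
  decouples the two radial equations.\<close>

lemma Lambda_at_angle:
  assumes r: "r > 0"
  shows "Lambda f (r, 0) = 2 * v0 r * sin_part f r - g0 r / 4 * (PB r / r\<^sup>2 + r\<^sup>2 * QB r)"
    and "Lambda f (r * cos (pi / 4), r * sin (pi / 4)) = - 2 * v0 r * cos_part f r + g0 r / 4 * (PA r / r\<^sup>2 + r\<^sup>2 * QA r)"
proof -
  have N: "nice1 f" by (rule nice2D(1)[OF nice])
  have n: "norm (r * cos t, r * sin t) = r" for t
    using r by (simp add: norm_Pair power_mult_distrib flip: distrib_left)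
  have nz: "(r * cos t, r * sin t) \<noteq> 0" for t using n[of t] r by (metis norm_zero less_irrefl)
  have rf: "rot f (r * cos t, r * sin t) = - 2 * cos_part f r * sin (2 * t) + 2 * sin_part f r * cos (2 * t)" for t
  proof -
    have "((\<lambda>t. cos_part f r * cos (2 * t) + sin_part f r * sin (2 * t)) has_real_derivative
       - 2 * cos_part f r * sin (2 * t) + 2 * sin_part f r * cos (2 * t)) (at t)"
      by (auto intro!: derivative_eq_intros)
    moreover have "((\<lambda>t. cos_part f r * cos (2 * t) + sin_part f r * sin (2 * t)) has_real_derivative rot f (r * cos t, r * sin t)) (at t)"
      using angular_derivative[OF Z_differentiable[OF Z], of r t] unfolding Y_mode2_polar[OF mode r] rot_def by simp
    ultimately show ?thesis by (rule DERIV_unique[rotated])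
  qed
  define W where "W z = Complex (PA r) (PB r) / z - z * Complex (QA r) (- QB r)" for z
  have rp: "2 * rot (inv_laplace f) (r * cos t, r * sin t) = - Im (W ((cpx (r * cos t, r * sin t))\<^sup>2))" for t
  proof -
    define z where "z = cpx (r * cos t, r * sin t)"
    have z0: "z \<noteq> 0" using n[of t] r unfolding z_def by (metis cpx_simps(3) norm_zero less_irrefl)
    have "z * (Complex (PA r) (PB r) / z ^ 3 - z * Complex (QA r) (- QB r)) = W (z\<^sup>2)"
      using z0 by (simp add: W_def field_simps eval_nat_numeral)
    then have e: "z * (pi * (Complex (PA r) (PB r) / z ^ 3 - z * Complex (QA r) (- QB r))) = of_real pi * W (z\<^sup>2)"
      by (simp add: mult.left_commute)
    have "2 * pi * rot (inv_laplace f) (r * cos t, r * sin t) = - Im (of_real pi * W (z\<^sup>2))"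
      using rot_inv_laplace[OF N, of "(r * cos t, r * sin t)", unfolded cauchy_mode2[OF nz[of t]] n, folded z_def]
      unfolding e .
    then have "pi * (2 * rot (inv_laplace f) (r * cos t, r * sin t)) = pi * (- Im (W (z\<^sup>2)))" by simp
    then show ?thesis unfolding z_def using mult_left_cancel[OF pi_neq_zero] by blast
  qed
  have L: "Lambda f (r * cos t, r * sin t) = v0 r * rot f (r * cos t, r * sin t) + g0 r / 2 * rot (inv_laplace f) (r * cos t, r * sin t)" for t
    using Lambda_rot[OF N nz, of t] unfolding n .
  have "(cpx (r * cos 0, r * sin 0))\<^sup>2 = of_real (r\<^sup>2)" by (simp add: complex_eq_iff power2_eq_square)
  then have "Im (W ((cpx (r * cos 0, r * sin 0))\<^sup>2)) = PB r / r\<^sup>2 + r\<^sup>2 * QB r" by (simp add: W_def del: of_real_power)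
  then have "rot (inv_laplace f) (r * cos 0, r * sin 0) = - (PB r / r\<^sup>2 + r\<^sup>2 * QB r) / 2" using rp[of 0] by simp
  from L[of 0, unfolded rf this]
  show "Lambda f (r, 0) = 2 * v0 r * sin_part f r - g0 r / 4 * (PB r / r\<^sup>2 + r\<^sup>2 * QB r)"
    by (simp add: right_diff_distrib distrib_left)
  have "(cpx (r * cos (pi / 4), r * sin (pi / 4)))\<^sup>2 = \<i> * of_real (r\<^sup>2)"
    by (simp add: complex_eq_iff power2_eq_square cos_45 sin_45)
  then have "Im (W ((cpx (r * cos (pi / 4), r * sin (pi / 4)))\<^sup>2)) = - (PA r / r\<^sup>2 + r\<^sup>2 * QA r)"
    using r by (simp add: W_def Im_divide power2_eq_square del: of_real_power)
  then show "Lambda f (r * cos (pi / 4), r * sin (pi / 4)) = - 2 * v0 r * cos_part f r + g0 r / 4 * (PA r / r\<^sup>2 + r\<^sup>2 * QA r)"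
  proof -
    assume "Im (W ((cpx (r * cos (pi / 4), r * sin (pi / 4)))\<^sup>2)) = - (PA r / r\<^sup>2 + r\<^sup>2 * QA r)"
    then have "rot (inv_laplace f) (r * cos (pi / 4), r * sin (pi / 4)) = (PA r / r\<^sup>2 + r\<^sup>2 * QA r) / 2" using rp[of "pi / 4"] by simp
    from L[of "pi / 4", unfolded rf this] show ?thesis by simp
  qed
qed

end

section \<open>The profiles of order two\<close>

lemma v0_pos: "r > 0 \<Longrightarrow> v0 r > 0"
  by (simp add: v0_def)

lemma g0_v0: assumes "r > 0" shows "g0 r = (r\<^sup>2 / 2) / (exp (r\<^sup>2 / 4) - 1) * v0 r"
proof -
  define e where "e = exp (r\<^sup>2 / 4)"
  have e: "e > 1" using assms by (simp add: e_def)
  have m: "exp (- r\<^sup>2 / 4) = 1 / e" using exp_minus[of "r\<^sup>2 / 4"] by (simp add: e_def inverse_eq_divide)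
  have 1: "1 - 1 / e = (e - 1) / e" using e by (simp add: diff_divide_distrib)
  have "(r\<^sup>2 / 2) / D * (D / e / (2 * pi * r\<^sup>2)) = 1 / e / (4 * pi)" if "D \<noteq> 0" for D :: real
    using that assms e by (simp add: divide_simps)
  from this[of "e - 1"] show ?thesis unfolding g0_def v0_def m e_def[symmetric] 1 using e by simp
qed

lemma mode_cancel:
  fixes v w g H X :: real
  assumes "2 * v * w = g / 4 * (4 * X)" "g = H * v" "v > 0"
  shows "w = H * X / 2"
proof -
  have "v * (2 * w) = v * (H * X)" using assms(1,2) by algebra
  then show ?thesis using assms(3) by simp
qed

lemma plane_polar:
  assumes "\<xi> \<noteq> (0 :: plane)"
  obtains r t where "r > 0" "\<xi> = (r * cos t, r * sin t)"
proof -
  have "cpx \<xi> = rcis (norm \<xi>) (Arg (cpx \<xi>))" using rcis_cmod_Arg[of "cpx \<xi>"] by simp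
  then have "fst \<xi> = norm \<xi> * cos (Arg (cpx \<xi>))" "snd \<xi> = norm \<xi> * sin (Arg (cpx \<xi>))"
    by (metis cpx_simps(1) Re_rcis, metis cpx_simps(2) Im_rcis)
  then have "\<xi> = (norm \<xi> * cos (Arg (cpx \<xi>)), norm \<xi> * sin (Arg (cpx \<xi>)))" by (metis prod.collapse)
  then show ?thesis using assms by (intro that[of "norm \<xi>"]) simp_all
qed

lemma pd_uminus:
  assumes "slice_diff f"
  shows "pd1 (\<lambda>\<xi>. - f \<xi>) = (\<lambda>\<xi>. - pd1 f \<xi>)" "pd2 (\<lambda>\<xi>. - f \<xi>) = (\<lambda>\<xi>. - pd2 f \<xi>)"
  by (intro pd1_eqI DERIV_minus slice_diff_pd1[OF assms], intro pd2_eqI DERIV_minus slice_diff_pd2[OF assms])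

lemma diffusion_flip: "diffusion (\<lambda>\<xi>. f (flip \<xi>)) \<xi> = diffusion f (flip \<xi>)"
  by (simp add: diffusion_def pd1_flip pd2_flip)

lemma diffusion_uminus: "nice2 f \<Longrightarrow> diffusion (\<lambda>\<xi>. - f \<xi>) \<xi> = - diffusion f \<xi>"
  by (simp add: diffusion_def pd_uminus nice2D add_divide_distrib)

lemma radial_uminus:
  assumes "radial w C"
  shows "radial (\<lambda>r. - w r) C" "radial.P (\<lambda>r. - w r) r = - radial.P w r" "radial.Q (\<lambda>r. - w r) r = - radial.Q w r"
proof -
  interpret radial w 0 C by fact
  show 1: "radial (\<lambda>r. - w r) C" using w_cont w_bound by unfold_locales (auto intro: continuous_on_minus)
  show "radial.P (\<lambda>r. - w r) r = - radial.P w r" "radial.Q (\<lambda>r. - w r) r = - radial.Q w r"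
    unfolding radial.P_def[OF 1] radial.Q_def[OF 1] P_def Q_def by simp_all
qed

context mode2
begin

lemma moments_vanish:
  "(LINT \<xi>|lborel. f \<xi>) = 0" "(LINT \<xi>|lborel. fst \<xi> * f \<xi>) = 0" "(LINT \<xi>|lborel. snd \<xi> * f \<xi>) = 0"
proof -
  have r: "rapid (\<lambda>\<eta>. norm \<eta> ^ n * f \<eta>)" for n by (intro tempered_mult_rapid tempered_power tempered_norm f)
  have "(LINT \<eta>|lborel. cpx \<eta> ^ (2 * 0) * of_real (f \<eta>)) = 0"
    unfolding even_moment[OF r] by simp
  then have "(LINT \<eta>|lborel. of_real (f \<eta>) :: complex) = 0" by simp
  then show "(LINT \<xi>|lborel. f \<xi>) = 0" by (simp only: integral_complex_of_real of_real_eq_0_iff)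
  have 1: "(LINT \<eta>|lborel. cpx \<eta> ^ 1 * of_real (f \<eta>)) = 0" by (rule odd_moment[OF _ r]) simp
  have i: "integrable lborel (\<lambda>\<eta>. cpx \<eta> ^ 1 * of_real (f \<eta>))"
    by (rule Bochner_Integration.integrable_bound[OF rapid_integrable[OF r[of 1]]])
      (measurable, rule AE_I2, simp add: norm_mult abs_mult)
  show "(LINT \<xi>|lborel. fst \<xi> * f \<xi>) = 0" "(LINT \<xi>|lborel. snd \<xi> * f \<xi>) = 0"
    using integral_Re[OF i] integral_Im[OF i] unfolding 1 by simp_all
qed

lemma quadratic_moment:
  "1 / pi * (LINT \<xi>|lborel. ((snd \<xi>)\<^sup>2 - (fst \<xi>)\<^sup>2) * f \<xi>) = radial.total (\<lambda>r. - cos_part f r)"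
proof -
  obtain C where R: "radial (cos_part f) C" "radial (sin_part f) C" by (rule parts_radial)
  then interpret a: radial "cos_part f" 0 C + b: radial "sin_part f" 0 C by auto
  have r: "rapid (\<lambda>\<eta>. norm \<eta> ^ n * f \<eta>)" for n by (intro tempered_mult_rapid tempered_power tempered_norm f)
  have i: "integrable lborel (\<lambda>\<eta>. cpx \<eta> ^ 2 * of_real (f \<eta>))"
    by (rule Bochner_Integration.integrable_bound[OF rapid_integrable[OF r[of 2]]])
      (measurable, rule AE_I2, simp add: norm_mult norm_power abs_mult)
  have "(LINT \<eta>|lborel. cpx \<eta> ^ (2 * 1) * of_real (f \<eta>)) =
     (LINT t|lborel. of_real pi * of_real (indicator {0<..} t * (t ^ 3 * cos_part f t)) + (\<i> * pi) * of_real (indicator {0<..} t * (t ^ 3 * sin_part f t)))"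
    unfolding even_moment[OF r]
    by (intro Bochner_Integration.integral_cong refl)
      (simp add: amp_def complex_eq_iff eval_nat_numeral indicator_def)
  also have "\<dots> = of_real pi * of_real (LINT t|lborel. indicator {0<..} t * (t ^ 3 * cos_part f t))
      + (\<i> * pi) * of_real (LINT t|lborel. indicator {0<..} t * (t ^ 3 * sin_part f t))"
  proof -
    have m: "integrable lborel (\<lambda>r. c * complex_of_real (g r))" "(LINT r|lborel. c * complex_of_real (g r)) = c * of_real (LINT r|lborel. g r)"
      if "integrable lborel g" for c and g :: "real \<Rightarrow> real"
      using that by (simp_all only: integrable_mult_right integrable_of_real integral_mult_right_zero integral_complex_of_real)
    show ?thesis
      by (simp only: Bochner_Integration.integral_add m[OF a.moment_integrable] m[OF b.moment_integrable])
  qed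
  finally have "Re (LINT \<eta>|lborel. cpx \<eta> ^ 2 * of_real (f \<eta>)) = pi * (LINT t|lborel. indicator {0<..} t * (t ^ 3 * cos_part f t))"
    by simp
  then have "(LINT \<eta>|lborel. ((fst \<eta>)\<^sup>2 - (snd \<eta>)\<^sup>2) * f \<eta>) = pi * (LINT t|lborel. indicator {0<..} t * (t ^ 3 * cos_part f t))"
    using integral_Re[OF i] by (simp add: Re_power2)
  moreover have "(LINT \<xi>|lborel. ((snd \<xi>)\<^sup>2 - (fst \<xi>)\<^sup>2) * f \<xi>) = - (LINT \<eta>|lborel. ((fst \<eta>)\<^sup>2 - (snd \<eta>)\<^sup>2) * f \<eta>)"
    by (subst Bochner_Integration.integral_minus[symmetric]) (simp add: algebra_simps)
  ultimately show ?thesis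
    unfolding radial.total_def[OF radial_uminus(1)[OF R(1)]] by simp
qed

text \<open>Vanishing of \<open>Lambda f\<close> on the ray of angle 0 is the radial equation of the
  sine part without strain, for which the energy argument leaves only 0.\<close>

lemma sin_part_zero:
  assumes L: "\<And>r. r > 0 \<Longrightarrow> Lambda f (r, 0) = 0" and r: "r > 0"
  shows "sin_part f r = 0"
proof -
  obtain C where "radial (sin_part f) C" by (rule parts_radial)
  then interpret b: radial "sin_part f" 0 C .
  interpret b: radial_mode "sin_part f" 0 C
  proof
    fix r :: real assume r: "r > 0"
    have "2 * v0 r * sin_part f r = g0 r / 4 * (PB r / r\<^sup>2 + r\<^sup>2 * QB r)"
      using Lambda_at_angle(1)[OF r] L[OF r] by simp
    then show "sin_part f r = (r\<^sup>2 / 2) / (exp (r\<^sup>2 / 4) - 1) * b.X r / 2"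
      by (intro mode_cancel[OF _ g0_v0[OF r] v0_pos[OF r]]) (simp add: b.X_def distrib_left)
  qed
  show ?thesis by (rule b.homogeneous_zero[OF refl r])
qed

lemma cos_part_zero:
  assumes L: "\<And>r. r > 0 \<Longrightarrow> Lambda f (r * cos (pi / 4), r * sin (pi / 4)) = 0" and r: "r > 0"
  shows "cos_part f r = 0"
proof -
  obtain C where "radial (cos_part f) C" by (rule parts_radial)
  then interpret b: radial "cos_part f" 0 C .
  interpret b: radial_mode "cos_part f" 0 C
  proof
    fix r :: real assume r: "r > 0"
    have "2 * v0 r * cos_part f r = g0 r / 4 * (PA r / r\<^sup>2 + r\<^sup>2 * QA r)"
      using Lambda_at_angle(2)[OF r] L[OF r] by simp
    then show "cos_part f r = (r\<^sup>2 / 2) / (exp (r\<^sup>2 / 4) - 1) * b.X r / 2"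
      by (intro mode_cancel[OF _ g0_v0[OF r] v0_pos[OF r]]) (simp add: b.X_def distrib_left)
  qed
  show ?thesis by (rule b.homogeneous_zero[OF refl r])
qed

text \<open>At angle pi/4 the product \<xi>1 \<xi>2 is r^2 / 2, so the right-hand side equals (g0 /
  4) (r^2 / pi). This is the strain term of X with \<open>\<kappa>\<close> = 1, once the sign of the
  cosine part is reversed.\<close>

lemma forced_total_bounds:
  assumes L: "\<And>\<xi>. Lambda f \<xi> = 1 / (2 * pi) * fst \<xi> * snd \<xi> * gaussian \<xi>"
  shows "22.24 \<le> radial.total (\<lambda>r. - cos_part f r)" "radial.total (\<lambda>r. - cos_part f r) < 22.25"
proof -
  obtain C where R: "radial (cos_part f) C" by (rule parts_radial)
  interpret b: radial "\<lambda>r. - cos_part f r" 1 C by (rule radial_uminus(1)[OF R])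
  interpret b: radial_mode "\<lambda>r. - cos_part f r" 1 C
  proof
    fix r :: real assume r: "r > 0"
    have "norm (r * cos (pi / 4), r * sin (pi / 4)) = r"
      using r by (simp add: norm_Pair power_mult_distrib flip: distrib_left)
    moreover have c: "cos (pi / 4) * sin (pi / 4) = (1::real) / 2"
      using sin_double[of "pi / 4"] by (simp add: mult_ac)
    ultimately have "Lambda f (r * cos (pi / 4), r * sin (pi / 4)) = r\<^sup>2 / (4 * pi) * g0 r"
      unfolding L gaussian_g0 by (simp add: power2_eq_square mult_ac c)
    then have "2 * v0 r * - cos_part f r = g0 r / 4 * (1 * r\<^sup>2 / pi + b.P r / r\<^sup>2 + r\<^sup>2 * b.Q r)"
      using Lambda_at_angle(2)[OF r] by (simp add: radial_uminus(2,3)[OF R] algebra_simps)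
    then show "- cos_part f r = (r\<^sup>2 / 2) / (exp (r\<^sup>2 / 4) - 1) * b.X r / 2"
      by (intro mode_cancel[OF _ g0_v0[OF r] v0_pos[OF r]]) (simp add: b.X_def distrib_left)
  qed
  show "22.24 \<le> radial.total (\<lambda>r. - cos_part f r)" "radial.total (\<lambda>r. - cos_part f r) < 22.25"
    by (rule b.total_bounds[OF refl])+
qed

text \<open>The swap is \<theta> to pi/2 - \<theta>, under which cos 2\<theta> changes sign. The
  polar form is available for r > 0 only, so the origin is settled by continuity.\<close>

lemma flip_antisymmetric:
  assumes s: "\<And>r. r > 0 \<Longrightarrow> sin_part f r = 0"
  shows "f (flip \<xi>) = - f \<xi>"
proof -
  have nz: "f (flip \<xi>) = - f \<xi>" if \<xi>: "\<xi> \<noteq> 0" for \<xi>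
  proof -
    obtain r t where r: "r > 0" and e: "\<xi> = (r * cos t, r * sin t)" using plane_polar[OF \<xi>] by metis
    have fl: "flip \<xi> = (r * cos (pi / 2 - t), r * sin (pi / 2 - t))" by (simp add: e cos_diff sin_diff)
    have c: "cos (2 * (pi / 2 - t)) = - cos (2 * t)" by (simp add: right_diff_distrib cos_diff)
    have "f (flip \<xi>) = cos_part f r * cos (2 * (pi / 2 - t))"
      unfolding fl Y_mode2_polar[OF mode r, of "pi / 2 - t"] s[OF r] by simp
    moreover have "f \<xi> = cos_part f r * cos (2 * t)"
      unfolding e Y_mode2_polar[OF mode r, of t] s[OF r] by simp
    ultimately show ?thesis unfolding c by simp
  qed
  have c: "isCont f 0" using Z_continuous[OF Z] by (metis continuous_on_eq_continuous_at open_UNIV UNIV_I)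
  have "((\<lambda>r. f (r, 0) + f (0, r)) \<longlongrightarrow> f 0 + f 0) (at_right 0)"
  proof (intro tendsto_add isCont_tendsto_compose[OF c])
    show "((\<lambda>r::real. (r, 0::real)) \<longlongrightarrow> 0) (at_right 0)" "((\<lambda>r::real. (0::real, r)) \<longlongrightarrow> 0) (at_right 0)"
      unfolding zero_prod_def by (intro tendsto_intros)+
  qed
  moreover have "\<forall>\<^sub>F r in at_right 0. f (r, 0) + f (0, r) = 0"
  proof (rule eventually_at_rightI[of 0 1])
    fix r :: real assume "r \<in> {0<..<1}"
    then have "(r, 0::real) \<noteq> 0" by (simp add: zero_prod_def)
    from nz[OF this] show "f (r, 0) + f (0, r) = 0" by simp
  qed simp
  then have "((\<lambda>r. f (r, 0) + f (0, r)) \<longlongrightarrow> 0) (at_right 0)" by (rule tendsto_eventually)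
  ultimately have "f 0 + f 0 = 0" using tendsto_unique[of "at_right (0::real)"] by force
  then have z: "f 0 = 0" by simp
  show ?thesis
  proof (cases "\<xi> = 0")
    case True
    then have "flip \<xi> = 0" by (simp add: flip_def zero_prod_def)
    then show ?thesis using True z by simp
  qed (rule nz)
qed

end

lemma order_two_profiles:
  assumes "order_two wE wNS zE zNS"
  defines "w2 \<equiv> \<lambda>r. - cos_part (wE 2) r"
  shows "mode2 (wE 2)" "mode2 (wNS 2)"
    and "\<And>r. r > 0 \<Longrightarrow> sin_part (wE 2) r = 0"
    and "\<And>r. r > 0 \<Longrightarrow> cos_part (wNS 2) r = 0"
    and "22.24 \<le> radial.total w2" "radial.total w2 < 22.25"
    and "1 / pi * (LINT \<xi>|lborel. ((snd \<xi>)\<^sup>2 - (fst \<xi>)\<^sup>2) * wE 2 \<xi>) = radial.total w2"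
    and "(LINT \<xi>|lborel. ((snd \<xi>)\<^sup>2 - (fst \<xi>)\<^sup>2) * wNS 2 \<xi>) = 0"
proof -
  note O = assms(1)[unfolded order_two_def]
  show m: "mode2 (wE 2)" "mode2 (wNS 2)" using O by (simp_all add: mode2_def)
  interpret E: mode2 "wE 2" by (rule m)
  interpret N: mode2 "wNS 2" by (rule m)
  have L: "Lambda (wE 2) \<xi> = 1 / (2 * pi) * fst \<xi> * snd \<xi> * gaussian \<xi>" for \<xi> using O by blast
  have L2: "Lambda (wNS 2) \<xi> = - (diffusion (wE 2) \<xi> - wE 2 \<xi>)" for \<xi>
  proof -
    have "Lambda (wNS 2) \<xi> + (diffusion (wE 2) \<xi> - wE 2 \<xi>) = 0" using O by blast
    then show ?thesis by linarith
  qed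
  show s: "sin_part (wE 2) r = 0" if "r > 0" for r
    by (rule E.sin_part_zero[OF _ that]) (simp add: L)
  show c: "cos_part (wNS 2) r = 0" if "r > 0" for r
  \<comment> \<open>The diffusion operator commutes with the swap, so applied to the antisymmetric
    \<open>wE 2\<close> it vanishes on the diagonal, as does \<open>wE 2\<close>. Hence the equation
    for the cosine part of \<open>wNS 2\<close> has no forcing.\<close>
  proof (rule N.cos_part_zero[OF _ that])
    fix r :: real assume r: "r > 0"
    define \<xi> :: plane where "\<xi> = (r * cos (pi / 4), r * sin (pi / 4))"
    have fl: "flip \<xi> = \<xi>" by (simp add: \<xi>_def cos_45 sin_45)
    have a: "wE 2 (flip \<eta>) = - wE 2 \<eta>" for \<eta> by (rule E.flip_antisymmetric[OF s])
    have "diffusion (wE 2) (flip \<xi>) = - diffusion (wE 2) \<xi>"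
      unfolding diffusion_flip[symmetric] a by (rule diffusion_uminus[OF E.nice])
    then have "diffusion (wE 2) \<xi> = 0" unfolding fl by simp
    moreover have "wE 2 \<xi> = 0" using a[of \<xi>] unfolding fl by simp
    ultimately show "Lambda (wNS 2) (r * cos (pi / 4), r * sin (pi / 4)) = 0"
      unfolding \<xi>_def[symmetric] L2 by simp
  qed
  show "22.24 \<le> radial.total w2" "radial.total w2 < 22.25"
    unfolding w2_def by (rule E.forced_total_bounds[OF L])+
  show "1 / pi * (LINT \<xi>|lborel. ((snd \<xi>)\<^sup>2 - (fst \<xi>)\<^sup>2) * wE 2 \<xi>) = radial.total w2"
    unfolding w2_def by (rule E.quadratic_moment)
  obtain C where R: "radial (cos_part (wNS 2)) C" by (rule N.parts_radial)
  have "radial.total (\<lambda>r. - cos_part (wNS 2) r) = (LINT t::real|lborel. 0)"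
    unfolding radial.total_def[OF radial_uminus(1)[OF R]]
    by (intro Bochner_Integration.integral_cong refl) (simp add: indicator_def c)
  then show "(LINT \<xi>|lborel. ((snd \<xi>)\<^sup>2 - (fst \<xi>)\<^sup>2) * wNS 2 \<xi>) = 0"
    using N.quadratic_moment by simp
qed

section \<open>Interaction with the mirror image\<close>

lemma pd_add:
  assumes "slice_diff f" "slice_diff g"
  shows "pd1 (\<lambda>\<xi>. f \<xi> + g \<xi>) = (\<lambda>\<xi>. pd1 f \<xi> + pd1 g \<xi>)"
    and "pd2 (\<lambda>\<xi>. f \<xi> + g \<xi>) = (\<lambda>\<xi>. pd2 f \<xi> + pd2 g \<xi>)"
    and "slice_diff (\<lambda>\<xi>. f \<xi> + g \<xi>)"
proof -
  note d1 = DERIV_add[OF slice_diff_pd1[OF assms(1)] slice_diff_pd1[OF assms(2)]]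
  note d2 = DERIV_add[OF slice_diff_pd2[OF assms(1)] slice_diff_pd2[OF assms(2)]]
  show "pd1 (\<lambda>\<xi>. f \<xi> + g \<xi>) = (\<lambda>\<xi>. pd1 f \<xi> + pd1 g \<xi>)" by (rule pd1_eqI) (rule d1)
  show "pd2 (\<lambda>\<xi>. f \<xi> + g \<xi>) = (\<lambda>\<xi>. pd2 f \<xi> + pd2 g \<xi>)" by (rule pd2_eqI) (rule d2)
  show "slice_diff (\<lambda>\<xi>. f \<xi> + g \<xi>)"
    by (rule slice_diffI[where g = "\<lambda>\<xi>. pd1 f \<xi> + pd1 g \<xi>" and h = "\<lambda>\<xi>. pd2 f \<xi> + pd2 g \<xi>"]) (rule d1 d2)+
qed

lemma pd_cmult:
  assumes "slice_diff f"
  shows "pd1 (\<lambda>\<xi>. c * f \<xi>) = (\<lambda>\<xi>. c * pd1 f \<xi>)"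
    and "pd2 (\<lambda>\<xi>. c * f \<xi>) = (\<lambda>\<xi>. c * pd2 f \<xi>)"
    and "slice_diff (\<lambda>\<xi>. c * f \<xi>)"
proof -
  note d1 = DERIV_cmult[OF slice_diff_pd1[OF assms]]
  note d2 = DERIV_cmult[OF slice_diff_pd2[OF assms]]
  show "pd1 (\<lambda>\<xi>. c * f \<xi>) = (\<lambda>\<xi>. c * pd1 f \<xi>)" by (rule pd1_eqI) (rule d1)
  show "pd2 (\<lambda>\<xi>. c * f \<xi>) = (\<lambda>\<xi>. c * pd2 f \<xi>)" by (rule pd2_eqI) (rule d2)
  show "slice_diff (\<lambda>\<xi>. c * f \<xi>)"
    by (rule slice_diffI[where g = "\<lambda>\<xi>. c * pd1 f \<xi>" and h = "\<lambda>\<xi>. c * pd2 f \<xi>"]) (rule d1 d2)+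
qed

lemma nice1_add: "nice1 f \<Longrightarrow> nice1 g \<Longrightarrow> nice1 (\<lambda>\<xi>. f \<xi> + g \<xi>)"
  by (simp add: nice1_def pd_add rapid_add)

lemma nice1_cmult: "nice1 f \<Longrightarrow> nice1 (\<lambda>\<xi>. c * f \<xi>)"
  by (simp add: nice1_def pd_cmult rapid_cmult)

lemma nice2_add:
  assumes "nice2 f" "nice2 g"
  shows "nice2 (\<lambda>\<xi>. f \<xi> + g \<xi>)"
proof -
  note F = nice2D[OF assms(1)] and G = nice2D[OF assms(2)]
  show ?thesis
    unfolding nice2_def pd_add(1,2)[OF F(11) G(11)] pd_add(2)[OF F(12) G(12)] pd_add(1)[OF F(13) G(13)] F(4) G(4)
    by (intro conjI refl nice1_add F G)
qed

lemma nice2_cmult: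
  assumes "nice2 f"
  shows "nice2 (\<lambda>\<xi>. c * f \<xi>)"
proof -
  note F = nice2D[OF assms]
  show ?thesis
    unfolding nice2_def pd_cmult(1,2)[OF F(11)] pd_cmult(2)[OF F(12)] pd_cmult(1)[OF F(13)] F(4)
    by (intro conjI refl nice1_cmult F)
qed

lemma nice2_0: "nice2 (\<lambda>\<xi>. 0)"
  using nice2_cmult[OF nice2_gaussian, of 0] by simp

lemma nice2_sum: "(\<And>k. k \<in> A \<Longrightarrow> nice2 (f k)) \<Longrightarrow> nice2 (\<lambda>\<xi>. \<Sum>k\<in>A. f k \<xi>)"
  by (induction A rule: infinite_finite_induct) (auto intro: nice2_0 nice2_add)

definition image_point :: "real \<Rightarrow> plane \<Rightarrow> plane" where
  "image_point \<epsilon> \<xi> = (- fst \<xi> - 1 / \<epsilon>, snd \<xi>)"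

lemma image_point_measurable [measurable]: "image_point \<epsilon> \<in> borel_measurable borel"
  unfolding image_point_def by (simp flip: borel_prod)

lemma norm_image_point: "norm (image_point \<epsilon> \<xi>) \<le> norm \<xi> + \<bar>1 / \<epsilon>\<bar>"
proof -
  have "image_point \<epsilon> \<xi> = (- fst \<xi>, snd \<xi>) - (1 / \<epsilon>, 0)" by (simp add: image_point_def)
  moreover have "norm (- fst \<xi>, snd \<xi>) = norm \<xi>" by (simp add: norm_prod_def)
  moreover have "norm (1 / \<epsilon>, 0 :: real) = \<bar>1 / \<epsilon>\<bar>" by (simp add: norm_prod_def)
  ultimately show ?thesis using norm_triangle_ineq4[of "(- fst \<xi>, snd \<xi>)" "(1 / \<epsilon>, 0)"] by simp
qed

lemma tempered_image:
  assumes F: "tempered F"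
  shows "tempered (\<lambda>\<xi>. F (image_point \<epsilon> \<xi>))"
proof -
  obtain C n where C: "C > 0" "\<And>\<xi>. \<bar>F \<xi>\<bar> \<le> C * (1 + norm \<xi>) ^ n" using temperedD[OF F] by metis
  show ?thesis
  proof (rule temperedI[of _ "C * (1 + \<bar>1 / \<epsilon>\<bar>) ^ n" n])
    show "(\<lambda>\<xi>. F (image_point \<epsilon> \<xi>)) \<in> borel_measurable borel"
      using tempered_measurable[OF F] by measurable
    fix \<xi> :: plane
    have "1 + norm (image_point \<epsilon> \<xi>) \<le> (1 + \<bar>1 / \<epsilon>\<bar>) * (1 + norm \<xi>)"
      using norm_image_point[of \<epsilon> \<xi>] mult_nonneg_nonneg[OF abs_ge_zero[of "1 / \<epsilon>"] norm_ge_zero[of \<xi>]]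
      unfolding distrib_left distrib_right mult_1_left mult_1_right by linarith
    then have "(1 + norm (image_point \<epsilon> \<xi>)) ^ n \<le> (1 + \<bar>1 / \<epsilon>\<bar>) ^ n * (1 + norm \<xi>) ^ n"
      unfolding power_mult_distrib[symmetric] by (intro power_mono) simp_all
    then have "C * (1 + norm (image_point \<epsilon> \<xi>)) ^ n \<le> C * ((1 + \<bar>1 / \<epsilon>\<bar>) ^ n * (1 + norm \<xi>) ^ n)"
      using C(1) by (intro mult_left_mono) auto
    then show "\<bar>F (image_point \<epsilon> \<xi>)\<bar> \<le> C * (1 + \<bar>1 / \<epsilon>\<bar>) ^ n * (1 + norm \<xi>) ^ n"
      using C(2)[of "image_point \<epsilon> \<xi>"] by (simp add: mult.assoc)
  qed
qed

lemma pd_image: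
  assumes "slice_diff F"
  shows "((\<lambda>s. F (image_point \<epsilon> (s, y))) has_real_derivative - pd1 F (image_point \<epsilon> (x, y))) (at x)"
    and "((\<lambda>s. F (image_point \<epsilon> (x, s))) has_real_derivative pd2 F (image_point \<epsilon> (x, y))) (at y)"
proof -
  have "((\<lambda>s. - s - 1 / \<epsilon>) has_real_derivative - 1) (at x)" by (auto intro!: derivative_eq_intros)
  from DERIV_chain2[where f = "\<lambda>s. F (s, y)" and g = "\<lambda>s. - s - 1 / \<epsilon>", OF slice_diff_pd1[OF assms] this]
  show "((\<lambda>s. F (image_point \<epsilon> (s, y))) has_real_derivative - pd1 F (image_point \<epsilon> (x, y))) (at x)"
    by (simp add: image_point_def)
  show "((\<lambda>s. F (image_point \<epsilon> (x, s))) has_real_derivative pd2 F (image_point \<epsilon> (x, y))) (at y)"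
    using slice_diff_pd2[OF assms, of "- x - 1 / \<epsilon>" y] by (simp add: image_point_def)
qed

section \<open>Multipole expansion of the image interaction\<close>

definition cmoment :: "nat \<Rightarrow> (plane \<Rightarrow> real) \<Rightarrow> complex" where
  "cmoment j f = (LINT \<eta>|lborel. cpx \<eta> ^ j * of_real (f \<eta>))"

lemma cmoment_integrable:
  assumes f: "rapid f"
  shows "integrable lborel (\<lambda>\<eta>. cpx \<eta> ^ j * of_real (f \<eta>))"
proof (rule Bochner_Integration.integrable_bound)
  note [measurable] = rapid_measurable[OF f]
  show "integrable lborel (\<lambda>\<eta>. norm \<eta> ^ j * f \<eta>)"
    by (intro rapid_integrable tempered_mult_rapid tempered_power tempered_norm f)
  show "(\<lambda>\<eta>. cpx \<eta> ^ j * of_real (f \<eta>)) \<in> borel_measurable lborel" by measurable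
  show "AE \<eta> in lborel. norm (cpx \<eta> ^ j * of_real (f \<eta>)) \<le> norm (norm \<eta> ^ j * f \<eta>)"
    by (rule AE_I2) (simp add: norm_mult norm_power abs_mult)
qed

lemma integral_cnj_power:
  assumes f: "rapid f"
  shows "integrable lborel (\<lambda>\<eta>. (z + cnj (cpx \<eta>)) ^ n * of_real (f \<eta>))"
    and "(LINT \<eta>|lborel. (z + cnj (cpx \<eta>)) ^ n * of_real (f \<eta>)) = (\<Sum>j\<le>n. of_nat (n choose j) * z ^ j * cnj (cmoment (n - j) f))"
proof -
  have e: "(z + cnj (cpx \<eta>)) ^ n * of_real (f \<eta>) =
      (\<Sum>j\<le>n. (of_nat (n choose j) * z ^ j) * cnj (cpx \<eta> ^ (n - j) * of_real (f \<eta>)))" for \<eta>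
    by (simp add: binomial_ring sum_distrib_right mult.assoc)
  have i: "integrable lborel (\<lambda>\<eta>. (of_nat (n choose j) * z ^ j) * cnj (cpx \<eta> ^ (n - j) * of_real (f \<eta>)))" for j
    by (intro integrable_mult_right) (simp only: integrable_cnj cmoment_integrable[OF f])
  show "integrable lborel (\<lambda>\<eta>. (z + cnj (cpx \<eta>)) ^ n * of_real (f \<eta>))"
    unfolding e by (intro Bochner_Integration.integrable_sum i)
  show "(LINT \<eta>|lborel. (z + cnj (cpx \<eta>)) ^ n * of_real (f \<eta>)) = (\<Sum>j\<le>n. of_nat (n choose j) * z ^ j * cnj (cmoment (n - j) f))"
    unfolding e cmoment_def Bochner_Integration.integral_sum[OF i] integral_mult_right_zero Bochner_Integration.integral_cnj ..
qed

text \<open>In complex notation, reflection of the first coordinate is conjugation up to sign: the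
  image point minus \<open>\<eta>\<close> is minus the conjugate of 1/\<epsilon> + \<xi> + cnj
  \<eta>. This form is ready for expansion in \<epsilon>.\<close>

lemma induced_velocity:
  fixes \<epsilon> :: real
  assumes g: "nice1 g"
  defines "E \<equiv> complex_of_real (1 / \<epsilon>)"
  shows "integrable lborel (\<lambda>\<eta>. of_real (g \<eta>) / (E + (cpx \<xi> + cnj (cpx \<eta>))))"
    and "- 2 * pi * pd1 (inv_laplace g) (image_point \<epsilon> \<xi>) = Re (LINT \<eta>|lborel. of_real (g \<eta>) / (E + (cpx \<xi> + cnj (cpx \<eta>))))"
proof -
  define a where "a = image_point \<epsilon> \<xi>"
  have r: "rapid g" using g by (simp add: nice1_def)
  note C = cauchy_transform[OF r, of a]
  have E: "E + (cpx \<xi> + cnj (cpx \<eta>)) = - cnj (cpx a - cpx \<eta>)" for \<eta>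
    by (simp add: complex_eq_iff E_def a_def image_point_def)
  have e: "of_real (g \<eta>) / (E + (cpx \<xi> + cnj (cpx \<eta>))) = - cnj (of_real (g \<eta>) / (cpx a - cpx \<eta>))" for \<eta>
    unfolding E by (simp only: complex_cnj_divide complex_cnj_complex_of_real minus_divide_right)
  show "integrable lborel (\<lambda>\<eta>. of_real (g \<eta>) / (E + (cpx \<xi> + cnj (cpx \<eta>))))"
    unfolding e by (rule Bochner_Integration.integrable_minus) (simp only: integrable_cnj C(1))
  have "(LINT \<eta>|lborel. of_real (g \<eta>) / (E + (cpx \<xi> + cnj (cpx \<eta>)))) = - cnj (LINT \<eta>|lborel. of_real (g \<eta>) / (cpx a - cpx \<eta>))"
    unfolding e by (simp only: Bochner_Integration.integral_minus Bochner_Integration.integral_cnj)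
  then show "- 2 * pi * pd1 (inv_laplace g) (image_point \<epsilon> \<xi>) = Re (LINT \<eta>|lborel. of_real (g \<eta>) / (E + (cpx \<xi> + cnj (cpx \<eta>))))"
    unfolding C(2) by (simp add: pd_inv_laplace[OF g] inv_laplace_pd1_kernel[OF g] a_def)
qed

text \<open>An exact identity for every w off the pole; no smallness of w against E is assumed, as
  \<open>\<xi>\<close> and \<open>\<eta>\<close> range over the whole plane.\<close>

lemma geometric_remainder:
  fixes E w e :: complex
  assumes "e * E = 1" "E + w \<noteq> 0"
  shows "1 / (E + w) - (\<Sum>n<N. e * (- e * w) ^ n) = (- e * w) ^ N / (E + w)"
proof (induction N)
  case (Suc N)
  have "1 / (E + w) - e = (- e * w) / (E + w)"
    using assms by (simp add: divide_simps) (simp add: algebra_simps)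
  then have "(- e * w) ^ N * (1 / (E + w) - e) = (- e * w) ^ Suc N / (E + w)" by simp
  then show ?case using Suc by (simp add: algebra_simps)
qed simp

lemma norm_sum_power_le: "norm (cpx \<xi> + cnj (cpx \<eta>)) ^ N \<le> (1 + norm \<xi>) ^ N * (1 + norm \<eta>) ^ N"
proof -
  have "norm (cpx \<xi> + cnj (cpx \<eta>)) \<le> norm \<xi> + norm \<eta>" using norm_triangle_ineq[of "cpx \<xi>" "cnj (cpx \<eta>)"] by simp
  also have "\<dots> \<le> (1 + norm \<xi>) * (1 + norm \<eta>)" by (simp add: distrib_left distrib_right)
  finally show ?thesis unfolding power_mult_distrib[symmetric] by (intro power_mono) simp_all
qed

text \<open>The remainder of the geometric sum is (\<epsilon> |w|)^N / |E + w|, where |E + w| is the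
  distance from \<open>\<eta>\<close> to the image point. The numerator goes into polynomial factors
  in \<open>\<xi>\<close> and \<open>\<eta>\<close>; the denominator is handled by
  \<open>rapid_kernel_bound\<close>, uniformly in the image point.\<close>

lemma velocity_expansion:
  assumes g: "nice1 g"
  obtains K where "K > 0"
    "\<And>\<epsilon> \<xi>. \<epsilon> > 0 \<Longrightarrow> \<bar>- 2 * pi * pd1 (inv_laplace g) (image_point \<epsilon> \<xi>)
       - (\<Sum>n<N. \<epsilon> * (- \<epsilon>) ^ n * Re (\<Sum>j\<le>n. of_nat (n choose j) * cpx \<xi> ^ j * cnj (cmoment (n - j) g)))\<bar>
       \<le> K * \<epsilon> ^ N * (1 + norm \<xi>) ^ N"
proof -
  have r: "rapid g" using g by (simp add: nice1_def)
  have rg: "rapid (\<lambda>\<eta>. (1 + norm \<eta>) ^ N * g \<eta>)"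
    by (intro tempered_mult_rapid tempered_power tempered_add tempered_const tempered_norm r)
  obtain K where K: "K > 0" "\<And>a. (LINT \<eta>|lborel. \<bar>(1 + norm \<eta>) ^ N * g \<eta>\<bar> / norm (a - \<eta>)) \<le> K"
    using rapid_kernel_bound[OF rg] by metis
  show ?thesis
  proof (rule that[OF K(1)])
    fix \<epsilon> :: real and \<xi> :: plane assume \<epsilon>: "\<epsilon> > 0"
    define E where "E = complex_of_real (1 / \<epsilon>)"
    define e where "e = complex_of_real \<epsilon>"
    define a where "a = image_point \<epsilon> \<xi>"
    define w where "w \<eta> = cpx \<xi> + cnj (cpx \<eta>)" for \<eta>
    have ne: "norm e = \<epsilon>" using \<epsilon> by (simp add: e_def)
    have eE: "e * E = 1" using \<epsilon> by (simp add: e_def E_def flip: of_real_mult)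
    note V = induced_velocity[OF g, of \<epsilon> \<xi>, folded E_def]
    note I = integral_cnj_power[OF r, of "cpx \<xi>"]
    define D where "D \<eta> = of_real (g \<eta>) / (E + w \<eta>) - (\<Sum>n<N. (e * (- e) ^ n) * (w \<eta> ^ n * of_real (g \<eta>)))" for \<eta>
    have iD: "integrable lborel D" unfolding D_def w_def
      by (intro Bochner_Integration.integrable_diff Bochner_Integration.integrable_sum integrable_mult_right V(1) I(1))
    have D: "(LINT \<eta>|lborel. D \<eta>) = (LINT \<eta>|lborel. of_real (g \<eta>) / (E + (cpx \<xi> + cnj (cpx \<eta>))))
       - (\<Sum>n<N. (e * (- e) ^ n) * (\<Sum>j\<le>n. of_nat (n choose j) * cpx \<xi> ^ j * cnj (cmoment (n - j) g)))"
      unfolding D_def w_def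
      by (simp only: Bochner_Integration.integral_diff Bochner_Integration.integral_sum Bochner_Integration.integrable_sum
         integrable_mult_right V(1) I integral_mult_right_zero)
    have R: "Re ((e * (- e) ^ n) * X) = \<epsilon> * (- \<epsilon>) ^ n * Re X" for n X
    proof -
      have "e * (- e) ^ n = complex_of_real (\<epsilon> * (- \<epsilon>) ^ n)" by (simp add: e_def)
      then show ?thesis by (simp only: times_complex.sel Re_complex_of_real Im_complex_of_real mult_zero_left diff_zero)
    qed
    have "\<bar>- 2 * pi * pd1 (inv_laplace g) (image_point \<epsilon> \<xi>)
       - (\<Sum>n<N. \<epsilon> * (- \<epsilon>) ^ n * Re (\<Sum>j\<le>n. of_nat (n choose j) * cpx \<xi> ^ j * cnj (cmoment (n - j) g)))\<bar>
       = \<bar>Re (LINT \<eta>|lborel. D \<eta>)\<bar>"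
      unfolding D V(2) by (simp only: minus_complex.simps Re_sum R)
    also have "\<dots> \<le> norm (LINT \<eta>|lborel. D \<eta>)" by (rule abs_Re_le_cmod)
    also have "\<dots> \<le> (LINT \<eta>|lborel. norm (D \<eta>))" by (rule integral_norm_bound)
    also have "\<dots> \<le> (LINT \<eta>|lborel. \<epsilon> ^ N * (1 + norm \<xi>) ^ N * (\<bar>(1 + norm \<eta>) ^ N * g \<eta>\<bar> / norm (a - \<eta>)))"
    proof (rule integral_mono_AE)
      show "integrable lborel (\<lambda>\<eta>. norm (D \<eta>))" using iD by (rule integrable_norm)
      show "integrable lborel (\<lambda>\<eta>. \<epsilon> ^ N * (1 + norm \<xi>) ^ N * (\<bar>(1 + norm \<eta>) ^ N * g \<eta>\<bar> / norm (a - \<eta>)))"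
        by (intro integrable_mult_right rapid_kernel_integrable rg)
      show "AE \<eta> in lborel. norm (D \<eta>) \<le> \<epsilon> ^ N * (1 + norm \<xi>) ^ N * (\<bar>(1 + norm \<eta>) ^ N * g \<eta>\<bar> / norm (a - \<eta>))"
      proof (rule AE_mp[OF AE_lborel_singleton[of a]], rule AE_I2, rule impI)
        fix \<eta> assume ne': "\<eta> \<noteq> a"
        have "E + w \<eta> = - cnj (cpx (a - \<eta>))"
          by (simp add: complex_eq_iff E_def w_def a_def image_point_def)
        then have n: "norm (E + w \<eta>) = norm (a - \<eta>)" by (simp only: norm_minus_cancel complex_mod_cnj cpx_simps)
        then have nz: "E + w \<eta> \<noteq> 0" using ne' by (metis eq_iff_diff_eq_0 norm_eq_zero)
        have "D \<eta> = of_real (g \<eta>) * (1 / (E + w \<eta>) - (\<Sum>n<N. e * (- e * w \<eta>) ^ n))"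
        proof -
          have "e * (- e) ^ n * (w \<eta> ^ n * of_real (g \<eta>)) = of_real (g \<eta>) * (e * (- e * w \<eta>) ^ n)" for n
            by (simp only: power_mult_distrib mult_ac)
          then show ?thesis
            unfolding D_def by (simp only: right_diff_distrib sum_distrib_left times_divide_eq_right mult_1_right)
        qed
        also have "\<dots> = of_real (g \<eta>) * ((- e * w \<eta>) ^ N / (E + w \<eta>))"
          unfolding geometric_remainder[OF eE nz] ..
        finally have "norm (D \<eta>) = \<bar>g \<eta>\<bar> * (\<epsilon> ^ N * norm (w \<eta>) ^ N / norm (a - \<eta>))"
          using ne by (simp only: norm_mult norm_divide norm_power norm_minus_cancel norm_of_real power_mult_distrib n)
        also have "\<dots> \<le> \<bar>g \<eta>\<bar> * (\<epsilon> ^ N * ((1 + norm \<xi>) ^ N * (1 + norm \<eta>) ^ N) / norm (a - \<eta>))"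
          unfolding w_def using \<epsilon> by (intro mult_left_mono divide_right_mono norm_sum_power_le) auto
        also have "\<dots> = \<epsilon> ^ N * (1 + norm \<xi>) ^ N * (\<bar>(1 + norm \<eta>) ^ N * g \<eta>\<bar> / norm (a - \<eta>))"
          by (simp add: abs_mult power_abs)
        finally show "norm (D \<eta>) \<le> \<epsilon> ^ N * (1 + norm \<xi>) ^ N * (\<bar>(1 + norm \<eta>) ^ N * g \<eta>\<bar> / norm (a - \<eta>))" .
      qed
    qed
    also have "\<dots> = \<epsilon> ^ N * (1 + norm \<xi>) ^ N * (LINT \<eta>|lborel. \<bar>(1 + norm \<eta>) ^ N * g \<eta>\<bar> / norm (a - \<eta>))"
      by (rule integral_mult_right_zero)
    also have "\<dots> \<le> \<epsilon> ^ N * (1 + norm \<xi>) ^ N * K"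
      using \<epsilon> by (intro mult_left_mono K) auto
    finally show "\<bar>- 2 * pi * pd1 (inv_laplace g) (image_point \<epsilon> \<xi>)
       - (\<Sum>n<N. \<epsilon> * (- \<epsilon>) ^ n * Re (\<Sum>j\<le>n. of_nat (n choose j) * cpx \<xi> ^ j * cnj (cmoment (n - j) g)))\<bar>
       \<le> K * \<epsilon> ^ N * (1 + norm \<xi>) ^ N" by (simp only: mult_ac)
  qed
qed

text \<open>The factor -2 pi normalizes the leading term: two unit masses at distance about
  1/\<epsilon> interact with strength \<epsilon>.\<close>

definition interaction :: "real \<Rightarrow> (plane \<Rightarrow> real) \<Rightarrow> (plane \<Rightarrow> real) \<Rightarrow> real" where
  "interaction \<epsilon> f g = (LINT \<xi>|lborel. f \<xi> * (- 2 * pi * pd1 (inv_laplace g) (image_point \<epsilon> \<xi>)))"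

text \<open>Binomial expansion of (\<xi> + cnj \<eta>)^n integrated against f and g; it is the
  coefficient of \<open>\<epsilon> * (- \<epsilon>) ^ n\<close> in the interaction.\<close>

definition multipole :: "nat \<Rightarrow> (plane \<Rightarrow> real) \<Rightarrow> (plane \<Rightarrow> real) \<Rightarrow> real" where
  "multipole n f g = Re (\<Sum>j\<le>n. of_nat (n choose j) * cmoment j f * cnj (cmoment (n - j) g))"

lemma rapid_interaction:
  assumes "rapid f" "nice1 g"
  shows "rapid (\<lambda>\<xi>. f \<xi> * (- 2 * pi * pd1 (inv_laplace g) (image_point \<epsilon> \<xi>)))"
  by (intro rapid_mult_tempered tempered_mult tempered_const tempered_image tempered_inv_laplace_pd assms)

lemma interaction_expansion:
  assumes f: "rapid f" and g: "nice1 g"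
  obtains C where "C > 0"
    "\<And>\<epsilon>. \<epsilon> > 0 \<Longrightarrow> \<bar>interaction \<epsilon> f g - (\<Sum>n<N. \<epsilon> * (- \<epsilon>) ^ n * multipole n f g)\<bar> \<le> C * \<epsilon> ^ N"
proof -
  note [measurable] = rapid_measurable[OF f]
  define h where "h n \<xi> = (\<Sum>j\<le>n. of_nat (n choose j) * cpx \<xi> ^ j * cnj (cmoment (n - j) g))" for n \<xi>
  obtain K where K: "K > 0" "\<And>\<epsilon> \<xi>. \<epsilon> > 0 \<Longrightarrow> \<bar>- 2 * pi * pd1 (inv_laplace g) (image_point \<epsilon> \<xi>)
       - (\<Sum>n<N. \<epsilon> * (- \<epsilon>) ^ n * Re (h n \<xi>))\<bar> \<le> K * \<epsilon> ^ N * (1 + norm \<xi>) ^ N"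
    by (rule velocity_expansion[OF g, where N = N, folded h_def]) (rule that)
  have e: "of_real (f \<xi>) * h n \<xi> = (\<Sum>j\<le>n. (of_nat (n choose j) * cnj (cmoment (n - j) g)) * (cpx \<xi> ^ j * of_real (f \<xi>)))" for n \<xi>
    unfolding h_def sum_distrib_left by (intro sum.cong refl) (simp only: mult_ac)
  have ic: "integrable lborel (\<lambda>\<xi>. of_real (f \<xi>) * h n \<xi>)" for n
    unfolding e by (intro Bochner_Integration.integrable_sum integrable_mult_right cmoment_integrable f)
  have re: "f \<xi> * Re (h n \<xi>) = Re (of_real (f \<xi>) * h n \<xi>)" for n \<xi> by simp
  have ih: "integrable lborel (\<lambda>\<xi>. f \<xi> * Re (h n \<xi>))" for n unfolding re by (rule integrable_Re[OF ic])
  have Ih: "(LINT \<xi>|lborel. f \<xi> * Re (h n \<xi>)) = multipole n f g" for n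
  proof -
    have "(LINT \<xi>|lborel. f \<xi> * Re (h n \<xi>)) = Re (LINT \<xi>|lborel. of_real (f \<xi>) * h n \<xi>)"
      unfolding re by (rule integral_Re[OF ic])
    also have "(LINT \<xi>|lborel. of_real (f \<xi>) * h n \<xi>) =
        (\<Sum>j\<le>n. (of_nat (n choose j) * cnj (cmoment (n - j) g)) * cmoment j f)"
      unfolding e cmoment_def[of _ f]
      by (subst Bochner_Integration.integral_sum)
        (simp_all only: integrable_mult_right cmoment_integrable[OF f] integral_mult_right_zero)
    finally show ?thesis unfolding multipole_def by (simp only: mult_ac)
  qed
  have rN: "rapid (\<lambda>\<xi>. (1 + norm \<xi>) ^ N * \<bar>f \<xi>\<bar>)"
    by (intro tempered_mult_rapid tempered_power tempered_add tempered_const tempered_norm rapid_abs f)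
  define A where "A = (LINT \<xi>|lborel. (1 + norm \<xi>) ^ N * \<bar>f \<xi>\<bar>)"
  have A: "A \<ge> 0" unfolding A_def by (intro Bochner_Integration.integral_nonneg) simp
  show ?thesis
  proof (rule that[of "K * A + 1"])
    show "K * A + 1 > 0" using K(1) A by (simp add: add_nonneg_pos)
    fix \<epsilon> :: real assume \<epsilon>: "\<epsilon> > 0"
    define D where "D \<xi> = f \<xi> * (- 2 * pi * pd1 (inv_laplace g) (image_point \<epsilon> \<xi>))
       - (\<Sum>n<N. (\<epsilon> * (- \<epsilon>) ^ n) * (f \<xi> * Re (h n \<xi>)))" for \<xi>
    note i1 = rapid_integrable[OF rapid_interaction[OF f g, of \<epsilon>]]
    have iD: "integrable lborel D" unfolding D_def
      by (intro Bochner_Integration.integrable_diff Bochner_Integration.integrable_sum integrable_mult_right ih i1)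
    have "(LINT \<xi>|lborel. D \<xi>) = interaction \<epsilon> f g - (\<Sum>n<N. \<epsilon> * (- \<epsilon>) ^ n * multipole n f g)"
      unfolding D_def interaction_def Ih[symmetric]
      by (simp only: Bochner_Integration.integral_diff Bochner_Integration.integral_sum Bochner_Integration.integrable_sum
         integrable_mult_right ih i1 integral_mult_right_zero)
    then have "\<bar>interaction \<epsilon> f g - (\<Sum>n<N. \<epsilon> * (- \<epsilon>) ^ n * multipole n f g)\<bar> = norm (LINT \<xi>|lborel. D \<xi>)" by simp
    also have "\<dots> \<le> (LINT \<xi>|lborel. norm (D \<xi>))" by (rule integral_norm_bound)
    also have "\<dots> \<le> (LINT \<xi>|lborel. K * \<epsilon> ^ N * ((1 + norm \<xi>) ^ N * \<bar>f \<xi>\<bar>))"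
    proof (rule integral_mono)
      show "integrable lborel (\<lambda>\<xi>. norm (D \<xi>))" using iD by (rule integrable_norm)
      show "integrable lborel (\<lambda>\<xi>. K * \<epsilon> ^ N * ((1 + norm \<xi>) ^ N * \<bar>f \<xi>\<bar>))"
        by (intro integrable_mult_right rapid_integrable rN)
      fix \<xi> :: plane
      have "D \<xi> = f \<xi> * (- 2 * pi * pd1 (inv_laplace g) (image_point \<epsilon> \<xi>) - (\<Sum>n<N. \<epsilon> * (- \<epsilon>) ^ n * Re (h n \<xi>)))"
        unfolding D_def right_diff_distrib sum_distrib_left by (simp only: mult_ac)
      then have "norm (D \<xi>) = \<bar>f \<xi>\<bar> * \<bar>- 2 * pi * pd1 (inv_laplace g) (image_point \<epsilon> \<xi>) - (\<Sum>n<N. \<epsilon> * (- \<epsilon>) ^ n * Re (h n \<xi>))\<bar>"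
        by (simp only: abs_mult real_norm_def)
      also have "\<dots> \<le> \<bar>f \<xi>\<bar> * (K * \<epsilon> ^ N * (1 + norm \<xi>) ^ N)"
        by (intro mult_left_mono K(2) \<epsilon> abs_ge_zero)
      finally show "norm (D \<xi>) \<le> K * \<epsilon> ^ N * ((1 + norm \<xi>) ^ N * \<bar>f \<xi>\<bar>)" by (simp only: mult_ac)
    qed
    also have "\<dots> = (K * A) * \<epsilon> ^ N" unfolding integral_mult_right_zero A_def by (simp only: mult_ac)
    also have "\<dots> \<le> (K * A + 1) * \<epsilon> ^ N" using \<epsilon> by (intro mult_right_mono) auto
    finally show "\<bar>interaction \<epsilon> f g - (\<Sum>n<N. \<epsilon> * (- \<epsilon>) ^ n * multipole n f g)\<bar> \<le> (K * A + 1) * \<epsilon> ^ N" .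
  qed
qed

text \<open>The kernel \<open>K1\<close> is odd, so exchanging the two variables changes the sign of
  the double integral. Absolute integrability, needed for Fubini, follows from the uniform kernel
  bound.\<close>

lemma self_velocity_zero:
  assumes f: "nice1 f"
  shows "(LINT \<xi>|lborel. f \<xi> * pd1 (inv_laplace f) \<xi>) = 0"
proof -
  have r: "rapid f" using f by (simp add: nice1_def)
  note [measurable] = rapid_measurable[OF r]
  define F where "F \<xi> \<eta> = f \<xi> * (K1 (\<xi> - \<eta>) * f \<eta>)" for \<xi> \<eta>
  obtain K where K: "K > 0" "\<And>a. (LINT \<eta>|lborel. \<bar>f \<eta>\<bar> / norm (a - \<eta>)) \<le> K"
    using rapid_kernel_bound[OF r] by metis
  have ik: "integrable lborel (\<lambda>\<eta>. K1 (\<xi> - \<eta>) * f \<eta>)" for \<xi>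
    by (rule kernel_integrable[OF r K1_measurable abs_K1_le])
  have m [measurable]: "(\<lambda>p. F (fst p) (snd p)) \<in> borel_measurable (lborel \<Otimes>\<^sub>M lborel)"
    unfolding F_def by measurable
  have "integrable (lborel \<Otimes>\<^sub>M lborel) (\<lambda>p. F (fst p) (snd p))"
  proof (rule lborel_pair.Fubini_integrable[OF m])
    show "AE \<xi> in lborel. integrable lborel (\<lambda>\<eta>. F (fst (\<xi>, \<eta>)) (snd (\<xi>, \<eta>)))"
      unfolding F_def fst_conv snd_conv by (intro AE_I2 integrable_mult_right ik)
    show "integrable lborel (\<lambda>\<xi>. LINT \<eta>|lborel. norm (F (fst (\<xi>, \<eta>)) (snd (\<xi>, \<eta>))))"
    proof (rule Bochner_Integration.integrable_bound)
      show "integrable lborel (\<lambda>\<xi>. K * \<bar>f \<xi>\<bar>)"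
        by (intro integrable_mult_right rapid_integrable rapid_abs r)
      show "(\<lambda>\<xi>. LINT \<eta>|lborel. norm (F (fst (\<xi>, \<eta>)) (snd (\<xi>, \<eta>)))) \<in> borel_measurable lborel"
        unfolding F_def by measurable
      show "AE \<xi> in lborel. norm (LINT \<eta>|lborel. norm (F (fst (\<xi>, \<eta>)) (snd (\<xi>, \<eta>)))) \<le> norm (K * \<bar>f \<xi>\<bar>)"
      proof (rule AE_I2)
        fix \<xi> :: plane
        have "(LINT \<eta>|lborel. norm (F \<xi> \<eta>)) = \<bar>f \<xi>\<bar> * (LINT \<eta>|lborel. \<bar>K1 (\<xi> - \<eta>) * f \<eta>\<bar>)"
          unfolding F_def by (simp add: abs_mult)
        also have "\<dots> \<le> \<bar>f \<xi>\<bar> * (LINT \<eta>|lborel. \<bar>f \<eta>\<bar> / norm (\<xi> - \<eta>))"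
        proof (intro mult_left_mono integral_mono integrable_abs ik rapid_kernel_integrable r)
          fix \<eta>
          show "\<bar>K1 (\<xi> - \<eta>) * f \<eta>\<bar> \<le> \<bar>f \<eta>\<bar> / norm (\<xi> - \<eta>)"
            using mult_right_mono[OF abs_K1_le[of "\<xi> - \<eta>"] abs_ge_zero[of "f \<eta>"]] by (simp add: abs_mult)
        qed simp
        also have "\<dots> \<le> \<bar>f \<xi>\<bar> * K" by (intro mult_left_mono K) simp
        finally have "(LINT \<eta>|lborel. norm (F \<xi> \<eta>)) \<le> \<bar>f \<xi>\<bar> * K" .
        moreover have "0 \<le> (LINT \<eta>|lborel. norm (F \<xi> \<eta>))" by (intro Bochner_Integration.integral_nonneg) simp
        ultimately show "norm (LINT \<eta>|lborel. norm (F (fst (\<xi>, \<eta>)) (snd (\<xi>, \<eta>)))) \<le> norm (K * \<bar>f \<xi>\<bar>)"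
          using K(1) by (simp add: abs_mult mult.commute)
      qed
    qed
  qed
  then have "integrable (lborel \<Otimes>\<^sub>M lborel) (case_prod F)" by (simp add: case_prod_beta')
  from lborel_pair.Fubini_integral[OF this]
  have "(LINT \<xi>|lborel. LINT \<eta>|lborel. F \<xi> \<eta>) = (LINT \<eta>|lborel. LINT \<xi>|lborel. F \<xi> \<eta>)" ..
  also have "\<dots> = (LINT \<eta>|lborel. LINT \<xi>|lborel. - F \<eta> \<xi>)"
  proof (intro Bochner_Integration.integral_cong refl)
    fix \<xi> \<eta> :: plane
    have "K1 (\<xi> - \<eta>) = - K1 (\<eta> - \<xi>)" by (simp add: K1_def norm_minus_commute minus_divide_left)
    then show "F \<xi> \<eta> = - F \<eta> \<xi>" by (simp add: F_def)
  qed
  also have "\<dots> = - (LINT \<eta>|lborel. LINT \<xi>|lborel. F \<eta> \<xi>)" by simp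
  finally have z: "(LINT \<xi>|lborel. LINT \<eta>|lborel. F \<xi> \<eta>) = 0" by linarith
  have "f \<xi> * pd1 (inv_laplace f) \<xi> = 1 / (2 * pi) * (LINT \<eta>|lborel. F \<xi> \<eta>)" for \<xi>
    by (simp add: pd_inv_laplace[OF f] inv_laplace_pd1_kernel[OF f] F_def)
  then show ?thesis using z by (simp only: integral_mult_right_zero mult_zero_right)
qed

lemma inv_laplace_add:
  assumes "rapid f" "rapid g"
  shows "inv_laplace (\<lambda>\<xi>. f \<xi> + g \<xi>) = (\<lambda>\<xi>. inv_laplace f \<xi> + inv_laplace g \<xi>)"
  unfolding inv_laplace_def
  by (simp only: distrib_left Bochner_Integration.integral_add log_integrable[OF assms(1)] log_integrable[OF assms(2)])

lemma inv_laplace_cmult: "inv_laplace (\<lambda>\<xi>. c * f \<xi>) = (\<lambda>\<xi>. c * inv_laplace f \<xi>)"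
  unfolding inv_laplace_def mult.left_commute[of _ c] integral_mult_right_zero ..

lemma velocity_add:
  assumes "nice1 f" "nice1 g"
  shows "pd1 (inv_laplace (\<lambda>\<xi>. f \<xi> + g \<xi>)) \<xi> = pd1 (inv_laplace f) \<xi> + pd1 (inv_laplace g) \<xi>"
proof -
  have r: "rapid f" "rapid g" using assms by (simp_all add: nice1_def)
  show ?thesis
    unfolding inv_laplace_add[OF r] pd_add(1)[OF pd_inv_laplace(3)[OF assms(1)] pd_inv_laplace(3)[OF assms(2)]] ..
qed

lemma velocity_cmult:
  assumes "nice1 f"
  shows "pd1 (inv_laplace (\<lambda>\<xi>. c * f \<xi>)) \<xi> = c * pd1 (inv_laplace f) \<xi>"
  unfolding inv_laplace_cmult pd_cmult(1)[OF pd_inv_laplace(3)[OF assms]] ..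

lemma interaction_add_left:
  assumes "rapid f" "rapid g" "nice1 h"
  shows "interaction \<epsilon> (\<lambda>\<xi>. f \<xi> + g \<xi>) h = interaction \<epsilon> f h + interaction \<epsilon> g h"
  unfolding interaction_def distrib_right
  by (intro Bochner_Integration.integral_add rapid_integrable rapid_interaction assms)

lemma interaction_cmult_left: "interaction \<epsilon> (\<lambda>\<xi>. c * f \<xi>) h = c * interaction \<epsilon> f h"
  unfolding interaction_def mult.assoc[of c] integral_mult_right_zero ..

lemma interaction_add_right:
  assumes "rapid f" "nice1 g" "nice1 h"
  shows "interaction \<epsilon> f (\<lambda>\<xi>. g \<xi> + h \<xi>) = interaction \<epsilon> f g + interaction \<epsilon> f h"
  unfolding interaction_def velocity_add[OF assms(2,3)] distrib_left
  by (intro Bochner_Integration.integral_add rapid_integrable rapid_interaction assms)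

lemma interaction_cmult_right:
  assumes "nice1 g"
  shows "interaction \<epsilon> f (\<lambda>\<xi>. c * g \<xi>) = c * interaction \<epsilon> f g"
proof -
  have "f \<xi> * (- 2 * pi * (c * X)) = c * (f \<xi> * (- 2 * pi * X))" for \<xi> X by simp
  then show ?thesis unfolding interaction_def velocity_cmult[OF assms] by (simp only: integral_mult_right_zero)
qed

section \<open>Moments of the remainder\<close>

lemma d_eps_Omega_app:
  "d_eps (Omega_app wE wNS k \<delta>) \<epsilon> \<xi> = (\<Sum>j=2..k. (real j * \<epsilon> ^ (j - Suc 0)) * profile wE wNS \<delta> j \<xi>)"
proof -
  have "((\<lambda>e. gaussian \<xi> + (\<Sum>j=2..k. e ^ j * profile wE wNS \<delta> j \<xi>)) has_real_derivative
      0 + (\<Sum>j=2..k. (real j * \<epsilon> ^ (j - Suc 0)) * profile wE wNS \<delta> j \<xi>)) (at \<epsilon>)"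
    by (intro DERIV_add DERIV_const DERIV_sum DERIV_cmult_right DERIV_pow)
  then show ?thesis unfolding d_eps_def Omega_app_def by (simp add: DERIV_imp_deriv)
qed

lemma integral_weighted_sum:
  assumes "tempered \<phi>" "\<And>j. j \<in> A \<Longrightarrow> rapid (f j)"
  shows "rapid (\<lambda>\<xi>. \<Sum>j\<in>A. c j * f j \<xi>)"
    and "(LINT \<xi>|lborel. \<phi> \<xi> * (\<Sum>j\<in>A. c j * f j \<xi>)) = (\<Sum>j\<in>A. c j * (LINT \<xi>|lborel. \<phi> \<xi> * f j \<xi>))"
proof -
  show "rapid (\<lambda>\<xi>. \<Sum>j\<in>A. c j * f j \<xi>)" by (intro rapid_sum rapid_cmult assms)
  have e: "\<phi> \<xi> * (\<Sum>j\<in>A. c j * f j \<xi>) = (\<Sum>j\<in>A. c j * (\<phi> \<xi> * f j \<xi>))" for \<xi>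
    unfolding sum_distrib_left by (intro sum.cong refl) (simp only: mult_ac)
  show "(LINT \<xi>|lborel. \<phi> \<xi> * (\<Sum>j\<in>A. c j * f j \<xi>)) = (\<Sum>j\<in>A. c j * (LINT \<xi>|lborel. \<phi> \<xi> * f j \<xi>))"
    unfolding e
    by (subst Bochner_Integration.integral_sum)
      (auto intro!: integrable_mult_right rapid_integrable tempered_mult_rapid assms)
qed

definition moment :: "(plane \<Rightarrow> real) \<Rightarrow> (plane \<Rightarrow> real) \<Rightarrow> real" where
  "moment \<phi> f = (LINT \<xi>|lborel. \<phi> \<xi> * f \<xi>)"

lemma moment2_moment: "moment2 f = moment snd f"
  by (simp add: moment_def moment2_def)

lemma moment_add:
  assumes "tempered \<phi>" "rapid f" "rapid g"
  shows "moment \<phi> (\<lambda>\<xi>. f \<xi> + g \<xi>) = moment \<phi> f + moment \<phi> g"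
  unfolding moment_def distrib_left
  by (intro Bochner_Integration.integral_add rapid_integrable tempered_mult_rapid assms)

lemma moment_cmult: "moment \<phi> (\<lambda>\<xi>. c * f \<xi>) = c * moment \<phi> f"
  unfolding moment_def mult.left_commute[of _ c] integral_mult_right_zero ..

lemma moment_sum:
  assumes "tempered \<phi>" "\<And>j. j \<in> A \<Longrightarrow> rapid (f j)"
  shows "moment \<phi> (\<lambda>\<xi>. \<Sum>j\<in>A. c j * f j \<xi>) = (\<Sum>j\<in>A. c j * moment \<phi> (f j))"
  unfolding moment_def by (rule integral_weighted_sum(2)[OF assms])

definition nice_profiles :: "(nat \<Rightarrow> plane \<Rightarrow> real) \<Rightarrow> (nat \<Rightarrow> plane \<Rightarrow> real) \<Rightarrow> nat \<Rightarrow> bool" where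
  "nice_profiles wE wNS k \<longleftrightarrow> (\<forall>j\<in>{2..k}. nice2 (wE j) \<and> nice2 (wNS j))"

lemma nice2_profile:
  assumes "nice_profiles wE wNS k" "j \<in> {2..k}"
  shows "nice2 (profile wE wNS \<delta> j)"
proof -
  have "nice2 (\<lambda>\<xi>. wE j \<xi> + \<delta> * wNS j \<xi>)"
    using assms unfolding nice_profiles_def by (intro nice2_add nice2_cmult) blast+
  then show ?thesis by (simp add: profile_def[abs_def])
qed

lemma nice2_Omega_app:
  assumes "nice_profiles wE wNS k"
  shows "nice2 (Omega_app wE wNS k \<delta> \<epsilon>)"
  unfolding Omega_app_def[abs_def]
  by (intro nice2_add nice2_gaussian nice2_sum nice2_cmult nice2_profile[OF assms])

text \<open>Diffusion and bracket have integral 0, so the mass comes from the \<epsilon>-derivative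
  alone. Against \<xi>2 the bracket leaves the integral of the horizontal derivative of the
  potential times \<open>\<Omega>\<close>: the vortex exerts no net force on itself, and its image
  and the translation term remain.\<close>

lemma remainder_moments:
  fixes \<delta> \<epsilon> :: real and zE zNS :: "nat \<Rightarrow> real"
  assumes N: "nice_profiles wE wNS k" and \<epsilon>: "\<epsilon> > 0"
  defines "\<Omega> \<equiv> Omega_app wE wNS k \<delta> \<epsilon>" and "R \<equiv> remainder wE wNS zE zNS k \<delta> \<epsilon>"
  shows "rapid R"
    and "moment (\<lambda>\<xi>. 1) R = - \<delta> * (\<Sum>j=2..k. (real j / 2 * \<epsilon> ^ j) * moment (\<lambda>\<xi>. 1) (profile wE wNS \<delta> j))"
    and "moment snd R = - \<delta> * (moment snd \<Omega> / 2 + (\<Sum>j=2..k. (real j / 2 * \<epsilon> ^ j) * moment snd (profile wE wNS \<delta> j)))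
      + (interaction \<epsilon> \<Omega> \<Omega> - \<epsilon> * zeta_app zE zNS k \<delta> \<epsilon> * moment (\<lambda>\<xi>. 1) \<Omega>) / (2 * pi)"
proof -
  have O: "nice2 \<Omega>" unfolding \<Omega>_def by (rule nice2_Omega_app[OF N])
  note D = nice2D[OF O]
  define \<Psi> where "\<Psi> = inv_laplace \<Omega>"
  have \<Psi>: "slice_diff \<Psi>" "tempered \<Psi>" "tempered (pd1 \<Psi>)" "tempered (pd2 \<Psi>)"
    unfolding \<Psi>_def by (intro pd_inv_laplace(3) tempered_inv_laplace_pd D(1))+
  define c where "c = \<epsilon> * zeta_app zE zNS k \<delta> \<epsilon> / (2 * pi)"
  define F where "F \<eta> = \<Psi> \<eta> - \<Psi> (image_point \<epsilon> \<eta>) + c * fst \<eta>" for \<eta>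
  note dF1 = DERIV_add[OF DERIV_diff[OF slice_diff_pd1[OF \<Psi>(1)] pd_image(1)[OF \<Psi>(1)]] DERIV_cmult[OF DERIV_ident]]
  note dF2 = DERIV_diff[OF slice_diff_pd2[OF \<Psi>(1)] pd_image(2)[OF \<Psi>(1)]]
  \<comment> \<open>The reflected potential enters with a minus sign, and the reflection reverses
    its first derivative; hence the double minus.\<close>
  define F1 where "F1 \<eta> = pd1 \<Psi> \<eta> - - pd1 \<Psi> (image_point \<epsilon> \<eta>) + c * 1" for \<eta>
  define F2 where "F2 \<eta> = pd2 \<Psi> \<eta> - pd2 \<Psi> (image_point \<epsilon> \<eta>)" for \<eta>
  have d1: "((\<lambda>s. F (s, y)) has_real_derivative F1 (x, y)) (at x)" for x y
    unfolding F_def F1_def fst_conv by (rule dF1)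
  have d2: "((\<lambda>s. F (x, s)) has_real_derivative F2 (x, y)) (at y)" for x y
    unfolding F_def F2_def fst_conv by (rule DERIV_cong[OF DERIV_add[OF dF2 DERIV_const]]) simp
  have pF: "pd1 F = F1" "pd2 F = F2" by (rule pd1_eqI[OF d1], rule pd2_eqI[OF d2])
  have sF: "slice_diff F" by (rule slice_diffI[OF d1 d2])
  have tF: "tempered F" "tempered (pd1 F)" "tempered (pd2 F)"
  proof -
    show "tempered F" unfolding F_def
      by (intro tempered_add tempered_diff tempered_mult tempered_const tempered_fst tempered_image \<Psi>)
    have "tempered (\<lambda>\<eta>. - 1 * pd1 \<Psi> (image_point \<epsilon> \<eta>))"
      by (intro tempered_mult tempered_const tempered_image \<Psi>)
    then show "tempered (pd1 F)" unfolding pF F1_def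
      by (intro tempered_add tempered_diff tempered_const \<Psi>) simp
    show "tempered (pd2 F)" unfolding pF F2_def
      by (intro tempered_diff tempered_image \<Psi>)
  qed
  note B = bracket_integrals[OF sF tF O]
  note L = diffusion_integrals[OF O]
  define s where "s \<xi> = (\<Sum>j=2..k. (real j / 2 * \<epsilon> ^ j) * profile wE wNS \<delta> j \<xi>)" for \<xi>
  have rp: "rapid (profile wE wNS \<delta> j)" if "j \<in> {2..k}" for j using nice2D(5)[OF nice2_profile[OF N that]] .
  have rs: "rapid s" unfolding s_def by (intro rapid_sum rapid_cmult rp)
  have sm: "moment \<phi> s = (\<Sum>j=2..k. (real j / 2 * \<epsilon> ^ j) * moment \<phi> (profile wE wNS \<delta> j))" if "tempered \<phi>" for \<phi>
    unfolding s_def by (rule moment_sum[OF that rp])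
  have es: "\<epsilon> / 2 * d_eps (Omega_app wE wNS k \<delta>) \<epsilon> \<xi> = s \<xi>" for \<xi>
  proof -
    have "\<epsilon> / 2 * (real j * \<epsilon> ^ (j - Suc 0) * p) = real j / 2 * \<epsilon> ^ j * p" if "j \<in> {2..k}" for j and p :: real
    proof -
      have "j = Suc (j - Suc 0)" using that by simp
      then have "\<epsilon> ^ j = \<epsilon> * \<epsilon> ^ (j - Suc 0)" by (metis power_Suc)
      then show ?thesis by simp
    qed
    then show ?thesis unfolding d_eps_Omega_app s_def sum_distrib_left by (intro sum.cong refl)
  qed
  have R: "R = (\<lambda>\<xi>. \<delta> * (diffusion \<Omega> \<xi> - s \<xi>) + bracket F \<Omega> \<xi>)"
  proof
    fix \<xi>
    have "(\<lambda>\<eta>. Psi_app wE wNS k \<delta> \<epsilon> \<eta> - reflect_shift \<epsilon> (Psi_app wE wNS k \<delta> \<epsilon>) \<eta>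
       + \<epsilon> * fst \<eta> / (2 * pi) * zeta_app zE zNS k \<delta> \<epsilon>) = F"
      unfolding F_def[abs_def] \<Psi>_def \<Omega>_def Psi_app_def reflect_shift_def image_point_def c_def
      by (intro ext) simp
    then show "R \<xi> = \<delta> * (diffusion \<Omega> \<xi> - s \<xi>) + bracket F \<Omega> \<xi>"
      unfolding R_def remainder_def es \<Omega>_def by simp
  qed
  show "rapid R" unfolding R by (intro rapid_add rapid_cmult rapid_diff L(1) rs B(1))
  have mR: "moment \<phi> R = \<delta> * (moment \<phi> (diffusion \<Omega>) - moment \<phi> s) + moment \<phi> (bracket F \<Omega>)" if "tempered \<phi>" for \<phi>
  proof -
    have i: "integrable lborel (\<lambda>\<xi>. \<phi> \<xi> * diffusion \<Omega> \<xi>)" "integrable lborel (\<lambda>\<xi>. \<phi> \<xi> * s \<xi>)" "integrable lborel (\<lambda>\<xi>. \<phi> \<xi> * bracket F \<Omega> \<xi>)"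
      by (intro rapid_integrable tempered_mult_rapid that L(1) rs B(1))+
    have e: "\<phi> \<xi> * R \<xi> = \<delta> * (\<phi> \<xi> * diffusion \<Omega> \<xi> - \<phi> \<xi> * s \<xi>) + \<phi> \<xi> * bracket F \<Omega> \<xi>" for \<xi>
      unfolding R by (simp add: algebra_simps)
    show ?thesis unfolding moment_def e
      by (simp only: Bochner_Integration.integral_add Bochner_Integration.integral_diff integral_mult_right_zero
          integrable_mult_right Bochner_Integration.integrable_diff i)
  qed
  show "moment (\<lambda>\<xi>. 1) R = - \<delta> * (\<Sum>j=2..k. (real j / 2 * \<epsilon> ^ j) * moment (\<lambda>\<xi>. 1) (profile wE wNS \<delta> j))"
    unfolding mR[OF tempered_const] sm[OF tempered_const, symmetric] using L(2) B(2) by (simp add: moment_def)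
  have "(LINT \<xi>|lborel. pd1 F \<xi> * \<Omega> \<xi>) = (LINT \<xi>|lborel. \<Omega> \<xi> * pd1 \<Psi> \<xi>
      + (- 1 / (2 * pi)) * (\<Omega> \<xi> * (- 2 * pi * pd1 \<Psi> (image_point \<epsilon> \<xi>))) + c * (1 * \<Omega> \<xi>))"
    unfolding pF F1_def by (intro Bochner_Integration.integral_cong refl) (simp add: field_simps)
  also have "\<dots> = 0 + (- 1 / (2 * pi)) * interaction \<epsilon> \<Omega> \<Omega> + c * moment (\<lambda>\<xi>. 1) \<Omega>"
  proof -
    have i: "integrable lborel (\<lambda>\<xi>. \<Omega> \<xi> * pd1 \<Psi> \<xi>)" "integrable lborel (\<lambda>\<xi>. 1 * \<Omega> \<xi>)"
      "integrable lborel (\<lambda>\<xi>. \<Omega> \<xi> * (- 2 * pi * pd1 \<Psi> (image_point \<epsilon> \<xi>)))"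
      unfolding \<Psi>_def
      by (intro rapid_integrable rapid_mult_tempered tempered_inv_laplace_pd rapid_cmult rapid_interaction D)+
    have z: "(LINT \<xi>|lborel. \<Omega> \<xi> * pd1 \<Psi> \<xi>) = 0"
      unfolding \<Psi>_def by (rule self_velocity_zero[OF D(1)])
    show ?thesis unfolding interaction_def moment_def \<Psi>_def[symmetric]
      by (simp only: Bochner_Integration.integral_add integral_mult_right_zero integrable_mult_right
          Bochner_Integration.integrable_add i z)
  qed
  finally have "moment snd (bracket F \<Omega>) = (interaction \<epsilon> \<Omega> \<Omega> - \<epsilon> * zeta_app zE zNS k \<delta> \<epsilon> * moment (\<lambda>\<xi>. 1) \<Omega>) / (2 * pi)"
    unfolding moment_def[of snd] B(3) by (simp add: c_def diff_divide_distrib)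
  moreover have "moment snd (diffusion \<Omega>) = - moment snd \<Omega> / 2" unfolding moment_def L(3) by simp
  ultimately show "moment snd R = - \<delta> * (moment snd \<Omega> / 2 + (\<Sum>j=2..k. (real j / 2 * \<epsilon> ^ j) * moment snd (profile wE wNS \<delta> j)))
      + (interaction \<epsilon> \<Omega> \<Omega> - \<epsilon> * zeta_app zE zNS k \<delta> \<epsilon> * moment (\<lambda>\<xi>. 1) \<Omega>) / (2 * pi)"
    unfolding mR[OF tempered_snd] sm[OF tempered_snd] by (simp add: right_diff_distrib distrib_left)
qed

section \<open>Comparison of coefficients\<close>

lemma weight_measurable [measurable]: "weight \<in> borel_measurable borel"
  unfolding weight_def by measurable

lemma bigO_Z_bound:
  assumes "bigO_Z K f"
  obtains \<epsilon>0 C N where "\<epsilon>0 > 0"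
    "\<And>\<epsilon>. 0 < \<epsilon> \<Longrightarrow> \<epsilon> < \<epsilon>0 \<Longrightarrow> f \<epsilon> \<in> borel_measurable borel"
    "\<And>\<epsilon> \<xi>. 0 < \<epsilon> \<Longrightarrow> \<epsilon> < \<epsilon>0 \<Longrightarrow> \<bar>f \<epsilon> \<xi>\<bar> \<le> \<bar>C\<bar> * \<epsilon> ^ K * ((1 + norm \<xi>) ^ N * ew \<xi>)"
proof -
  define g where "g = (\<lambda>\<epsilon> \<xi>. weight \<xi> * f \<epsilon> \<xi>)"
  have "bigO_S K g" using assms by (simp only: bigO_Z_def g_def)
  then obtain \<epsilon>0 where e0: "\<epsilon>0 > 0" and
     s: "\<forall>m\<le>K. \<forall>\<epsilon>\<in>{0<..<\<epsilon>0}. smooth_plane ((d_eps ^^ m) g \<epsilon>)" and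
     b: "\<forall>a b. \<forall>m\<le>K. \<exists>C (N::nat). \<forall>\<epsilon>\<in>{0<..<\<epsilon>0}. \<forall>\<xi>. \<bar>pd a b ((d_eps ^^ m) g \<epsilon>) \<xi>\<bar> \<le> C * (1 + norm \<xi>) ^ N * \<epsilon> ^ (K - m)"
    unfolding bigO_S_def by blast
  have s0: "smooth_plane (g \<epsilon>)" if "0 < \<epsilon>" "\<epsilon> < \<epsilon>0" for \<epsilon>
    using s[rule_format, of 0 \<epsilon>] that by simp
  have "\<exists>C (N::nat). \<forall>\<epsilon>\<in>{0<..<\<epsilon>0}. \<forall>\<xi>. \<bar>pd 0 0 ((d_eps ^^ 0) g \<epsilon>) \<xi>\<bar> \<le> C * (1 + norm \<xi>) ^ N * \<epsilon> ^ (K - 0)"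
    using b by blast
  then obtain C N where C: "\<forall>\<epsilon>\<in>{0<..<\<epsilon>0}. \<forall>\<xi>. \<bar>g \<epsilon> \<xi>\<bar> \<le> C * (1 + norm \<xi>) ^ N * \<epsilon> ^ K"
    unfolding pd_def funpow_0 diff_zero by blast
  have f: "f \<epsilon> = (\<lambda>\<xi>. ew \<xi> * g \<epsilon> \<xi>)" for \<epsilon>
    unfolding g_def by (rule ext) (rule Z_space_ew)
  have ewm: "ew \<in> borel_measurable borel" by (rule rapid_measurable[OF rapid_ew])
  show ?thesis
  proof (rule that[OF e0])
    fix \<epsilon> assume e: "0 < \<epsilon>" "\<epsilon> < \<epsilon>0"
    have "pd 0 0 (g \<epsilon>) differentiable_on UNIV" using s0[OF e] unfolding smooth_plane_def by blast
    then have "continuous_on UNIV (g \<epsilon>)"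
      unfolding pd_def funpow_0 by (rule differentiable_imp_continuous_on)
    then have [measurable]: "g \<epsilon> \<in> borel_measurable borel" by (rule borel_measurable_continuous_onI)
    show "f \<epsilon> \<in> borel_measurable borel" unfolding f using ewm by measurable
    fix \<xi>
    have ew0: "ew \<xi> \<ge> 0" by (simp add: ew_def)
    have "\<bar>g \<epsilon> \<xi>\<bar> \<le> C * (1 + norm \<xi>) ^ N * \<epsilon> ^ K" using C e by (metis greaterThanLessThan_iff)
    also have "\<dots> \<le> \<bar>C\<bar> * (1 + norm \<xi>) ^ N * \<epsilon> ^ K" using e by (intro mult_right_mono) auto
    finally have "ew \<xi> * \<bar>g \<epsilon> \<xi>\<bar> \<le> ew \<xi> * (\<bar>C\<bar> * (1 + norm \<xi>) ^ N * \<epsilon> ^ K)" by (rule mult_left_mono[OF _ ew0])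
    then show "\<bar>f \<epsilon> \<xi>\<bar> \<le> \<bar>C\<bar> * \<epsilon> ^ K * ((1 + norm \<xi>) ^ N * ew \<xi>)"
      unfolding f abs_mult abs_of_nonneg[OF ew0] by (simp only: mult_ac)
  qed
qed

lemma bigO_Z_integral:
  assumes f: "bigO_Z K f" and \<phi>: "tempered \<phi>"
  shows "\<exists>C. \<forall>\<^sub>F \<epsilon> in at_right 0. integrable lborel (\<lambda>\<xi>. \<phi> \<xi> * f \<epsilon> \<xi>) \<and> \<bar>LINT \<xi>|lborel. \<phi> \<xi> * f \<epsilon> \<xi>\<bar> \<le> C * \<epsilon> ^ K"
proof -
  obtain \<epsilon>0 C N where e0: "\<epsilon>0 > 0"
    and m: "\<And>\<epsilon>. 0 < \<epsilon> \<Longrightarrow> \<epsilon> < \<epsilon>0 \<Longrightarrow> f \<epsilon> \<in> borel_measurable borel"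
    and b: "\<And>\<epsilon> \<xi>. 0 < \<epsilon> \<Longrightarrow> \<epsilon> < \<epsilon>0 \<Longrightarrow> \<bar>f \<epsilon> \<xi>\<bar> \<le> \<bar>C\<bar> * \<epsilon> ^ K * ((1 + norm \<xi>) ^ N * ew \<xi>)"
    by (rule bigO_Z_bound[OF f]) (rule that)
  define W where "W \<xi> = \<bar>\<phi> \<xi> * ((1 + norm \<xi>) ^ N * ew \<xi>)\<bar>" for \<xi>
  have rW: "rapid W" unfolding W_def
    by (intro rapid_abs tempered_mult_rapid tempered_power tempered_add tempered_const tempered_norm rapid_ew \<phi>)
  have *: "integrable lborel (\<lambda>\<xi>. \<phi> \<xi> * f \<epsilon> \<xi>) \<and> \<bar>LINT \<xi>|lborel. \<phi> \<xi> * f \<epsilon> \<xi>\<bar> \<le> (\<bar>C\<bar> * (LINT \<xi>|lborel. W \<xi>)) * \<epsilon> ^ K"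
    if e: "0 < \<epsilon>" "\<epsilon> < \<epsilon>0" for \<epsilon>
  proof -
    note [measurable] = m[OF e] tempered_measurable[OF \<phi>]
    have le: "norm (\<phi> \<xi> * f \<epsilon> \<xi>) \<le> \<bar>C\<bar> * \<epsilon> ^ K * W \<xi>" for \<xi>
    proof -
      have "0 \<le> (1 + norm \<xi>) ^ N * ew \<xi>" by (simp add: ew_def)
      then have W: "W \<xi> = \<bar>\<phi> \<xi>\<bar> * ((1 + norm \<xi>) ^ N * ew \<xi>)" unfolding W_def abs_mult[of "\<phi> \<xi>"] by simp
      have "\<bar>\<phi> \<xi>\<bar> * \<bar>f \<epsilon> \<xi>\<bar> \<le> \<bar>\<phi> \<xi>\<bar> * (\<bar>C\<bar> * \<epsilon> ^ K * ((1 + norm \<xi>) ^ N * ew \<xi>))"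
        by (intro mult_left_mono b e abs_ge_zero)
      then show ?thesis unfolding W real_norm_def abs_mult by (simp only: mult_ac)
    qed
    have iW: "integrable lborel (\<lambda>\<xi>. \<bar>C\<bar> * \<epsilon> ^ K * W \<xi>)" by (intro integrable_mult_right rapid_integrable rW)
    have i: "integrable lborel (\<lambda>\<xi>. \<phi> \<xi> * f \<epsilon> \<xi>)"
    proof (rule Bochner_Integration.integrable_bound[OF iW])
      show "(\<lambda>\<xi>. \<phi> \<xi> * f \<epsilon> \<xi>) \<in> borel_measurable lborel" by measurable
      show "AE \<xi> in lborel. norm (\<phi> \<xi> * f \<epsilon> \<xi>) \<le> norm (\<bar>C\<bar> * \<epsilon> ^ K * W \<xi>)"
        by (rule AE_I2) (rule order_trans[OF le], simp)
    qed
    have "norm (LINT \<xi>|lborel. \<phi> \<xi> * f \<epsilon> \<xi>) \<le> (LINT \<xi>|lborel. norm (\<phi> \<xi> * f \<epsilon> \<xi>))" by (rule integral_norm_bound)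
    also have "\<dots> \<le> (LINT \<xi>|lborel. \<bar>C\<bar> * \<epsilon> ^ K * W \<xi>)"
      by (rule integral_mono[OF integrable_norm[OF i] iW le])
    also have "\<dots> = (\<bar>C\<bar> * (LINT \<xi>|lborel. W \<xi>)) * \<epsilon> ^ K" unfolding integral_mult_right_zero by (simp only: mult_ac)
    finally show ?thesis using i by simp
  qed
  show ?thesis
    by (rule exI[of _ "\<bar>C\<bar> * (LINT \<xi>|lborel. W \<xi>)"], rule eventually_at_rightI[OF _ e0], rule *) simp_all
qed

text \<open>Powers of \<delta> from the second on are at most \<delta>^2 on (0, 1]. The conditional
  accounts for n = 0, where the sum has no linear term.\<close>

lemma linear_part_estimate:
  fixes F :: "nat \<Rightarrow> real"
  assumes "0 < \<delta>" "\<delta> \<le> 1"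
  shows "\<bar>(\<Sum>j\<le>n. \<delta> ^ j * F j) - F 0 - \<delta> * (if n = 0 then 0 else F 1)\<bar> \<le> \<delta>\<^sup>2 * (\<Sum>j\<le>n. \<bar>F j\<bar>)"
proof (induction n)
  case (Suc n)
  show ?case
  proof (cases "n = 0")
    case False
    then have "\<delta> ^ Suc n \<le> \<delta>\<^sup>2" using assms by (intro power_decreasing) auto
    then have "\<bar>\<delta> ^ Suc n * F (Suc n)\<bar> \<le> \<delta>\<^sup>2 * \<bar>F (Suc n)\<bar>"
      unfolding abs_mult using assms by (intro mult_right_mono) auto
    then show ?thesis using Suc False by (simp add: distrib_left)
  qed (simp add: assms)
qed (simp add: assms)

lemma linear_le_quadratic:
  fixes a0 a1 B :: real
  assumes "\<And>\<delta>. 0 < \<delta> \<Longrightarrow> \<delta> \<le> 1 \<Longrightarrow> \<bar>a0 + \<delta> * a1\<bar> \<le> B * \<delta>\<^sup>2"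
  shows "a0 = 0" "a1 = 0"
proof -
  have ev: "\<forall>\<^sub>F \<delta>::real in at_right 0. 0 < \<delta> \<and> \<delta> \<le> 1" by (rule eventually_at_rightI[of 0 1]) auto
  have "((\<lambda>\<delta>. \<bar>a0 + \<delta> * a1\<bar> - B * \<delta>\<^sup>2) \<longlongrightarrow> \<bar>a0 + 0 * a1\<bar> - B * 0\<^sup>2) (at_right 0)"
    by (intro tendsto_intros)
  moreover have "\<forall>\<^sub>F \<delta> in at_right 0. \<bar>a0 + \<delta> * a1\<bar> - B * \<delta>\<^sup>2 \<le> 0"
    using ev by eventually_elim (use assms in force)
  ultimately have "\<bar>a0 + 0 * a1\<bar> - B * 0\<^sup>2 \<le> 0" by (rule tendsto_upperbound) simp
  then show a0: "a0 = 0" by simp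
  have le: "\<bar>a1\<bar> - B * \<delta> \<le> 0" if "0 < \<delta>" "\<delta> \<le> 1" for \<delta>
  proof -
    have "\<delta> * \<bar>a1\<bar> \<le> \<delta> * (B * \<delta>)" using assms[OF that] that a0 by (simp add: abs_mult power2_eq_square mult_ac)
    then show ?thesis using that by (simp add: mult_le_cancel_left_pos)
  qed
  have "((\<lambda>\<delta>. \<bar>a1\<bar> - B * \<delta>) \<longlongrightarrow> \<bar>a1\<bar> - B * 0) (at_right 0)"
    by (intro tendsto_intros)
  moreover have "\<forall>\<^sub>F \<delta> in at_right 0. \<bar>a1\<bar> - B * \<delta> \<le> 0"
    using ev by eventually_elim (use le in blast)
  ultimately have "\<bar>a1\<bar> - B * 0 \<le> 0" by (rule tendsto_upperbound) simp
  then show "a1 = 0" by simp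
qed

lemma leading_coefficient_unique:
  fixes q :: "real \<Rightarrow> real"
  assumes "\<forall>\<^sub>F \<epsilon> in at_right 0. \<bar>q \<epsilon> - \<epsilon> ^ m * x\<bar> \<le> C * \<epsilon> ^ Suc m"
    and "\<forall>\<^sub>F \<epsilon> in at_right 0. \<bar>q \<epsilon> - \<epsilon> ^ m * y\<bar> \<le> D * \<epsilon> ^ Suc m"
  shows "x = y"
proof -
  have ev: "\<forall>\<^sub>F \<epsilon>::real in at_right 0. 0 < \<epsilon>" by (rule eventually_at_rightI[of 0 1]) auto
  have le: "\<forall>\<^sub>F \<epsilon> in at_right 0. \<bar>x - y\<bar> - (C + D) * \<epsilon> \<le> 0"
    using assms ev
  proof eventually_elim
    case (elim \<epsilon>)
    have "\<bar>\<epsilon> ^ m * x - \<epsilon> ^ m * y\<bar> \<le> C * \<epsilon> ^ Suc m + D * \<epsilon> ^ Suc m" using elim by linarith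
    moreover have "\<bar>\<epsilon> ^ m * x - \<epsilon> ^ m * y\<bar> = \<epsilon> ^ m * \<bar>x - y\<bar>"
      using elim(3) by (simp add: abs_mult flip: right_diff_distrib)
    moreover have "C * \<epsilon> ^ Suc m + D * \<epsilon> ^ Suc m = \<epsilon> ^ m * ((C + D) * \<epsilon>)"
      by (simp add: algebra_simps)
    ultimately have "\<epsilon> ^ m * \<bar>x - y\<bar> \<le> \<epsilon> ^ m * ((C + D) * \<epsilon>)" by simp
    then show ?case using elim(3) by (simp add: mult_le_cancel_left_pos)
  qed
  have lim: "((\<lambda>\<epsilon>. \<bar>x - y\<bar> - (C + D) * \<epsilon>) \<longlongrightarrow> \<bar>x - y\<bar> - (C + D) * 0) (at_right 0)"
    by (intro tendsto_intros)
  have "\<bar>x - y\<bar> - (C + D) * 0 \<le> 0" by (rule tendsto_upperbound[OF lim le]) simp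
  then show ?thesis by simp
qed

text \<open>The terms of order \<open>\<delta>\<^sup>2\<close> do not interfere because everything is polynomial in \<open>\<delta>\<close>.\<close>

lemma bigO_Z_delta_coefficients:
  assumes R: "bigO_Z_delta K R" and \<phi>: "tempered \<phi>"
    and p: "\<And>\<epsilon> \<delta>. 0 < \<epsilon> \<Longrightarrow> 0 < \<delta> \<Longrightarrow> \<delta> \<le> 1 \<Longrightarrow> (LINT \<xi>|lborel. \<phi> \<xi> * R \<delta> \<epsilon> \<xi>) = p0 \<epsilon> + \<delta> * p1 \<epsilon> + \<delta>\<^sup>2 * p2 \<epsilon>"
  shows "\<exists>C. \<forall>\<^sub>F \<epsilon> in at_right 0. \<bar>p0 \<epsilon>\<bar> \<le> C * \<epsilon> ^ K \<and> \<bar>p1 \<epsilon>\<bar> \<le> C * \<epsilon> ^ K"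
proof -
  obtain n :: nat and f g where fg: "\<forall>j\<le>n. bigO_Z K (f j) \<and> bigO_Z 2 (g j)"
    and R': "\<forall>\<delta>\<in>{0<..1}. \<forall>\<epsilon>>0. \<forall>\<xi>. R \<delta> \<epsilon> \<xi> = (\<Sum>j\<le>n. \<delta> ^ j * f j \<epsilon> \<xi>) + \<delta>\<^sup>2 * (\<Sum>j\<le>n. \<delta> ^ j * g j \<epsilon> \<xi>)"
    using R unfolding bigO_Z_delta_def by blast
  define F where "F j \<epsilon> = (LINT \<xi>|lborel. \<phi> \<xi> * f j \<epsilon> \<xi>)" for j \<epsilon>
  define G where "G j \<epsilon> = (LINT \<xi>|lborel. \<phi> \<xi> * g j \<epsilon> \<xi>)" for j \<epsilon>
  have "\<forall>j\<in>{..n}. \<exists>C. \<forall>\<^sub>F \<epsilon> in at_right 0. integrable lborel (\<lambda>\<xi>. \<phi> \<xi> * f j \<epsilon> \<xi>) \<and> \<bar>F j \<epsilon>\<bar> \<le> C * \<epsilon> ^ K"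
    unfolding F_def using fg bigO_Z_integral[OF _ \<phi>] by blast
  then obtain C where C: "\<forall>j\<in>{..n}. \<forall>\<^sub>F \<epsilon> in at_right 0. integrable lborel (\<lambda>\<xi>. \<phi> \<xi> * f j \<epsilon> \<xi>) \<and> \<bar>F j \<epsilon>\<bar> \<le> C j * \<epsilon> ^ K"
    by (rule bchoice[THEN exE])
  have "\<forall>j\<in>{..n}. \<forall>\<^sub>F \<epsilon> in at_right 0. integrable lborel (\<lambda>\<xi>. \<phi> \<xi> * g j \<epsilon> \<xi>)"
  proof
    fix j assume "j \<in> {..n}"
    then have "bigO_Z 2 (g j)" using fg by simp
    then obtain D where "\<forall>\<^sub>F \<epsilon> in at_right 0. integrable lborel (\<lambda>\<xi>. \<phi> \<xi> * g j \<epsilon> \<xi>) \<and> \<bar>LINT \<xi>|lborel. \<phi> \<xi> * g j \<epsilon> \<xi>\<bar> \<le> D * \<epsilon> ^ 2"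
      using bigO_Z_integral[OF _ \<phi>] by blast
    then show "\<forall>\<^sub>F \<epsilon> in at_right 0. integrable lborel (\<lambda>\<xi>. \<phi> \<xi> * g j \<epsilon> \<xi>)" by eventually_elim blast
  qed
  note evG = eventually_ball_finite[OF finite_atMost this] and evF = eventually_ball_finite[OF finite_atMost C]
  have ev0: "\<forall>\<^sub>F \<epsilon>::real in at_right 0. 0 < \<epsilon>" by (rule eventually_at_rightI[of 0 1]) auto
  have "\<forall>\<^sub>F \<epsilon> in at_right 0. \<bar>p0 \<epsilon>\<bar> \<le> (\<bar>C 0\<bar> + \<bar>C 1\<bar>) * \<epsilon> ^ K \<and> \<bar>p1 \<epsilon>\<bar> \<le> (\<bar>C 0\<bar> + \<bar>C 1\<bar>) * \<epsilon> ^ K"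
  proof (rule eventually_mono[OF eventually_conj[OF evG eventually_conj[OF evF ev0]]])
    fix \<epsilon> :: real
    assume "(\<forall>j\<in>{..n}. integrable lborel (\<lambda>\<xi>. \<phi> \<xi> * g j \<epsilon> \<xi>)) \<and>
      (\<forall>j\<in>{..n}. integrable lborel (\<lambda>\<xi>. \<phi> \<xi> * f j \<epsilon> \<xi>) \<and> \<bar>F j \<epsilon>\<bar> \<le> C j * \<epsilon> ^ K) \<and> 0 < \<epsilon>"
    then have elim: "\<And>j. j \<le> n \<Longrightarrow> integrable lborel (\<lambda>\<xi>. \<phi> \<xi> * g j \<epsilon> \<xi>)"
      "\<And>j. j \<le> n \<Longrightarrow> integrable lborel (\<lambda>\<xi>. \<phi> \<xi> * f j \<epsilon> \<xi>)"
      "\<And>j. j \<le> n \<Longrightarrow> \<bar>F j \<epsilon>\<bar> \<le> C j * \<epsilon> ^ K" and \<epsilon>: "0 < \<epsilon>"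
      by (blast intro: atMost_iff[THEN iffD2])+
    define F1 where "F1 = (if n = 0 then 0 else F 1 \<epsilon>)"
    define B where "B = (\<Sum>j\<le>n. \<bar>F j \<epsilon>\<bar>) + (\<Sum>j\<le>n. \<bar>G j \<epsilon>\<bar>) + \<bar>p2 \<epsilon>\<bar>"
    \<comment> \<open>For fixed \<open>\<epsilon>\<close> the constant and linear coefficients in
      \<delta> differ from those of the given decomposition by a quadratic error. The constant B may
      depend on \<open>\<epsilon>\<close>, as only \<delta> tends to 0; the coefficients are
      therefore equal, and the bounds for \<open>F 0\<close> and \<open>F 1\<close> carry
      over.\<close>
    have main: "\<bar>(p0 \<epsilon> - F 0 \<epsilon>) + \<delta> * (p1 \<epsilon> - F1)\<bar> \<le> B * \<delta>\<^sup>2" if \<delta>: "0 < \<delta>" "\<delta> \<le> 1" for \<delta>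
    proof -
      have e: "\<phi> \<xi> * R \<delta> \<epsilon> \<xi> = (\<Sum>j\<le>n. \<delta> ^ j * (\<phi> \<xi> * f j \<epsilon> \<xi>)) + \<delta>\<^sup>2 * (\<Sum>j\<le>n. \<delta> ^ j * (\<phi> \<xi> * g j \<epsilon> \<xi>))" for \<xi>
      proof -
        have "R \<delta> \<epsilon> \<xi> = (\<Sum>j\<le>n. \<delta> ^ j * f j \<epsilon> \<xi>) + \<delta>\<^sup>2 * (\<Sum>j\<le>n. \<delta> ^ j * g j \<epsilon> \<xi>)"
          by (rule R'[rule_format]) (use \<delta> \<epsilon> in simp_all)
        then show ?thesis
          by (simp only: distrib_left sum_distrib_left mult.left_commute[of "\<phi> \<xi>"])
      qed
      have i: "integrable lborel (\<lambda>\<xi>. \<Sum>j\<le>n. \<delta> ^ j * (\<phi> \<xi> * f j \<epsilon> \<xi>))" "integrable lborel (\<lambda>\<xi>. \<Sum>j\<le>n. \<delta> ^ j * (\<phi> \<xi> * g j \<epsilon> \<xi>))"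
        by (intro Bochner_Integration.integrable_sum integrable_mult_right elim; simp)+
      have v: "(LINT \<xi>|lborel. (\<Sum>j\<le>n. \<delta> ^ j * (\<phi> \<xi> * f j \<epsilon> \<xi>))) = (\<Sum>j\<le>n. \<delta> ^ j * F j \<epsilon>)"
        "(LINT \<xi>|lborel. (\<Sum>j\<le>n. \<delta> ^ j * (\<phi> \<xi> * g j \<epsilon> \<xi>))) = (\<Sum>j\<le>n. \<delta> ^ j * G j \<epsilon>)"
        unfolding F_def G_def integral_mult_right_zero[symmetric]
        by (intro Bochner_Integration.integral_sum integrable_mult_right elim; simp)+
      have "(LINT \<xi>|lborel. \<phi> \<xi> * R \<delta> \<epsilon> \<xi>) = (\<Sum>j\<le>n. \<delta> ^ j * F j \<epsilon>) + \<delta>\<^sup>2 * (\<Sum>j\<le>n. \<delta> ^ j * G j \<epsilon>)"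
        unfolding e by (simp only: Bochner_Integration.integral_add integrable_mult_right integral_mult_right_zero i v)
      then have I: "p0 \<epsilon> + \<delta> * p1 \<epsilon> + \<delta>\<^sup>2 * p2 \<epsilon> = (\<Sum>j\<le>n. \<delta> ^ j * F j \<epsilon>) + \<delta>\<^sup>2 * (\<Sum>j\<le>n. \<delta> ^ j * G j \<epsilon>)"
        using p[OF \<epsilon> \<delta>] by simp
      have b1: "\<bar>(\<Sum>j\<le>n. \<delta> ^ j * F j \<epsilon>) - F 0 \<epsilon> - \<delta> * F1\<bar> \<le> \<delta>\<^sup>2 * (\<Sum>j\<le>n. \<bar>F j \<epsilon>\<bar>)"
        unfolding F1_def by (rule linear_part_estimate[OF \<delta>, where n = n and F = "\<lambda>j. F j \<epsilon>"])
      have "\<bar>\<Sum>j\<le>n. \<delta> ^ j * G j \<epsilon>\<bar> \<le> (\<Sum>j\<le>n. \<bar>G j \<epsilon>\<bar>)"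
      proof (rule order_trans[OF sum_abs sum_mono])
        fix j
        have "\<delta> ^ j \<le> 1" using \<delta> by (simp add: power_le_one)
        then show "\<bar>\<delta> ^ j * G j \<epsilon>\<bar> \<le> \<bar>G j \<epsilon>\<bar>" using \<delta> by (simp add: abs_mult mult_left_le_one_le)
      qed
      then have b2: "\<bar>\<delta>\<^sup>2 * (\<Sum>j\<le>n. \<delta> ^ j * G j \<epsilon>)\<bar> \<le> \<delta>\<^sup>2 * (\<Sum>j\<le>n. \<bar>G j \<epsilon>\<bar>)"
        unfolding abs_mult by (simp add: mult_left_mono)
      have b3: "\<bar>\<delta>\<^sup>2 * p2 \<epsilon>\<bar> = \<delta>\<^sup>2 * \<bar>p2 \<epsilon>\<bar>" by (simp add: abs_mult)
      have "B * \<delta>\<^sup>2 = \<delta>\<^sup>2 * (\<Sum>j\<le>n. \<bar>F j \<epsilon>\<bar>) + \<delta>\<^sup>2 * (\<Sum>j\<le>n. \<bar>G j \<epsilon>\<bar>) + \<delta>\<^sup>2 * \<bar>p2 \<epsilon>\<bar>"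
        unfolding B_def by (simp only: distrib_left mult.commute)
      then show ?thesis using I b1 b2 b3 unfolding right_diff_distrib by linarith
    qed
    from linear_le_quadratic[OF main] have pF: "p0 \<epsilon> = F 0 \<epsilon>" "p1 \<epsilon> = F1" by simp_all
    have p: "0 \<le> \<epsilon> ^ K" using \<epsilon> by simp
    have "\<bar>F 0 \<epsilon>\<bar> \<le> C 0 * \<epsilon> ^ K" by (rule elim(3)) simp
    also have "\<dots> \<le> (\<bar>C 0\<bar> + \<bar>C 1\<bar>) * \<epsilon> ^ K" by (intro mult_right_mono p) simp
    finally have "\<bar>F 0 \<epsilon>\<bar> \<le> (\<bar>C 0\<bar> + \<bar>C 1\<bar>) * \<epsilon> ^ K" .
    moreover have "\<bar>F1\<bar> \<le> (\<bar>C 0\<bar> + \<bar>C 1\<bar>) * \<epsilon> ^ K"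
    proof (cases "n = 0")
      case False
      then have "\<bar>F1\<bar> \<le> C 1 * \<epsilon> ^ K" using elim(3)[of 1] by (simp add: F1_def)
      also have "\<dots> \<le> (\<bar>C 0\<bar> + \<bar>C 1\<bar>) * \<epsilon> ^ K" by (intro mult_right_mono p) simp
      finally show ?thesis .
    qed (use p in \<open>simp add: F1_def\<close>)
    ultimately show "\<bar>p0 \<epsilon>\<bar> \<le> (\<bar>C 0\<bar> + \<bar>C 1\<bar>) * \<epsilon> ^ K \<and> \<bar>p1 \<epsilon>\<bar> \<le> (\<bar>C 0\<bar> + \<bar>C 1\<bar>) * \<epsilon> ^ K" using pF by simp
  qed
  then show ?thesis by (rule exI)
qed

section \<open>Orders of vanishing in epsilon\<close>

definition small :: "nat \<Rightarrow> (real \<Rightarrow> real) \<Rightarrow> bool" where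
  "small K h \<longleftrightarrow> (\<exists>C. \<forall>\<^sub>F \<epsilon> in at_right 0. \<bar>h \<epsilon>\<bar> \<le> C * \<epsilon> ^ K)"

lemma eventually_unit: "\<forall>\<^sub>F \<epsilon>::real in at_right 0. 0 < \<epsilon> \<and> \<epsilon> \<le> 1"
  by (rule eventually_at_rightI[of 0 1]) auto

lemma small_cong:
  assumes "small K h" "\<And>\<epsilon>. \<epsilon> > 0 \<Longrightarrow> g \<epsilon> = h \<epsilon>"
  shows "small K g"
proof -
  obtain C where "\<forall>\<^sub>F \<epsilon> in at_right 0. \<bar>h \<epsilon>\<bar> \<le> C * \<epsilon> ^ K" using assms(1) unfolding small_def by blast
  with eventually_unit have "\<forall>\<^sub>F \<epsilon> in at_right 0. \<bar>g \<epsilon>\<bar> \<le> C * \<epsilon> ^ K"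
    by eventually_elim (simp add: assms(2))
  then show ?thesis unfolding small_def by blast
qed

lemma small_0: "small K (\<lambda>\<epsilon>. 0)"
  unfolding small_def by (rule exI[of _ 0]) simp

lemma small_add:
  assumes "small K f" "small K g"
  shows "small K (\<lambda>\<epsilon>. f \<epsilon> + g \<epsilon>)"
proof -
  obtain C D where "\<forall>\<^sub>F \<epsilon> in at_right 0. \<bar>f \<epsilon>\<bar> \<le> C * \<epsilon> ^ K" "\<forall>\<^sub>F \<epsilon> in at_right 0. \<bar>g \<epsilon>\<bar> \<le> D * \<epsilon> ^ K"
    using assms unfolding small_def by blast
  then have "\<forall>\<^sub>F \<epsilon> in at_right 0. \<bar>f \<epsilon> + g \<epsilon>\<bar> \<le> (C + D) * \<epsilon> ^ K"
    by eventually_elim (simp add: distrib_right)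
  then show ?thesis unfolding small_def by blast
qed

lemma small_cmult:
  assumes "small K f"
  shows "small K (\<lambda>\<epsilon>. c * f \<epsilon>)"
proof -
  obtain C where "\<forall>\<^sub>F \<epsilon> in at_right 0. \<bar>f \<epsilon>\<bar> \<le> C * \<epsilon> ^ K" using assms unfolding small_def by blast
  then have "\<forall>\<^sub>F \<epsilon> in at_right 0. \<bar>c * f \<epsilon>\<bar> \<le> (\<bar>c\<bar> * C) * \<epsilon> ^ K"
    by eventually_elim (simp add: abs_mult mult.assoc mult_left_mono)
  then show ?thesis unfolding small_def by blast
qed

lemma small_power_mult:
  assumes "small K f"
  shows "small (m + K) (\<lambda>\<epsilon>. \<epsilon> ^ m * f \<epsilon>)"
proof -
  obtain C where "\<forall>\<^sub>F \<epsilon> in at_right 0. \<bar>f \<epsilon>\<bar> \<le> C * \<epsilon> ^ K" using assms unfolding small_def by blast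
  with eventually_unit have "\<forall>\<^sub>F \<epsilon> in at_right 0. \<bar>\<epsilon> ^ m * f \<epsilon>\<bar> \<le> C * \<epsilon> ^ (m + K)"
  proof eventually_elim
    case (elim \<epsilon>)
    then have "\<epsilon> ^ m * \<bar>f \<epsilon>\<bar> \<le> \<epsilon> ^ m * (C * \<epsilon> ^ K)" by (intro mult_left_mono) auto
    then show ?case using elim(1) by (simp add: abs_mult power_add mult_ac)
  qed
  then show ?thesis unfolding small_def by blast
qed

lemma small_mono:
  assumes "small K f" "L \<le> K"
  shows "small L f"
proof -
  obtain C where "\<forall>\<^sub>F \<epsilon> in at_right 0. \<bar>f \<epsilon>\<bar> \<le> C * \<epsilon> ^ K" using assms(1) unfolding small_def by blast
  with eventually_unit have "\<forall>\<^sub>F \<epsilon> in at_right 0. \<bar>f \<epsilon>\<bar> \<le> \<bar>C\<bar> * \<epsilon> ^ L"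
  proof eventually_elim
    case (elim \<epsilon>)
    have "C * \<epsilon> ^ K \<le> \<bar>C\<bar> * \<epsilon> ^ K" using elim(1) by (intro mult_right_mono) auto
    also have "\<dots> \<le> \<bar>C\<bar> * \<epsilon> ^ L" using elim(1) assms(2) by (intro mult_left_mono power_decreasing) auto
    finally show ?case using elim(2) by linarith
  qed
  then show ?thesis unfolding small_def by blast
qed

lemma small_power: "small m (\<lambda>\<epsilon>. \<epsilon> ^ m * c)"
proof -
  have "small 0 (\<lambda>\<epsilon>. c)" unfolding small_def by (rule exI[of _ "\<bar>c\<bar>"]) simp
  from small_power_mult[OF this, of m] show ?thesis by simp
qed

lemma small_unique:
  assumes "small (Suc m) (\<lambda>\<epsilon>. q \<epsilon> - \<epsilon> ^ m * x)" "small (Suc m) (\<lambda>\<epsilon>. q \<epsilon> - \<epsilon> ^ m * y)"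
  shows "x = y"
proof -
  obtain C D where "\<forall>\<^sub>F \<epsilon> in at_right 0. \<bar>q \<epsilon> - \<epsilon> ^ m * x\<bar> \<le> C * \<epsilon> ^ Suc m"
    "\<forall>\<^sub>F \<epsilon> in at_right 0. \<bar>q \<epsilon> - \<epsilon> ^ m * y\<bar> \<le> D * \<epsilon> ^ Suc m"
    using assms unfolding small_def by blast
  then show ?thesis by (rule leading_coefficient_unique)
qed

lemma small_interaction:
  assumes "rapid f" "nice1 g"
  shows "small N (\<lambda>\<epsilon>. interaction \<epsilon> f g - (\<Sum>n<N. \<epsilon> * (- \<epsilon>) ^ n * multipole n f g))"
proof -
  obtain C where C: "\<And>\<epsilon>. \<epsilon> > 0 \<Longrightarrow> \<bar>interaction \<epsilon> f g - (\<Sum>n<N. \<epsilon> * (- \<epsilon>) ^ n * multipole n f g)\<bar> \<le> C * \<epsilon> ^ N"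
    by (rule interaction_expansion[OF assms, where N = N]) (rule that)
  from eventually_unit have "\<forall>\<^sub>F \<epsilon> in at_right 0. \<bar>interaction \<epsilon> f g - (\<Sum>n<N. \<epsilon> * (- \<epsilon>) ^ n * multipole n f g)\<bar> \<le> C * \<epsilon> ^ N"
    by (rule eventually_mono) (rule C, blast)
  then show ?thesis unfolding small_def by blast
qed

section \<open>Expansion of the interaction between profiles\<close>

lemma cmoment_0: "cmoment 0 f = of_real (moment (\<lambda>\<xi>. 1) f)"
  by (simp add: cmoment_def moment_def)

lemma cmoment_1:
  assumes "rapid f"
  shows "Re (cmoment 1 f) = moment fst f" "Im (cmoment 1 f) = moment snd f"
  using integral_Re[OF cmoment_integrable[OF assms, of 1]] integral_Im[OF cmoment_integrable[OF assms, of 1]]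
  by (simp_all add: cmoment_def moment_def)

lemma integral_radial_gaussian: "(LINT r|lborel. indicator {0<..} r * (r * exp (- r\<^sup>2 / 4) / 2)) = (1::real)"
proof -
  have lim: "((\<lambda>r::real. - exp (- r\<^sup>2 / 4)) \<longlongrightarrow> - 0) at_top"
  proof (intro tendsto_minus filterlim_compose[OF exp_at_bot])
    have "filterlim (\<lambda>r::real. 1 / 4 * r ^ 2) at_top at_top"
      by (rule filterlim_tendsto_pos_mult_at_top[OF tendsto_const _ filterlim_pow_at_top[OF _ filterlim_ident]]) simp_all
    then show "filterlim (\<lambda>r::real. - r\<^sup>2 / 4) at_bot at_top" by (simp add: filterlim_uminus_at_bot)
  qed
  have "(\<integral>\<^sup>+r. ennreal (r * exp (- r\<^sup>2 / 4) / 2) * indicator {0..} r \<partial>lborel) = - 0 - (- exp (- (0::real)\<^sup>2 / 4))"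
  proof (rule nn_integral_FTC_atLeast[OF _ _ _ lim])
    show "((\<lambda>r. - exp (- r\<^sup>2 / 4)) has_real_derivative r * exp (- r\<^sup>2 / 4) / 2) (at r)" for r :: real
      by (auto intro!: derivative_eq_intros)
  qed simp_all
  also have "(\<integral>\<^sup>+r. ennreal (r * exp (- r\<^sup>2 / 4) / 2) * indicator {0..} r \<partial>lborel) =
      (\<integral>\<^sup>+r. ennreal (indicator {0<..} r * (r * exp (- r\<^sup>2 / 4) / 2)) \<partial>lborel)"
    by (intro nn_integral_cong) (auto simp: indicator_def order_le_less)
  finally have nn: "(\<integral>\<^sup>+r. ennreal (indicator {0<..} r * (r * exp (- r\<^sup>2 / 4) / 2)) \<partial>lborel) = 1" by simp
  have "(LINT r|lborel. indicator {0<..} r * (r * exp (- r\<^sup>2 / 4) / 2)) = enn2real 1"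
    unfolding nn[symmetric] by (rule integral_eq_nn_integral) (auto simp: indicator_def)
  then show ?thesis unfolding enn2real_1 .
qed

lemma rapid_norm_power: "rapid f \<Longrightarrow> rapid (\<lambda>\<eta>. norm \<eta> ^ n * f \<eta>)"
  by (intro tempered_mult_rapid tempered_power tempered_norm)

lemma rapid_gaussian: "rapid gaussian"
  by (rule nice2D(5)[OF nice2_gaussian])

lemma cmoment_gaussian:
  assumes "n \<le> 5"
  shows "cmoment n gaussian = (if n = 0 then 1 else 0)"
proof -
  note r = rapid_norm_power[OF rapid_gaussian]
  have odd: "cmoment n gaussian = 0" if "odd n" for n
    unfolding cmoment_def by (rule even_modes.odd_moment[OF gaussian_modes that r])
  have even: "cmoment (2 * j) gaussian = 0" if "j > 0" for j
    unfolding cmoment_def even_modes.even_moment[OF gaussian_modes r] using that by simp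
  have "cmoment (2 * 0) gaussian = (LINT r|lborel. complex_of_real (indicator {0<..} r * (r * exp (- r\<^sup>2 / 4) / 2)))"
    unfolding cmoment_def even_modes.even_moment[OF gaussian_modes r]
    by (intro Bochner_Integration.integral_cong refl) (simp add: g0_def indicator_def)
  also have "\<dots> = 1" by (simp only: integral_complex_of_real integral_radial_gaussian of_real_1)
  finally have zero: "cmoment 0 gaussian = 1" by simp
  consider "n = 0" | "odd n" | j where "n = 2 * j" "j > 0" by (metis evenE neq0_conv mult_0_right)
  then show ?thesis by cases (auto simp: zero odd even odd_pos)
qed

lemma moment_gaussian: "moment (\<lambda>\<xi>. 1) gaussian = 1" "moment fst gaussian = 0" "moment snd gaussian = 0"
  using cmoment_gaussian[of 0] cmoment_gaussian[of 1] cmoment_1[OF rapid_gaussian] by (simp_all add: cmoment_0)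

text \<open>In this range the only nonzero complex moment of the Gaussian is its mass 1, so one end
  of the binomial sum survives.\<close>

lemma multipole_gaussian:
  assumes "n \<le> 5"
  shows "multipole n gaussian f = Re (cmoment n f)" "multipole n f gaussian = Re (cmoment n f)"
proof -
  have "(\<Sum>j\<le>n. of_nat (n choose j) * cmoment j gaussian * cnj (cmoment (n - j) f)) = (\<Sum>j\<le>n. if j = 0 then cnj (cmoment n f) else 0)"
    using assms by (intro sum.cong refl) (simp add: cmoment_gaussian)
  then show "multipole n gaussian f = Re (cmoment n f)" unfolding multipole_def by simp
  have "(\<Sum>j\<le>n. of_nat (n choose j) * cmoment j f * cnj (cmoment (n - j) gaussian)) = (\<Sum>j\<le>n. if j = n then cmoment n f else 0)"
    using assms by (intro sum.cong refl) (simp add: cmoment_gaussian)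
  then show "multipole n f gaussian = Re (cmoment n f)" unfolding multipole_def by simp
qed

lemma multipole_0: "multipole 0 f g = moment (\<lambda>\<xi>. 1) f * moment (\<lambda>\<xi>. 1) g"
  by (simp add: multipole_def cmoment_0)

lemma mode2_moments:
  assumes "mode2 f"
  shows "nice2 f" "moment (\<lambda>\<xi>. 1) f = 0" "moment fst f = 0" "moment snd f = 0" "cmoment 3 f = 0"
proof -
  interpret mode2 f by (rule assms)
  show "nice2 f" by (rule nice)
  show "moment (\<lambda>\<xi>. 1) f = 0" "moment fst f = 0" "moment snd f = 0"
    using moments_vanish by (simp_all add: moment_def)
  show "cmoment 3 f = 0" unfolding cmoment_def by (rule odd_moment[OF _ rapid_norm_power[OF f]]) simp
qed

lemma small_interaction_1: "rapid f \<Longrightarrow> nice1 g \<Longrightarrow> small 1 (\<lambda>\<epsilon>. interaction \<epsilon> f g)"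
proof -
  assume "rapid f" "nice1 g"
  from small_add[OF small_interaction[OF this, of 1] small_power[of 1 "multipole 0 f g"]] show ?thesis by simp
qed

lemma small_interaction_2:
  assumes "rapid f" "nice1 g" "multipole 0 f g = 0"
  shows "small 2 (\<lambda>\<epsilon>. interaction \<epsilon> f g)"
  by (rule small_cong[OF small_add[OF small_interaction[OF assms(1,2), of 2] small_power[of 2 "- multipole 1 f g"]]])
    (simp add: assms(3) eval_nat_numeral)

lemma small_interaction_3:
  assumes "rapid f" "nice1 g" "multipole 0 f g = 0" "multipole 1 f g = 0"
  shows "small 3 (\<lambda>\<epsilon>. interaction \<epsilon> f g)"
  by (rule small_cong[OF small_add[OF small_interaction[OF assms(1,2), of 3] small_power[of 3 "multipole 2 f g"]]])
    (use assms(3,4) in \<open>simp add: eval_nat_numeral\<close>)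

lemma small_interaction_gaussian:
  assumes f: "nice2 f" and M: "moment (\<lambda>\<xi>. 1) f = 0"
  shows "small 2 (\<lambda>\<epsilon>. interaction \<epsilon> gaussian f + interaction \<epsilon> f gaussian)"
    and "moment fst f = 0 \<Longrightarrow> small 3 (\<lambda>\<epsilon>. interaction \<epsilon> gaussian f + interaction \<epsilon> f gaussian)"
proof -
  note D = nice2D[OF f] and G = nice2D[OF nice2_gaussian]
  have z: "Re (cmoment 0 f) = 0" by (simp add: cmoment_0 M)
  show "small 2 (\<lambda>\<epsilon>. interaction \<epsilon> gaussian f + interaction \<epsilon> f gaussian)"
    by (intro small_add small_interaction_2 D G) (simp_all add: multipole_gaussian z)
  assume "moment fst f = 0"
  then have o: "Re (cmoment 1 f) = 0" using cmoment_1(1)[OF D(5)] by simp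
  show "small 3 (\<lambda>\<epsilon>. interaction \<epsilon> gaussian f + interaction \<epsilon> f gaussian)"
    by (intro small_add small_interaction_3 D G) (simp_all add: multipole_gaussian z o del: One_nat_def)
qed

lemma interaction_gaussian_gaussian: "small 6 (\<lambda>\<epsilon>. interaction \<epsilon> gaussian gaussian - \<epsilon>)"
  by (rule small_cong[OF small_interaction[OF rapid_gaussian nice2D(1)[OF nice2_gaussian], of 6]])
    (simp add: eval_nat_numeral multipole_gaussian cmoment_gaussian)

text \<open>Both orders of the pair contribute \<open>Re (cmoment 2 f)\<close> at n = 2, where the
  prefactor is \<epsilon> (- \<epsilon>)^2 = \<epsilon>^3; this is the origin of the factor
  2.\<close>

lemma interaction_gaussian_mode2:
  assumes "mode2 f"
  shows "small 4 (\<lambda>\<epsilon>. interaction \<epsilon> gaussian f + interaction \<epsilon> f gaussian - \<epsilon> ^ 3 * (2 * Re (cmoment 2 f)))"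
proof -
  note m = mode2_moments[OF assms]
  note D = nice2D[OF m(1)] and G = nice2D[OF nice2_gaussian]
  have z: "Re (cmoment 0 f) = 0" "Re (cmoment 1 f) = 0" "Re (cmoment 3 f) = 0"
    using m cmoment_1(1)[OF D(5)] by (simp_all add: cmoment_0)
  have s: "(\<Sum>n<4. \<epsilon> * (- \<epsilon>) ^ n * h n) = \<epsilon> * h 0 - \<epsilon>\<^sup>2 * h 1 + \<epsilon> ^ 3 * h 2 - \<epsilon> ^ 4 * h 3" for \<epsilon> :: real and h
    by (simp add: eval_nat_numeral)
  show ?thesis
    by (rule small_cong[OF small_add[OF small_interaction[OF G(5) D(1), of 4] small_interaction[OF D(5) G(1), of 4]]])
      (simp add: s multipole_gaussian z del: One_nat_def)
qed

lemma interaction_expand: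
  fixes a b c \<epsilon> :: real
  assumes "nice2 f" "nice2 g" "nice2 h"
  defines "S \<equiv> interaction \<epsilon>"
  shows "S (\<lambda>\<xi>. gaussian \<xi> + (a * f \<xi> + (b * g \<xi> + c * h \<xi>))) (\<lambda>\<xi>. gaussian \<xi> + (a * f \<xi> + (b * g \<xi> + c * h \<xi>))) =
     S gaussian gaussian + a * (S gaussian f + S f gaussian) + b * (S gaussian g + S g gaussian) + c * (S gaussian h + S h gaussian)
     + a * a * S f f + a * b * (S f g + S g f) + a * c * (S f h + S h f) + b * b * S g g + b * c * (S g h + S h g) + c * c * S h h"
proof -
  note F = nice2D[OF assms(1)] and G = nice2D[OF assms(2)] and H = nice2D[OF assms(3)] and E = nice2D[OF nice2_gaussian]
  have l: "S (\<lambda>\<xi>. gaussian \<xi> + (a * f \<xi> + (b * g \<xi> + c * h \<xi>))) k = S gaussian k + (a * S f k + (b * S g k + c * S h k))"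
    if "nice1 k" for k
  proof -
    have "rapid (\<lambda>\<xi>. a * f \<xi>)" "rapid (\<lambda>\<xi>. b * g \<xi>)" "rapid (\<lambda>\<xi>. c * h \<xi>)" by (intro rapid_cmult F G H)+
    then show ?thesis unfolding S_def
      by (simp only: interaction_add_left[OF _ _ that] interaction_cmult_left rapid_add E(5))
  qed
  have r: "S k (\<lambda>\<xi>. gaussian \<xi> + (a * f \<xi> + (b * g \<xi> + c * h \<xi>))) = S k gaussian + (a * S k f + (b * S k g + c * S k h))"
    if "rapid k" for k
  proof -
    have "nice1 (\<lambda>\<xi>. a * f \<xi>)" "nice1 (\<lambda>\<xi>. b * g \<xi>)" "nice1 (\<lambda>\<xi>. c * h \<xi>)" by (intro nice1_cmult F G H)+
    then show ?thesis unfolding S_def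
      by (simp only: interaction_add_right[OF that] interaction_cmult_right nice1_add E(1) F(1) G(1) H(1))
  qed
  have n: "nice1 (\<lambda>\<xi>. gaussian \<xi> + (a * f \<xi> + (b * g \<xi> + c * h \<xi>)))" by (intro nice1_add nice1_cmult E F G H)
  show ?thesis unfolding l[OF n] r[OF E(5)] r[OF F(5)] r[OF G(5)] r[OF H(5)] by (simp add: algebra_simps)
qed

text \<open>Count of powers: f against the Gaussian gives \<epsilon>^2 times \<epsilon>^3, the term
  displayed. To reach \<epsilon>^6, g needs an interaction of order \<epsilon>^3 (mass and first
  moment 0), while h and the pair f, f need order \<epsilon>^2 (mass 0). All other pairs carry at
  least \<epsilon>^5 and need only order \<epsilon>.\<close>

lemma self_interaction_expansion:
  assumes f: "mode2 f" and g: "nice2 g" "moment (\<lambda>\<xi>. 1) g = 0" "moment fst g = 0"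
    and h: "nice2 h" "moment (\<lambda>\<xi>. 1) h = 0"
  defines "A \<equiv> \<lambda>\<epsilon> \<xi>. gaussian \<xi> + (\<epsilon>\<^sup>2 * f \<xi> + (\<epsilon> ^ 3 * g \<xi> + \<epsilon> ^ 4 * h \<xi>))"
  shows "small 6 (\<lambda>\<epsilon>. interaction \<epsilon> (A \<epsilon>) (A \<epsilon>) - \<epsilon> - \<epsilon> ^ 5 * (2 * Re (cmoment 2 f)))"
proof -
  note m = mode2_moments[OF f]
  note F = nice2D[OF m(1)] and G = nice2D[OF g(1)] and H = nice2D[OF h(1)]
  have ff: "small 2 (\<lambda>\<epsilon>. interaction \<epsilon> f f)"
    by (rule small_interaction_2[OF F(5) F(1)]) (simp add: multipole_0 m)
  have two: "small 1 (\<lambda>\<epsilon>. interaction \<epsilon> p q + interaction \<epsilon> q p)" if "nice2 p" "nice2 q" for p q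
    by (intro small_add small_interaction_1 nice2D that)
  have up: "small 6 (\<lambda>\<epsilon>. \<epsilon> ^ m * x \<epsilon>)" if "small k x" "6 \<le> m + k" for m k x
    by (rule small_mono[OF small_power_mult[OF that(1)] that(2)])
  note terms = interaction_gaussian_gaussian
    up[OF interaction_gaussian_mode2[OF f], of 2]
    up[OF small_interaction_gaussian(2)[OF g], of 3]
    up[OF small_interaction_gaussian(1)[OF h], of 4]
    up[OF ff, of 4]
    up[OF two[OF m(1) g(1)], of 5]
    up[OF two[OF m(1) h(1)], of 6]
    up[OF small_interaction_1[OF G(5) G(1)], of 6]
    up[OF two[OF g(1) h(1)], of 7]
    up[OF small_interaction_1[OF H(5) H(1)], of 8]
  have pw: "\<epsilon>\<^sup>2 * \<epsilon>\<^sup>2 = \<epsilon> ^ 4" "\<epsilon>\<^sup>2 * \<epsilon> ^ 3 = \<epsilon> ^ 5" "\<epsilon>\<^sup>2 * \<epsilon> ^ 4 = \<epsilon> ^ 6" "\<epsilon> ^ 3 * \<epsilon> ^ 3 = \<epsilon> ^ 6"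
    "\<epsilon> ^ 3 * \<epsilon> ^ 4 = \<epsilon> ^ 7" "\<epsilon> ^ 4 * \<epsilon> ^ 4 = \<epsilon> ^ 8" for \<epsilon> :: real
    by (simp_all flip: power_add)
  show ?thesis
  proof (rule small_cong)
    show "small 6 (\<lambda>\<epsilon>. (interaction \<epsilon> gaussian gaussian - \<epsilon>)
      + \<epsilon>\<^sup>2 * (interaction \<epsilon> gaussian f + interaction \<epsilon> f gaussian - \<epsilon> ^ 3 * (2 * Re (cmoment 2 f)))
      + \<epsilon> ^ 3 * (interaction \<epsilon> gaussian g + interaction \<epsilon> g gaussian)
      + \<epsilon> ^ 4 * (interaction \<epsilon> gaussian h + interaction \<epsilon> h gaussian)
      + \<epsilon> ^ 4 * interaction \<epsilon> f f
      + \<epsilon> ^ 5 * (interaction \<epsilon> f g + interaction \<epsilon> g f)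
      + \<epsilon> ^ 6 * (interaction \<epsilon> f h + interaction \<epsilon> h f)
      + \<epsilon> ^ 6 * interaction \<epsilon> g g
      + \<epsilon> ^ 7 * (interaction \<epsilon> g h + interaction \<epsilon> h g)
      + \<epsilon> ^ 8 * interaction \<epsilon> h h)"
      by (intro small_add terms) simp_all
    fix \<epsilon> :: real
    have "\<epsilon>\<^sup>2 * (X - \<epsilon> ^ 3 * c) = \<epsilon>\<^sup>2 * X - \<epsilon> ^ 5 * c" for X c
      by (simp add: right_diff_distrib pw flip: mult.assoc)
    then show "interaction \<epsilon> (A \<epsilon>) (A \<epsilon>) - \<epsilon> - \<epsilon> ^ 5 * (2 * Re (cmoment 2 f)) = (interaction \<epsilon> gaussian gaussian - \<epsilon>)
      + \<epsilon>\<^sup>2 * (interaction \<epsilon> gaussian f + interaction \<epsilon> f gaussian - \<epsilon> ^ 3 * (2 * Re (cmoment 2 f)))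
      + \<epsilon> ^ 3 * (interaction \<epsilon> gaussian g + interaction \<epsilon> g gaussian)
      + \<epsilon> ^ 4 * (interaction \<epsilon> gaussian h + interaction \<epsilon> h gaussian)
      + \<epsilon> ^ 4 * interaction \<epsilon> f f
      + \<epsilon> ^ 5 * (interaction \<epsilon> f g + interaction \<epsilon> g f)
      + \<epsilon> ^ 6 * (interaction \<epsilon> f h + interaction \<epsilon> h f)
      + \<epsilon> ^ 6 * interaction \<epsilon> g g
      + \<epsilon> ^ 7 * (interaction \<epsilon> g h + interaction \<epsilon> h g)
      + \<epsilon> ^ 8 * interaction \<epsilon> h h"
      unfolding A_def interaction_expand[OF m(1) g(1) h(1)] pw by simp
  qed
qed

text \<open>Prepares \<open>zNS 2 = 0\<close>, which is read off at \<epsilon>^3. Mass and first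
  moment of n vanish, so its interaction with the Gaussian already has order \<epsilon>^3 before the
  factor \<epsilon>^2.\<close>

lemma cross_interaction_small:
  assumes f: "mode2 f" and n: "mode2 n"
  defines "A \<equiv> \<lambda>\<epsilon> \<xi>. gaussian \<xi> + \<epsilon>\<^sup>2 * f \<xi>" and "B \<equiv> \<lambda>\<epsilon> \<xi>. \<epsilon>\<^sup>2 * n \<xi>"
  shows "small 4 (\<lambda>\<epsilon>. interaction \<epsilon> (A \<epsilon>) (B \<epsilon>) + interaction \<epsilon> (B \<epsilon>) (A \<epsilon>))"
proof -
  note m = mode2_moments[OF f] and m' = mode2_moments[OF n]
  note F = nice2D[OF m(1)] and N = nice2D[OF m'(1)] and G = nice2D[OF nice2_gaussian]
  have "small 4 (\<lambda>\<epsilon>. \<epsilon>\<^sup>2 * (interaction \<epsilon> gaussian n + interaction \<epsilon> n gaussian))"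
    by (rule small_mono[OF small_power_mult[OF small_interaction_gaussian(2)[OF m'(1,2,3)]]]) simp
  moreover have "small 4 (\<lambda>\<epsilon>. \<epsilon> ^ 4 * (interaction \<epsilon> f n + interaction \<epsilon> n f))"
    by (rule small_mono[OF small_power_mult[where K = 1]]) (intro small_add small_interaction_1 F N, simp)
  ultimately show ?thesis
  proof (rule small_cong[OF small_add])
    fix \<epsilon> :: real
    have 1: "interaction \<epsilon> (A \<epsilon>) (B \<epsilon>) = \<epsilon>\<^sup>2 * (interaction \<epsilon> gaussian n + \<epsilon>\<^sup>2 * interaction \<epsilon> f n)"
      unfolding A_def B_def interaction_cmult_right[OF N(1)] interaction_add_left[OF G(5) rapid_cmult[OF F(5)] N(1)] interaction_cmult_left ..
    have 2: "interaction \<epsilon> (B \<epsilon>) (A \<epsilon>) = \<epsilon>\<^sup>2 * (interaction \<epsilon> n gaussian + \<epsilon>\<^sup>2 * interaction \<epsilon> n f)"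
      unfolding A_def B_def interaction_cmult_left interaction_add_right[OF N(5) G(1) nice1_cmult[OF F(1)]] interaction_cmult_right[OF F(1)] ..
    show "interaction \<epsilon> (A \<epsilon>) (B \<epsilon>) + interaction \<epsilon> (B \<epsilon>) (A \<epsilon>) =
      \<epsilon>\<^sup>2 * (interaction \<epsilon> gaussian n + interaction \<epsilon> n gaussian) + \<epsilon> ^ 4 * (interaction \<epsilon> f n + interaction \<epsilon> n f)"
      unfolding 1 2 by (simp add: algebra_simps eval_nat_numeral)
  qed
qed

text \<open>A and B are the constant and linear parts of \<open>Omega_app\<close> in \<delta>, c and
  d those of \<open>zeta_app\<close>. The first estimate determines the mass of \<open>H1\<close>,
  the second \<open>zE k\<close> through \<xi>2 and the constant part, the third
  \<open>zNS k\<close> through \<xi>2 and the linear part.\<close>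

lemma order_step:
  assumes N: "nice_profiles wE wNS k" and H: "H0 \<in> Z_space" "H1 \<in> Z_space"
    and O: "bigO_Z_delta (k + 2) (\<lambda>\<delta> \<epsilon> \<xi>. remainder wE wNS zE zNS k \<delta> \<epsilon> \<xi> - \<epsilon> ^ (k + 1) * (H0 \<xi> + \<delta> * H1 \<xi>))"
  defines "A \<equiv> \<lambda>\<epsilon> \<xi>. gaussian \<xi> + (\<Sum>j=2..k. \<epsilon> ^ j * wE j \<xi>)" and "B \<equiv> \<lambda>\<epsilon> \<xi>. \<Sum>j=2..k. \<epsilon> ^ j * wNS j \<xi>"
    and "c \<equiv> \<lambda>\<epsilon>. 1 + (\<Sum>i=1..k-1. \<epsilon> ^ i * zE i)" and "d \<equiv> \<lambda>\<epsilon>. \<Sum>i=1..k-1. \<epsilon> ^ i * zNS i"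
  shows "small (k + 2) (\<lambda>\<epsilon>. - (\<Sum>j=2..k. (real j / 2 * \<epsilon> ^ j) * moment (\<lambda>\<xi>. 1) (wE j)) - \<epsilon> ^ (k + 1) * moment (\<lambda>\<xi>. 1) H1)"
    and "small (k + 2) (\<lambda>\<epsilon>. (interaction \<epsilon> (A \<epsilon>) (A \<epsilon>) - \<epsilon> * c \<epsilon> * moment (\<lambda>\<xi>. 1) (A \<epsilon>)) / (2 * pi) - \<epsilon> ^ (k + 1) * moment snd H0)"
    and "small (k + 2) (\<lambda>\<epsilon>. (interaction \<epsilon> (A \<epsilon>) (B \<epsilon>) + interaction \<epsilon> (B \<epsilon>) (A \<epsilon>)
        - \<epsilon> * (c \<epsilon> * moment (\<lambda>\<xi>. 1) (B \<epsilon>) + d \<epsilon> * moment (\<lambda>\<xi>. 1) (A \<epsilon>))) / (2 * pi)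
        - (moment snd (A \<epsilon>) / 2 + (\<Sum>j=2..k. (real j / 2 * \<epsilon> ^ j) * moment snd (wE j))) - \<epsilon> ^ (k + 1) * moment snd H1)"
proof -
  note HD = nice2D[OF Z_imp_nice2[OF H(1)]] nice2D[OF Z_imp_nice2[OF H(2)]]
  have nE: "nice2 (wE j)" "nice2 (wNS j)" if "j \<in> {2..k}" for j using N that unfolding nice_profiles_def by blast+
  have nA: "nice2 (A \<epsilon>)" "nice2 (B \<epsilon>)" for \<epsilon>
  proof -
    show "nice2 (A \<epsilon>)" unfolding A_def by (intro nice2_add nice2_gaussian nice2_sum nice2_cmult nE)
    show "nice2 (B \<epsilon>)" unfolding B_def by (intro nice2_sum nice2_cmult nE)
  qed
  have Om: "Omega_app wE wNS k \<delta> \<epsilon> = (\<lambda>\<xi>. A \<epsilon> \<xi> + \<delta> * B \<epsilon> \<xi>)" for \<delta> \<epsilon>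
    unfolding Omega_app_def[abs_def] profile_def A_def B_def
    by (simp add: distrib_left sum.distrib sum_distrib_left mult.left_commute add.assoc)
  have z: "zeta_app zE zNS k \<delta> \<epsilon> = c \<epsilon> + \<delta> * d \<epsilon>" for \<delta> \<epsilon>
    unfolding zeta_app_def c_def d_def by (simp add: distrib_left sum.distrib sum_distrib_left mult.left_commute)
  have mO: "moment \<phi> (Omega_app wE wNS k \<delta> \<epsilon>) = moment \<phi> (A \<epsilon>) + \<delta> * moment \<phi> (B \<epsilon>)" if "tempered \<phi>" for \<phi> \<delta> \<epsilon>
    unfolding Om moment_add[OF that nice2D(5)[OF nA(1)] rapid_cmult[OF nice2D(5)[OF nA(2)]]] moment_cmult ..
  have mP: "(\<Sum>j=2..k. x j * moment \<phi> (profile wE wNS \<delta> j)) =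
     (\<Sum>j=2..k. x j * moment \<phi> (wE j)) + \<delta> * (\<Sum>j=2..k. x j * moment \<phi> (wNS j))" if "tempered \<phi>" for \<phi> \<delta> and x :: "nat \<Rightarrow> real"
  proof -
    have "moment \<phi> (profile wE wNS \<delta> j) = moment \<phi> (wE j) + \<delta> * moment \<phi> (wNS j)" if "j \<in> {2..k}" for j
      unfolding profile_def[abs_def]
        moment_add[OF \<open>tempered \<phi>\<close> nice2D(5)[OF nE(1)[OF that]] rapid_cmult[OF nice2D(5)[OF nE(2)[OF that]]]] moment_cmult ..
    then have "(\<Sum>j=2..k. x j * moment \<phi> (profile wE wNS \<delta> j)) = (\<Sum>j=2..k. x j * moment \<phi> (wE j) + \<delta> * (x j * moment \<phi> (wNS j)))"
      by (intro sum.cong refl) (simp add: distrib_left)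
    then show ?thesis by (simp add: sum.distrib sum_distrib_left)
  qed
  have I: "interaction \<epsilon> (Omega_app wE wNS k \<delta> \<epsilon>) (Omega_app wE wNS k \<delta> \<epsilon>) = interaction \<epsilon> (A \<epsilon>) (A \<epsilon>)
     + \<delta> * (interaction \<epsilon> (A \<epsilon>) (B \<epsilon>) + interaction \<epsilon> (B \<epsilon>) (A \<epsilon>)) + \<delta>\<^sup>2 * interaction \<epsilon> (B \<epsilon>) (B \<epsilon>)" for \<delta> \<epsilon>
  proof -
    note a = nice2D[OF nA(1)[of \<epsilon>]] and b = nice2D[OF nA(2)[of \<epsilon>]]
    have n: "nice1 (\<lambda>\<xi>. A \<epsilon> \<xi> + \<delta> * B \<epsilon> \<xi>)" by (intro nice1_add nice1_cmult a b)
    show ?thesis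
      unfolding Om interaction_add_left[OF a(5) rapid_cmult[OF b(5)] n] interaction_cmult_left
        interaction_add_right[OF a(5) a(1) nice1_cmult[OF b(1)]] interaction_add_right[OF b(5) a(1) nice1_cmult[OF b(1)]]
        interaction_cmult_right[OF b(1)]
      by (simp add: algebra_simps power2_eq_square)
  qed
  have L: "(LINT \<xi>|lborel. \<phi> \<xi> * (remainder wE wNS zE zNS k \<delta> \<epsilon> \<xi> - \<epsilon> ^ (k + 1) * (H0 \<xi> + \<delta> * H1 \<xi>)))
     = moment \<phi> (remainder wE wNS zE zNS k \<delta> \<epsilon>) - \<epsilon> ^ (k + 1) * (moment \<phi> H0 + \<delta> * moment \<phi> H1)"
    if "\<epsilon> > 0" "tempered \<phi>" for \<phi> \<delta> \<epsilon>
  proof -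
    note r = remainder_moments(1)[OF N that(1), of zE zNS \<delta>]
    have i: "integrable lborel (\<lambda>\<xi>. \<phi> \<xi> * remainder wE wNS zE zNS k \<delta> \<epsilon> \<xi>)" "integrable lborel (\<lambda>\<xi>. \<phi> \<xi> * H0 \<xi>)"
      "integrable lborel (\<lambda>\<xi>. \<phi> \<xi> * H1 \<xi>)"
      by (intro rapid_integrable tempered_mult_rapid that r HD)+
    have e: "\<phi> \<xi> * (remainder wE wNS zE zNS k \<delta> \<epsilon> \<xi> - \<epsilon> ^ (k + 1) * (H0 \<xi> + \<delta> * H1 \<xi>)) =
       \<phi> \<xi> * remainder wE wNS zE zNS k \<delta> \<epsilon> \<xi> - \<epsilon> ^ (k + 1) * (\<phi> \<xi> * H0 \<xi> + \<delta> * (\<phi> \<xi> * H1 \<xi>))" for \<xi>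
      unfolding right_diff_distrib distrib_left by (simp only: mult_ac)
    show ?thesis unfolding e moment_def
      by (simp only: Bochner_Integration.integral_add Bochner_Integration.integral_diff integral_mult_right_zero
        integrable_mult_right Bochner_Integration.integrable_add i)
  qed
  have sm: "small K p0" "small K p1" if "\<exists>C. \<forall>\<^sub>F \<epsilon> in at_right 0. \<bar>p0 \<epsilon>\<bar> \<le> C * \<epsilon> ^ K \<and> \<bar>p1 \<epsilon>\<bar> \<le> C * \<epsilon> ^ K" for K p0 p1
    using that unfolding small_def by (blast intro: eventually_mono)+
  show "small (k + 2) (\<lambda>\<epsilon>. - (\<Sum>j=2..k. (real j / 2 * \<epsilon> ^ j) * moment (\<lambda>\<xi>. 1) (wE j)) - \<epsilon> ^ (k + 1) * moment (\<lambda>\<xi>. 1) H1)"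
  proof (rule sm(2)[OF bigO_Z_delta_coefficients[OF O tempered_const[of 1]]])
    fix \<epsilon> \<delta> :: real assume e: "0 < \<epsilon>"
    show "(LINT \<xi>|lborel. 1 * (remainder wE wNS zE zNS k \<delta> \<epsilon> \<xi> - \<epsilon> ^ (k + 1) * (H0 \<xi> + \<delta> * H1 \<xi>))) =
       - (\<epsilon> ^ (k + 1) * moment (\<lambda>\<xi>. 1) H0)
       + \<delta> * (- (\<Sum>j=2..k. (real j / 2 * \<epsilon> ^ j) * moment (\<lambda>\<xi>. 1) (wE j)) - \<epsilon> ^ (k + 1) * moment (\<lambda>\<xi>. 1) H1)
       + \<delta>\<^sup>2 * - (\<Sum>j=2..k. (real j / 2 * \<epsilon> ^ j) * moment (\<lambda>\<xi>. 1) (wNS j))"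
      unfolding L[OF e tempered_const] remainder_moments(2)[OF N e] mP[OF tempered_const]
      by (simp add: algebra_simps power2_eq_square)
  qed
  have alg: "- \<delta> * ((a + \<delta> * b) / 2 + (s + \<delta> * t)) + (x + \<delta> * y + \<delta>\<^sup>2 * w - \<epsilon> * (c + \<delta> * d) * (m + \<delta> * n)) / (2 * pi) - e * (h0 + \<delta> * h1)
    = ((x - \<epsilon> * c * m) / (2 * pi) - e * h0) + \<delta> * ((y - \<epsilon> * (c * n + d * m)) / (2 * pi) - (a / 2 + s) - e * h1)
      + \<delta>\<^sup>2 * (- (b / 2 + t) + (w - \<epsilon> * d * n) / (2 * pi))"
    for \<delta> a b s t x y w \<epsilon> c d m n e h0 h1 :: real
    by (simp add: field_simps power2_eq_square)
  note main = bigO_Z_delta_coefficients[OF O tempered_snd, of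
    "\<lambda>\<epsilon>. (interaction \<epsilon> (A \<epsilon>) (A \<epsilon>) - \<epsilon> * c \<epsilon> * moment (\<lambda>\<xi>. 1) (A \<epsilon>)) / (2 * pi) - \<epsilon> ^ (k + 1) * moment snd H0"
    "\<lambda>\<epsilon>. (interaction \<epsilon> (A \<epsilon>) (B \<epsilon>) + interaction \<epsilon> (B \<epsilon>) (A \<epsilon>)
        - \<epsilon> * (c \<epsilon> * moment (\<lambda>\<xi>. 1) (B \<epsilon>) + d \<epsilon> * moment (\<lambda>\<xi>. 1) (A \<epsilon>))) / (2 * pi)
        - (moment snd (A \<epsilon>) / 2 + (\<Sum>j=2..k. (real j / 2 * \<epsilon> ^ j) * moment snd (wE j))) - \<epsilon> ^ (k + 1) * moment snd H1"
    "\<lambda>\<epsilon>. - (moment snd (B \<epsilon>) / 2 + (\<Sum>j=2..k. (real j / 2 * \<epsilon> ^ j) * moment snd (wNS j)))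
        + (interaction \<epsilon> (B \<epsilon>) (B \<epsilon>) - \<epsilon> * d \<epsilon> * moment (\<lambda>\<xi>. 1) (B \<epsilon>)) / (2 * pi)"]
  have "\<exists>C. \<forall>\<^sub>F \<epsilon> in at_right 0. \<bar>(interaction \<epsilon> (A \<epsilon>) (A \<epsilon>) - \<epsilon> * c \<epsilon> * moment (\<lambda>\<xi>. 1) (A \<epsilon>)) / (2 * pi) - \<epsilon> ^ (k + 1) * moment snd H0\<bar> \<le> C * \<epsilon> ^ (k + 2)
    \<and> \<bar>(interaction \<epsilon> (A \<epsilon>) (B \<epsilon>) + interaction \<epsilon> (B \<epsilon>) (A \<epsilon>)
        - \<epsilon> * (c \<epsilon> * moment (\<lambda>\<xi>. 1) (B \<epsilon>) + d \<epsilon> * moment (\<lambda>\<xi>. 1) (A \<epsilon>))) / (2 * pi)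
        - (moment snd (A \<epsilon>) / 2 + (\<Sum>j=2..k. (real j / 2 * \<epsilon> ^ j) * moment snd (wE j))) - \<epsilon> ^ (k + 1) * moment snd H1\<bar> \<le> C * \<epsilon> ^ (k + 2)"
    by (rule main, unfold L[OF _ tempered_snd], subst remainder_moments(3)[OF N], assumption)
      (unfold mO[OF tempered_snd] mO[OF tempered_const] mP[OF tempered_snd] I z, rule alg)
  from sm[OF this]
  show "small (k + 2) (\<lambda>\<epsilon>. (interaction \<epsilon> (A \<epsilon>) (A \<epsilon>) - \<epsilon> * c \<epsilon> * moment (\<lambda>\<xi>. 1) (A \<epsilon>)) / (2 * pi) - \<epsilon> ^ (k + 1) * moment snd H0)"
    "small (k + 2) (\<lambda>\<epsilon>. (interaction \<epsilon> (A \<epsilon>) (B \<epsilon>) + interaction \<epsilon> (B \<epsilon>) (A \<epsilon>)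
        - \<epsilon> * (c \<epsilon> * moment (\<lambda>\<xi>. 1) (B \<epsilon>) + d \<epsilon> * moment (\<lambda>\<xi>. 1) (A \<epsilon>))) / (2 * pi)
        - (moment snd (A \<epsilon>) / 2 + (\<Sum>j=2..k. (real j / 2 * \<epsilon> ^ j) * moment snd (wE j))) - \<epsilon> ^ (k + 1) * moment snd H1)"
    by this+
qed

section \<open>Orders two to four of the construction\<close>

lemma small_cong':
  assumes "small K h" "K = L" "\<And>\<epsilon>. \<epsilon> > 0 \<Longrightarrow> g \<epsilon> = h \<epsilon>"
  shows "small L g"
  using small_cong[OF assms(1,3)] assms(2) by simp

lemma gaussian_Y_mode0: "gaussian \<in> Y_mode 0"
proof -
  have "gaussian (r * cos t, r * sin t) = g0 r * cos (real 0 * t) + 0 * sin (real 0 * t)" if "r > 0" for r t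
  proof -
    have "(norm (r * cos t, r * sin t))\<^sup>2 = r\<^sup>2"
      unfolding norm_plane_power2 using sin_cos_squared_add2[of t]
      by (simp add: power_mult_distrib flip: distrib_left)
    then have "norm (r * cos t, r * sin t) = r" by (rule power2_eq_imp_eq[OF _ norm_ge_zero less_imp_le[OF that]])
    then show ?thesis unfolding gaussian_g0 by simp
  qed
  then have "\<exists>a b. \<forall>r>0. \<forall>\<theta>. gaussian (r * cos \<theta>, r * sin \<theta>) = a r * cos (real 0 * \<theta>) + b r * sin (real 0 * \<theta>)"
    by (intro exI[of _ g0] exI[of _ "\<lambda>r. 0"] allI impI)
  then show ?thesis unfolding Y_mode_def by (intro CollectI conjI Z_imp_Y gaussian_in_Z)
qed

lemma Y_mode0_fst_moment:
  assumes u: "u \<in> Y_mode 0" and r: "rapid u"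
  shows "moment fst u = 0"
proof -
  note [measurable] = rapid_measurable[OF r]
  have "\<exists>a b. \<forall>r>0. \<forall>\<theta>. u (r * cos \<theta>, r * sin \<theta>) = a r * cos (real 0 * \<theta>) + b r * sin (real 0 * \<theta>)"
    using u unfolding Y_mode_def mem_Collect_eq by (rule conjunct2)
  then obtain a b where ab': "\<forall>r>0. \<forall>\<theta>. u (r * cos \<theta>, r * sin \<theta>) = a r * cos (real 0 * \<theta>) + b r * sin (real 0 * \<theta>)"
    by (elim exE) (rule that)
  note ab = ab'[rule_format]
  have even: "u (0 - \<xi>) = u \<xi>" for \<xi>
  proof (cases "\<xi> = 0")
    case False
    then obtain r t where rt: "r > 0" "\<xi> = (r * cos t, r * sin t)" by (rule plane_polar)
    have m: "0 - \<xi> = (r * cos (t + pi), r * sin (t + pi))" by (simp add: rt(2) zero_prod_def)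
    show ?thesis unfolding m ab[OF rt(1)] unfolding rt(2) ab[OF rt(1)] by simp
  qed simp
  have "(LINT \<xi>|lborel. fst (0 - \<xi>) * u (0 - \<xi>)) = moment fst u"
    unfolding moment_def
    by (rule integral_reflect[where f = "\<lambda>\<xi>. fst \<xi> * u \<xi>"])
      (rule rapid_measurable[OF tempered_mult_rapid[OF tempered_fst r]])
  also have "(LINT \<xi>|lborel. fst (0 - \<xi>) * u (0 - \<xi>)) = - moment fst u"
    unfolding moment_def even by simp
  finally show ?thesis by simp
qed

text \<open>Integrating the equation of u gives c times the mass of u equal to the mass of P, as
  diffusion conserves mass. Testing the projection with the Gaussian, which is constant against
  \<open>weight\<close>, shows that P has the mass of the projected function; that is the mass of
  \<open>H1\<close>, since \<open>pd2 gaussian\<close> has mass 0.\<close>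

lemma next_profile_moments:
  assumes H1: "H1 \<in> Z_space" and M: "moment (\<lambda>\<xi>. 1) H1 = 0"
    and P: "proj0 (\<lambda>\<xi>. H1 \<xi> + z * pd2 gaussian \<xi>) P"
    and u: "u \<in> Y_mode 0" "u \<in> Z_space" "\<And>\<xi>. diffusion u \<xi> - c * u \<xi> + P \<xi> = 0" "c \<noteq> 0"
    and v: "v \<in> ker_Lambda_perp" "v \<in> Z_space"
  shows "nice2 (\<lambda>\<xi>. u \<xi> + v \<xi>)" "moment (\<lambda>\<xi>. 1) (\<lambda>\<xi>. u \<xi> + v \<xi>) = 0" "moment fst (\<lambda>\<xi>. u \<xi> + v \<xi>) = 0"
proof -
  note U = nice2D[OF Z_imp_nice2[OF u(2)]] and V = nice2D[OF Z_imp_nice2[OF v(2)]]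
    and H = nice2D[OF Z_imp_nice2[OF H1]] and G = nice2D[OF nice2_gaussian]
  show "nice2 (\<lambda>\<xi>. u \<xi> + v \<xi>)" by (intro nice2_add Z_imp_nice2 u v)
  define K where "K = (\<lambda>\<xi>. H1 \<xi> + z * pd2 gaussian \<xi>)"
  have rK: "rapid K" unfolding K_def by (intro rapid_add rapid_cmult H G)
  have "moment (\<lambda>\<xi>. 1) (pd2 gaussian) = 0"
  proof -
    have "moment (\<lambda>\<xi>. 1) (pd2 gaussian) = - 1 / 2 * moment snd gaussian"
      unfolding pd2_gaussian moment_cmult[symmetric] by (simp add: moment_def)
    then show ?thesis by (simp add: moment_gaussian)
  qed
  then have mK: "moment (\<lambda>\<xi>. 1) K = 0"
    unfolding K_def moment_add[OF tempered_const H(5) rapid_cmult[OF G(7)]] moment_cmult M by simp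
  have "P \<xi> = c * u \<xi> - diffusion u \<xi>" for \<xi> using u(3)[of \<xi>] by linarith
  then have P': "P = (\<lambda>\<xi>. c * u \<xi> - diffusion u \<xi>)" by (rule ext)
  note du = diffusion_integrals[OF Z_imp_nice2[OF u(2)]]
  have iP: "integrable lborel P" unfolding P'
    by (intro Bochner_Integration.integrable_diff integrable_mult_right rapid_integrable U du(1))
  have "(LINT \<xi>|lborel. P \<xi>) = c * (LINT \<xi>|lborel. u \<xi>) - (LINT \<xi>|lborel. diffusion u \<xi>)"
    unfolding P' integral_mult_right_zero[symmetric]
    by (intro Bochner_Integration.integral_diff integrable_mult_right rapid_integrable U du(1))
  moreover have "(LINT \<xi>|lborel. P \<xi>) = 0"
  proof -
    have "inner_Y (\<lambda>\<xi>. K \<xi> - P \<xi>) gaussian = 0"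
      unfolding K_def by (rule bspec[OF conjunct2[OF P[unfolded proj0_def]] gaussian_Y_mode0])
    moreover have "inner_Y (\<lambda>\<xi>. K \<xi> - P \<xi>) gaussian = (LINT \<xi>|lborel. 1 / (4 * pi) * (K \<xi> - P \<xi>))"
      unfolding inner_Y_def
    proof (intro Bochner_Integration.integral_cong refl)
      fix \<xi>
      have "gaussian \<xi> * weight \<xi> = ew \<xi> * weight \<xi> * (1 / (4 * pi))" unfolding gaussian_ew by simp
      then have "gaussian \<xi> * weight \<xi> = 1 / (4 * pi)" unfolding ew_weight by simp
      then show "(K \<xi> - P \<xi>) * gaussian \<xi> * weight \<xi> = 1 / (4 * pi) * (K \<xi> - P \<xi>)" by (simp add: mult.assoc)
    qed
    ultimately have "(LINT \<xi>|lborel. K \<xi> - P \<xi>) = 0" unfolding integral_mult_right_zero by simp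
    moreover have "(LINT \<xi>|lborel. K \<xi> - P \<xi>) = (LINT \<xi>|lborel. K \<xi>) - (LINT \<xi>|lborel. P \<xi>)"
      by (rule Bochner_Integration.integral_diff[OF rapid_integrable[OF rK] iP])
    ultimately show ?thesis using mK unfolding moment_def mult_1_left by linarith
  qed
  ultimately have "c * (LINT \<xi>|lborel. u \<xi>) = 0" using du(2) by linarith
  then have "moment (\<lambda>\<xi>. 1) u = 0" using u(4) unfolding moment_def mult_1_left by simp
  moreover have "moment (\<lambda>\<xi>. 1) v = 0" "moment fst v = 0"
    using ker_Lambda_perp_moments[OF v(1)] unfolding moment_def mult_1_left by this+
  moreover have "moment fst u = 0" by (rule Y_mode0_fst_moment[OF u(1) U(5)])
  ultimately show "moment (\<lambda>\<xi>. 1) (\<lambda>\<xi>. u \<xi> + v \<xi>) = 0" "moment fst (\<lambda>\<xi>. u \<xi> + v \<xi>) = 0"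
    unfolding moment_add[OF tempered_const U(5) V(5)] moment_add[OF tempered_fst U(5) V(5)] by linarith+
qed

lemma next_orderD:
  assumes "next_order wE wNS zE zNS k"
  obtains H0 H1 where "H0 \<in> Z_space" "H1 \<in> Z_space"
    "bigO_Z_delta (k + 2) (\<lambda>\<delta> \<epsilon> \<xi>. remainder wE wNS zE zNS k \<delta> \<epsilon> \<xi> - \<epsilon> ^ (k + 1) * (H0 \<xi> + \<delta> * H1 \<xi>))"
    "zE k = 2 * pi * moment snd H0" "zNS k = 2 * pi * moment snd H1"
    "nice2 (wE (k + 1))" "nice2 (wNS (k + 1))"
    "moment (\<lambda>\<xi>. 1) H1 = 0 \<Longrightarrow> moment (\<lambda>\<xi>. 1) (wE (k + 1)) = 0 \<and> moment fst (wE (k + 1)) = 0"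
proof -
  obtain H0 H1 K1 P u v where H: "H0 \<in> Z_space" "H1 \<in> Z_space"
    and O: "bigO_Z_delta (k + 2) (\<lambda>\<delta> \<epsilon> \<xi>. remainder wE wNS zE zNS k \<delta> \<epsilon> \<xi> - \<epsilon> ^ (k + 1) * (H0 \<xi> + \<delta> * H1 \<xi>))"
    and z: "zE k = 2 * pi * moment2 H0" "zNS k = 2 * pi * moment2 H1"
    and K1: "K1 = (\<lambda>\<xi>. H1 \<xi> + zNS k / (2 * pi) * pd2 gaussian \<xi>)"
    and P: "proj0 K1 P" and u: "u \<in> Y_mode 0 \<inter> Z_space" "\<forall>\<xi>. diffusion u \<xi> - real (k + 1) / 2 * u \<xi> + P \<xi> = 0"
    and v: "v \<in> ker_Lambda_perp \<inter> Z_space" and w: "wE (k + 1) = (\<lambda>\<xi>. u \<xi> + v \<xi>)" "wNS (k + 1) \<in> ker_Lambda_perp \<inter> Z_space"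
    using assms unfolding next_order_def by (elim bexE exE conjE) (rule that)
  have uz: "u \<in> Y_mode 0" "u \<in> Z_space" using u(1) by blast+
  have ue: "diffusion u \<xi> - real (k + 1) / 2 * u \<xi> + P \<xi> = 0" for \<xi> using u(2) by (rule spec)
  have k: "real (k + 1) / 2 \<noteq> 0" by simp
  have vz: "v \<in> ker_Lambda_perp" "v \<in> Z_space" "wNS (k + 1) \<in> Z_space" using v w by blast+
  show ?thesis
  proof (rule that[OF H O z[unfolded moment2_moment]])
    show "nice2 (wE (k + 1))" unfolding w by (intro nice2_add Z_imp_nice2 uz vz)
    show "nice2 (wNS (k + 1))" by (rule Z_imp_nice2[OF vz(3)])
    assume M: "moment (\<lambda>\<xi>. 1) H1 = 0"
    show "moment (\<lambda>\<xi>. 1) (wE (k + 1)) = 0 \<and> moment fst (wE (k + 1)) = 0"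
      unfolding w using next_profile_moments(2,3)[OF H(2) M P[unfolded K1] uz ue k vz(1,2)] by blast
  qed
qed

lemma mass_gaussian_sum:
  assumes "\<And>j. j \<in> J \<Longrightarrow> nice2 (w j)" "\<And>j. j \<in> J \<Longrightarrow> moment (\<lambda>\<xi>. 1) (w j) = 0"
  shows "moment (\<lambda>\<xi>. 1) (\<lambda>\<xi>. gaussian \<xi> + (\<Sum>j\<in>J. x j * w j \<xi>)) = 1"
proof -
  have r: "rapid (w j)" if "j \<in> J" for j by (rule nice2D(5)[OF assms(1)[OF that]])
  have "(\<Sum>j\<in>J. x j * moment (\<lambda>\<xi>. 1) (w j)) = 0" by (rule sum.neutral) (simp add: assms(2))
  moreover have "rapid (\<lambda>\<xi>. \<Sum>j\<in>J. x j * w j \<xi>)" by (intro rapid_sum rapid_cmult r)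
  moreover have "moment (\<lambda>\<xi>. 1) (\<lambda>\<xi>. \<Sum>j\<in>J. x j * w j \<xi>) = (\<Sum>j\<in>J. x j * moment (\<lambda>\<xi>. 1) (w j))"
    by (rule moment_sum[OF tempered_const r])
  ultimately show ?thesis
    by (simp only: moment_add[OF tempered_const rapid_gaussian] moment_gaussian add_0_right)
qed

lemma sum_two: "(\<Sum>j=2..2::nat. f j) = (f 2 :: real)"
  and sum_three: "(\<Sum>j=2..3::nat. f j) = (f 2 + f 3 :: real)"
  and sum_four: "(\<Sum>j=2..4::nat. f j) = (f 2 + (f 3 + f 4) :: real)"
  by (simp_all add: eval_nat_numeral)

text \<open>Three rounds k = 2, 3, 4, each comparing coefficients of \<epsilon>^(k+1). Besides the
  speed coefficients, the first two rounds yield the vanishing mass of \<open>H1\<close> and with it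
  the moments of the next Euler profile that the following rounds consume. The last round is
  available because M \<ge> 5.\<close>

lemma approximate_coefficients:
  assumes "approximate_solution wE wNS zE zNS M" "M \<ge> 5"
  shows "zE 1 = 0" "zNS 1 = 0" "zE 2 = 0" "zNS 2 = 0" "zE 3 = 0" "zE 4 = 2 * Re (cmoment 2 (wE 2))"
proof -
  have O: "order_two wE wNS zE zNS" and S: "next_order wE wNS zE zNS 2" "next_order wE wNS zE zNS 3" "next_order wE wNS zE zNS 4"
    using assms unfolding approximate_solution_def by simp_all
  show z1: "zE 1 = 0" "zNS 1 = 0" using O unfolding order_two_def by blast+
  note m2 = order_two_profiles(1,2)[OF O]
  note E2 = mode2_moments[OF m2(1)] and N2 = mode2_moments[OF m2(2)]
  define q where "q = Re (cmoment 2 (wE 2))"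
  \<comment> \<open>One expansion for all rounds: profiles not yet present are replaced by
    0.\<close>
  have self: "small 6 (\<lambda>\<epsilon>. (interaction \<epsilon> (\<lambda>\<xi>. gaussian \<xi> + (\<epsilon>\<^sup>2 * wE 2 \<xi> + (\<epsilon> ^ 3 * g \<xi> + \<epsilon> ^ 4 * h \<xi>)))
      (\<lambda>\<xi>. gaussian \<xi> + (\<epsilon>\<^sup>2 * wE 2 \<xi> + (\<epsilon> ^ 3 * g \<xi> + \<epsilon> ^ 4 * h \<xi>))) - \<epsilon>) / (2 * pi) - \<epsilon> ^ 5 * (q / pi))"
    if "nice2 g" "moment (\<lambda>\<xi>. 1) g = 0" "moment fst g = 0" "nice2 h" "moment (\<lambda>\<xi>. 1) h = 0" for g h
    by (rule small_cong[OF small_cmult[OF self_interaction_expansion[OF m2(1) that], of "1 / (2 * pi)"]])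
      (simp add: q_def field_simps)
  \<comment> \<open>In the rounds before the last, the \<epsilon>^5 term is itself
    negligible.\<close>
  have lower: "small K (\<lambda>\<epsilon>. f \<epsilon> - 0)" if "small 6 (\<lambda>\<epsilon>. f \<epsilon> - \<epsilon> ^ 5 * (q / pi))" "K \<le> 5" for f K
    by (rule small_mono[OF small_cong[OF small_add[OF small_mono[OF that(1), of 5] small_power[of 5 "q / pi"]]] that(2)]) simp_all
  have zero: "nice2 (\<lambda>\<xi>. 0)" "moment (\<lambda>\<xi>. 1) (\<lambda>\<xi>. 0) = 0" "moment fst (\<lambda>\<xi>. 0) = 0"
    by (simp_all add: nice2_0 moment_def)

  \<comment> \<open>Round k = 2, at \<epsilon>^3: zero mass and \<open>fst\<close>-moment of
    \<open>wE 3\<close>, then \<open>zE 2 = 0\<close>. Only here is the part linear in \<delta>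
    tested against \<xi>2, for \<open>zNS 2 = 0\<close>.\<close>
  obtain H0 H1 where H: "H0 \<in> Z_space" "H1 \<in> Z_space"
    "bigO_Z_delta (2 + 2) (\<lambda>\<delta> \<epsilon> \<xi>. remainder wE wNS zE zNS 2 \<delta> \<epsilon> \<xi> - \<epsilon> ^ (2 + 1) * (H0 \<xi> + \<delta> * H1 \<xi>))"
    "zE 2 = 2 * pi * moment snd H0" "zNS 2 = 2 * pi * moment snd H1"
    and n3: "nice2 (wE (2 + 1))" "nice2 (wNS (2 + 1))"
    and m3: "moment (\<lambda>\<xi>. 1) H1 = 0 \<Longrightarrow> moment (\<lambda>\<xi>. 1) (wE (2 + 1)) = 0 \<and> moment fst (wE (2 + 1)) = 0"
    by (rule next_orderD[OF S(1)]) (rule that)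
  have np2: "nice_profiles wE wNS 2" using E2(1) N2(1) by (simp add: nice_profiles_def)
  note st = order_step[OF np2 H(1-3)]
  have i2: "j = 2" if "j \<in> {2..2}" for j :: nat using that by simp
  have mass: "moment (\<lambda>\<xi>. 1) (\<lambda>\<xi>. gaussian \<xi> + (\<Sum>j=2..2. y j * wE j \<xi>)) = 1" for y
    by (rule mass_gaussian_sum; drule i2; simp add: E2)
  have c2: "1 + (\<Sum>i=1..2-1. \<epsilon> ^ i * zE i) = 1" "(\<Sum>i=1..2-1. \<epsilon> ^ i * zNS i) = 0" for \<epsilon>
    using z1 by simp_all
  have "small (Suc 3) (\<lambda>\<epsilon>. 0 - \<epsilon> ^ 3 * moment (\<lambda>\<xi>. 1) H1)"
    by (rule small_cong'[OF st(1)]) (simp_all add: sum_two E2)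
  then have "moment (\<lambda>\<xi>. 1) H1 = 0" by (rule small_unique) (simp add: small_0)
  then have m3: "moment (\<lambda>\<xi>. 1) (wE 3) = 0" "moment fst (wE 3) = 0" using m3 by simp_all
  have n3: "nice2 (wE 3)" "nice2 (wNS 3)" using n3 by simp_all
  define p where "p \<epsilon> = (interaction \<epsilon> (\<lambda>\<xi>. gaussian \<xi> + \<epsilon>\<^sup>2 * wE 2 \<xi>) (\<lambda>\<xi>. gaussian \<xi> + \<epsilon>\<^sup>2 * wE 2 \<xi>) - \<epsilon>) / (2 * pi)" for \<epsilon>
  have "small (Suc 3) (\<lambda>\<epsilon>. p \<epsilon> - \<epsilon> ^ 3 * moment snd H0)"
  proof (rule small_cong'[OF st(2)])
    fix \<epsilon> :: real
    show "p \<epsilon> - \<epsilon> ^ 3 * moment snd H0 =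
       (interaction \<epsilon> (\<lambda>\<xi>. gaussian \<xi> + (\<Sum>j=2..2. \<epsilon> ^ j * wE j \<xi>)) (\<lambda>\<xi>. gaussian \<xi> + (\<Sum>j=2..2. \<epsilon> ^ j * wE j \<xi>))
         - \<epsilon> * (1 + (\<Sum>i=1..2-1. \<epsilon> ^ i * zE i)) * moment (\<lambda>\<xi>. 1) (\<lambda>\<xi>. gaussian \<xi> + (\<Sum>j=2..2. \<epsilon> ^ j * wE j \<xi>))) / (2 * pi)
         - \<epsilon> ^ (2 + 1) * moment snd H0"
      unfolding mass c2 unfolding sum_two p_def by simp
  qed simp
  moreover have "small (Suc 3) (\<lambda>\<epsilon>. p \<epsilon> - \<epsilon> ^ 3 * 0)"
    using lower[OF self[OF zero zero(1,2)], of 4] by (simp add: p_def)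
  ultimately have "moment snd H0 = 0" by (rule small_unique)
  then show z2: "zE 2 = 0" using H(4) by simp
  define x where "x \<epsilon> = (interaction \<epsilon> (\<lambda>\<xi>. gaussian \<xi> + \<epsilon>\<^sup>2 * wE 2 \<xi>) (\<lambda>\<xi>. \<epsilon>\<^sup>2 * wNS 2 \<xi>)
      + interaction \<epsilon> (\<lambda>\<xi>. \<epsilon>\<^sup>2 * wNS 2 \<xi>) (\<lambda>\<xi>. gaussian \<xi> + \<epsilon>\<^sup>2 * wE 2 \<xi>)) / (2 * pi)" for \<epsilon>
  have snd0: "moment snd (\<lambda>\<xi>. gaussian \<xi> + y * wE 2 \<xi>) = 0" for y
    unfolding moment_add[OF tempered_snd rapid_gaussian rapid_cmult[OF nice2D(5)[OF E2(1)]]] moment_cmult moment_gaussian E2 by simp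
  have "small (Suc 3) (\<lambda>\<epsilon>. x \<epsilon> - \<epsilon> ^ 3 * moment snd H1)"
  proof (rule small_cong'[OF st(3)])
    fix \<epsilon> :: real
    show "x \<epsilon> - \<epsilon> ^ 3 * moment snd H1 =
       (interaction \<epsilon> (\<lambda>\<xi>. gaussian \<xi> + (\<Sum>j=2..2. \<epsilon> ^ j * wE j \<xi>)) (\<lambda>\<xi>. \<Sum>j=2..2. \<epsilon> ^ j * wNS j \<xi>)
         + interaction \<epsilon> (\<lambda>\<xi>. \<Sum>j=2..2. \<epsilon> ^ j * wNS j \<xi>) (\<lambda>\<xi>. gaussian \<xi> + (\<Sum>j=2..2. \<epsilon> ^ j * wE j \<xi>))
         - \<epsilon> * ((1 + (\<Sum>i=1..2-1. \<epsilon> ^ i * zE i)) * moment (\<lambda>\<xi>. 1) (\<lambda>\<xi>. \<Sum>j=2..2. \<epsilon> ^ j * wNS j \<xi>)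
           + (\<Sum>i=1..2-1. \<epsilon> ^ i * zNS i) * moment (\<lambda>\<xi>. 1) (\<lambda>\<xi>. gaussian \<xi> + (\<Sum>j=2..2. \<epsilon> ^ j * wE j \<xi>)))) / (2 * pi)
         - (moment snd (\<lambda>\<xi>. gaussian \<xi> + (\<Sum>j=2..2. \<epsilon> ^ j * wE j \<xi>)) / 2 + (\<Sum>j=2..2. (real j / 2 * \<epsilon> ^ j) * moment snd (wE j)))
         - \<epsilon> ^ (2 + 1) * moment snd H1"
      unfolding c2 sum_two snd0 moment_cmult E2 N2 x_def by simp
  qed simp
  moreover have "small (Suc 3) (\<lambda>\<epsilon>. x \<epsilon> - \<epsilon> ^ 3 * 0)"
    by (rule small_cong'[OF small_cmult[OF cross_interaction_small[OF m2], of "1 / (2 * pi)"]]) (simp_all add: x_def)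
  ultimately have "moment snd H1 = 0" by (rule small_unique)
  then show z2': "zNS 2 = 0" using H(5) by simp

  \<comment> \<open>Round k = 3, at \<epsilon>^4: zero mass of \<open>wE 4\<close> and
    \<open>zE 3 = 0\<close>.\<close>
  obtain H0 H1 where H: "H0 \<in> Z_space" "H1 \<in> Z_space"
    "bigO_Z_delta (3 + 2) (\<lambda>\<delta> \<epsilon> \<xi>. remainder wE wNS zE zNS 3 \<delta> \<epsilon> \<xi> - \<epsilon> ^ (3 + 1) * (H0 \<xi> + \<delta> * H1 \<xi>))"
    "zE 3 = 2 * pi * moment snd H0"
    and n4: "nice2 (wE (3 + 1))" "nice2 (wNS (3 + 1))"
    and m4: "moment (\<lambda>\<xi>. 1) H1 = 0 \<Longrightarrow> moment (\<lambda>\<xi>. 1) (wE (3 + 1)) = 0 \<and> moment fst (wE (3 + 1)) = 0"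
    by (rule next_orderD[OF S(2)]) (rule that)
  have i3: "j = 2 \<or> j = 3" if "j \<in> {2..3}" for j :: nat using that by auto
  have np3: "nice_profiles wE wNS 3"
    unfolding nice_profiles_def by (rule ballI; drule i3; elim disjE; simp add: E2 N2 n3)
  note st = order_step[OF np3 H(1-3)]
  have mass: "moment (\<lambda>\<xi>. 1) (\<lambda>\<xi>. gaussian \<xi> + (\<Sum>j=2..3. y j * wE j \<xi>)) = 1" for y
    by (rule mass_gaussian_sum; drule i3; elim disjE; simp add: E2 n3 m3)
  have c3: "1 + (\<Sum>i=1..3-1. \<epsilon> ^ i * zE i) = 1" for \<epsilon>
  proof -
    have "(\<Sum>i=1..3-1. \<epsilon> ^ i * zE i) = \<epsilon> ^ 1 * zE 1 + \<epsilon>\<^sup>2 * zE 2" by (simp add: eval_nat_numeral)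
    then show ?thesis unfolding z1 z2 by simp
  qed
  have "small (Suc 4) (\<lambda>\<epsilon>. 0 - \<epsilon> ^ 4 * moment (\<lambda>\<xi>. 1) H1)"
    by (rule small_cong'[OF st(1)]) (simp_all add: sum_three E2 m3)
  then have "moment (\<lambda>\<xi>. 1) H1 = 0" by (rule small_unique) (simp add: small_0)
  then have m4: "moment (\<lambda>\<xi>. 1) (wE 4) = 0" using m4 by simp
  have n4: "nice2 (wE 4)" "nice2 (wNS 4)" using n4 by simp_all
  define p where "p \<epsilon> = (interaction \<epsilon> (\<lambda>\<xi>. gaussian \<xi> + (\<epsilon>\<^sup>2 * wE 2 \<xi> + \<epsilon> ^ 3 * wE 3 \<xi>))
      (\<lambda>\<xi>. gaussian \<xi> + (\<epsilon>\<^sup>2 * wE 2 \<xi> + \<epsilon> ^ 3 * wE 3 \<xi>)) - \<epsilon>) / (2 * pi)" for \<epsilon>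
  have "small (Suc 4) (\<lambda>\<epsilon>. p \<epsilon> - \<epsilon> ^ 4 * moment snd H0)"
  proof (rule small_cong'[OF st(2)])
    fix \<epsilon> :: real
    show "p \<epsilon> - \<epsilon> ^ 4 * moment snd H0 =
       (interaction \<epsilon> (\<lambda>\<xi>. gaussian \<xi> + (\<Sum>j=2..3. \<epsilon> ^ j * wE j \<xi>)) (\<lambda>\<xi>. gaussian \<xi> + (\<Sum>j=2..3. \<epsilon> ^ j * wE j \<xi>))
         - \<epsilon> * (1 + (\<Sum>i=1..3-1. \<epsilon> ^ i * zE i)) * moment (\<lambda>\<xi>. 1) (\<lambda>\<xi>. gaussian \<xi> + (\<Sum>j=2..3. \<epsilon> ^ j * wE j \<xi>))) / (2 * pi)
         - \<epsilon> ^ (3 + 1) * moment snd H0"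
      unfolding mass c3 unfolding sum_three p_def by simp
  qed simp
  moreover have "small (Suc 4) (\<lambda>\<epsilon>. p \<epsilon> - \<epsilon> ^ 4 * 0)"
    using lower[OF self[OF n3(1) m3 zero(1,2)], of 5] by (simp add: p_def)
  ultimately have "moment snd H0 = 0" by (rule small_unique)
  then show z3: "zE 3 = 0" using H(4) by simp

  \<comment> \<open>Round k = 4, at \<epsilon>^5: the quadratic moment of \<open>wE 2\<close>
    appears for the first time.\<close>
  obtain H0 H1 where H: "H0 \<in> Z_space" "H1 \<in> Z_space"
    "bigO_Z_delta (4 + 2) (\<lambda>\<delta> \<epsilon> \<xi>. remainder wE wNS zE zNS 4 \<delta> \<epsilon> \<xi> - \<epsilon> ^ (4 + 1) * (H0 \<xi> + \<delta> * H1 \<xi>))"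
    "zE 4 = 2 * pi * moment snd H0"
    by (rule next_orderD[OF S(3)]) (rule that)
  have i4: "j = 2 \<or> j = 3 \<or> j = 4" if "j \<in> {2..4}" for j :: nat using that by auto
  have np4: "nice_profiles wE wNS 4"
    unfolding nice_profiles_def by (rule ballI; drule i4; elim disjE; simp add: E2 N2 n3 n4)
  note st = order_step[OF np4 H(1-3)]
  have mass: "moment (\<lambda>\<xi>. 1) (\<lambda>\<xi>. gaussian \<xi> + (\<Sum>j=2..4. y j * wE j \<xi>)) = 1" for y
    by (rule mass_gaussian_sum; drule i4; elim disjE; simp add: E2 n3 m3 n4 m4)
  have c4: "1 + (\<Sum>i=1..4-1. \<epsilon> ^ i * zE i) = 1" for \<epsilon>
  proof -
    have "(\<Sum>i=1..4-1. \<epsilon> ^ i * zE i) = \<epsilon> ^ 1 * zE 1 + \<epsilon>\<^sup>2 * zE 2 + \<epsilon> ^ 3 * zE 3" by (simp add: eval_nat_numeral)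
    then show ?thesis unfolding z1 z2 z3 by simp
  qed
  define p where "p \<epsilon> = (interaction \<epsilon> (\<lambda>\<xi>. gaussian \<xi> + (\<epsilon>\<^sup>2 * wE 2 \<xi> + (\<epsilon> ^ 3 * wE 3 \<xi> + \<epsilon> ^ 4 * wE 4 \<xi>)))
      (\<lambda>\<xi>. gaussian \<xi> + (\<epsilon>\<^sup>2 * wE 2 \<xi> + (\<epsilon> ^ 3 * wE 3 \<xi> + \<epsilon> ^ 4 * wE 4 \<xi>))) - \<epsilon>) / (2 * pi)" for \<epsilon>
  have "small (Suc 5) (\<lambda>\<epsilon>. p \<epsilon> - \<epsilon> ^ 5 * moment snd H0)"
  proof (rule small_cong'[OF st(2)])
    fix \<epsilon> :: real
    show "p \<epsilon> - \<epsilon> ^ 5 * moment snd H0 =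
       (interaction \<epsilon> (\<lambda>\<xi>. gaussian \<xi> + (\<Sum>j=2..4. \<epsilon> ^ j * wE j \<xi>)) (\<lambda>\<xi>. gaussian \<xi> + (\<Sum>j=2..4. \<epsilon> ^ j * wE j \<xi>))
         - \<epsilon> * (1 + (\<Sum>i=1..4-1. \<epsilon> ^ i * zE i)) * moment (\<lambda>\<xi>. 1) (\<lambda>\<xi>. gaussian \<xi> + (\<Sum>j=2..4. \<epsilon> ^ j * wE j \<xi>))) / (2 * pi)
         - \<epsilon> ^ (4 + 1) * moment snd H0"
      unfolding mass c4 unfolding sum_four p_def by simp
  qed simp
  moreover have "small (Suc 5) (\<lambda>\<epsilon>. p \<epsilon> - \<epsilon> ^ 5 * (q / pi))"
    using self[OF n3(1) m3 n4(1) m4] by (simp add: p_def)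
  ultimately have "moment snd H0 = q / pi" by (rule small_unique)
  then show "zE 4 = 2 * Re (cmoment 2 (wE 2))" using H(4) by (simp add: q_def)
qed

section \<open>Assembly of the speed estimate\<close>

lemma cmoment_2:
  assumes "rapid f"
  shows "Re (cmoment 2 f) = - moment (\<lambda>\<xi>. (snd \<xi>)\<^sup>2 - (fst \<xi>)\<^sup>2) f"
proof -
  have "Re (cmoment 2 f) = (LINT \<xi>|lborel. Re (cpx \<xi> ^ 2 * of_real (f \<xi>)))"
    unfolding cmoment_def by (rule integral_Re[OF cmoment_integrable[OF assms], symmetric])
  also have "\<dots> = (LINT \<xi>|lborel. - (((snd \<xi>)\<^sup>2 - (fst \<xi>)\<^sup>2) * f \<xi>))"
    by (intro Bochner_Integration.integral_cong refl) (simp add: Re_power2 algebra_simps)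
  also have "\<dots> = - moment (\<lambda>\<xi>. (snd \<xi>)\<^sup>2 - (fst \<xi>)\<^sup>2) f"
    unfolding moment_def by (rule Bochner_Integration.integral_minus)
  finally show ?thesis .
qed

lemma zeta_app_estimate:
  fixes \<epsilon> \<delta> :: real
  assumes z: "zE 1 = 0" "zNS 1 = 0" "zE 2 = 0" "zNS 2 = 0" "zE 3 = 0"
    and M: "M - 1 = 4 + p" and \<epsilon>: "0 < \<epsilon>" "\<epsilon> \<le> 1" and \<delta>: "0 < \<delta>" "\<delta> \<le> 1"
  shows "\<bar>zeta_app zE zNS M \<delta> \<epsilon> - (1 + zE 4 * \<epsilon> ^ 4)\<bar>
    \<le> (\<bar>zNS 3\<bar> + \<bar>zNS 4\<bar> + (\<Sum>k=4+1..4+p. \<bar>zE k\<bar> + \<bar>zNS k\<bar>)) * (\<epsilon> ^ 5 + \<delta>\<^sup>2 * \<epsilon>)"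
proof -
  define T where "T k = \<epsilon> ^ k * (zE k + \<delta> * zNS k)" for k
  define b where "b = \<epsilon> ^ 5 + \<delta>\<^sup>2 * \<epsilon>"
  have "(\<Sum>k=1..4. T k) = T 1 + T 2 + T 3 + T 4" by (simp add: eval_nat_numeral)
  also have "\<dots> = \<delta> * \<epsilon> ^ 3 * zNS 3 + (zE 4 * \<epsilon> ^ 4 + \<delta> * \<epsilon> ^ 4 * zNS 4)"
    unfolding T_def z by (simp add: algebra_simps)
  finally have head: "(\<Sum>k=1..4. T k) = \<delta> * \<epsilon> ^ 3 * zNS 3 + (zE 4 * \<epsilon> ^ 4 + \<delta> * \<epsilon> ^ 4 * zNS 4)" .
  have "zeta_app zE zNS M \<delta> \<epsilon> = 1 + (\<Sum>k=1..4. T k) + (\<Sum>k=4+1..4+p. T k)"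
    unfolding zeta_app_def M T_def[symmetric] by (subst sum.ub_add_nat) simp_all
  then have e: "zeta_app zE zNS M \<delta> \<epsilon> - (1 + zE 4 * \<epsilon> ^ 4) = \<delta> * \<epsilon> ^ 3 * zNS 3 + \<delta> * \<epsilon> ^ 4 * zNS 4 + (\<Sum>k=4+1..4+p. T k)"
    unfolding head by simp
  \<comment> \<open>The arithmetic-geometric mean of \<epsilon>^5 and \<delta>^2 \<epsilon>: this
    absorbs \<delta> \<epsilon>^3, and with \<epsilon> \<le> 1 also \<delta> \<epsilon>^4.\<close>
  have "0 \<le> \<epsilon> * (\<delta> - \<epsilon>\<^sup>2)\<^sup>2" using \<epsilon> by simp
  also have "\<dots> = b - 2 * (\<delta> * \<epsilon> ^ 3)" unfolding b_def by (simp add: power2_eq_square eval_nat_numeral algebra_simps)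
  finally have d3: "\<delta> * \<epsilon> ^ 3 \<le> b" using mult_nonneg_nonneg[OF less_imp_le[OF \<delta>(1)] zero_le_power[OF less_imp_le[OF \<epsilon>(1)], of 3]] by linarith
  have "\<delta> * \<epsilon> ^ 4 \<le> \<delta> * \<epsilon> ^ 3" using \<epsilon> \<delta> by (intro mult_left_mono power_decreasing) auto
  with d3 have d4: "\<delta> * \<epsilon> ^ 4 \<le> b" by linarith
  have "\<bar>\<delta> * \<epsilon> ^ 3 * zNS 3\<bar> \<le> \<bar>zNS 3\<bar> * b" "\<bar>\<delta> * \<epsilon> ^ 4 * zNS 4\<bar> \<le> \<bar>zNS 4\<bar> * b"
    using mult_right_mono[OF d3 abs_ge_zero[of "zNS 3"]] mult_right_mono[OF d4 abs_ge_zero[of "zNS 4"]] \<epsilon> \<delta>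
    by (simp_all add: abs_mult mult.commute)
  moreover have "\<bar>\<Sum>k=4+1..4+p. T k\<bar> \<le> (\<Sum>k=4+1..4+p. \<bar>zE k\<bar> + \<bar>zNS k\<bar>) * b"
    unfolding sum_distrib_right
  proof (rule order_trans[OF sum_abs sum_mono])
    fix k assume "k \<in> {4+1..4+p}"
    then have "\<epsilon> ^ k \<le> \<epsilon> ^ 5" using \<epsilon> by (intro power_decreasing) auto
    also have "\<dots> \<le> b" using \<epsilon> by (simp add: b_def)
    finally have k: "\<epsilon> ^ k \<le> b" .
    have "\<delta> * \<bar>zNS k\<bar> \<le> \<bar>zNS k\<bar>" using \<delta> by (simp add: mult_left_le_one_le)
    then have "\<bar>zE k + \<delta> * zNS k\<bar> \<le> \<bar>zE k\<bar> + \<bar>zNS k\<bar>"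
      using abs_triangle_ineq[of "zE k" "\<delta> * zNS k"] \<delta> by (simp add: abs_mult)
    then have "\<epsilon> ^ k * \<bar>zE k + \<delta> * zNS k\<bar> \<le> b * (\<bar>zE k\<bar> + \<bar>zNS k\<bar>)"
      using k \<epsilon> \<delta> by (intro mult_mono) (auto simp: b_def)
    then show "\<bar>T k\<bar> \<le> (\<bar>zE k\<bar> + \<bar>zNS k\<bar>) * b" using \<epsilon> by (simp add: T_def abs_mult mult.commute)
  qed
  ultimately show ?thesis unfolding e b_def[symmetric] distrib_right by linarith
qed

theorem proposition3p17:
  fixes wE wNS :: "nat \<Rightarrow> plane \<Rightarrow> real" and zE zNS :: "nat \<Rightarrow> real" and M :: nat
  assumes "M \<ge> 5" and "approximate_solution wE wNS zE zNS M"
  shows "\<exists>(\<alpha>::real) (w2 :: real \<Rightarrow> real) (w2hat :: real \<Rightarrow> real).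
    (\<forall>\<delta>\<in>{0<..1}. \<forall>r>0. \<forall>\<theta>. profile wE wNS \<delta> 2 (r * cos \<theta>, r * sin \<theta>)
        = - w2 r * cos (2 * \<theta>) + \<delta> * w2hat r * sin (2 * \<theta>)) \<and>
    (\<forall>\<delta>\<in>{0<..1}. \<alpha> = 1 / pi *
        (LINT \<xi>|lborel. ((snd \<xi>)\<^sup>2 - (fst \<xi>)\<^sup>2) * profile wE wNS \<delta> 2 \<xi>)) \<and>
    \<alpha> = (LINT r:{0<..}|lborel. r ^ 3 * w2 r) \<and>
    22.24 \<le> \<alpha> \<and> \<alpha> < 22.25 \<and>
    (\<exists>C \<epsilon>0. \<epsilon>0 > 0 \<and> (\<forall>\<Gamma> d \<nu> t \<delta> \<epsilon>.
        \<Gamma> > 0 \<and> d > 0 \<and> \<nu> > 0 \<and> t > 0 \<and>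
        \<delta> = \<nu> / \<Gamma> \<and> \<delta> \<le> 1 \<and> \<epsilon> = sqrt (\<nu> * t) / d \<and> \<epsilon> < \<epsilon>0 \<longrightarrow>
        \<bar>advection_speed zE zNS M \<Gamma> d \<nu> t
            - \<Gamma> / (2 * pi * d) * (1 - 2 * pi * \<alpha> * \<epsilon> ^ 4)\<bar>
          \<le> \<Gamma> / (2 * pi * d) * (C * (\<epsilon> ^ 5 + \<delta>\<^sup>2 * \<epsilon>))))"
proof -
  have O: "order_two wE wNS zE zNS" using assms(2) unfolding approximate_solution_def by blast
  note P = order_two_profiles[OF O]
  note Z = approximate_coefficients[OF assms(2,1)]
  note rE = nice2D(5)[OF mode2_moments(1)[OF P(1)]] and rN = nice2D(5)[OF mode2_moments(1)[OF P(2)]]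
  define w2 where "w2 = (\<lambda>r. - cos_part (wE 2) r)"
  define \<alpha> where "\<alpha> = radial.total w2"
  let ?q = "\<lambda>\<xi>::plane. (snd \<xi>)\<^sup>2 - (fst \<xi>)\<^sup>2"
  have tq: "tempered ?q" by (intro tempered_diff tempered_power tempered_fst tempered_snd)
  have qE: "moment ?q (wE 2) = pi * \<alpha>"
    using P(7) unfolding moment_def \<alpha>_def w2_def by (simp add: field_simps)
  have polar: "profile wE wNS \<delta> 2 (r * cos \<theta>, r * sin \<theta>) = - w2 r * cos (2 * \<theta>) + \<delta> * sin_part (wNS 2) r * sin (2 * \<theta>)"
    if r: "r > 0" for \<delta> r \<theta>
    unfolding profile_def Y_mode2_polar[OF mode2.mode[OF P(1)] r] Y_mode2_polar[OF mode2.mode[OF P(2)] r] P(3)[OF r] P(4)[OF r] w2_def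
    by simp
  have quad: "\<alpha> = 1 / pi * (LINT \<xi>|lborel. ((snd \<xi>)\<^sup>2 - (fst \<xi>)\<^sup>2) * profile wE wNS \<delta> 2 \<xi>)" for \<delta>
  proof -
    have "moment ?q (profile wE wNS \<delta> 2) = moment ?q (wE 2) + \<delta> * moment ?q (wNS 2)"
      unfolding profile_def[abs_def] moment_add[OF tq rE rapid_cmult[OF rN]] moment_cmult ..
    \<comment> \<open>The Navier-Stokes part is a pure sine mode, so the quadratic moment does not
      depend on \<open>\<delta>\<close>.\<close>
    also have "moment ?q (wNS 2) = 0" unfolding moment_def by (rule P(8))
    finally have "moment ?q (profile wE wNS \<delta> 2) = pi * \<alpha>" unfolding qE by simp
    then show ?thesis unfolding moment_def by simp
  qed
  obtain C0 where R: "radial (cos_part (wE 2)) C0" by (rule mode2.parts_radial[OF P(1)])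
  have total: "\<alpha> = (LINT r:{0<..}|lborel. r ^ 3 * w2 r)"
    unfolding \<alpha>_def radial.total_def[OF radial_uminus(1)[OF R, folded w2_def]] set_lebesgue_integral_def by simp
  \<comment> \<open>The sign changes because \<open>Re (cmoment 2 f)\<close> weights with \<xi>1^2 -
    \<xi>2^2, whereas \<open>\<alpha>\<close> uses the opposite order.\<close>
  have z4: "zE 4 = - 2 * pi * \<alpha>" unfolding Z(6) cmoment_2[OF rE] qE by simp
  define p where "p = M - 5"
  have p: "M - 1 = 4 + p" using assms(1) by (simp add: p_def)
  define C where "C = \<bar>zNS 3\<bar> + \<bar>zNS 4\<bar> + (\<Sum>k=4+1..4+p. \<bar>zE k\<bar> + \<bar>zNS k\<bar>)"
  have speed: "\<bar>advection_speed zE zNS M \<Gamma> d \<nu> t - \<Gamma> / (2 * pi * d) * (1 - 2 * pi * \<alpha> * \<epsilon> ^ 4)\<bar>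
      \<le> \<Gamma> / (2 * pi * d) * (C * (\<epsilon> ^ 5 + \<delta>\<^sup>2 * \<epsilon>))"
    if h: "\<Gamma> > 0 \<and> d > 0 \<and> \<nu> > 0 \<and> t > 0 \<and> \<delta> = \<nu> / \<Gamma> \<and> \<delta> \<le> 1 \<and> \<epsilon> = sqrt (\<nu> * t) / d \<and> \<epsilon> < 1" for \<Gamma> d \<nu> t \<delta> \<epsilon>
  proof -
    from h have h': "\<Gamma> > 0" "d > 0" "\<nu> > 0" "t > 0" "\<delta> = \<nu> / \<Gamma>" "\<delta> \<le> 1" "\<epsilon> = sqrt (\<nu> * t) / d" "\<epsilon> < 1" by blast+
    have "0 < sqrt (\<nu> * t) / d" using h'(2-4) by simp
    then have b: "0 < \<epsilon>" "\<epsilon> \<le> 1" "0 < \<delta>" "\<delta> \<le> 1"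
      using h'(6,8) divide_pos_pos[OF h'(3,1)] unfolding h'(7)[symmetric] h'(5)[symmetric] by simp_all
    have c: "0 \<le> \<Gamma> / (2 * pi * d)" using h'(1,2) by simp
    have "\<bar>zeta_app zE zNS M \<delta> \<epsilon> - (1 + zE 4 * \<epsilon> ^ 4)\<bar> \<le> C * (\<epsilon> ^ 5 + \<delta>\<^sup>2 * \<epsilon>)"
      unfolding C_def by (rule zeta_app_estimate[OF Z(1-5) p b])
    from mult_left_mono[OF this c]
    have "\<bar>\<Gamma> / (2 * pi * d) * (zeta_app zE zNS M \<delta> \<epsilon> - (1 + zE 4 * \<epsilon> ^ 4))\<bar> \<le> \<Gamma> / (2 * pi * d) * (C * (\<epsilon> ^ 5 + \<delta>\<^sup>2 * \<epsilon>))"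
      unfolding abs_mult abs_of_nonneg[OF c] .
    moreover have "advection_speed zE zNS M \<Gamma> d \<nu> t = \<Gamma> / (2 * pi * d) * zeta_app zE zNS M \<delta> \<epsilon>"
      using h by (simp only: advection_speed_def)
    moreover have "1 - 2 * pi * \<alpha> * \<epsilon> ^ 4 = 1 + zE 4 * \<epsilon> ^ 4" unfolding z4 by simp
    ultimately show ?thesis by (simp only: right_diff_distrib)
  qed
  have bounds: "22.24 \<le> \<alpha>" "\<alpha> < 22.25" using P(5,6) unfolding \<alpha>_def w2_def by simp_all
  have fin: "\<exists>C \<epsilon>0. \<epsilon>0 > 0 \<and> (\<forall>\<Gamma> d \<nu> t \<delta> \<epsilon>.
        \<Gamma> > 0 \<and> d > 0 \<and> \<nu> > 0 \<and> t > 0 \<and>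
        \<delta> = \<nu> / \<Gamma> \<and> \<delta> \<le> 1 \<and> \<epsilon> = sqrt (\<nu> * t) / d \<and> \<epsilon> < \<epsilon>0 \<longrightarrow>
        \<bar>advection_speed zE zNS M \<Gamma> d \<nu> t
            - \<Gamma> / (2 * pi * d) * (1 - 2 * pi * \<alpha> * \<epsilon> ^ 4)\<bar>
          \<le> \<Gamma> / (2 * pi * d) * (C * (\<epsilon> ^ 5 + \<delta>\<^sup>2 * \<epsilon>)))"
    by (rule exI[of _ C], rule exI[of _ "1::real"], rule conjI[OF zero_less_one], intro allI impI, rule speed, assumption)
  show ?thesis
  proof (rule exI[of _ \<alpha>], rule exI[of _ w2], rule exI[of _ "sin_part (wNS 2)"], intro conjI)
    show "\<forall>\<delta>\<in>{0<..1}. \<forall>r>0. \<forall>\<theta>. profile wE wNS \<delta> 2 (r * cos \<theta>, r * sin \<theta>)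
        = - w2 r * cos (2 * \<theta>) + \<delta> * sin_part (wNS 2) r * sin (2 * \<theta>)"
      by (intro ballI allI impI polar)
    show "\<forall>\<delta>\<in>{0<..1}. \<alpha> = 1 / pi *
        (LINT \<xi>|lborel. ((snd \<xi>)\<^sup>2 - (fst \<xi>)\<^sup>2) * profile wE wNS \<delta> 2 \<xi>)"
      by (intro ballI quad)
  qed (rule total bounds fin)+
qed

end
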